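(* Let $r\in\mathbb N$. For $N\ge r$ let $(X_{t,k}^N)_{t\ge 0}=(X_{t,k,1}^N,\ldots,X_{t,k,N}^N)_{t\ge 0}$ be the Bessel process of type $A_{N-1}$ with multiplicity $k$ started in $0\in\mathbb R^N$. Let $z_{N-r+1,N}$ be the $r$-th largest zero of the Hermite polynomial $H_N$, and let $a_r$ be the $r$-th largest zero of the Airy function $\mathsf{Ai}$. Then, for each $t>0$, $$\lim_{N\to\infty}\left(\lim_{k\to\infty}N^{1/6}\sqrt{2k}\left(\frac{X_{t,k,N-r+1}^N}{\sqrt{2kt}}-z_{N-r+1,N}\right)\right)=G_r$$ in distribution, where $G_r$ is an $\mathcal N(0,\sigma_{max,r}^2)$-distributed random variable with variance $$\sigma_{max,r}^2=\int_0^\infty\frac{\mathsf{Ai}(x+a_r)^2}{\mathsf{Ai}'(a_r)^2\,x}\,dx ,$$ whose numerical values are $0.582\ldots$ for $r=2$, $0.472\ldots$ for $r=3$, $0.407\ldots$ for $r=4$. Moreover, $\sigma_{max,r}^2\to 0$ as $r\to\infty$.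
   Context: The Bessel process of type $A_{N-1}$ with multiplicity $k>0$ is the Markov process on the closed Weyl chamber $C_N^A=\{x\in\mathbb R^N: x_1\le x_2\le\dots\le x_N\}$ with reflecting boundary and generator $L_Af=\frac12\Delta f+k\sum_{i=1}^N\bigl(\sum_{j\ne i}\frac1{x_i-x_j}\bigr)\frac{\partial f}{\partial x_i}$. When started in $0$, for $t>0$ the random vector $X_{t,k}^N$ has the Lebesgue density on $C_N^A$ proportional (with normalizing constant depending on $k,t,N$) to $e^{-\|y\|^2/(2t)}\prod_{i<j}(y_j-y_i)^{2k}$. $H_N$ is the classical (physicists') Hermite polynomial, orthogonal with respect to $e^{-x^2}$; its zeros are $z_{1,N}<\dots<z_{N,N}$. They are known (classical Plancherel-Rotach formula) to satisfy $\frac{z_{N-r+1,N}}{\sqrt{2N}}=1-\frac{|a_r|}{2N^{2/3}}+O(N^{-1})$ as $N\to\infty$. $\mathsf{Ai}$ is the Airy function, i.e. the solution of $y''(z)=z\,y(z)$ on $\mathbb R$ with $y(z)\to0$ as $z\to\infty$ and $y(0)=\frac1{3^{2/3}\Gamma(2/3)}$; its zeros are $\dots<a_3<a_2<a_1<0$. The iterated limit means: for each fixed $N$ the inner expression converges in distribution as $k\to\infty$, and the resulting limit laws converge weakly as $N\to\infty$. The values "$0.582\ldots$" etc. denote initial digits of decimal expansions. *)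

theory Defs
  imports "HOL-Probability.Probability" "HOL-Combinatorics.Permutations"
begin

section \<open>Bessel processes of type A\<close>

text \<open>
  Since the dimension \<open>N\<close> tends to infinity, \<open>\<real>\<^sup>N\<close> is modelled by the functions on
  \<open>{1..N}\<close> (extensional, i.e. \<^const>\<open>undefined\<close> elsewhere), which is the space of the product
  measures \<^const>\<open>PiM\<close>. The topology used on it is the subspace topology of the product
  topology.
\<close>

definition vecs :: "nat \<Rightarrow> (nat \<Rightarrow> real) set" where
  "vecs N = {1..N} \<rightarrow>\<^sub>E UNIV"

definition origin :: "nat \<Rightarrow> nat \<Rightarrow> real" where
  "origin N = (\<lambda>i\<in>{1..N}. 0)"

definition weyl_A :: "nat \<Rightarrow> (nat \<Rightarrow> real) set" where
  "weyl_A N = {x \<in> vecs N. \<forall>i\<in>{1..N}. \<forall>j\<in>{1..N}. i \<le> j \<longrightarrow> x i \<le> x j}"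

definition weyl_borel :: "nat \<Rightarrow> (nat \<Rightarrow> real) measure" where
  "weyl_borel N = restrict_space (\<Pi>\<^sub>M i\<in>{1..N}. borel) (weyl_A N)"

definition weyl_lborel :: "nat \<Rightarrow> (nat \<Rightarrow> real) measure" where
  "weyl_lborel N = restrict_space (\<Pi>\<^sub>M i\<in>{1..N}. lborel) (weyl_A N)"

definition partial :: "nat \<Rightarrow> ((nat \<Rightarrow> real) \<Rightarrow> real) \<Rightarrow> (nat \<Rightarrow> real) \<Rightarrow> real" where
  "partial i f x = deriv (\<lambda>s. f (x(i := s))) (x i)"

definition has_cont_partials :: "nat \<Rightarrow> ((nat \<Rightarrow> real) \<Rightarrow> real) \<Rightarrow> bool" where
  "has_cont_partials N f \<longleftrightarrow>
     (\<forall>i\<in>{1..N}. (\<forall>x\<in>vecs N. (\<lambda>s. f (x(i := s))) differentiable at (x i)) \<and>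
                 continuous_on (vecs N) (partial i f))"

text \<open>
  The reflecting boundary is encoded in the test functions: they are the \<open>C\<^sup>2\<close> functions of
  compact support on \<open>\<real>\<^sup>N\<close> that are invariant under permutation of the coordinates. In
  particular their derivative normal to each wall \<open>x\<^sub>i = x\<^sub>j\<close> vanishes (Neumann condition).
\<close>

definition bessel_test :: "nat \<Rightarrow> ((nat \<Rightarrow> real) \<Rightarrow> real) \<Rightarrow> bool" where
  "bessel_test N f \<longleftrightarrow>
     continuous_on (vecs N) f \<and> has_cont_partials N f \<and>
     (\<forall>i\<in>{1..N}. has_cont_partials N (partial i f)) \<and>
     (\<forall>\<pi>. \<pi> permutes {1..N} \<longrightarrow> (\<forall>x\<in>vecs N. f (x \<circ> \<pi>) = f x)) \<and>
     (\<exists>R. \<forall>x\<in>vecs N. (\<exists>i\<in>{1..N}. R < \<bar>x i\<bar>) \<longrightarrow> f x = 0)"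

text \<open>
  On the walls the singular terms get the value 0 (division by zero). This is harmless: the
  generator is only ever integrated against the law of the process over time, and the process
  spends no time on the walls.
\<close>

definition bessel_generator ::
    "nat \<Rightarrow> real \<Rightarrow> ((nat \<Rightarrow> real) \<Rightarrow> real) \<Rightarrow> (nat \<Rightarrow> real) \<Rightarrow> real" where
  "bessel_generator N k f x =
     1/2 * (\<Sum>i\<in>{1..N}. partial i (partial i f) x) +
     k * (\<Sum>i\<in>{1..N}. (\<Sum>j\<in>{1..N} - {i}. 1 / (x i - x j)) * partial i f x)"

definition bessel_weight :: "nat \<Rightarrow> real \<Rightarrow> real \<Rightarrow> (nat \<Rightarrow> real) \<Rightarrow> real" where
  "bessel_weight N k t y =
     exp (- (\<Sum>i\<in>{1..N}. (y i)\<^sup>2) / (2 * t)) *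
     (\<Prod>j\<in>{1..N}. \<Prod>i\<in>{1..<j}. (y j - y i) powr (2 * k))"

definition bessel_law0 :: "nat \<Rightarrow> real \<Rightarrow> real \<Rightarrow> (nat \<Rightarrow> real) measure" where
  "bessel_law0 N k t =
     density (weyl_lborel N)
       (\<lambda>y. ennreal (bessel_weight N k t y / (LINT u|weyl_lborel N. bessel_weight N k t u)))"

text \<open>
  Transition semigroup of the Bessel process: a semigroup of Markov kernels on the closed
  chamber whose generator is \<^const>\<open>bessel_generator\<close>, in the integrated form
  \<open>P\<^sub>t f - f = \<integral>\<^sub>0\<^sup>t P\<^sub>s (L f) ds\<close>. The last clause is the classical closed form of the kernel
  at the starting point 0.
\<close>

definition bessel_semigroup ::
    "nat \<Rightarrow> real \<Rightarrow> (real \<Rightarrow> (nat \<Rightarrow> real) \<Rightarrow> (nat \<Rightarrow> real) measure) \<Rightarrow> bool" where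
  "bessel_semigroup N k P \<longleftrightarrow>
     (\<forall>t\<ge>0. P t \<in> measurable (weyl_borel N) (prob_algebra (weyl_borel N))) \<and>
     (\<forall>x\<in>weyl_A N. P 0 x = return (weyl_borel N) x) \<and>
     (\<forall>s\<ge>0. \<forall>t\<ge>0. \<forall>x\<in>weyl_A N. P (s + t) x = P s x \<bind> P t) \<and>
     (\<forall>f. bessel_test N f \<longrightarrow> (\<forall>x\<in>weyl_A N. \<forall>t\<ge>0.
        set_integrable lborel {0..t} (\<lambda>s. LINT y|P s x. bessel_generator N k f y) \<and>
        (LINT y|P t x. f y) - f x =
          (LINT s:{0..t}|lborel. (LINT y|P s x. bessel_generator N k f y)))) \<and>
     (\<forall>t>0. P t (origin N) = bessel_law0 N k t)"

definition natural_filtration ::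
    "'w measure \<Rightarrow> 'b measure \<Rightarrow> (real \<Rightarrow> 'w \<Rightarrow> 'b) \<Rightarrow> real \<Rightarrow> 'w measure" where
  "natural_filtration M S X t =
     sigma (space M) {X s -` B \<inter> space M | s B. 0 \<le> s \<and> s \<le> t \<and> B \<in> sets S}"

definition markov_process ::
    "'w measure \<Rightarrow> 'b measure \<Rightarrow> (real \<Rightarrow> 'b \<Rightarrow> 'b measure) \<Rightarrow> (real \<Rightarrow> 'w \<Rightarrow> 'b) \<Rightarrow> bool" where
  "markov_process M S P X \<longleftrightarrow>
     prob_space M \<and> (\<forall>t\<ge>0. X t \<in> measurable M S) \<and>
     (\<forall>s\<ge>0. \<forall>t\<ge>s. \<forall>B\<in>sets S. AE \<omega> in M.
        real_cond_exp M (natural_filtration M S X s) (indicat_real (X t -` B \<inter> space M)) \<omega> =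
        measure (P (t - s) (X s \<omega>)) B)"

definition bessel_process0 ::
    "nat \<Rightarrow> real \<Rightarrow> 'w measure \<Rightarrow> (real \<Rightarrow> 'w \<Rightarrow> nat \<Rightarrow> real) \<Rightarrow> bool" where
  "bessel_process0 N k M X \<longleftrightarrow>
     (\<exists>P. bessel_semigroup N k P \<and> markov_process M (weyl_borel N) P X) \<and>
     (AE \<omega> in M. X 0 \<omega> = origin N)"

section \<open>Hermite polynomials and their zeros\<close>

fun hermite :: "nat \<Rightarrow> real poly" where
  "hermite 0 = 1"
| "hermite (Suc n) = [:0, 2:] * hermite n - pderiv (hermite n)"

text \<open>
  The recursion is the one that results from Rodrigues' formula for the physicists' Hermite
  polynomials.
\<close>

lemma hermite_rodrigues:
  "(deriv ^^ n) (\<lambda>x. exp (- x\<^sup>2)) = (\<lambda>x. (-1) ^ n * poly (hermite n) x * exp (- x\<^sup>2))"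
proof (induction n)
  case 0
  show ?case by simp
next
  case (Suc n)
  have "((\<lambda>x. (-1) ^ n * poly (hermite n) x * exp (- x\<^sup>2)) has_real_derivative
          (-1) ^ Suc n * poly (hermite (Suc n)) x * exp (- x\<^sup>2)) (at x)" for x :: real
    by (auto intro!: derivative_eq_intros simp: algebra_simps)
  then have "deriv (\<lambda>x. (-1) ^ n * poly (hermite n) x * exp (- x\<^sup>2)) =
          (\<lambda>x. (-1) ^ Suc n * poly (hermite (Suc n)) x * exp (- x\<^sup>2))"
    by (intro ext DERIV_imp_deriv)
  then show ?case
    using Suc.IH by simp
qed

text \<open>\<open>hermite_zero N j\<close> is the \<open>j\<close>-th smallest zero of \<open>H\<^sub>N\<close>, where \<open>1 \<le> j \<le> N\<close>.\<close>

definition hermite_zero :: "nat \<Rightarrow> nat \<Rightarrow> real" where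
  "hermite_zero N j = sorted_list_of_set {x. poly (hermite N) x = 0} ! (j - 1)"

section \<open>The Airy function\<close>

definition Ai :: "real \<Rightarrow> real" where
  "Ai = (THE y. (\<exists>y'. \<forall>z. (y has_real_derivative y' z) (at z) \<and>
                         (y' has_real_derivative z * y z) (at z)) \<and>
                (y \<longlongrightarrow> 0) at_top \<and>
                y 0 = 1 / (3 powr (2/3) * Gamma (2/3)))"

text \<open>
  The \<open>r\<close>-th largest zero, where \<open>r \<ge> 1\<close>; then the cardinality condition also forces
  finiteness of the set.
\<close>

definition airy_zero :: "nat \<Rightarrow> real" where
  "airy_zero r = (THE a. Ai a = 0 \<and> card {x. a \<le> x \<and> Ai x = 0} = r)"

definition sigma2_integrand :: "nat \<Rightarrow> real \<Rightarrow> real" where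
  "sigma2_integrand r x = (Ai (x + airy_zero r))\<^sup>2 / ((deriv Ai (airy_zero r))\<^sup>2 * x)"

definition sigma2_max :: "nat \<Rightarrow> real" where
  "sigma2_max r = (LINT x:{0<..}|lborel. sigma2_integrand r x)"

section \<open>Convergence in distribution\<close>

text \<open>The library's \<^const>\<open>weak_conv_m\<close> for an arbitrary filter instead of sequences.\<close>

definition weak_conv_along :: "'i filter \<Rightarrow> ('i \<Rightarrow> real measure) \<Rightarrow> real measure \<Rightarrow> bool" where
  "weak_conv_along F \<mu>s \<mu> \<longleftrightarrow>
     (\<forall>x. isCont (cdf \<mu>) x \<longrightarrow> ((\<lambda>i. cdf (\<mu>s i) x) \<longlongrightarrow> cdf \<mu> x) F)"

lemma weak_conv_along_sequentially: "weak_conv_along sequentially \<mu>s \<mu> \<longleftrightarrow> weak_conv_m \<mu>s \<mu>"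
  by (simp add: weak_conv_along_def weak_conv_m_def weak_conv_def)

definition normal_dist0 :: "real \<Rightarrow> real measure" where
  "normal_dist0 v = density lborel (\<lambda>x. ennreal (normal_density 0 (sqrt v) x))"

end

theory Submission
  imports Defs
begin

text \<open>
  For fixed \<open>N\<close>, the density of the process at time \<open>t\<close>, centred at the zeros \<open>z\<close> of \<open>H\<^sub>N\<close> (the
  minimum of the energy) and rescaled, converges to the Gaussian density \<open>exp (- u \<bullet> A u / 2)\<close> as
  \<open>k \<rightarrow> \<infinity>\<close>, dominated by a Gaussian since \<open>ln (1 + v) \<le> v\<close>. Here \<open>A\<close> is the Hessian of the energy. Its
  eigenvalues are \<open>1, \<dots>, N\<close>, with eigenvectors given by the polynomials dual to the Hermite
  polynomials, so the limiting variance of a coordinate is a weighted sum of squares of dual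
  polynomials. Their three-term recursion at an edge zero is a discretised Airy equation with mesh
  \<open>N\<^bsup>-1/3\<^esup>\<close>, and by Sturm comparison the edge zeros of \<open>H\<^sub>N\<close>, rescaled, converge to the zeros of \<open>Ai\<close>.
  Hence \<open>N\<^bsup>1/3\<^esup>\<close> times the variance is a Riemann sum that converges to \<open>\<integral> Ai(x + a\<^sub>r)\<^sup>2 / (Ai'(a\<^sub>r)\<^sup>2 x)\<close>.
  This tends to 0 because \<open>Ai(\<cdot> + a\<^sub>r) / Ai'(a\<^sub>r)\<close> has \<open>L\<^sup>2\<close> norm 1 and is bounded by its energy near 0.

  For the digits, the square \<open>U\<close> of the normalised Airy function satisfies a linear equation of third
  order, so its Taylor coefficients obey a recursion that is checked in integer arithmetic. The
  instability of this recursion is met by enclosing \<open>a\<^sub>r\<close> to up to 30 digits, by sign changes of the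
  power series of \<open>Ai\<close>; the tail of the integral beyond \<open>X\<close> is at most \<open>U''(X) / (2X)\<close>.
\<close>


section \<open>Second order linear equations\<close>

text \<open>Only the law at one time matters: conditioning on time 0 leaves the density in the last
  clause of \<open>bessel_semigroup\<close>. The spectrum of the Hessian comes from applying p'' - 2
  x p' to Lagrange interpolants at the zeros of H_N: H_m is an eigenvector with eigenvalue -2m, and
  the case m = N - 1 evaluates the diagonal. \<open>Ai\<close> is known only by its decay, so it is
  built from the power series \<open>af\<close>, \<open>ag\<close> at 0: \<open>af / ag\<close>
  decreases, \<open>af' / ag'\<close> increases, and the value \<open>airy_kappa\<close> trapped
  between them makes \<open>af - airy_kappa * ag\<close> decay. The same two bounds later enclose
  \<open>airy_kappa\<close> numerically.

  In the edge coordinate the potential of the Hermite functions exceeds a shifted linear one on the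
  whole line, but stays below one only on compact sets; hence the two bounds for the edge zeros have
  different proofs. The Riemann sum carries the weight 1/k, singular at 0, so the discrete solution
  must be close to the Airy function with an error proportional to the distance from 0. The
  stability estimate therefore runs over difference quotients.\<close>

definition ode2 :: "(real \<Rightarrow> real) \<Rightarrow> (real \<Rightarrow> real) \<Rightarrow> (real \<Rightarrow> real) \<Rightarrow> bool" where
  "ode2 p y y' \<longleftrightarrow> (\<forall>x. (y has_real_derivative y' x) (at x) \<and>
                        (y' has_real_derivative p x * y x) (at x))"

lemma ode2D:
  assumes "ode2 p y y'"
  shows "(y has_real_derivative y' x) (at x)" "(y' has_real_derivative p x * y x) (at x)"
  using assms by (auto simp: ode2_def)

lemma ode2_isCont:
  assumes "ode2 p y y'"
  shows "isCont y x" "isCont y' x"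
  using ode2D[OF assms] by (auto intro: DERIV_isCont)

lemma ode2_continuous_on:
  assumes "ode2 p y y'"
  shows "continuous_on S y" "continuous_on S y'"
  using ode2_isCont[OF assms] by (auto intro: continuous_at_imp_continuous_on)

lemma ode2_lincomb:
  assumes "ode2 p y y'" "ode2 p w w'"
  shows "ode2 p (\<lambda>x. a * y x + b * w x) (\<lambda>x. a * y' x + b * w' x)"
  unfolding ode2_def
  using ode2D[OF assms(1)] ode2D[OF assms(2)]
  by (auto intro!: derivative_eq_intros simp: algebra_simps)

lemma ode2_shift:
  assumes "ode2 p y y'"
  shows "ode2 (\<lambda>x. p (x + s)) (\<lambda>x. y (x + s)) (\<lambda>x. y' (x + s))"
  unfolding ode2_def using ode2D[OF assms, of "_ + s"] by (simp add: DERIV_shift)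

lemma wronskian_deriv:
  assumes "ode2 p y y'" "ode2 q w w'"
  shows "((\<lambda>x. y x * w' x - y' x * w x) has_real_derivative (q x - p x) * (y x * w x)) (at x)"
  using ode2D[OF assms(1)] ode2D[OF assms(2)]
  by (auto intro!: derivative_eq_intros simp: algebra_simps)

lemma wronskian_const:
  assumes "ode2 p y y'" "ode2 p w w'"
  shows "y x * w' x - y' x * w x = y s * w' s - y' s * w s"
proof -
  have "\<forall>x. ((\<lambda>x. y x * w' x - y' x * w x) has_real_derivative 0) (at x)"
    using wronskian_deriv[OF assms] by simp
  then show ?thesis by (rule DERIV_isconst_all)
qed

lemma ode2_represent:
  assumes f: "ode2 p f f'" "f s = 1" "f' s = 0"
    and g: "ode2 p g g'" "g s = 0" "g' s = 1"
    and y: "ode2 p y y'"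
  shows "y x = y s * f x + y' s * g x"
proof -
  have 1: "f x * g' x - f' x * g x = 1"
    using wronskian_const[OF f(1) g(1), of x s] f g by simp
  have 2: "y x * g' x - y' x * g x = y s"
    using wronskian_const[OF y g(1), of x s] g by simp
  have 3: "y x * f' x - y' x * f x = - y' s"
    using wronskian_const[OF y f(1), of x s] f by simp
  have "y x = y x * (f x * g' x - f' x * g x)" using 1 by simp
  also have "\<dots> = f x * (y x * g' x - y' x * g x) - g x * (y x * f' x - y' x * f x)"
    by (simp add: algebra_simps)
  finally show ?thesis using 2 3 by simp
qed

section \<open>Sturm comparison on bounded intervals\<close>

lemma pos_right_deriv_nonneg:
  fixes w :: "real \<Rightarrow> real"
  assumes "(w has_real_derivative d) (at a)" "w a = 0" "a < b" "\<And>x. a < x \<Longrightarrow> x < b \<Longrightarrow> 0 < w x"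
  shows "0 \<le> d"
proof (rule ccontr)
  assume "\<not> 0 \<le> d"
  then obtain e where "e > 0" "\<And>h. 0 < h \<Longrightarrow> h < e \<Longrightarrow> w (a + h) < w a"
    using DERIV_neg_dec_right[OF assms(1)] by auto
  moreover define h where "h = min (e/2) ((b-a)/2)"
  ultimately have h: "0 < h" "h < e" "w (a + h) < w a" using assms(3) by (auto simp: min_def)
  have "h \<le> (b-a)/2" unfolding h_def by (rule min.cobounded2)
  then have "a + h < b" using assms(3) by argo
  with h
  show False using assms(4)[of "a + h"] assms(2) by auto
qed

lemma pos_left_deriv_nonpos:
  fixes w :: "real \<Rightarrow> real"
  assumes "(w has_real_derivative d) (at b)" "w b = 0" "a < b" "\<And>x. a < x \<Longrightarrow> x < b \<Longrightarrow> 0 < w x"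
  shows "d \<le> 0"
proof (rule ccontr)
  assume "\<not> d \<le> 0"
  then obtain e where "e > 0" "\<And>h. 0 < h \<Longrightarrow> h < e \<Longrightarrow> w (b - h) < w b"
    using DERIV_pos_inc_left[OF assms(1)] by auto
  moreover define h where "h = min (e/2) ((b-a)/2)"
  ultimately have h: "0 < h" "h < e" "w (b - h) < w b" using assms(3) by (auto simp: min_def)
  have "h \<le> (b-a)/2" unfolding h_def by (rule min.cobounded2)
  then have "a < b - h" using assms(3) by argo
  with h
  show False using assms(4)[of "b - h"] assms(2) by auto
qed

lemma nonzero_const_sign:
  fixes w :: "real \<Rightarrow> real"
  assumes "continuous_on S w" "connected S" "\<And>x. x \<in> S \<Longrightarrow> w x \<noteq> 0"
  shows "(\<forall>x\<in>S. 0 < w x) \<or> (\<forall>x\<in>S. w x < 0)"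
proof (rule ccontr)
  assume "\<not> ?thesis"
  then obtain x y where xy: "x \<in> S" "y \<in> S" "w x < 0" "w y > 0"
    using assms(3) by (metis linorder_neqE_linordered_idom)
  have "connected (w ` S)" using assms by (intro connected_continuous_image)
  then have "0 \<in> w ` S"
    by (meson xy connected_iff_interval image_eqI less_imp_le)
  then show False using assms(3) by auto
qed

text \<open>The Wronskian \<open>y * w' - y' * w\<close> has derivative
  \<open>(q - p) * (y * w)\<close>, so it increases strictly on the interval. But \<open>w\<close>
  vanishes at both ends and is positive inside, which makes the Wronskian nonnegative at
  \<open>a\<close> and nonpositive at \<open>b\<close>.\<close>

lemma sturm_core:
  assumes y: "ode2 p y y'" and w: "ode2 q w w'" and "a < b"
    and "w a = 0" "w b = 0" "\<And>x. a < x \<Longrightarrow> x < b \<Longrightarrow> 0 < w x"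
    and pq: "\<And>x. a < x \<Longrightarrow> x < b \<Longrightarrow> p x < q x"
    and ypos: "\<And>x. a < x \<Longrightarrow> x < b \<Longrightarrow> 0 < y x"
  shows False
proof -
  have wa: "w' a \<ge> 0" using pos_right_deriv_nonneg[OF ode2D(1)[OF w]] assms by blast
  have wb: "w' b \<le> 0" using pos_left_deriv_nonpos[OF ode2D(1)[OF w]] assms by blast
  \<comment> \<open>Positivity of \<open>y\<close> is known only inside; continuity carries the weak
    inequality to the end points, where \<open>y\<close> may vanish.\<close>
  have ycl: "y x \<ge> 0" if "x \<in> closure {a<..<b}" for x
    by (rule continuous_ge_on_closure[OF ode2_continuous_on(1)[OF y] that])
       (use ypos in \<open>auto intro: less_imp_le\<close>)
  have ya: "y a \<ge> 0" "y b \<ge> 0" using \<open>a < b\<close> by (auto intro!: ycl)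
  let ?W = "\<lambda>x. y x * w' x - y' x * w x"
  have "?W a < ?W b"
  proof (rule DERIV_pos_imp_increasing_open[OF \<open>a < b\<close>])
    show "continuous_on {a..b} ?W"
      by (intro continuous_intros ode2_continuous_on[OF y] ode2_continuous_on[OF w])
    fix x assume "a < x" "x < b"
    then show "\<exists>d. (?W has_real_derivative d) (at x) \<and> d > 0"
      using wronskian_deriv[OF y w, of x] pq[of x] ypos[of x] assms(6)[of x] by (metis
        diff_gt_0_iff_gt mult_pos_pos)
  qed
  moreover have "?W a \<ge> 0" using wa ya assms by simp
  moreover have "?W b \<le> 0" using wb ya assms by (simp add: mult_nonneg_nonpos)
  ultimately show False by simp
qed

lemma ode2_uminus: "ode2 p y y' \<Longrightarrow> ode2 p (\<lambda>x. - y x) (\<lambda>x. - y' x)"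
  using ode2_lincomb[of p y y' y y' "-1" 0] by simp

text \<open>If \<open>y\<close> had no zero, neither function would change sign on the open
  interval. Both equations are invariant under negation, so each of the four sign patterns is an
  instance of the positive case.\<close>

lemma sturm_consecutive:
  assumes y: "ode2 p y y'" and w: "ode2 q w w'" and ab: "a < b"
    and w0: "w a = 0" "w b = 0" "\<And>x. a < x \<Longrightarrow> x < b \<Longrightarrow> w x \<noteq> 0"
    and pq: "\<And>x. a < x \<Longrightarrow> x < b \<Longrightarrow> p x < q x"
  shows "\<exists>x. a < x \<and> x < b \<and> y x = 0"
proof (rule ccontr)
  assume "\<not> ?thesis"
  then have y0: "\<And>x. x \<in> {a<..<b} \<Longrightarrow> y x \<noteq> 0" by auto
  have w0': "\<And>x. x \<in> {a<..<b} \<Longrightarrow> w x \<noteq> 0" using w0 by auto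
  have "(\<forall>x\<in>{a<..<b}. 0 < y x) \<or> (\<forall>x\<in>{a<..<b}. y x < 0)"
    by (rule nonzero_const_sign[OF ode2_continuous_on(1)[OF y] _ y0]) auto
  moreover have "(\<forall>x\<in>{a<..<b}. 0 < w x) \<or> (\<forall>x\<in>{a<..<b}. w x < 0)"
    by (rule nonzero_const_sign[OF ode2_continuous_on(1)[OF w] _ w0']) auto
  ultimately show False
    using sturm_core[OF y w ab w0(1,2) _ pq]
      sturm_core[OF ode2_uminus[OF y] w ab w0(1,2) _ pq]
      sturm_core[OF y ode2_uminus[OF w] ab _ _ _ pq]
      sturm_core[OF ode2_uminus[OF y] ode2_uminus[OF w] ab _ _ _ pq] w0(1,2)
    by (auto; fastforce)
qed

text \<open>The zeros \<open>a\<close> and \<open>b\<close> need not be adjacent. Finiteness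
  provides a first zero \<open>c\<close> after \<open>a\<close>, and the interval from
  \<open>a\<close> to \<open>c\<close> already contains a zero of \<open>y\<close>.\<close>

lemma sturm:
  assumes y: "ode2 p y y'" and w: "ode2 q w w'" and ab: "a < b"
    and w0: "w a = 0" "w b = 0" and fin: "finite {x. a \<le> x \<and> x \<le> b \<and> w x = 0}"
    and pq: "\<And>x. a < x \<Longrightarrow> x < b \<Longrightarrow> p x < q x"
  shows "\<exists>x. a < x \<and> x < b \<and> y x = 0"
proof -
  let ?Z = "{x. a < x \<and> x \<le> b \<and> w x = 0}"
  have finZ: "finite ?Z" by (rule finite_subset[OF _ fin]) auto
  have ne: "b \<in> ?Z" using ab w0 by auto
  define c where "c = Min ?Z"
  have c: "a < c" "c \<le> b" "w c = 0" using Min_in[OF finZ] ne unfolding c_def by auto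
  have "w x \<noteq> 0" if "a < x" "x < c" for x
    using Min_le[OF finZ, of x] that c unfolding c_def[symmetric] by force
  from sturm_consecutive[OF y w c(1) w0(1) c(3) this] obtain x where "a < x" "x < c" "y x = 0"
    using pq c by force
  then show ?thesis using c by force
qed

text \<open>Adding a new largest element \<open>b\<close> to \<open>A\<close> yields a point of
  \<open>T\<close> beyond \<open>Max A\<close>, which the smaller interval does not count, so the
  count grows by at least one. This turns Sturm comparison into inequalities between numbers of
  zeros.\<close>

lemma interlacing_card:
  fixes S T :: "real set"
  assumes "finite S" "finite T" "S \<noteq> {}"
    and "\<And>a b. a \<in> S \<Longrightarrow> b \<in> S \<Longrightarrow> a < b \<Longrightarrow> \<exists>t\<in>T. a < t \<and> t < b"
  shows "card S \<le> Suc (card {t\<in>T. Min S < t \<and> t < Max S})"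
  using assms(1,3,4)
proof (induction S rule: finite_linorder_max_induct)
  case empty then show ?case by simp
next
  case (insert b A)
  show ?case
  proof (cases "A = {}")
    case False
    have M: "Max A \<in> A" "Min A \<in> A" using False insert by auto
    obtain t where t: "t \<in> T" "Max A < t" "t < b" using insert M by blast
    have "card A \<le> Suc (card {t\<in>T. Min A < t \<and> t < Max A})"
      using insert False by auto
    moreover have "card {t\<in>T. Min A < t \<and> t < Max A} < card {s\<in>T. Min (insert b A) < s \<and> s < Max (insert b A)}"
    proof (rule psubset_card_mono)
      show "finite {s\<in>T. Min (insert b A) < s \<and> s < Max (insert b A)}" using assms by auto
      have mi: "Min (insert b A) = Min A" "Max (insert b A) = b"
      proof -
        have "Min A < b" "Max A < b" using insert(2) M by auto
        then show "Min (insert b A) = Min A" "Max (insert b A) = b"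
          using insert(1) False by simp_all
      qed
      have "Min A \<le> Max A" using M insert by auto
      then have "t \<in> {s\<in>T. Min (insert b A) < s \<and> s < Max (insert b A)}"
        using t unfolding mi by auto
      moreover have "t \<notin> {t\<in>T. Min A < t \<and> t < Max A}" using t by auto
      moreover have "{t\<in>T. Min A < t \<and> t < Max A} \<subseteq> {s\<in>T. Min (insert b A) < s \<and> s < Max (insert b A)}"
        unfolding mi using insert M by auto
      ultimately show "{t\<in>T. Min A < t \<and> t < Max A} \<subset> {s\<in>T. Min (insert b A) < s \<and> s < Max (insert b A)}"
        by blast
    qed
    moreover have "card (insert b A) = Suc (card A)" using insert by (subst card_insert_disjoint) auto
    ultimately show ?thesis by linarith
  qed auto
qed

section \<open>Uniqueness, spacing and finiteness of zeros\<close>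

lemma taylor2_bound:
  fixes y :: "real \<Rightarrow> real"
  assumes y: "\<And>x. (y has_real_derivative y' x) (at x)" "\<And>x. (y' has_real_derivative y2 x) (at x)"
    and c: "y' c = 0"
    and K: "\<And>x. min c e < x \<Longrightarrow> x < max c e \<Longrightarrow> \<bar>y2 x\<bar> \<le> K"
  shows "\<bar>y e - y c\<bar> \<le> K * (e - c)\<^sup>2 / 2"
proof (cases "e = c")
  case False
  have "\<exists>t. (if e < c then e < t \<and> t < c else c < t \<and> t < e) \<and>
    y e = (\<Sum>m<2. ((\<lambda>m. if m = 0 then y else if m = 1 then y' else y2) m c / fact m) * (e - c)^m)
       + ((\<lambda>m. if m = (0::nat) then y else if m = 1 then y' else y2) 2 t / fact 2) * (e - c)^2"
    by (rule Taylor[where a="min c e" and b="max c e"]) (use False y in \<open>auto simp: less_2_cases_iff\<close>)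
  then obtain t where t: "min c e < t" "t < max c e" "y e = y c + y2 t / 2 * (e - c)\<^sup>2"
    using c by (auto simp: numeral_2_eq_2 lessThan_Suc split: if_splits)
  have "\<bar>y2 t\<bar> * (e - c)\<^sup>2 \<le> K * (e - c)\<^sup>2" using K[OF t(1,2)] by (intro mult_right_mono) auto
  then show ?thesis using t(3) by (simp add: abs_mult)
qed auto

lemma continuous_bounded_Icc:
  fixes p :: "real \<Rightarrow> real"
  assumes "continuous_on UNIV p"
  shows "\<exists>Q>0. \<forall>x\<in>{a..b}. \<bar>p x\<bar> \<le> Q"
proof -
  have "compact (p ` {a..b})"
    using assms by (intro compact_continuous_image) (auto intro: continuous_on_subset)
  from compact_imp_bounded[OF this] show ?thesis unfolding bounded_pos by auto
qed

text \<open>On a window of half-width \<open>h \<le> 1\<close> with \<open>Q * h \<le> 1\<close>,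
  Taylor's formula bounds the maximum of \<open>\<bar>y\<bar>\<close> by half of itself, so
  \<open>y\<close> vanishes there. Finitely many such steps lead from \<open>s\<close> to
  \<open>x\<close>.\<close>

lemma ode2_zero_imp_zero:
  assumes y: "ode2 p y y'" and p: "continuous_on UNIV p" and s: "y s = 0" "y' s = 0"
  shows "y x = 0"
proof -
  have *: "y b = 0 \<and> y' b = 0"
    if yy: "y a = 0" "y' a = 0" and ab: "\<bar>b - a\<bar> \<le> h" and h: "h > 0" "h \<le> 1" and Q: "\<And>x. x \<in> {a-1..a+1} \<Longrightarrow> \<bar>p x\<bar> \<le> Q"
      "Q * h \<le> 1" "Q \<ge> 0"
    for a b h Q
  proof -
    obtain c where c: "c \<in> {a-h..a+h}" "\<And>x. x \<in> {a-h..a+h} \<Longrightarrow> \<bar>y x\<bar> \<le> \<bar>y c\<bar>"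
      using continuous_attains_sup[of "{a-h..a+h}" "\<lambda>x. \<bar>y x\<bar>"]
        continuous_on_rabs[OF ode2_continuous_on(1)[OF y]] h by fastforce
    have "\<bar>y c - y a\<bar> \<le> (Q * \<bar>y c\<bar>) * (c - a)\<^sup>2 / 2"
    proof (rule taylor2_bound[OF ode2D(1)[OF y] ode2D(2)[OF y] yy(2)])
      fix x assume "min a c < x" "x < max a c"
      then have "x \<in> {a-h..a+h}" using c h by (auto simp: min_def max_def split: if_splits)
      moreover from this h have "x \<in> {a-1..a+1}" by auto
      ultimately show "\<bar>p x * y x\<bar> \<le> Q * \<bar>y c\<bar>"
        unfolding abs_mult by (intro mult_mono Q c) auto
    qed
    also have "\<dots> \<le> \<bar>y c\<bar> / 2"
    proof -
      have "(c - a)\<^sup>2 \<le> h * h" using c h unfolding power2_eq_square abs_le_square_iff[symmetric]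
        by (metis abs_le_square_iff abs_of_pos abs_diff_le_iff atLeastAtMost_iff power2_eq_square)
      also have "\<dots> \<le> h" using h by (simp add: mult_le_cancel_left1 mult_left_le)
      finally have "Q * (c - a)\<^sup>2 \<le> Q * h" using Q(3) by (rule mult_left_mono)
      then have "Q * (c-a)\<^sup>2 \<le> 1" using Q by simp
      then have "\<bar>y c\<bar> * (Q * (c-a)\<^sup>2) \<le> \<bar>y c\<bar> * 1" by (intro mult_left_mono) auto
      then show ?thesis by (simp add: algebra_simps)
    qed
    finally have "y c = 0" using yy by (simp split: abs_split)
    then have z: "y x = 0" if "x \<in> {a-h..a+h}" for x using c(2)[OF that] by simp
    have yb: "y b = 0" by (rule z) (use ab in auto)
    have "y' b = 0"
    proof (cases "b < a")
      case True
      have "\<exists>z>b. z < a \<and> y' a - y' b = (a - b) * (p z * y z)"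
        by (rule MVT2[OF True]) (use ode2D[OF y] in auto)
      then show ?thesis using z ab yy by auto
    next
      case False
      show ?thesis
      proof (cases "a < b")
        case True
        have "\<exists>z>a. z < b \<and> y' b - y' a = (b - a) * (p z * y z)"
          by (rule MVT2[OF True]) (use ode2D[OF y] in auto)
        then show ?thesis using z ab yy by auto
      qed (use False yy in auto)
    qed
    with yb show ?thesis by simp
  qed
  \<comment> \<open>All windows met on the way from \<open>s\<close> to \<open>x\<close>, enlarged
    to half-width 1, lie between \<open>- R\<close> and \<open>R\<close>, so one bound
    \<open>Q\<close> for the coefficient serves every step.\<close>
  define R where "R = \<bar>s\<bar> + \<bar>x - s\<bar> + 2"
  obtain Q0 where Q0: "\<And>x. x \<in> {-R..R} \<Longrightarrow> \<bar>p x\<bar> \<le> Q0"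
    using continuous_bounded_Icc[OF p] by metis
  define Q where "Q = max Q0 0"
  \<comment> \<open>This choice makes the step length at most \<open>1 / max Q 1\<close>, the
    half-width of the windows.\<close>
  obtain n :: nat where n: "real n > max 1 (max Q 1 * \<bar>x - s\<bar>)" using reals_Archimedean2 by blast
  define st where "st = (x - s) / real n"
  have npos: "real n > 0" using n by auto
  have st: "\<bar>st\<bar> \<le> 1 / (max Q 1)"
    using n npos unfolding st_def by (simp add: field_simps abs_mult max_def split: if_splits)
  have "k \<le> n \<longrightarrow> y (s + real k * st) = 0 \<and> y' (s + real k * st) = 0" for k
  proof (induction k)
    case 0 show ?case using s by simp
  next
    case (Suc k)
    show ?case
    proof
      assume k: "Suc k \<le> n"
      have kn: "\<bar>real k * st\<bar> \<le> \<bar>x - s\<bar>"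
      proof -
        have "real k * \<bar>st\<bar> \<le> real n * \<bar>st\<bar>" using k by (intro mult_right_mono) auto
        also have "\<dots> = \<bar>x - s\<bar>" unfolding st_def using npos by (simp add: abs_divide)
        finally show ?thesis by (simp add: abs_mult)
      qed
      show "y (s + real (Suc k) * st) = 0 \<and> y' (s + real (Suc k) * st) = 0"
      proof (rule *[where a="s + real k * st" and h="1 / max Q 1" and Q=Q])
        show "\<bar>s + real (Suc k) * st - (s + real k * st)\<bar> \<le> 1 / max Q 1" using st by (simp add: algebra_simps)
        show "Q * (1 / max Q 1) \<le> 1" by (simp add: max_def)
        fix v assume "v \<in> {s + real k * st - 1..s + real k * st + 1}"
        then have "v \<in> {-R..R}" using kn unfolding R_def by auto
        then show "\<bar>p v\<bar> \<le> Q" using Q0[of v] unfolding Q_def by auto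
      qed (use Suc k in \<open>auto simp: Q_def\<close>)
    qed
  qed
  from this[of n] show ?thesis using npos unfolding st_def by simp
qed

text \<open>By Taylor's formula, each of the two zeros is at distance at least \<open>\<surd>(2/Q)\<close> from a maximum of
  \<open>\<bar>y\<bar>\<close> between them.\<close>

lemma ode2_zero_gap:
  assumes y: "ode2 p y y'" and p: "continuous_on UNIV p" and ab: "a < b" "y a = 0" "y b = 0"
    and Q: "\<And>x. x \<in> {a..b} \<Longrightarrow> \<bar>p x\<bar> \<le> Q" and nz: "\<exists>s. y s \<noteq> 0"
  shows "8 \<le> Q * (b - a)\<^sup>2"
proof -
  obtain c where c: "c \<in> {a..b}" "\<And>x. x \<in> {a..b} \<Longrightarrow> \<bar>y x\<bar> \<le> \<bar>y c\<bar>"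
    using continuous_attains_sup[of "{a..b}" "\<lambda>x. \<bar>y x\<bar>"]
      continuous_on_rabs[OF ode2_continuous_on(1)[OF y]] ab by fastforce
  \<comment> \<open>Otherwise \<open>y\<close> vanishes on the whole interval, hence together with
    its derivative at the midpoint, and then everywhere by uniqueness.\<close>
  have "y c \<noteq> 0"
  proof
    assume "y c = 0"
    then have z: "y x = 0" if "x \<in> {a..b}" for x using c(2)[OF that] by simp
    define m where "m = (a + b)/2"
    have m: "a < m" "m < b" using ab by (auto simp: m_def)
    have "y' m = 0"
    proof (rule DERIV_unique[OF ode2D(1)[OF y, of m]])
      have "eventually (\<lambda>x. x \<in> {a<..<b}) (nhds m)" using m by (intro eventually_nhds_in_open) auto
      then have "eventually (\<lambda>x. y x = 0) (nhds m)" by eventually_elim (use z in auto)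
      then show "(y has_real_derivative 0) (at m)"
        using DERIV_cong_ev[of m m y "\<lambda>_. 0" 0 0] by simp
    qed
    then have "y x = 0" for x using ode2_zero_imp_zero[OF y p z[of m]] m by auto
    then show False using nz by auto
  qed
  then have cab: "a < c" "c < b" using c ab by (auto simp: less_le)
  have "y' c = 0"
  proof (cases "y c > 0")
    case True
    show ?thesis
    proof (rule DERIV_local_max[OF ode2D(1)[OF y, of c], of "min (c-a) (b-c)"])
      show "\<forall>z. \<bar>c - z\<bar> < min (c - a) (b - c) \<longrightarrow> y z \<le> y c"
      proof (intro allI impI)
        fix z assume "\<bar>c - z\<bar> < min (c - a) (b - c)"
        then have "\<bar>y z\<bar> \<le> \<bar>y c\<bar>" by (intro c(2)) auto
        then show "y z \<le> y c" using True by auto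
      qed
    qed (use cab in auto)
  next
    case False
    then have "y c < 0" using \<open>y c \<noteq> 0\<close> by simp
    show ?thesis
    proof (rule DERIV_local_min[OF ode2D(1)[OF y, of c], of "min (c-a) (b-c)"])
      show "\<forall>z. \<bar>c - z\<bar> < min (c - a) (b - c) \<longrightarrow> y c \<le> y z"
      proof (intro allI impI)
        fix z assume "\<bar>c - z\<bar> < min (c - a) (b - c)"
        then have "\<bar>y z\<bar> \<le> \<bar>y c\<bar>" by (intro c(2)) auto
        then show "y c \<le> y z" using \<open>y c < 0\<close> by auto
      qed
    qed (use cab in auto)
  qed
  \<comment> \<open>Taylor's formula at the maximum gives \<open>2 \<le> Q * (e - c)\<^sup>2\<close>
    at an end point \<open>e\<close>. The end point nearer to \<open>c\<close> is at distance at
    most half the length, whence the constant 8.\<close>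
  have main: "8 \<le> Q * (b - a)\<^sup>2" if e: "y e = 0" "e \<in> {a..b}" "2 * \<bar>e - c\<bar> \<le> b - a" for e
  proof -
    have "\<bar>y e - y c\<bar> \<le> (Q * \<bar>y c\<bar>) * (e - c)\<^sup>2 / 2"
    proof (rule taylor2_bound[OF ode2D(1)[OF y] ode2D(2)[OF y] \<open>y' c = 0\<close>])
      fix x assume "min c e < x" "x < max c e"
      then have "x \<in> {a..b}" using c e by (auto simp: min_def max_def split: if_splits)
      moreover have "0 \<le> Q" using Q[of x] \<open>x \<in> {a..b}\<close> by auto
      ultimately show "\<bar>p x * y x\<bar> \<le> Q * \<bar>y c\<bar>"
        unfolding abs_mult by (intro mult_mono Q c) auto
    qed
    then have "\<bar>y c\<bar> * 2 \<le> \<bar>y c\<bar> * (Q * (e - c)\<^sup>2)" using e by (simp add: algebra_simps)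
    then have "2 \<le> Q * (e - c)\<^sup>2" using \<open>y c \<noteq> 0\<close> by (simp add: mult_le_cancel_left)
    moreover have "0 \<le> Q" using Q[of a] ab by auto
    moreover have "4 * (e-c)\<^sup>2 \<le> (b - a)\<^sup>2"
    proof -
      have "(2 * \<bar>e - c\<bar>)\<^sup>2 \<le> (b-a)\<^sup>2" using e(3) by (intro power_mono) auto
      then show ?thesis by (simp add: power_mult_distrib)
    qed
    ultimately show ?thesis
      using mult_left_mono[of "4 * (e-c)\<^sup>2" "(b-a)\<^sup>2" Q] by simp
  qed
  show ?thesis
  proof (cases "2 * (c - a) \<le> b - a")
    case True then show ?thesis using main[of a] ab cab by auto
  next
    case False then show ?thesis using main[of b] ab cab by (auto simp: abs_if)
  qed
qed

text \<open>An accumulation point would put two zeros at distance at most \<open>1 / sqrt Q\<close>,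
  but distinct zeros are at least \<open>sqrt (8 / Q)\<close> apart.\<close>

lemma ode2_finite_zeros:
  assumes y: "ode2 p y y'" and p: "continuous_on UNIV p" and nz: "\<exists>s. y s \<noteq> 0"
  shows "finite {x. a \<le> x \<and> x \<le> b \<and> y x = 0}"
proof (rule ccontr)
  assume inf: "infinite {x. a \<le> x \<and> x \<le> b \<and> y x = 0}" (is "infinite ?S")
  obtain Q where Q: "\<And>x. x \<in> {a..b} \<Longrightarrow> \<bar>p x\<bar> \<le> Q" "Q > 0"
    using continuous_bounded_Icc[OF p] by metis
  have "?S \<subseteq> {a..b}" by auto
  from Heine_Borel_imp_Bolzano_Weierstrass[OF compact_Icc inf this]
  obtain l where l: "l islimpt ?S" by (elim bexE)
  define d where "d = 1 / sqrt Q"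
  have d: "d > 0" "Q * d\<^sup>2 = 1" using Q unfolding d_def by (auto simp: power_divide)
  have "d / 2 > 0" using d by simp
  then have infB: "infinite (?S \<inter> ball l (d/2))"
    using l unfolding islimpt_eq_infinite_ball by blast
  obtain u where u: "u \<in> ?S \<inter> ball l (d/2)"
    using infinite_imp_nonempty[OF infB] by blast
  obtain v where v: "v \<in> ?S \<inter> ball l (d/2) - {u}"
    using infinite_imp_nonempty[OF infinite_remove[OF infB]] by blast
  have "\<exists>u v. u \<in> ?S \<inter> ball l (d/2) \<and> v \<in> ?S \<inter> ball l (d/2) \<and> u < v"
  proof (cases "u < v")
    case False
    then have "v < u" using v by auto
    then show ?thesis using u v by blast
  qed (use u v in blast)
  then obtain u v where uv: "u \<in> ?S \<inter> ball l (d/2)" "v \<in> ?S \<inter> ball l (d/2)" "u < v"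
    by blast
  then have "8 \<le> Q * (v - u)\<^sup>2"
    by (intro ode2_zero_gap[OF y p _ _ _ _ nz]) (use Q in auto)
  moreover have "v - u \<le> d" using uv unfolding Int_iff mem_ball dist_real_def by linarith
  then have "(v-u)\<^sup>2 \<le> d\<^sup>2" using uv by (intro power_mono) auto
  then have "Q * (v-u)\<^sup>2 \<le> Q * d\<^sup>2" using Q by (intro mult_left_mono) auto
  ultimately show False using d by simp
qed

section \<open>The Airy equation\<close>

text \<open>The parameter \<open>l\<close> is an eigenvalue: translating \<open>Ai\<close> so that
  its zero \<open>- l\<close> moves to the origin produces a solution on the half line with boundary
  value 0.\<close>

abbreviation airy_ode :: "real \<Rightarrow> (real \<Rightarrow> real) \<Rightarrow> (real \<Rightarrow> real) \<Rightarrow> bool" where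
  "airy_ode l \<equiv> ode2 (\<lambda>x. x - l)"

fun airy_coeff :: "real \<Rightarrow> real \<Rightarrow> real \<Rightarrow> nat \<Rightarrow> real" where
  "airy_coeff l a b 0 = a"
| "airy_coeff l a b (Suc 0) = b"
| "airy_coeff l a b (Suc (Suc n)) =
     ((if n = 0 then 0 else airy_coeff l a b (n - 1)) - l * airy_coeff l a b n) / ((real n + 1) * (real n + 2))"

text \<open>The constant 1/8 is the decay by 1/2 over three steps; \<open>q\<close> counts only half
  because it multiplies the later of the two terms, which is already halved once more. The lemma
  serves twice: for convergence of the power series and for the truncation error of the
  certificates.\<close>

lemma geometric_decay_rec:
  fixes t :: "nat \<Rightarrow> real"
  assumes "\<And>n. n \<ge> m \<Longrightarrow> \<bar>t (n + 3)\<bar> \<le> p * \<bar>t n\<bar> + q * \<bar>t (n + 1)\<bar>"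
    and "0 \<le> p" "0 \<le> q" "p + q / 2 \<le> 1 / 8"
    and "\<bar>t m\<bar> \<le> C" "\<bar>t (m + 1)\<bar> \<le> C / 2" "\<bar>t (m + 2)\<bar> \<le> C / 4"
  shows "\<bar>t (m + n)\<bar> \<le> C / 2 ^ n"
proof (induction n rule: less_induct)
  case (less n)
  consider "n = 0" | "n = 1" | "n = 2" | k where "n = k + 3"
    by (metis One_nat_def Suc_1 add.commute add_Suc_right add_cancel_left_right not0_implies_Suc
        numeral_3_eq_3 plus_1_eq_Suc)
  then show ?case
  proof cases
    case 4
    have "\<bar>t (m + n)\<bar> \<le> p * \<bar>t (m + k)\<bar> + q * \<bar>t (m + (k + 1))\<bar>"
      using assms(1)[of "m + k"] 4 by (simp add: add.assoc)
    also have "\<dots> \<le> p * (C / 2 ^ k) + q * (C / 2 ^ (k + 1))"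
      using less[of k] less[of "k+1"] 4 assms(2,3) by (intro add_mono mult_left_mono) auto
    also have "\<dots> = (p + q / 2) * (C / 2 ^ k)" by (simp add: field_simps)
    also have "\<dots> \<le> 1 / 8 * (C / 2 ^ k)"
    proof (rule mult_right_mono[OF assms(4)])
      show "0 \<le> C / 2 ^ k" using less[of k] 4 by (auto intro: order.trans[OF abs_ge_zero])
    qed
    also have "\<dots> = C / 2 ^ n" unfolding 4 by (simp add: power_add field_simps)
    finally show ?thesis .
  qed (use assms in auto)
qed

lemma summable_airy_coeff: "summable (\<lambda>n. airy_coeff l a b n * z ^ n)"
proof -
  let ?t = "\<lambda>n. airy_coeff l a b n * z ^ n"
  \<comment> \<open>From this index on the denominators push the two coefficients of the recursion
    below 1/16 and 1/8, and \<open>1/16 + (1/8)/2\<close> is exactly the admissible 1/8.\<close>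
  obtain m0 :: nat where m0: "real m0 > max 1 (max (16 * \<bar>z\<bar>^3) (8 * \<bar>l\<bar> * z\<^sup>2))"
    using reals_Archimedean2 by blast
  have rec: "\<bar>?t (n + 3)\<bar> \<le> 1/16 * \<bar>?t n\<bar> + 1/8 * \<bar>?t (n + 1)\<bar>" if n: "n \<ge> m0" for n
  proof -
    let ?D = "(real n + 2) * (real n + 3)"
    have "real m0 \<le> real n" using n by simp
    then have Dn: "?D \<ge> real m0" "?D > 0"
      using m0 by (auto intro!: order.trans[OF _ mult_mono[of 1 "real n + 2" "real m0" "real n + 3"]])
    have e: "?t (n + 3) = ?t n * (z^3 / ?D) - ?t (n+1) * (l * z\<^sup>2 / ?D)"
    proof -
      have "airy_coeff l a b (n + 3) = (airy_coeff l a b n - l * airy_coeff l a b (n + 1)) / ?D"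
        by (simp add: numeral_3_eq_3 algebra_simps)
      then have "?t (n+3) = (airy_coeff l a b n - l * airy_coeff l a b (n + 1)) / ?D * z^(n+3)" by simp
      also have "\<dots> = ?t n * (z^3 / ?D) - ?t (n+1) * (l * z\<^sup>2 / ?D)"
        unfolding diff_divide_distrib left_diff_distrib
        by (simp add: power_add power2_eq_square power3_eq_cube mult_ac)
      finally show ?thesis .
    qed
    have a: "\<bar>z^3 / ?D\<bar> \<le> 1/16"
      using m0 Dn by (simp add: abs_mult power_abs field_simps)
    have b: "\<bar>l * z\<^sup>2 / ?D\<bar> \<le> 1/8"
      using m0 Dn by (simp add: abs_mult power_abs field_simps)
    have "\<bar>?t (n + 3)\<bar> \<le> \<bar>?t n\<bar> * \<bar>z^3 / ?D\<bar> + \<bar>?t (n+1)\<bar> * \<bar>l * z\<^sup>2 / ?D\<bar>"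
      unfolding e abs_mult[symmetric] by (rule abs_triangle_ineq4)
    also have "\<dots> \<le> \<bar>?t n\<bar> * (1/16) + \<bar>?t (n+1)\<bar> * (1/8)"
      by (intro add_mono mult_left_mono a b) auto
    finally show ?thesis by simp
  qed
  define C where "C = \<bar>?t m0\<bar> + 2 * \<bar>?t (m0 + 1)\<bar> + 4 * \<bar>?t (m0 + 2)\<bar>"
  have B: "\<bar>?t (m0 + n)\<bar> \<le> C / 2 ^ n" for n
    by (rule geometric_decay_rec[OF rec]) (auto simp: C_def simp del: airy_coeff.simps)
  have "summable (\<lambda>n. ?t (n + m0))"
  proof (rule summable_comparison_test'[of "\<lambda>n. C * (1/2)^n" 0])
    show "summable (\<lambda>n. C * (1/2::real)^n)" by (intro summable_mult summable_geometric) auto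
    show "norm (?t (n + m0)) \<le> C * (1/2)^n" for n
      using B[of n] by (simp add: add.commute power_divide)
  qed
  then show ?thesis by (subst (asm) summable_iff_shift)
qed

definition airy_fps :: "real \<Rightarrow> real \<Rightarrow> real \<Rightarrow> real fps" where
  "airy_fps l a b = Abs_fps (airy_coeff l a b)"

definition airy_sol :: "real \<Rightarrow> real \<Rightarrow> real \<Rightarrow> real \<Rightarrow> real" where
  "airy_sol l a b = eval_fps (airy_fps l a b)"

definition airy_sol' :: "real \<Rightarrow> real \<Rightarrow> real \<Rightarrow> real \<Rightarrow> real" where
  "airy_sol' l a b = eval_fps (fps_deriv (airy_fps l a b))"

lemma nth_airy_fps: "fps_nth (airy_fps l a b) n = airy_coeff l a b n"
  by (simp add: airy_fps_def)

lemma conv_radius_airy_fps [simp]: "fps_conv_radius (airy_fps l a b) = \<infinity>"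
  unfolding fps_conv_radius_def airy_fps_def
  by (rule conv_radius_inftyI'') (simp add: summable_airy_coeff)

lemma fps_conv_radius_deriv_infty [simp]:
  "fps_conv_radius (f :: real fps) = \<infinity> \<Longrightarrow> fps_conv_radius (fps_deriv f) = \<infinity>"
  using fps_conv_radius_deriv[of f] by simp

lemma airy_fps_ode:
  "fps_deriv (fps_deriv (airy_fps l a b)) = (fps_X - fps_const l) * airy_fps l a b"
proof (rule fps_ext)
  fix n
  have "fps_nth (fps_deriv (fps_deriv (airy_fps l a b))) n
      = (real n + 1) * (real n + 2) * airy_coeff l a b (Suc (Suc n))"
    by (simp add: airy_fps_def algebra_simps)
  also have "\<dots> = (if n = 0 then 0 else airy_coeff l a b (n - 1)) - l * airy_coeff l a b n"
    by (simp del: of_nat_Suc)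
  finally show "fps_nth (fps_deriv (fps_deriv (airy_fps l a b))) n
      = fps_nth ((fps_X - fps_const l) * airy_fps l a b) n"
    by (simp add: left_diff_distrib airy_fps_def)
qed

lemma airy_sol_ode: "airy_ode l (airy_sol l a b) (airy_sol' l a b)"
proof -
  have "eval_fps (fps_deriv (fps_deriv (airy_fps l a b))) x = (x - l) * airy_sol l a b x" for x
    unfolding airy_fps_ode airy_sol_def
    by (subst eval_fps_mult) (auto simp: eval_fps_diff intro: less_le_trans[OF _ fps_conv_radius_diff])
  then show ?thesis
    unfolding ode2_def airy_sol_def airy_sol'_def
    using has_field_derivative_eval_fps[of _ "airy_fps l a b"]
      has_field_derivative_eval_fps[of _ "fps_deriv (airy_fps l a b)"] by simp
qed

lemma airy_sol_0 [simp]: "airy_sol l a b 0 = a" "airy_sol' l a b 0 = b"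
  by (auto simp: airy_sol_def airy_sol'_def eval_fps_at_0 airy_fps_def)

lemma airy_ode_continuous [simp]: "continuous_on S (\<lambda>x::real. x - l)"
  by (intro continuous_intros)

lemma airy_ode_shift:
  assumes "airy_ode l y y'"
  shows "airy_ode (l - s) (\<lambda>x. y (x + s)) (\<lambda>x. y' (x + s))"
  using ode2_shift[OF assms, of s] by (simp add: algebra_simps)

section \<open>The recessive solution of the Airy equation\<close>

definition af where "af = airy_sol 0 1 0"
definition af' where "af' = airy_sol' 0 1 0"
definition ag where "ag = airy_sol 0 0 1"
definition ag' where "ag' = airy_sol' 0 0 1"

lemma af_ode: "airy_ode 0 af af'" and ag_ode: "airy_ode 0 ag ag'"
  unfolding af_def af'_def ag_def ag'_def by (rule airy_sol_ode)+

lemma af_0 [simp]: "af 0 = 1" "af' 0 = 0" "ag 0 = 0" "ag' 0 = 1"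
  unfolding af_def af'_def ag_def ag'_def by simp_all

lemma af_ag_wronskian: "af x * ag' x - af' x * ag x = 1"
  using wronskian_const[OF af_ode ag_ode, of x 0] by simp

lemma airy_represent:
  assumes "airy_ode 0 y y'"
  shows "y x = y 0 * af x + y' 0 * ag x"
  by (rule ode2_represent[OF af_ode _ _ ag_ode _ _ assms]) auto

text \<open>For nonnegative initial data all Taylor coefficients at 0 are nonnegative, so every
  partial sum is a lower bound on the positive half line.\<close>

lemma ag_bounds:
  assumes "0 \<le> x"
  shows "x \<le> ag x" "1 + x^3/3 \<le> ag' x" "1 \<le> af x" "0 \<le> af' x"
proof -
  have nn: "0 \<le> airy_coeff 0 a b n" if "0 \<le> a" "0 \<le> b" for a b n
    using that by (induction "0::real" a b n rule: airy_coeff.induct) auto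
  have ev: "eval_fps F x \<ge> sum (\<lambda>n. fps_nth F n * x ^ n) {..<k}"
    if "fps_conv_radius F = \<infinity>" "\<And>n. 0 \<le> fps_nth F n" for F :: "real fps" and k
    unfolding eval_fps_def
    by (rule sum_le_suminf[OF summable_fps]) (use that assms in auto)
  show "x \<le> ag x"
    using ev[of "airy_fps 0 0 1" 2] nn[of 0 1]
    unfolding ag_def airy_sol_def by (simp add: nth_airy_fps numeral_2_eq_2)
  show "1 \<le> af x"
    using ev[of "airy_fps 0 1 0" 1] nn[of 1 0]
    by (simp add: af_def airy_sol_def nth_airy_fps)
  show "0 \<le> af' x"
    using ev[of "fps_deriv (airy_fps 0 1 0)" 0] nn[of 1 0]
    by (simp add: af'_def airy_sol'_def nth_airy_fps)
  have "sum (\<lambda>n. fps_nth (fps_deriv (airy_fps 0 0 1)) n * x ^ n) {..<4} = 1 + x^3/3"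
    by (simp add: nth_airy_fps eval_nat_numeral)
  then show "1 + x^3/3 \<le> ag' x"
    using ev[of "fps_deriv (airy_fps 0 0 1)" 4] nn[of 0 1]
    by (simp add: ag'_def airy_sol'_def nth_airy_fps)
qed

lemma ag_pos: "0 < x \<Longrightarrow> 0 < ag x" "0 \<le> x \<Longrightarrow> 0 < ag' x"
proof -
  show "0 < x \<Longrightarrow> 0 < ag x" using ag_bounds(1)[of x] by simp
  assume "0 \<le> x"
  then have "0 \<le> x^3/3" by simp
  then show "0 < ag' x" using ag_bounds(2)[OF \<open>0 \<le> x\<close>] by linarith
qed

text \<open>Classically this number is \<open>- Ai'(0) / Ai(0)\<close>. As the ratio decreases, the
  infimum is also its limit at infinity.\<close>

definition airy_kappa :: real where
  "airy_kappa = (INF x\<in>{0<..}. af x / ag x)"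

text \<open>By the Wronskian identity the derivative of the ratio is
  \<open>- 1 / (ag t)\<^sup>2\<close>.\<close>

lemma af_div_ag_strict_decreasing:
  assumes "0 < x" "x < s"
  shows "af s / ag s < af x / ag x"
proof (rule DERIV_neg_imp_decreasing[OF assms(2)])
  fix t assume "x \<le> t" "t \<le> s"
  then have t: "ag t > 0" using assms ag_pos by auto
  have "((\<lambda>x. af x / ag x) has_real_derivative ((af' t * ag t - af t * ag' t) / (ag t * ag t))) (at t)"
    using t by (intro DERIV_divide ode2D[OF af_ode] ode2D[OF ag_ode]) auto
  moreover have "(af' t * ag t - af t * ag' t) / (ag t * ag t) < 0"
    using af_ag_wronskian[of t] t by (intro divide_neg_pos) auto
  ultimately show "\<exists>d. ((\<lambda>x. af x / ag x) has_real_derivative d) (at t) \<and> d < 0" by blast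
qed

text \<open>By the Wronskian identity the expression is \<open>af' x / ag' x\<close>, whose
  derivative is \<open>x / (ag' x)\<^sup>2\<close>. Together with the decreasing ratio
  \<open>af / ag\<close> it traps \<open>airy_kappa\<close> from both sides.\<close>

lemma af_div_ag_lower_increasing:
  assumes "0 < x" "x \<le> s"
  shows "af x / ag x - 1 / (ag x * ag' x) \<le> af s / ag s - 1 / (ag s * ag' s)"
proof (rule DERIV_nonneg_imp_nondecreasing[OF assms(2)])
  fix t assume "x \<le> t" "t \<le> s"
  then have t: "ag t > 0" "ag' t > 0" "t > 0" using assms ag_pos by auto
  have "((\<lambda>x. af x / ag x - 1 / (ag x * ag' x)) has_real_derivative
     ((af' t * ag t - af t * ag' t) / (ag t * ag t) - (0 * (ag t * ag' t) - 1 * (ag' t * ag' t + (t - 0) * ag t * ag t)) /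
       ((ag t * ag' t) * (ag t * ag' t)))) (at t)"
    using t by (intro DERIV_divide DERIV_diff DERIV_mult ode2D[OF af_ode] ode2D[OF ag_ode] DERIV_const) auto
  moreover have "(af' t * ag t - af t * ag' t) / (ag t * ag t) - (0 * (ag t * ag' t) - 1 * (ag' t * ag' t + (t - 0) * ag t * ag t)) /
       ((ag t * ag' t) * (ag t * ag' t)) = t / (ag' t * ag' t)"
    using af_ag_wronskian[of t] t by (simp add: field_simps)
  moreover have "t / (ag' t * ag' t) \<ge> 0" using t by simp
  ultimately show "\<exists>d. ((\<lambda>x. af x / ag x - 1 / (ag x * ag' x)) has_real_derivative d) (at t) \<and> 0 \<le> d"
    by metis
qed

lemma airy_kappa_bounds:
  assumes "0 < x"
  shows "airy_kappa < af x / ag x" "af x / ag x - 1 / (ag x * ag' x) \<le> airy_kappa"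
proof -
  have bdd: "bdd_below ((\<lambda>x. af x / ag x) ` {0<..})"
  proof (rule bdd_belowI2[of _ 0])
    fix x :: real assume "x \<in> {0<..}"
    then show "0 \<le> af x / ag x" using ag_bounds(3)[of x] ag_pos(1)[of x] by simp
  qed
  have "airy_kappa \<le> af (x + 1) / ag (x + 1)"
    unfolding airy_kappa_def using assms by (intro cINF_lower bdd) auto
  also have "\<dots> < af x / ag x" using assms by (intro af_div_ag_strict_decreasing) auto
  finally show "airy_kappa < af x / ag x" .
  have lb: "1 / (ag s * ag' s) > 0" if "s > 0" for s using ag_pos[of s] that by simp
  show "af x / ag x - 1 / (ag x * ag' x) \<le> airy_kappa"
    unfolding airy_kappa_def
  proof (rule cINF_greatest)
    fix s :: real assume "s \<in> {0<..}"
    then have s: "s > 0" by simp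
    show "af x / ag x - 1 / (ag x * ag' x) \<le> af s / ag s"
    proof (cases "x \<le> s")
      case True
      then show ?thesis using af_div_ag_lower_increasing[OF assms True] lb[OF s] by linarith
    next
      case False
      then show ?thesis using af_div_ag_strict_decreasing[OF s, of x] lb[OF assms] by linarith
    qed
  qed auto
qed

text \<open>The lower bound at 1 equals \<open>af' 1 / ag' 1\<close>, and \<open>af'\<close>
  increases strictly from \<open>af' 0 = 0\<close>. Later this excludes 0 as a maximum point of
  \<open>\<bar>aa\<bar>\<close> on an interval to its left.\<close>

lemma airy_kappa_pos: "0 < airy_kappa"
proof -
  have "0 < af 1 / ag 1 - 1 / (ag 1 * ag' 1)"
  proof -
    have "af' 1 > 0"
    proof -
      have "((\<lambda>x. af' x) has_real_derivative (x - 0) * af x) (at x)" for x using ode2D(2)[OF af_ode] by simp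
      then have "af' 0 < af' 1"
      proof (intro DERIV_pos_imp_increasing_open[of 0 1 af'])
        fix x :: real assume "0 < x" "x < 1"
        then show "\<exists>d. (af' has_real_derivative d) (at x) \<and> 0 < d"
          using ode2D(2)[OF af_ode, of x] ag_bounds(3)[of x] by (intro exI[of _ "(x - 0) * af x"]) auto
      qed (auto intro: ode2_continuous_on[OF af_ode])
      then show ?thesis by simp
    qed
    then have "af 1 * ag' 1 > 1" using af_ag_wronskian[of 1] mult_pos_pos[of "af' 1" "ag 1"] ag_pos[of 1] by linarith
    then show ?thesis using ag_pos[of 1] by (simp add: field_simps)
  qed
  then show ?thesis using airy_kappa_bounds(2)[of 1] by simp
qed

text \<open>The recessive solution, normalised to be 1 at 0; \<open>Ai\<close> is a multiple of it.\<close>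

definition aa where "aa x = af x - airy_kappa * ag x"
definition aa' where "aa' x = af' x - airy_kappa * ag' x"

lemma aa_ode: "airy_ode 0 aa aa'"
  using ode2_lincomb[OF af_ode ag_ode, of 1 "- airy_kappa"] unfolding aa_def[abs_def] aa'_def[abs_def] by simp

lemma aa_0 [simp]: "aa 0 = 1" "aa' 0 = - airy_kappa" by (simp_all add: aa_def aa'_def)

lemma aa_pos: "0 \<le> x \<Longrightarrow> 0 < aa x"
proof (cases "x = 0")
  case False
  assume "0 \<le> x"
  with False have x: "0 < x" by simp
  then have "airy_kappa * ag x < af x"
    using airy_kappa_bounds(1)[OF x] ag_pos(1)[OF x] by (simp add: pos_less_divide_eq)
  then show ?thesis by (simp add: aa_def)
qed simp

text \<open>The lower bound for \<open>airy_kappa\<close>, multiplied by \<open>ag x\<close>, is an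
  upper bound for \<open>aa x\<close>.\<close>

lemma aa_le: "0 \<le> x \<Longrightarrow> aa x \<le> 1 / ag' x"
proof (cases "x = 0")
  case False
  assume "0 \<le> x"
  with False have x: "0 < x" by simp
  then have "ag x * (af x / ag x - 1 / (ag x * ag' x)) \<le> ag x * airy_kappa"
    using airy_kappa_bounds(2)[OF x] ag_pos(1)[OF x] by (intro mult_left_mono) auto
  moreover have "ag x * (af x / ag x - 1 / (ag x * ag' x)) = af x - 1 / ag' x"
    using ag_pos(1)[OF x] by (simp add: right_diff_distrib)
  ultimately show ?thesis by (simp add: aa_def mult.commute)
qed simp

text \<open>The true decay is faster than exponential; a cubic rate suffices to send
  \<open>aa\<close> and also \<open>x * (aa x)\<^sup>2\<close> to 0.\<close>

lemma aa_le_cubic: "0 < x \<Longrightarrow> aa x \<le> 3 / x ^ 3"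
proof -
  assume x: "0 < x"
  then have "x^3/3 \<le> ag' x" using ag_bounds(2)[of x] by simp
  moreover have "0 < x^3/3" using x by simp
  ultimately have "1 / ag' x \<le> 1 / (x^3/3)" using x ag_pos(2)[of x] by (intro divide_left_mono mult_pos_pos) auto
  then show ?thesis using aa_le[of x] x by simp
qed

lemma aa_tendsto: "(aa \<longlongrightarrow> 0) at_top"
proof (rule tendsto_sandwich[of "\<lambda>_. 0" _ _ "\<lambda>x. 3 / x ^ 3"])
  show "((\<lambda>x::real. 3 / x ^ 3) \<longlongrightarrow> 0) at_top"
    by (intro tendsto_divide_0[OF tendsto_const] filterlim_at_top_imp_at_infinity
         filterlim_pow_at_top filterlim_ident) auto
  show "\<forall>\<^sub>F x in at_top. 0 \<le> aa x"
    using eventually_ge_at_top[of 0] by eventually_elim (use aa_pos in \<open>auto intro: less_imp_le\<close>)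
  show "\<forall>\<^sub>F x in at_top. aa x \<le> 3 / x ^ 3"
    using eventually_gt_at_top[of 0] by eventually_elim (use aa_le_cubic in auto)
qed auto

lemma aa'_mono: 
  assumes "0 \<le> x" "x \<le> s"
  shows "aa' x \<le> aa' s"
proof (rule DERIV_nonneg_imp_nondecreasing[of x s aa'])
  fix t assume "x \<le> t"
  with assms have "0 \<le> t" by simp
  then show "\<exists>d. (aa' has_real_derivative d) (at t) \<and> 0 \<le> d"
    using ode2D(2)[OF aa_ode, of t] aa_pos[of t] by (intro exI[of _ "(t - 0) * aa t"]) auto
qed (use assms in auto)

text \<open>Since \<open>aa'\<close> is nondecreasing on the half line, one nonnegative value would
  make \<open>aa\<close> nondecreasing from there on, against its positivity and its limit
  0.\<close>

lemma aa'_neg: "0 \<le> x \<Longrightarrow> aa' x < 0"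
proof (rule ccontr)
  assume x: "0 \<le> x" "\<not> aa' x < 0"
  have "aa x \<le> aa s" if "x \<le> s" for s
  proof (rule DERIV_nonneg_imp_nondecreasing[OF that])
    fix t assume "x \<le> t"
    then show "\<exists>d. (aa has_real_derivative d) (at t) \<and> 0 \<le> d"
      using ode2D(1)[OF aa_ode] aa'_mono[of x t] x by (intro exI[of _ "aa' t"]) auto
  qed
  then have "aa x \<le> 0"
    by (intro tendsto_lowerbound[OF aa_tendsto eventually_mono[OF eventually_ge_at_top[of x]]]) auto
  then show False using aa_pos[of x] x by simp
qed

text \<open>By convexity \<open>aa' x\<close> lies between the backward difference of
  \<open>aa\<close> with step 1 and 0.\<close>

lemma aa'_tendsto: "(aa' \<longlongrightarrow> 0) at_top"
proof (rule tendsto_sandwich[of "\<lambda>x. aa x - aa (x - 1)" _ _ "\<lambda>_. 0"])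
  have "filterlim (\<lambda>x::real. x - 1) at_top at_top"
    using filterlim_tendsto_add_at_top[OF tendsto_const[of "-1::real" at_top] filterlim_ident] by simp
  then have "((\<lambda>x. aa (x - 1)) \<longlongrightarrow> 0) at_top" by (rule filterlim_compose[OF aa_tendsto])
  from tendsto_diff[OF aa_tendsto this] show "((\<lambda>x. aa x - aa (x - 1)) \<longlongrightarrow> 0) at_top" by simp
  show "\<forall>\<^sub>F x in at_top. aa' x \<le> 0"
    using eventually_ge_at_top[of 0] by eventually_elim (use aa'_neg in \<open>auto intro: less_imp_le\<close>)
  show "\<forall>\<^sub>F x in at_top. aa x - aa (x - 1) \<le> aa' x"
    using eventually_ge_at_top[of 1]
  proof eventually_elim
    case (elim x)
    have "\<exists>z>x-1. z < x \<and> aa x - aa (x-1) = (x - (x-1)) * aa' z"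
      by (rule MVT2) (use ode2D[OF aa_ode] in auto)
    then obtain z where "x - 1 < z" "z < x" "aa x - aa (x-1) = aa' z" by auto
    then show ?case using aa'_mono[of z x] elim by auto
  qed
qed auto

text \<open>In the basis \<open>aa\<close>, \<open>ag\<close> the coefficient of \<open>ag\<close>
  must vanish, because \<open>ag x \<ge> x\<close> does not tend to 0.\<close>

lemma decaying_airy_unique:
  assumes y: "airy_ode 0 y y'" and lim: "(y \<longlongrightarrow> 0) at_top"
  shows "y x = y 0 * aa x"
proof -
  define c where "c = y' 0 + airy_kappa * y 0"
  have rep: "y x = y 0 * aa x + c * ag x" for x
    using airy_represent[OF y, of x] by (simp add: aa_def c_def algebra_simps)
  have "((\<lambda>x. y x - y 0 * aa x) \<longlongrightarrow> 0 - y 0 * 0) at_top"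
    by (intro tendsto_intros lim aa_tendsto)
  moreover have "y x - y 0 * aa x = c * ag x" for x using rep[of x] by linarith
  ultimately have l: "((\<lambda>x. c * ag x) \<longlongrightarrow> 0) at_top" by simp
  have "\<bar>c\<bar> \<le> 0"
  proof (rule tendsto_lowerbound[OF tendsto_rabs_zero[OF l]])
    show "\<forall>\<^sub>F x in at_top. \<bar>c\<bar> \<le> \<bar>c * ag x\<bar>"
      using eventually_ge_at_top[of 1]
    proof eventually_elim
      case (elim x)
      then have "1 \<le> \<bar>ag x\<bar>" using ag_bounds(1)[of x] by simp
      then show ?case unfolding abs_mult using mult_left_mono[of 1 "\<bar>ag x\<bar>" "\<bar>c\<bar>"] by simp
    qed
  qed auto
  then show ?thesis using rep[of x] by simp
qed

definition Ai0 :: real where "Ai0 = 1 / (3 powr (2/3) * Gamma (2/3))"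

lemma Ai0_pos: "Ai0 > 0" unfolding Ai0_def by (intro divide_pos_pos mult_pos_pos Gamma_real_pos) auto

text \<open>This resolves the definite description: existence is \<open>aa\<close>, uniqueness is
  \<open>decaying_airy_unique\<close>. The factor \<open>Ai0\<close> affects neither the zeros nor
  the ratio in the variance, so everything below works with \<open>aa\<close>.\<close>

lemma Ai_eq: "Ai x = Ai0 * aa x"
proof -
  have "Ai = (\<lambda>x. Ai0 * aa x)"
    unfolding Ai_def
  proof (rule the_equality, intro conjI exI allI)
    fix z
    show "((\<lambda>x. Ai0 * aa x) has_real_derivative Ai0 * aa' z) (at z)"
      using ode2D[OF aa_ode] by (intro DERIV_cmult)
    show "((\<lambda>x. Ai0 * aa' x) has_real_derivative z * (Ai0 * aa z)) (at z)"
      using DERIV_cmult[OF ode2D(2)[OF aa_ode], of Ai0 z] by (simp add: algebra_simps)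
  next
    show "((\<lambda>x. Ai0 * aa x) \<longlongrightarrow> 0) at_top" using tendsto_mult_right_zero[OF aa_tendsto] by simp
  next
    show "Ai0 * aa 0 = 1 / (3 powr (2 / 3) * Gamma (2 / 3))" by (simp add: Ai0_def)
  next
    fix y :: "real \<Rightarrow> real"
    assume y: "(\<exists>y'. \<forall>z. (y has_real_derivative y' z) (at z) \<and> (y' has_real_derivative z * y z) (at z)) \<and>
         (y \<longlongrightarrow> 0) at_top \<and> y 0 = 1 / (3 powr (2 / 3) * Gamma (2 / 3))"
    then obtain y' where "airy_ode 0 y y'" unfolding ode2_def by auto
    then show "y = (\<lambda>x. Ai0 * aa x)" using decaying_airy_unique[of y y'] y by (auto simp: Ai0_def)
  qed
  then show ?thesis by metis
qed

lemma deriv_Ai: "deriv Ai x = Ai0 * aa' x"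
proof -
  have "Ai = (\<lambda>x. Ai0 * aa x)" using Ai_eq by auto
  then show ?thesis using DERIV_imp_deriv[OF DERIV_cmult[OF ode2D(1)[OF aa_ode], of Ai0 x]] by simp
qed

lemma Ai_eq_0_iff: "Ai x = 0 \<longleftrightarrow> aa x = 0" using Ai0_pos by (simp add: Ai_eq)

subsection \<open>Zeros\<close>

definition airy_zeros :: "real set" where "airy_zeros = {x. Ai x = 0}"

lemma airy_zeros_aa: "x \<in> airy_zeros \<longleftrightarrow> aa x = 0"
  by (simp add: airy_zeros_def Ai_eq_0_iff)

lemma airy_zeros_neg: "x \<in> airy_zeros \<Longrightarrow> x < 0"
  using aa_pos[of x] by (cases "0 \<le> x") (auto simp: airy_zeros_aa)

lemma finite_airy_zeros_ge: "finite {x \<in> airy_zeros. a \<le> x}"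
proof -
  have "finite {x. a \<le> x \<and> x \<le> 0 \<and> aa x = 0}"
    by (rule ode2_finite_zeros[OF aa_ode airy_ode_continuous]) (use aa_0 in \<open>auto intro!: exI[of _ 0]\<close>)
  then show ?thesis
    by (rule rev_finite_subset) (use airy_zeros_neg in \<open>auto simp: airy_zeros_aa intro: less_imp_le\<close>)
qed

text \<open>Left of -1 the coefficient of the Airy equation is below that of the equation of
  \<open>sin\<close>, so a zero lies between any two consecutive negative multiples of
  \<open>pi\<close>.\<close>

lemma airy_zeros_unbounded: "\<exists>x\<in>airy_zeros. x < a"
proof -
  define n where "n = nat \<lceil>\<bar>a\<bar>\<rceil> + 1"
  have n: "real n \<ge> 1" "real n \<ge> \<bar>a\<bar>" unfolding n_def by linarith+
  have pi: "pi > 1" using pi_gt3 by simp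
  have s: "ode2 (\<lambda>_. -1) sin cos"
    unfolding ode2_def by (auto intro!: derivative_eq_intros)
  have "\<exists>x. - (real (n + 1) * pi) < x \<and> x < - (real n * pi) \<and> aa x = 0"
  proof (rule sturm[OF aa_ode s])
    show "finite {x. - (real (n + 1) * pi) \<le> x \<and> x \<le> - (real n * pi) \<and> sin x = 0}"
      by (rule ode2_finite_zeros[OF s]) (auto intro!: exI[of _ "pi/2"])
    fix x assume x: "x < - (real n * pi)"
    have "1 * 1 < real n * pi" using n pi by (intro mult_le_less_imp_less) auto
    then show "x - 0 < -1" using x by linarith
  next
    show "sin (- (real (n + 1) * pi)) = 0" "sin (- (real n * pi)) = 0"
      unfolding sin_minus sin_npi by simp_all
  qed (use pi in \<open>auto simp: algebra_simps\<close>)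
  moreover have "- (real n * pi) \<le> a"
  proof -
    have "real n * 1 \<le> real n * pi" using pi by (intro mult_left_mono) auto
    then show ?thesis using n by linarith
  qed
  ultimately show ?thesis by (force simp: airy_zeros_aa)
qed

text \<open>The next zero below \<open>c\<close> exists as a maximum: some zero \<open>b\<close>
  lies below \<open>c\<close>, and only finitely many lie in between.\<close>

lemma card_airy_zeros_surj:
  assumes "r \<ge> 1"
  shows "\<exists>a\<in>airy_zeros. card {x \<in> airy_zeros. a \<le> x} = r"
  using assms
proof (induction r rule: nat_induct_at_least)
  case base
  obtain b where b: "b \<in> airy_zeros" using airy_zeros_unbounded by blast
  let ?S = "{x \<in> airy_zeros. b \<le> x}"
  define a where "a = Max ?S"
  have a: "a \<in> ?S" unfolding a_def by (rule Max_in[OF finite_airy_zeros_ge]) (use b in auto)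
  have "{x \<in> airy_zeros. a \<le> x} = {a}"
    using a Max_ge[OF finite_airy_zeros_ge, of _ b] unfolding a_def[symmetric] by fastforce
  then show ?case using a by (intro bexI[of _ a]) auto
next
  case (Suc r)
  then obtain c where c: "c \<in> airy_zeros" "card {x \<in> airy_zeros. c \<le> x} = r" by auto
  obtain b where b: "b \<in> airy_zeros" "b < c" using airy_zeros_unbounded by blast
  let ?S = "{x \<in> airy_zeros. b \<le> x \<and> x < c}"
  have fin: "finite ?S" by (rule finite_subset[OF _ finite_airy_zeros_ge[of b]]) auto
  define a where "a = Max ?S"
  have a: "a \<in> ?S" unfolding a_def by (rule Max_in[OF fin]) (use b in auto)
  have "{x \<in> airy_zeros. a \<le> x} = insert a {x \<in> airy_zeros. c \<le> x}"
    using a Max_ge[OF fin] unfolding a_def[symmetric] by fastforce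
  moreover have "a \<notin> {x \<in> airy_zeros. c \<le> x}" using a by auto
  ultimately have "card {x \<in> airy_zeros. a \<le> x} = Suc r" using c finite_airy_zeros_ge by simp
  then show ?case using a by (intro bexI[of _ a]) auto
qed

lemma card_airy_zeros_strict:
  assumes "a \<in> airy_zeros" "a < b"
  shows "card {x \<in> airy_zeros. b \<le> x} < card {x \<in> airy_zeros. a \<le> x}"
proof (rule psubset_card_mono[OF finite_airy_zeros_ge])
  have "a \<in> {x \<in> airy_zeros. a \<le> x}" "a \<notin> {x \<in> airy_zeros. b \<le> x}" using assms by auto
  moreover have "{x \<in> airy_zeros. b \<le> x} \<subseteq> {x \<in> airy_zeros. a \<le> x}" using assms by auto
  ultimately show "{x \<in> airy_zeros. b \<le> x} \<subset> {x \<in> airy_zeros. a \<le> x}" by blast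
qed

lemma airy_zero_eqI:
  assumes "a \<in> airy_zeros" "card {x \<in> airy_zeros. a \<le> x} = r"
  shows "airy_zero r = a"
  unfolding airy_zero_def
proof (rule the_equality)
  have *: "{x. a \<le> x \<and> Ai x = 0} = {x \<in> airy_zeros. a \<le> x}" for a by (auto simp: airy_zeros_def)
  show "Ai a = 0 \<and> card {x. a \<le> x \<and> Ai x = 0} = r"
    using assms unfolding * by (auto simp: airy_zeros_def)
  fix b assume "Ai b = 0 \<and> card {x. b \<le> x \<and> Ai x = 0} = r"
  then have "b \<in> airy_zeros" "card {x \<in> airy_zeros. b \<le> x} = r"
    unfolding * by (auto simp: airy_zeros_def)
  then show "b = a"
    using card_airy_zeros_strict[of a b] card_airy_zeros_strict[of b a] assms by fastforce
qed

lemma airy_zero: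
  assumes "r \<ge> 1"
  shows "airy_zero r \<in> airy_zeros" "card {x \<in> airy_zeros. airy_zero r \<le> x} = r"
        "aa (airy_zero r) = 0" "airy_zero r < 0"
proof -
  obtain a where a: "a\<in>airy_zeros" "card {x \<in> airy_zeros. a \<le> x} = r"
    using card_airy_zeros_surj[OF assms] by auto
  then show 1: "airy_zero r \<in> airy_zeros" "card {x \<in> airy_zeros. airy_zero r \<le> x} = r"
    using airy_zero_eqI[OF a] by auto
  then show "aa (airy_zero r) = 0" "airy_zero r < 0" using airy_zeros_neg by (auto simp: airy_zeros_aa)
qed

text \<open>The form in which zeros are compared: a bound for the \<open>r\<close>-th zero is a
  bound on a number of zeros, and numbers of zeros are what interlacing provides.\<close>

lemma airy_zero_ge_iff:
  assumes "r \<ge> 1"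
  shows "a \<le> airy_zero r \<longleftrightarrow> r \<le> card {x \<in> airy_zeros. a \<le> x}"
proof
  assume "a \<le> airy_zero r"
  then have "card {x \<in> airy_zeros. airy_zero r \<le> x} \<le> card {x \<in> airy_zeros. a \<le> x}"
    by (intro card_mono finite_airy_zeros_ge) auto
  then show "r \<le> card {x \<in> airy_zeros. a \<le> x}" using airy_zero(2)[OF assms] by simp
next
  assume "r \<le> card {x \<in> airy_zeros. a \<le> x}"
  then show "a \<le> airy_zero r"
    using card_airy_zeros_strict[OF airy_zero(1)[OF assms], of a] airy_zero(2)[OF assms] by force
qed

lemma airy_zero_tendsto: "filterlim airy_zero at_bot sequentially"
  unfolding filterlim_at_bot
proof
  fix Z :: real
  let ?n = "card {x \<in> airy_zeros. Z \<le> x}"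
  show "\<forall>\<^sub>F r in sequentially. airy_zero r \<le> Z"
    using eventually_ge_at_top[of "Suc ?n"]
  proof eventually_elim
    case (elim r)
    then show ?case using airy_zero_ge_iff[of r Z] by auto
  qed
qed

lemma aa'_airy_zero: "r \<ge> 1 \<Longrightarrow> aa' (airy_zero r) \<noteq> 0"
  using ode2_zero_imp_zero[OF aa_ode airy_ode_continuous airy_zero(3), of r 0] by auto

subsection \<open>The eigenfunctions of the Airy operator on the half line\<close>

definition ev :: "nat \<Rightarrow> real" where "ev r = - airy_zero r"
text \<open>Eigenfunction of \<open>- y'' + x * y\<close> on the half line with value 0 at the
  origin and eigenvalue \<open>ev r\<close>, normalised by slope 1 at the origin.\<close>

definition ef where "ef r x = aa (x + airy_zero r) / aa' (airy_zero r)"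
definition ef' where "ef' r x = aa' (x + airy_zero r) / aa' (airy_zero r)"

lemma ev_pos: "r \<ge> 1 \<Longrightarrow> 0 < ev r" using airy_zero(4) by (simp add: ev_def)

lemma ef_ode: "airy_ode (ev r) (ef r) (ef' r)"
  using ode2_lincomb[OF airy_ode_shift[OF aa_ode, of "airy_zero r"] airy_ode_shift[OF aa_ode, of "airy_zero r"],
       of "1 / aa' (airy_zero r)" 0]
  unfolding ef_def[abs_def] ef'_def[abs_def] ev_def by simp

lemma ef_0: "r \<ge> 1 \<Longrightarrow> ef r 0 = 0" "r \<ge> 1 \<Longrightarrow> ef' r 0 = 1"
  using airy_zero(3) aa'_airy_zero by (auto simp: ef_def ef'_def)

lemma filterlim_add_const_at_top: "filterlim (\<lambda>x::real. x + c) at_top at_top"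
  using filterlim_tendsto_add_at_top[OF tendsto_const[of c at_top] filterlim_ident]
  by (simp add: add.commute)

text \<open>Minus an energy, and an antiderivative of the square of \<open>ef\<close>. It rises from
  -1 at the origin to 0 at infinity, which gives the total mass 1 and bounds both \<open>ef\<close>
  and \<open>ef'\<close> where \<open>x\<close> is below \<open>ev r\<close>.\<close>

definition ef_en where "ef_en r x = (x - ev r) * (ef r x)\<^sup>2 - (ef' r x)\<^sup>2"

lemma ef_en_deriv: "(ef_en r has_real_derivative (ef r x)\<^sup>2) (at x)"
  unfolding ef_en_def[abs_def] using ode2D[OF ef_ode[of r], of x]
  by (auto intro!: derivative_eq_intros simp: power2_eq_square algebra_simps)

lemma ef_en_0: "r \<ge> 1 \<Longrightarrow> ef_en r 0 = -1" by (simp add: ef_en_def ef_0)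

lemma ef_en_mono: "x \<le> s \<Longrightarrow> ef_en r x \<le> ef_en r s"
  by (rule DERIV_nonneg_imp_nondecreasing[of x s "ef_en r"]) (use ef_en_deriv in \<open>auto intro!: exI\<close>)

lemma ef_en_tendsto: "(ef_en r \<longlongrightarrow> 0) at_top"
proof -
  have "((\<lambda>x. x * (aa x)\<^sup>2) \<longlongrightarrow> 0) at_top"
  proof (rule tendsto_sandwich[of "\<lambda>_. 0" _ _ "\<lambda>x. 9 / x ^ 5"])
    show "((\<lambda>x::real. 9 / x ^ 5) \<longlongrightarrow> 0) at_top"
      by (intro tendsto_divide_0[OF tendsto_const] filterlim_at_top_imp_at_infinity
           filterlim_pow_at_top filterlim_ident) auto
    show "\<forall>\<^sub>F x in at_top. 0 \<le> x * (aa x)\<^sup>2"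
      using eventually_ge_at_top[of 0] by eventually_elim auto
    show "\<forall>\<^sub>F x in at_top. x * (aa x)\<^sup>2 \<le> 9 / x ^ 5"
      using eventually_gt_at_top[of 0]
    proof eventually_elim
      case (elim x)
      then have "(aa x)\<^sup>2 \<le> (3 / x^3)\<^sup>2" using aa_le_cubic[of x] aa_pos[of x] by (intro power_mono) auto
      then have "x * (aa x)\<^sup>2 \<le> x * (3 / x^3)\<^sup>2" using elim by (intro mult_left_mono) auto
      also have "\<dots> = 9 / x^5" using elim by (simp add: field_simps eval_nat_numeral)
      finally show ?case .
    qed
  qed auto
  from tendsto_diff[OF this tendsto_power[OF aa'_tendsto, of 2]]
  have "((\<lambda>x. x * (aa x)\<^sup>2 - (aa' x)\<^sup>2) \<longlongrightarrow> 0) at_top" by simp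
  from filterlim_compose[OF this filterlim_add_const_at_top[of "airy_zero r"]]
  have "((\<lambda>x. ((x + airy_zero r) * (aa (x + airy_zero r))\<^sup>2 - (aa' (x + airy_zero r))\<^sup>2)) \<longlongrightarrow> 0) at_top" .
  from tendsto_mult_right_zero[OF this, of "1 / (aa' (airy_zero r))\<^sup>2"]
  show ?thesis
    by (simp add: ef_en_def[abs_def] ef_def ef'_def ev_def power_divide diff_divide_distrib)
qed

lemma ef_en_le_0: "ef_en r x \<le> 0"
  by (rule tendsto_lowerbound[OF ef_en_tendsto eventually_mono[OF eventually_ge_at_top[of x]]])
     (auto intro: ef_en_mono)

section \<open>The variance integral\<close>

definition s2i where "s2i r x = (ef r x)\<^sup>2 / x"

lemma sigma2_integrand_eq: "sigma2_integrand r x = s2i r x"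
  using Ai0_pos by (simp add: sigma2_integrand_def s2i_def Ai_eq deriv_Ai ef_def power_mult_distrib power_divide)

lemma ef_lipschitz: "\<exists>C>0. \<forall>x\<in>{0..X}. \<bar>ef r x\<bar> \<le> C \<and> \<bar>ef' r x\<bar> \<le> C"
proof -
  obtain A B where A: "A > 0" "\<forall>x\<in>{0..X}. \<bar>ef r x\<bar> \<le> A" and B: "\<forall>x\<in>{0..X}. \<bar>ef' r x\<bar> \<le> B"
    using continuous_bounded_Icc[OF ode2_continuous_on(1)[OF ef_ode[of r]], of 0 X]
      continuous_bounded_Icc[OF ode2_continuous_on(2)[OF ef_ode[of r]], of 0 X] by auto
  show ?thesis by (rule exI[of _ "max A B"]) (use A B in force)
qed

lemma ef_linear_bound:
  assumes "r \<ge> 1" "\<forall>x\<in>{0..X}. \<bar>ef' r x\<bar> \<le> C" "x \<in> {0..X}"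
  shows "\<bar>ef r x\<bar> \<le> C * x"
proof (cases "x = 0")
  case False
  then have x: "0 < x" using assms by auto
  have "\<exists>z>0. z < x \<and> ef r x - ef r 0 = (x - 0) * ef' r z"
    by (rule MVT2[OF x]) (use ode2D[OF ef_ode] in auto)
  then obtain z where z: "0 < z" "z < x" "ef r x = x * ef' r z" using ef_0[OF assms(1)] by auto
  have "\<bar>ef' r z\<bar> \<le> C" using assms(2,3) z by auto
  then show ?thesis using x z by (simp add: abs_mult mult.commute)
qed (use ef_0 assms in auto)

text \<open>At 0 the division by zero gives the value 0. This is also the limit, because
  \<open>ef r x / x\<close> tends to 1 and \<open>ef r x\<close> to 0.\<close>

lemma s2i_continuous_on:
  assumes "r \<ge> 1" shows "continuous_on UNIV (s2i r)"
proof (rule continuous_at_imp_continuous_on, rule ballI)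
  fix x :: real
  show "isCont (s2i r) x"
  proof (cases "x = 0")
    case False
    then show ?thesis unfolding s2i_def[abs_def]
      by (intro continuous_intros ode2_isCont[OF ef_ode]) auto
  next
    case True
    have "((\<lambda>x. ef r x / x) \<longlongrightarrow> 1) (at 0)"
      using ode2D(1)[OF ef_ode[of r], of 0] ef_0[OF assms] by (simp add: has_field_derivative_iff)
    moreover have "(ef r \<longlongrightarrow> 0) (at 0)"
      using ode2_isCont(1)[OF ef_ode[of r], of 0] ef_0[OF assms] by (simp add: isCont_def)
    ultimately have "((\<lambda>x. ef r x / x * ef r x) \<longlongrightarrow> 1 * 0) (at 0)" by (rule tendsto_mult)
    then show ?thesis using True by (simp add: isCont_def s2i_def[abs_def] power2_eq_square)
  qed
qed

lemma s2i_nonneg: "0 \<le> x \<Longrightarrow> 0 \<le> s2i r x" by (simp add: s2i_def)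

lemma ef_sq_integral_tail:
  "(\<integral>\<^sup>+x. ennreal ((ef r x)\<^sup>2) * indicator {a..} x \<partial>lborel) = ennreal (- ef_en r a)"
  using nn_integral_FTC_atLeast[of "\<lambda>x. (ef r x)\<^sup>2" a "ef_en r" 0] ef_en_deriv ef_en_tendsto
  by (simp add: borel_measurable_continuous_onI continuous_on_power ode2_continuous_on(1)[OF ef_ode])

lemma s2i_measurable: "r \<ge> 1 \<Longrightarrow> s2i r \<in> borel_measurable borel"
  by (intro borel_measurable_continuous_onI s2i_continuous_on)

lemma ef_measurable [measurable]: "ef r \<in> borel_measurable borel"
  by (intro borel_measurable_continuous_onI ode2_continuous_on(1)[OF ef_ode])

text \<open>Beyond \<open>a\<close> the weight \<open>1 / x\<close> is at most \<open>1 / a\<close>,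
  and the mass of the square of \<open>ef\<close> there is exactly
  \<open>- ef_en r a\<close>.\<close>

lemma s2i_tail:
  assumes "r \<ge> 1" "0 < a"
  shows "(\<integral>\<^sup>+x. ennreal (s2i r x) * indicator {a..} x \<partial>lborel) \<le> ennreal (- ef_en r a / a)"
proof -
  have "(\<integral>\<^sup>+x. ennreal (s2i r x) * indicator {a..} x \<partial>lborel)
      \<le> (\<integral>\<^sup>+x. ennreal (1/a) * (ennreal ((ef r x)\<^sup>2) * indicator {a..} x) \<partial>lborel)"
  proof (rule nn_integral_mono)
    fix x
    have "s2i r x \<le> 1/a * (ef r x)\<^sup>2" if "a \<le> x"
      using that assms unfolding s2i_def by (simp add: frac_le)
    then show "ennreal (s2i r x) * indicator {a..} x \<le> ennreal (1/a) * (ennreal ((ef r x)\<^sup>2) * indicator {a..} x)"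
      using assms by (auto split: split_indicator simp: ennreal_mult[symmetric] intro!: ennreal_leI)
  qed
  also have "\<dots> = ennreal (1/a) * ennreal (- ef_en r a)"
    unfolding ef_sq_integral_tail[symmetric]
    by (intro nn_integral_cmult) (use ef_measurable in measurable)
  also have "\<dots> = ennreal (- ef_en r a / a)"
    using assms ef_en_le_0[of r a] by (simp add: ennreal_mult[symmetric])
  finally show ?thesis .
qed

lemma s2i_integrable_tail:
  assumes "r \<ge> 1" "0 < a"
  shows "set_integrable lborel {a..} (s2i r)" "(LINT x:{a..}|lborel. s2i r x) \<le> - ef_en r a / a"
        "0 \<le> (LINT x:{a..}|lborel. s2i r x)"
proof -
  have eq: "ennreal (indicator {a..} x * s2i r x) = ennreal (s2i r x) * indicator {a..} x" for x
    using assms by (auto split: split_indicator)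
  have nn: "AE x in lborel. 0 \<le> indicator {a..} x * s2i r x"
    using assms s2i_nonneg[of _ r] by (auto split: split_indicator)
  have m: "(\<lambda>x. indicator {a..} x * s2i r x) \<in> borel_measurable lborel"
    using s2i_measurable[OF assms(1)] by simp
  have fin: "(\<integral>\<^sup>+x. ennreal (indicator {a..} x * s2i r x) \<partial>lborel) < \<infinity>"
    unfolding eq using s2i_tail[OF assms] by (rule order.strict_trans1) simp
  show I: "set_integrable lborel {a..} (s2i r)"
    unfolding set_integrable_def using fin nn m by (intro integrableI_nonneg) auto
  show "(LINT x:{a..}|lborel. s2i r x) \<le> - ef_en r a / a"
  proof -
    have "ennreal (LINT x:{a..}|lborel. s2i r x) = (\<integral>\<^sup>+x. ennreal (indicator {a..} x * s2i r x) \<partial>lborel)"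
      unfolding set_lebesgue_integral_def
      using I nn unfolding set_integrable_def by (subst nn_integral_eq_integral) auto
    also have "\<dots> \<le> ennreal (- ef_en r a / a)" unfolding eq by (rule s2i_tail[OF assms])
    finally have "ennreal (LINT x:{a..}|lborel. s2i r x) \<le> ennreal (- ef_en r a / a)" .
    moreover have "0 \<le> - ef_en r a / a" using assms ef_en_le_0[of r a] by (intro divide_nonneg_pos) auto
    ultimately show ?thesis by (subst (asm) ennreal_le_iff) auto
  qed
  show "0 \<le> (LINT x:{a..}|lborel. s2i r x)"
    unfolding set_lebesgue_integral_def using nn by (intro integral_nonneg_AE) simp
qed

lemma s2i_split:
  assumes "r \<ge> 1" "0 < a"
  shows "set_integrable lborel {0<..} (s2i r)"
    "sigma2_max r = (LINT x:{0..a}|lborel. s2i r x) + (LINT x:{a..}|lborel. s2i r x)"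
proof -
  have I1: "set_integrable lborel {0..a} (s2i r)"
    by (rule borel_integrable_atLeastAtMost') (rule continuous_on_subset[OF s2i_continuous_on[OF assms(1)]], auto)
  note I2 = s2i_integrable_tail(1)[OF assms]
  have U: "{0..a} \<union> {a..} = {0..}" using assms by auto
  have I: "set_integrable lborel {0..} (s2i r)"
    using set_integrable_Un[OF I1 I2] by (simp add: U)
  show "set_integrable lborel {0<..} (s2i r)"
    by (rule set_integrable_subset[OF I]) auto
  have "sigma2_max r = (LINT x:{0<..}|lborel. s2i r x)"
    by (simp add: sigma2_max_def sigma2_integrand_eq)
  also have "\<dots> = (LINT x:{0..}|lborel. s2i r x)"
    unfolding set_lebesgue_integral_def
    by (rule Bochner_Integration.integral_cong) (auto split: split_indicator simp: s2i_def)
  also have "\<dots> = (LINT x:{0..a} \<union> {a..}|lborel. s2i r x)" by (simp add: U)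
  also have "\<dots> = (LINT x:{0..a}|lborel. s2i r x) + (LINT x:{a..}|lborel. s2i r x)"
  proof (rule set_integral_Un_AE[OF _ _ _ I1 I2])
    show "AE x in lborel. \<not> (x \<in> {0..a} \<and> x \<in> {a..})"
      using AE_lborel_singleton[of a] by eventually_elim auto
  qed auto
  finally show "sigma2_max r = (LINT x:{0..a}|lborel. s2i r x) + (LINT x:{a..}|lborel. s2i r x)" .
qed

lemma s2i_antiderivative:
  assumes "r \<ge> 1" "0 \<le> X" "\<And>x. x \<in> {0..X} \<Longrightarrow> (F has_real_derivative s2i r x) (at x)"
  shows "(LINT x:{0..X}|lborel. s2i r x) = F X - F 0"
  unfolding set_lebesgue_integral_def
proof (rule integral_FTC_atLeastAtMost[OF assms(2)])
  show "continuous_on {0..X} (s2i r)" by (rule continuous_on_subset[OF s2i_continuous_on[OF assms(1)]]) auto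
  fix x assume "0 \<le> x" "x \<le> X"
  then show "(F has_vector_derivative s2i r x) (at x within {0..X})"
    using assms(3) by (auto simp: has_real_derivative_iff_has_vector_derivative intro: has_vector_derivative_at_within)
qed

lemma sigma2_max_tendsto: "sigma2_max \<longlonglongrightarrow> 0"
proof (rule LIMSEQ_I)
  fix e :: real assume e: "e > 0"
  define X where "X = max 1 (8 / e)"
  have X: "X \<ge> 1" "1 / X \<le> e / 8" using e by (auto simp: X_def max_def field_simps)
  \<comment> \<open>The three thresholds serve in turn: \<open>2 * X\<close> yields
    \<open>(ef r x)\<^sup>2 \<le> 2 / ev r\<close> for all \<open>x\<close> up to \<open>X\<close>;
    \<open>4 * X / e\<close> makes this small against the length \<open>X\<close>;
    \<open>32 / e\<^sup>2\<close> makes \<open>\<bar>ef r x\<bar> \<le> e / 4\<close>.\<close>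
  define K where "K = max (2 * X) (max (4 * X / e) (32 / e\<^sup>2)) + 1"
  have "\<forall>\<^sub>F r in sequentially. airy_zero r \<le> - K" using airy_zero_tendsto by (simp add: filterlim_at_bot)
  then obtain N where N: "\<And>r. r \<ge> N \<Longrightarrow> airy_zero r \<le> - K" by (auto simp: eventually_sequentially)
  show "\<exists>no. \<forall>r\<ge>no. norm (sigma2_max r - 0) < e"
  proof (intro exI[of _ "max N 1"] allI impI)
    fix r assume r: "max N 1 \<le> r"
    then have r1: "r \<ge> 1" by simp
    have l: "ev r \<ge> K" using N[of r] r by (simp add: ev_def)
    have K: "K > 2 * X" "K > 4 * X / e" "K > 32 / e\<^sup>2" unfolding K_def by linarith+
    have en: "(ef' r x)\<^sup>2 + (ev r - x) * (ef r x)\<^sup>2 \<le> 1" if "0 \<le> x" for x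
      using ef_en_mono[OF that, of r] ef_en_0[OF r1] by (simp add: ef_en_def algebra_simps)
    have d: "\<bar>ef' r x\<bar> \<le> 1" if "x \<in> {0..1}" for x
    proof -
      have "(ev r - x) * (ef r x)\<^sup>2 \<ge> 0" using l K X that by (intro mult_nonneg_nonneg) auto
      then have "(ef' r x)\<^sup>2 \<le> 1" using en[of x] that by auto
      then show ?thesis using abs_le_square_iff[of "ef' r x" 1] by simp
    qed
    have ey: "(ef r x)\<^sup>2 \<le> 2 / ev r" if "x \<in> {0..X}" for x
    proof -
      have "ev r / 2 \<le> ev r - x" using l K X that by auto
      then have "ev r / 2 * (ef r x)\<^sup>2 \<le> (ev r - x) * (ef r x)\<^sup>2" by (intro mult_right_mono) auto
      also have "\<dots> \<le> 1" using en[of x] zero_le_power2[of "ef' r x"] that unfolding atLeastAtMost_iff by linarith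
      finally show ?thesis using l K X by (simp add: field_simps)
    qed
    \<comment> \<open>Near the origin one factor \<open>\<bar>ef r x\<bar> \<le> x\<close> absorbs
      the weight \<open>1 / x\<close> and the other factor is small; beyond 1 the weight is at most
      1.\<close>
    have b: "s2i r x \<le> e / 4 * indicator {0..1} x + e / (2 * X)" if "x \<in> {0..X}" for x
    proof (cases "x \<le> 1")
      case True
      have x1: "x \<in> {0..1}" using that True by auto
      have "\<bar>ef r x\<bar> \<le> 1 * x" by (rule ef_linear_bound[OF r1, of 1]) (use d x1 in auto)
      moreover have "\<bar>ef r x\<bar> \<le> e / 4"
      proof -
        have "(ef r x)\<^sup>2 \<le> 2 / ev r" by (rule ey[OF that])
        also have "\<dots> \<le> 2 / (32 / e\<^sup>2)"
          using l K e X by (intro divide_left_mono mult_pos_pos divide_pos_pos) auto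
        also have "\<dots> = (e/4)\<^sup>2" using e by (simp add: power2_eq_square field_simps)
        finally show ?thesis using e abs_le_square_iff[of "ef r x" "e/4"] by auto
      qed
      ultimately have "\<bar>ef r x\<bar> * \<bar>ef r x\<bar> \<le> x * (e/4)" by (intro mult_mono) auto
      then have "s2i r x \<le> e/4" using x1 by (cases "x = 0") (use e in \<open>auto simp: s2i_def power2_eq_square field_simps\<close>)
      then show ?thesis using x1 e X by (simp add: add_increasing2)
    next
      case False
      have "s2i r x \<le> (ef r x)\<^sup>2 / 1" unfolding s2i_def using False by (intro divide_left_mono) auto
      also have "\<dots> \<le> 2 / ev r" using ey[OF that] by simp
      also have "\<dots> \<le> 2 / (4 * X / e)" using l K e X by (intro divide_left_mono mult_pos_pos) auto
      also have "\<dots> = e / (2 * X)" by simp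
      finally show ?thesis using False by simp
    qed
    have eqI: "indicat_real {0..X} x *\<^sub>R (e / 4 * indicator {0..1} x + e / (2 * X))
        = e / 4 * indicator {0..1} x + e / (2 * X) * indicator {0..X} x" for x
      using X by (auto split: split_indicator)
    have "(LINT x:{0..X}|lborel. s2i r x) \<le> (LINT x:{0..X}|lborel. (e / 4 * indicator {0..1} x + e / (2 * X)))"
    proof (rule set_integral_mono)
      show "set_integrable lborel {0..X} (s2i r)"
        by (rule borel_integrable_atLeastAtMost') (rule continuous_on_subset[OF s2i_continuous_on[OF r1]], auto)
      show "set_integrable lborel {0..X} (\<lambda>x. e / 4 * indicator {0..1} x + e / (2 * X))"
        unfolding set_integrable_def eqI using X
        by (intro Bochner_Integration.integrable_add integrable_mult_right integrable_real_indicator) auto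
    qed (use b in auto)
    also have "\<dots> = e / 4 + e / 2"
    proof -
      have "(LINT x:{0..X}|lborel. (e / 4 * indicator {0..1} x + e / (2 * X))) =
         (LINT x|lborel. e / 4 * indicator {0..1} x + e / (2 * X) * indicator {0..X} x)"
        unfolding set_lebesgue_integral_def eqI ..
      also have "\<dots> = e / 4 * 1 + e / (2 * X) * X"
        using X by (subst Bochner_Integration.integral_add) auto
      finally show ?thesis using X by simp
    qed
    finally have A: "(LINT x:{0..X}|lborel. s2i r x) \<le> e / 4 + e / 2" .
    have X0: "X > 0" using X by simp
    have "- ef_en r X / X \<le> 1 / X"
      using ef_en_mono[of 0 X r] ef_en_0[OF r1] X by (intro divide_right_mono) auto
    then have B: "(LINT x:{X..}|lborel. s2i r x) \<le> e / 8"
      using s2i_integrable_tail(2)[OF r1 X0] X by linarith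
    have "0 \<le> sigma2_max r"
      unfolding sigma2_max_def set_lebesgue_integral_def
      by (intro integral_nonneg_AE) (auto split: split_indicator simp: sigma2_integrand_eq s2i_def)
    then show "norm (sigma2_max r - 0) < e"
      using s2i_split(2)[OF r1 X0] A B e by simp
  qed
qed

text \<open>For some \<open>X\<close> the mass of the square of \<open>ef\<close> up to
  \<open>X\<close> exceeds 1/2, and there the weight \<open>1 / x\<close> is at least
  \<open>1 / X\<close>.\<close>

lemma sigma2_max_pos:
  assumes r: "r \<ge> 1"
  shows "0 < sigma2_max r"
proof -
  have "\<forall>\<^sub>F x in at_top. ef_en r x > -1/2"
    using ef_en_tendsto[of r] by (rule order_tendstoD) simp
  then have "\<forall>\<^sub>F x in at_top. ef_en r x > -1/2 \<and> x > 0"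
    using eventually_gt_at_top[of 0] by eventually_elim auto
  then obtain X where X: "ef_en r X > -1/2" "X > 0"
    using eventually_happens[of _ "at_top::real filter"] by fastforce
  have "(LINT x:{0..X}|lborel. (ef r x)\<^sup>2 / X) = ef_en r X / X - ef_en r 0 / X"
    unfolding set_lebesgue_integral_def
  proof (rule integral_FTC_atLeastAtMost[of 0 X "\<lambda>x. ef_en r x / X"])
    show "continuous_on {0..X} (\<lambda>x. (ef r x)\<^sup>2 / X)"
      using X by (intro continuous_intros ode2_continuous_on(1)[OF ef_ode]) auto
    fix x
    show "((\<lambda>x. ef_en r x / X) has_vector_derivative (ef r x)\<^sup>2 / X) (at x within {0..X})"
      using DERIV_cdivide[OF ef_en_deriv[of r x], of X]
      by (auto simp: has_real_derivative_iff_has_vector_derivative intro: has_vector_derivative_at_within)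
  qed (use X in auto)
  also have "ef_en r X / X - ef_en r 0 / X > 0"
    unfolding diff_divide_distrib[symmetric] using X ef_en_0[OF r] by simp
  finally have "0 < (LINT x:{0..X}|lborel. (ef r x)\<^sup>2 / X)" .
  also have "\<dots> \<le> (LINT x:{0..X}|lborel. s2i r x)"
  proof (rule set_integral_mono)
    show "set_integrable lborel {0..X} (s2i r)"
      by (rule borel_integrable_atLeastAtMost') (rule continuous_on_subset[OF s2i_continuous_on[OF r]], auto)
    show "set_integrable lborel {0..X} (\<lambda>x. (ef r x)\<^sup>2 / X)"
      using X by (intro borel_integrable_atLeastAtMost' continuous_intros ode2_continuous_on(1)[OF ef_ode]) auto
    fix x assume x: "x \<in> {0..X}"
    show "(ef r x)\<^sup>2 / X \<le> s2i r x"
    proof (cases "x = 0")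
      case True then show ?thesis using ef_0[OF r] by (simp add: s2i_def)
    next
      case False then show ?thesis using x X unfolding s2i_def by (intro divide_left_mono) auto
    qed
  qed
  also have "\<dots> \<le> sigma2_max r"
    using s2i_split(2)[OF r X(2)] s2i_integrable_tail(3)[OF r X(2)] by simp
  finally show ?thesis .
qed

section \<open>Hermite polynomials\<close>

lemma poly_ext_real:
  fixes p q :: "real poly"
  assumes "\<And>x. poly p x = poly q x"
  shows "p = q"
  using assms poly_eq_poly_eq_iff[of p q] by auto

declare hermite.simps(2) [simp del]

lemma pderiv_sum: "pderiv (sum f A) = (\<Sum>x\<in>A. pderiv (f x :: real poly))"
  by (induction A rule: infinite_finite_induct) (auto simp: pderiv_add)

lemma poly_hermite_Suc:
  "poly (hermite (Suc n)) x = 2 * x * poly (hermite n) x - poly (pderiv (hermite n)) x"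
  by (simp add: hermite.simps algebra_simps)

lemma pderiv_hermite_Suc: "pderiv (hermite (Suc n)) = smult (2 * (real n + 1)) (hermite n)"
proof (induction n)
  case 0
  show ?case by (simp add: hermite.simps pderiv_pCons one_pCons)
next
  case (Suc n)
  have "pderiv (hermite (Suc (Suc n))) = smult 2 (hermite (Suc n)) +
      ([:0,2:] * pderiv (hermite (Suc n)) - pderiv (pderiv (hermite (Suc n))))"
    by (simp only: hermite.simps(2)[of "Suc n"] pderiv_diff pderiv_mult)
       (simp add: pderiv_pCons algebra_simps)
  also have "[:0,2:] * pderiv (hermite (Suc n)) - pderiv (pderiv (hermite (Suc n)))
      = smult (2 * (real n + 1)) (hermite (Suc n))"
    unfolding Suc.IH pderiv_smult mult_smult_right smult_diff_right[symmetric]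
    by (simp only: hermite.simps(2)[symmetric])
  finally show ?case by (simp add: smult_add_left[symmetric])
qed

lemma hermite_deriv:
  "poly (pderiv (hermite n)) x = 2 * real n * poly (hermite (n - 1)) x"
  by (cases n) (simp_all add: pderiv_hermite_Suc)

lemma hermite_rec:
  "poly (hermite (Suc (Suc n))) x = 2 * x * poly (hermite (Suc n)) x - 2 * (real n + 1) * poly (hermite n) x"
  by (simp only: poly_hermite_Suc[of "Suc n"] pderiv_hermite_Suc poly_smult)

lemma hermite_ode:
  "poly (pderiv (pderiv (hermite n))) x = 2 * x * poly (pderiv (hermite n)) x - 2 * real n * poly (hermite n) x"
proof (cases n)
  case (Suc m)
  have "poly (pderiv (pderiv (hermite n))) x = 2 * real n * poly (pderiv (hermite m)) x"
    unfolding Suc pderiv_hermite_Suc pderiv_smult by simp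
  moreover have "poly (pderiv (hermite m)) x = 2 * x * poly (hermite m) x - poly (hermite n) x"
    unfolding Suc poly_hermite_Suc by simp
  moreover have "poly (pderiv (hermite n)) x = 2 * real n * poly (hermite m) x"
    unfolding Suc pderiv_hermite_Suc by simp
  ultimately show ?thesis by (simp add: algebra_simps)
qed simp

lemma degree_hermite: "degree (hermite n) = n \<and> lead_coeff (hermite n) = 2 ^ n"
proof (induction n)
  case (Suc n)
  have ne: "hermite n \<noteq> 0" using Suc by auto
  have d: "degree ([:0, 2:] * hermite n) = Suc n" using Suc ne by (subst degree_mult_eq) auto
  have "degree (pderiv (hermite n)) < Suc n" using Suc by (simp add: degree_pderiv)
  then have dl: "degree (- pderiv (hermite n)) < degree ([:0, 2:] * hermite n)" using d by simp
  have "degree (hermite (Suc n)) = Suc n"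
    using degree_add_eq_left[OF dl] d by (simp add: hermite.simps(2))
  moreover have "lead_coeff (hermite (Suc n)) = 2 * lead_coeff (hermite n)"
  proof -
    have "lead_coeff (hermite (Suc n)) = lead_coeff ([:0, 2:] * hermite n)"
      using lead_coeff_add_le[OF dl] by (simp add: hermite.simps(2))
    also have "\<dots> = 2 * lead_coeff (hermite n)" unfolding lead_coeff_mult by simp
    finally show ?thesis .
  qed
  ultimately show ?case using Suc by (metis power_Suc)
qed simp

lemma hermite_neq_0 [simp]: "hermite n \<noteq> 0"
  using degree_hermite[of n] by auto

text \<open>Once \<open>x \<ge> 1 / c\<close> the exponent \<open>c * x\<^sup>2\<close> exceeds
  \<open>x\<close>, so plain exponential decay suffices. The value \<open>c = 1\<close> belongs to
  Rodrigues' formula, \<open>c = 1/2\<close> to the Hermite functions.\<close>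

lemma poly_div_exp_tendsto_0:
  fixes p :: "real poly"
  assumes "c > 0"
  shows "((\<lambda>x. poly p x * exp (- c * x\<^sup>2)) \<longlongrightarrow> 0) at_top"
proof -
  have 1: "((\<lambda>x. \<Sum>i\<le>degree p. coeff p i * (x ^ i / exp x)) \<longlongrightarrow> (\<Sum>i\<le>degree p. coeff p i * 0)) at_top"
    by (intro tendsto_sum tendsto_mult tendsto_const tendsto_power_div_exp_0)
  have "((\<lambda>x. poly p x / exp x) \<longlongrightarrow> 0) at_top"
    using 1 by (simp add: poly_altdef sum_divide_distrib)
  from tendsto_rabs_zero[OF this] have 2: "((\<lambda>x. \<bar>poly p x / exp x\<bar>) \<longlongrightarrow> 0) at_top" .
  show ?thesis
  proof (rule Lim_null_comparison[OF _ 2])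
    show "\<forall>\<^sub>F x in at_top. norm (poly p x * exp (- c * x\<^sup>2)) \<le> \<bar>poly p x / exp x\<bar>"
      using eventually_ge_at_top[of "max 1 (1/c)"]
    proof eventually_elim
      case (elim x)
      then have "1 \<le> c * x" "0 \<le> x" using assms by (auto simp: field_simps)
      then have "1 * x \<le> (c * x) * x" by (intro mult_right_mono) auto
      then have "exp (- c * x\<^sup>2) \<le> exp (- x)" by (simp add: power2_eq_square)
      then show ?case by (simp add: abs_mult exp_minus divide_inverse mult_left_mono)
    qed
  qed
qed

lemma poly_div_exp_tendsto_0_at_bot:
  fixes p :: "real poly"
  assumes "c > 0"
  shows "((\<lambda>x. poly p x * exp (- c * x\<^sup>2)) \<longlongrightarrow> 0) at_bot"
  using poly_div_exp_tendsto_0[OF assms, of "pcompose p [:0, -1:]"]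
  by (simp add: filterlim_at_bot_mirror poly_pcompose)

definition hzeros :: "nat \<Rightarrow> real set" where "hzeros n = {x. poly (hermite n) x = 0}"

lemma finite_hzeros [simp]: "finite (hzeros n)"
  unfolding hzeros_def by (rule poly_roots_finite) simp

lemma hermite_exp_deriv:
  "((\<lambda>x. poly (hermite n) x * exp (- 1 * x\<^sup>2)) has_real_derivative
     - (poly (hermite (Suc n)) x * exp (- 1 * x\<^sup>2))) (at x)"
  by (auto intro!: derivative_eq_intros simp: poly_hermite_Suc algebra_simps)

text \<open>Rolle's theorem on a half line: if the derivative kept one sign beyond \<open>a\<close>,
  the function would leave the value 0 strictly monotonically and could not return to 0 in the
  limit.\<close>

lemma nonzero_deriv_no_limit_at_top:
  fixes f :: "real \<Rightarrow> real"
  assumes f: "\<And>x. (f has_real_derivative f' x) (at x)" and c: "continuous_on UNIV f'"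
    and a: "f a = 0" and lim: "(f \<longlongrightarrow> 0) at_top"
  shows "\<exists>x>a. f' x = 0"
proof (rule ccontr)
  assume "\<not> ?thesis"
  then have nz: "\<And>x. x \<in> {a<..} \<Longrightarrow> f' x \<noteq> 0" by auto
  have *: False if g: "\<And>x. (g has_real_derivative g' x) (at x)" "g a = 0" "(g \<longlongrightarrow> 0) at_top" "\<And>x. x > a \<Longrightarrow> 0 < g' x"
    for g g' :: "real \<Rightarrow> real"
  proof -
    have inc: "g x < g y" if "a \<le> x" "x < y" for x y
    proof (rule DERIV_pos_imp_increasing_open[OF that(2)])
      show "continuous_on {x..y} g" by (intro continuous_at_imp_continuous_on ballI DERIV_isCont[OF g(1)])
      fix t assume "x < t" then show "\<exists>d. (g has_real_derivative d) (at t) \<and> 0 < d" using g that by force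
    qed
    have "g (a + 1) \<le> 0"
    proof (rule tendsto_lowerbound[OF g(3) eventually_mono[OF eventually_ge_at_top[of "a + 1"]]])
      fix x assume "a + 1 \<le> x"
      then show "g (a + 1) \<le> g x" using inc[of "a+1" x] by (cases "x = a + 1") auto
    qed simp
    then show False using inc[of a "a+1"] g(2) by simp
  qed
  have "(\<forall>x\<in>{a<..}. 0 < f' x) \<or> (\<forall>x\<in>{a<..}. f' x < 0)"
    by (rule nonzero_const_sign[OF continuous_on_subset[OF c] _ nz]) auto
  then show False
  proof
    assume "\<forall>x\<in>{a<..}. 0 < f' x" then show False using *[OF f a lim] by auto
  next
    assume "\<forall>x\<in>{a<..}. f' x < 0"
    then show False
      using *[of "\<lambda>x. - f x" "\<lambda>x. - f' x"] f a tendsto_minus[OF lim] by (auto intro!: DERIV_minus)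
  qed
qed

text \<open>The zeros of the next polynomial are the critical points of
  \<open>poly (hermite n) x * exp (- x\<^sup>2)\<close>, which vanishes at infinity.\<close>

lemma hermite_zero_above:
  assumes "a \<in> hzeros n"
  shows "\<exists>x>a. x \<in> hzeros (Suc n)"
proof -
  have "\<exists>x>a. - (poly (hermite (Suc n)) x * exp (- 1 * x\<^sup>2)) = 0"
    by (rule nonzero_deriv_no_limit_at_top[OF hermite_exp_deriv _ _ poly_div_exp_tendsto_0])
       (use assms in \<open>auto intro!: continuous_intros simp: hzeros_def\<close>)
  then show ?thesis by (simp add: hzeros_def)
qed

lemma hermite_zero_below:
  assumes "a \<in> hzeros n"
  shows "\<exists>x<a. x \<in> hzeros (Suc n)"
proof -
  have "\<exists>x>-a. poly (hermite (Suc n)) (-x) * exp (- 1 * x\<^sup>2) = 0"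
  proof (rule nonzero_deriv_no_limit_at_top[of "\<lambda>x. poly (hermite n) (-x) * exp (- 1 * x\<^sup>2)"])
    fix x
    show "((\<lambda>x. poly (hermite n) (- x) * exp (- 1 * x\<^sup>2)) has_real_derivative
         poly (hermite (Suc n)) (- x) * exp (- 1 * x\<^sup>2)) (at x)"
      using DERIV_chain2[where f="\<lambda>x. poly (hermite n) x * exp (- 1 * x\<^sup>2)" and g=uminus,
          OF hermite_exp_deriv[of n "-x"] DERIV_minus[OF DERIV_ident]] by simp
    show "((\<lambda>x. poly (hermite n) (- x) * exp (- 1 * x\<^sup>2)) \<longlongrightarrow> 0) at_top"
      using poly_div_exp_tendsto_0_at_bot[of 1 "hermite n"] by (simp add: filterlim_at_bot_mirror)
  qed (use assms in \<open>auto intro!: continuous_intros simp: hzeros_def\<close>)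
  then obtain x where "x > -a" "-x \<in> hzeros (Suc n)" by (auto simp: hzeros_def)
  then show ?thesis by (intro exI[of _ "-x"]) auto
qed

lemma hermite_zero_between:
  assumes "a \<in> hzeros n" "b \<in> hzeros n" "a < b"
  shows "\<exists>x. a < x \<and> x < b \<and> x \<in> hzeros (Suc n)"
proof -
  have "\<exists>z. a < z \<and> z < b \<and> (\<lambda>v. - (poly (hermite (Suc n)) z * exp (- 1 * z\<^sup>2)) * v) = (\<lambda>v. 0)"
  proof (rule Rolle_deriv[OF assms(3), where f="\<lambda>x. poly (hermite n) x * exp (- 1 * x\<^sup>2)"])
    show "continuous_on {a..b} (\<lambda>x. poly (hermite n) x * exp (- 1 * x\<^sup>2))" by (intro continuous_intros)
    show "((\<lambda>x. poly (hermite n) x * exp (- 1 * x\<^sup>2)) has_derivative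
          (\<lambda>v. - (poly (hermite (Suc n)) x * exp (- 1 * x\<^sup>2)) * v)) (at x)" for x
      using hermite_exp_deriv[of n x] unfolding has_field_derivative_def
      by (simp only: minus_mult_left)
  qed (use assms in \<open>auto simp: hzeros_def\<close>)
  then obtain z where z: "a < z" "z < b" "\<And>v. - (poly (hermite (Suc n)) z * exp (- 1 * z\<^sup>2)) * v = 0"
    by (metis (no_types))
  from z(3)[of 1] have "z \<in> hzeros (Suc n)" by (simp add: hzeros_def)
  with z show ?thesis by blast
qed

text \<open>Rolle's theorem gives \<open>n - 1\<close> zeros between those of the previous
  polynomial and one more on either side; the degree allows no more than these
  \<open>n + 1\<close>.\<close>

lemma card_hzeros: "card (hzeros n) = n"
proof (induction n)
  case (Suc n)
  show ?case
  proof (cases "n = 0")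
    case True
    have "hzeros 1 = {0}" by (auto simp: hzeros_def hermite.simps)
    then show ?thesis using True by simp
  next
    case False
    let ?S = "hzeros n" and ?T = "hzeros (Suc n)"
    have ne: "?S \<noteq> {}" using Suc False by force
    have le: "card ?T \<le> Suc n"
      unfolding hzeros_def using card_poly_roots_bound[of "hermite (Suc n)"] degree_hermite[of "Suc n"] by simp
    obtain u where u: "u > Max ?S" "u \<in> ?T" using hermite_zero_above Max_in[OF finite_hzeros ne] by blast
    obtain l where l: "l < Min ?S" "l \<in> ?T" using hermite_zero_below Min_in[OF finite_hzeros ne] by blast
    have "card ?S \<le> Suc (card {t\<in>?T. Min ?S < t \<and> t < Max ?S})"
      by (rule interlacing_card) (use ne hermite_zero_between in auto)
    moreover have "card (insert u (insert l {t\<in>?T. Min ?S < t \<and> t < Max ?S})) \<le> card ?T"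
      by (rule card_mono) (use u l in auto)
    moreover have "Min ?S \<le> Max ?S" using ne by (intro Min_le Max_in) auto
    then have "card (insert u (insert l {t\<in>?T. Min ?S < t \<and> t < Max ?S})) = Suc (Suc (card {t\<in>?T. Min ?S < t \<and> t < Max ?S}))"
      using u l by (subst card_insert_disjoint; auto)+
    ultimately show ?thesis using le Suc by simp
  qed
qed (simp add: hzeros_def)

lemma hermite_zero_bij:
  "bij_betw (hermite_zero N) {1..N} (hzeros N)"
  "strict_mono_on {1..N} (hermite_zero N)"
proof -
  let ?l = "sorted_list_of_set (hzeros N)"
  have len: "length ?l = N" by (simp add: card_hzeros)
  have hz: "hermite_zero N j = ?l ! (j - 1)" for j by (simp add: hermite_zero_def hzeros_def)
  show sm: "strict_mono_on {1..N} (hermite_zero N)"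
  proof (rule strict_mono_onI)
    fix i j assume ij: "i \<in> {1..N}" "j \<in> {1..N}" "i < j"
    then show "hermite_zero N i < hermite_zero N j"
      unfolding hz by (intro sorted_wrt_nth_less[OF strict_sorted_list_of_set]) (auto simp: card_hzeros)
  qed
  show "bij_betw (hermite_zero N) {1..N} (hzeros N)"
  proof (rule bij_betw_imageI)
    show "inj_on (hermite_zero N) {1..N}" using sm by (rule strict_mono_on_imp_inj_on)
    have "hermite_zero N ` {1..N} = (\<lambda>j. ?l ! j) ` {..<N}"
    proof -
      have "{..<N} = (\<lambda>j. j - 1) ` {1..N}" by (auto simp: image_iff intro!: bexI[of _ "Suc _"])
      then show ?thesis by (simp add: image_image hz)
    qed
    also have "\<dots> = set ?l" using len nth_image[of N ?l] by (simp add: lessThan_atLeast0)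
    finally show "hermite_zero N ` {1..N} = hzeros N" by simp
  qed
qed

text \<open>The Hermite function solves a linear equation of second order, so a double zero would
  make it vanish identically.\<close>

lemma hzeros_simple:
  assumes "z \<in> hzeros n"
  shows "poly (pderiv (hermite n)) z \<noteq> 0"
proof
  assume *: "poly (pderiv (hermite n)) z = 0"
  have s: "ode2 (\<lambda>x. x\<^sup>2 - (2 * real n + 1))
     (\<lambda>x. poly (hermite n) x * exp (- x\<^sup>2/2)) (\<lambda>x. (poly (pderiv (hermite n)) x - x * poly (hermite n) x) * exp (- x\<^sup>2/2))"
    unfolding ode2_def
    by (auto intro!: derivative_eq_intros simp: hermite_ode algebra_simps power2_eq_square)
  have "poly (hermite n) x * exp (- x\<^sup>2/2) = 0" for x
    by (rule ode2_zero_imp_zero[OF s, of z]) (use * assms in \<open>auto intro!: continuous_intros simp: hzeros_def\<close>)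
  then have "hzeros n = UNIV" by (auto simp: hzeros_def)
  then show False using finite_hzeros[of n] infinite_UNIV_char_0 by metis
qed

subsection \<open>Sums over the zeros\<close>

text \<open>The Lagrange polynomial of the node \<open>z\<close> without normalisation: its value at
  \<open>z\<close> is the derivative of \<open>hermite n\<close> there.\<close>

definition hlag :: "nat \<Rightarrow> real \<Rightarrow> real poly" where
  "hlag n z = hermite n div [:- z, 1:]"

lemma hlag:
  assumes "z \<in> hzeros n"
  shows "hermite n = [:- z, 1:] * hlag n z"
  using assms unfolding hlag_def hzeros_def poly_eq_0_iff_dvd by (intro dvd_mult_div_cancel[symmetric]) simp

lemma degree_hlag:
  assumes "z \<in> hzeros n"
  shows "degree (hlag n z) < n"
proof -
  have "hlag n z \<noteq> 0" using hlag[OF assms] hermite_neq_0[of n] by auto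
  then have "degree (hermite n) = 1 + degree (hlag n z)"
    by (subst hlag[OF assms], subst degree_mult_eq) auto
  then show ?thesis using degree_hermite[of n] by simp
qed

lemma hlag_values:
  assumes "z \<in> hzeros n"
  shows "poly (hermite n) x = (x - z) * poly (hlag n z) x"
    "poly (pderiv (hermite n)) x = (x - z) * poly (pderiv (hlag n z)) x + poly (hlag n z) x"
    "poly (pderiv (pderiv (hermite n))) x = (x - z) * poly (pderiv (pderiv (hlag n z))) x + 2 * poly (pderiv (hlag n z)) x"
    "poly (pderiv (pderiv (pderiv (hermite n)))) x = (x - z) * poly (pderiv (pderiv (pderiv (hlag n z)))) x + 3 * poly (pderiv (pderiv (hlag n z))) x"
proof -
  let ?L = "hlag n z"
  have 1: "hermite n = [:- z, 1:] * ?L" by (rule hlag[OF assms])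
  have p: "pderiv [:- z, 1:] = 1" by (simp add: pderiv_pCons)
  have 2: "pderiv (hermite n) = [:- z, 1:] * pderiv ?L + ?L"
    by (subst 1) (simp only: pderiv_mult p mult_1_right)
  have 3: "pderiv (pderiv (hermite n)) = [:- z, 1:] * pderiv (pderiv ?L) + pderiv ?L + pderiv ?L"
    unfolding 2 by (simp only: pderiv_add pderiv_mult p mult_1_right)
  have 4: "pderiv (pderiv (pderiv (hermite n))) = [:- z, 1:] * pderiv (pderiv (pderiv ?L)) + pderiv (pderiv ?L) + pderiv (pderiv ?L) + pderiv (pderiv ?L)"
    unfolding 3 by (simp only: pderiv_add pderiv_mult p mult_1_right)
  show "poly (hermite n) x = (x - z) * poly (hlag n z) x" by (subst 1) (simp add: algebra_simps)
  show "poly (pderiv (hermite n)) x = (x - z) * poly (pderiv (hlag n z)) x + poly (hlag n z) x"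
    by (subst 2) (simp add: algebra_simps)
  show "poly (pderiv (pderiv (hermite n))) x = (x - z) * poly (pderiv (pderiv (hlag n z))) x + 2 * poly (pderiv (hlag n z)) x"
    by (subst 3) (simp add: algebra_simps)
  show "poly (pderiv (pderiv (pderiv (hermite n)))) x = (x - z) * poly (pderiv (pderiv (pderiv (hlag n z)))) x + 3 * poly (pderiv (pderiv (hlag n z))) x"
    by (subst 4) (simp add: algebra_simps)
qed

text \<open>The third identity evaluates Hermite's operator p'' - 2 x p' on a Lagrange polynomial at
  another node. It follows by differentiating the factorisation of \<open>hermite n\<close> twice
  and using the Hermite equation; this is where the entries \<open>1 / (z - w)\<^sup>2\<close> of
  the Hessian arise.\<close>

lemma hlag_off_diagonal:
  assumes w: "w \<in> hzeros n" and z: "z \<in> hzeros n" and "z \<noteq> w"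
  shows "poly (hlag n w) z = 0"
    "poly (pderiv (hlag n w)) z = poly (pderiv (hermite n)) z / (z - w)"
    "poly (pderiv (pderiv (hlag n w))) z - 2 * z * poly (pderiv (hlag n w)) z
       = - 2 * poly (pderiv (hermite n)) z / (z - w)\<^sup>2"
proof -
  have H0: "poly (hermite n) z = 0" using z by (simp add: hzeros_def)
  show L0: "poly (hlag n w) z = 0" using hlag_values(1)[OF w, of z] H0 assms(3) by simp
  show L1: "poly (pderiv (hlag n w)) z = poly (pderiv (hermite n)) z / (z - w)"
    using hlag_values(2)[OF w, of z] L0 assms(3) by (simp add: field_simps)
  have "poly (pderiv (pderiv (hlag n w))) z = (2 * z * poly (pderiv (hermite n)) z - 2 * poly (pderiv (hlag n w)) z) / (z - w)"
    using hlag_values(3)[OF w, of z] hermite_ode[of n z] H0 assms(3) by (simp add: field_simps)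
  then show "poly (pderiv (pderiv (hlag n w))) z - 2 * z * poly (pderiv (hlag n w)) z
       = - 2 * poly (pderiv (hermite n)) z / (z - w)\<^sup>2"
    unfolding L1 using assms(3) by (simp add: power2_eq_square diff_divide_distrib)
qed

text \<open>At its own node the factor \<open>x - z\<close> vanishes, so each value costs one more
  derivative of \<open>hermite n\<close>; the third derivative comes from differentiating the
  Hermite equation.\<close>

lemma hlag_diagonal:
  assumes z: "z \<in> hzeros n"
  shows "poly (hlag n z) z = poly (pderiv (hermite n)) z"
    "poly (pderiv (hlag n z)) z = z * poly (pderiv (hermite n)) z"
    "poly (pderiv (pderiv (hlag n z))) z - 2 * z * poly (pderiv (hlag n z)) z
       = poly (pderiv (hermite n)) z * ((2 - 2 * real n - 2 * z\<^sup>2) / 3)"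
proof -
  have H0: "poly (hermite n) z = 0" using z by (simp add: hzeros_def)
  show "poly (hlag n z) z = poly (pderiv (hermite n)) z" using hlag_values(2)[OF z, of z] by simp
  show L1: "poly (pderiv (hlag n z)) z = z * poly (pderiv (hermite n)) z"
    using hlag_values(3)[OF z, of z] hermite_ode[of n z] H0 by simp
  have H3: "poly (pderiv (pderiv (pderiv (hermite n)))) z
    = 2 * z * poly (pderiv (pderiv (hermite n))) z + (2 - 2 * real n) * poly (pderiv (hermite n)) z"
  proof -
    have "pderiv (pderiv (hermite n)) = [:0, 2:] * pderiv (hermite n) - smult (2 * real n) (hermite n)"
      by (rule poly_ext_real) (simp add: hermite_ode)
    then have "pderiv (pderiv (pderiv (hermite n))) =
       [:0, 2:] * pderiv (pderiv (hermite n)) + pderiv (hermite n) * pderiv [:0, 2:] - smult (2 * real n) (pderiv (hermite n))"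
      by (simp only: pderiv_diff pderiv_mult pderiv_smult)
    then have "poly (pderiv (pderiv (pderiv (hermite n)))) z =
       poly ([:0, 2:] * pderiv (pderiv (hermite n)) + pderiv (hermite n) * pderiv [:0, 2:] - smult (2 * real n) (pderiv (hermite n))) z"
      by simp
    then show ?thesis by (simp add: pderiv_pCons algebra_simps)
  qed
  have "poly (pderiv (pderiv (hlag n z))) z = poly (pderiv (pderiv (pderiv (hermite n)))) z / 3"
    using hlag_values(4)[OF z, of z] by simp
  then show "poly (pderiv (pderiv (hlag n z))) z - 2 * z * poly (pderiv (hlag n z)) z
       = poly (pderiv (hermite n)) z * ((2 - 2 * real n - 2 * z\<^sup>2) / 3)"
    unfolding L1 H3 hermite_ode[of n z] H0 by (simp add: field_simps power2_eq_square)
qed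

lemma hlag_interpolation:
  assumes "degree p < n"
  shows "p = (\<Sum>w\<in>hzeros n. smult (poly p w / poly (pderiv (hermite n)) w) (hlag n w))" (is "_ = ?q")
proof (rule poly_eqI_degree[of "hzeros n"])
  fix z assume z: "z \<in> hzeros n"
  have "poly ?q z = (\<Sum>w\<in>hzeros n. poly p w / poly (pderiv (hermite n)) w * poly (hlag n w) z)"
    by (simp add: poly_sum)
  also have "\<dots> = (\<Sum>w\<in>hzeros n. if w = z then poly p z else 0)"
    by (intro sum.cong refl)
       (use z hlag_off_diagonal(1) hlag_diagonal(1) hzeros_simple in \<open>auto\<close>)
  also have "\<dots> = poly p z" using z by simp
  finally show "poly p z = poly ?q z" by simp
next
  show "degree p < card (hzeros n)" using assms by (simp add: card_hzeros)
  have "degree ?q \<le> n - 1"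
    by (rule degree_sum_le) (auto intro!: order.trans[OF degree_smult_le] dest!: degree_hlag)
  then show "degree ?q < card (hzeros n)" using assms by (simp add: card_hzeros)
qed

text \<open>Interpolating \<open>pderiv (hermite n)\<close> at the zeros gives all coefficients 1.
  Differentiating that sum at \<open>z\<close> and comparing with the Hermite equation yields the
  identity, which says that the zeros are a critical point of the energy.\<close>

lemma stieltjes:
  assumes z: "z \<in> hzeros n"
  shows "(\<Sum>w\<in>hzeros n - {z}. 1 / (z - w)) = z"
proof -
  have n: "n > 0" using z by (cases n) (auto simp: hzeros_def)
  let ?H = "poly (pderiv (hermite n))"
  have nz: "?H w \<noteq> 0" if "w \<in> hzeros n" for w using hzeros_simple[OF that] .
  have "pderiv (hermite n) = (\<Sum>w\<in>hzeros n. smult (?H w / ?H w) (hlag n w))"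
    by (rule hlag_interpolation) (use n degree_hermite[of n] in \<open>auto simp: degree_pderiv\<close>)
  also have "\<dots> = (\<Sum>w\<in>hzeros n. hlag n w)" using nz by (intro sum.cong) auto
  finally have "poly (pderiv (pderiv (hermite n))) z = poly (pderiv (\<Sum>w\<in>hzeros n. hlag n w)) z" by simp
  also have "\<dots> = (\<Sum>w\<in>hzeros n. poly (pderiv (hlag n w)) z)"
    by (simp add: pderiv_sum poly_sum)
  also have "\<dots> = poly (pderiv (hlag n z)) z + (\<Sum>w\<in>hzeros n - {z}. poly (pderiv (hlag n w)) z)"
    using z by (simp add: sum.remove)
  also have "(\<Sum>w\<in>hzeros n - {z}. poly (pderiv (hlag n w)) z) = ?H z * (\<Sum>w\<in>hzeros n - {z}. 1 / (z - w))"
    unfolding sum_distrib_left by (intro sum.cong refl) (use z hlag_off_diagonal(2) in auto)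
  finally have "2 * z * ?H z = z * ?H z + ?H z * (\<Sum>w\<in>hzeros n - {z}. 1 / (z - w))"
    using hlag_diagonal(2)[OF z] hermite_ode[of n z] z by (simp add: hzeros_def)
  then show ?thesis using nz[OF z] by (simp add: algebra_simps)
qed

text \<open>Interpolate \<open>hermite m\<close> and apply p'' - 2 x p' at \<open>z\<close>: one
  side is multiplied by -2m, the other is read off from the Lagrange polynomials.\<close>

lemma hermite_sum_inverse_squares:
  assumes z: "z \<in> hzeros n" and m: "m < n"
    and v: "\<And>w. v w = poly (hermite m) w / poly (pderiv (hermite n)) w"
  shows "(\<Sum>w\<in>hzeros n - {z}. v w / (z - w)\<^sup>2) = v z * (real m + (1 - real n - z\<^sup>2) / 3)"
proof -
  let ?H = "poly (pderiv (hermite n))"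
  let ?D = "\<lambda>p. poly (pderiv (pderiv p)) z - 2 * z * poly (pderiv p) z"
  have H: "?H z \<noteq> 0" using hzeros_simple[OF z] .
  have "hermite m = (\<Sum>w\<in>hzeros n. smult (v w) (hlag n w))"
    unfolding v by (rule hlag_interpolation) (use m degree_hermite[of m] in auto)
  then have "?D (hermite m) = ?D (\<Sum>w\<in>hzeros n. smult (v w) (hlag n w))" by simp
  also have "\<dots> = (\<Sum>w\<in>hzeros n. v w * ?D (hlag n w))"
    by (simp add: pderiv_sum poly_sum pderiv_smult sum_distrib_left sum_subtractf algebra_simps)
  also have "\<dots> = v z * ?D (hlag n z) + (\<Sum>w\<in>hzeros n - {z}. v w * ?D (hlag n w))"
    using z by (simp add: sum.remove)
  also have "(\<Sum>w\<in>hzeros n - {z}. v w * ?D (hlag n w)) = - 2 * ?H z * (\<Sum>w\<in>hzeros n - {z}. v w / (z - w)\<^sup>2)"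
    unfolding sum_distrib_left by (intro sum.cong refl) (use z hlag_off_diagonal(3) in auto)
  also have "?D (hlag n z) = ?H z * ((2 - 2 * real n - 2 * z\<^sup>2) / 3)" by (rule hlag_diagonal(3)[OF z])
  also have "?D (hermite m) = - 2 * real m * (v z * ?H z)" using hermite_ode[of m z] H by (simp add: v)
  finally have "?H z * (\<Sum>w\<in>hzeros n - {z}. v w / (z - w)\<^sup>2) = ?H z * (v z * (real m + (1 - real n - z\<^sup>2) / 3))"
    by (simp add: field_simps)
  then show ?thesis using H by simp
qed

text \<open>For degree \<open>n - 1\<close> the values divided by the derivative of
  \<open>hermite n\<close> are the constant \<open>1 / (2 * real n)\<close>. That case evaluates the
  sum of \<open>1 / (z - w)\<^sup>2\<close>, and combining it with degree \<open>m\<close> removes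
  the term in \<open>z\<^sup>2\<close>.\<close>

lemma hermite_eigenvector:
  assumes z: "z \<in> hzeros n" and m: "m < n"
    and v: "\<And>w. v w = poly (hermite m) w / poly (hermite (n - 1)) w"
  shows "(\<Sum>w\<in>hzeros n - {z}. (v z - v w) / (z - w)\<^sup>2) = (real n - 1 - real m) * v z"
proof -
  have n: "n > 0" using m by simp
  let ?H = "poly (pderiv (hermite n))"
  define u where "u w = poly (hermite m) w / ?H w" for w
  define e where "e w = poly (hermite (n-1)) w / ?H w" for w
  have vu: "v w = 2 * real n * u w" for w using n by (simp add: v u_def hermite_deriv)
  have e: "e w = 1 / (2 * real n)" if "w \<in> hzeros n" for w
    using hzeros_simple[OF that] by (simp add: e_def hermite_deriv)
  have 1: "(\<Sum>w\<in>hzeros n - {z}. u w / (z - w)\<^sup>2) = u z * (real m + (1 - real n - z\<^sup>2) / 3)"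
    by (rule hermite_sum_inverse_squares[OF z m u_def])
  have "(\<Sum>w\<in>hzeros n - {z}. e w / (z - w)\<^sup>2) = e z * (real (n-1) + (1 - real n - z\<^sup>2) / 3)"
    by (rule hermite_sum_inverse_squares[OF z _ e_def]) (use n in auto)
  moreover have "(\<Sum>w\<in>hzeros n - {z}. e w / (z - w)\<^sup>2) = 1 / (2 * real n) * (\<Sum>w\<in>hzeros n - {z}. 1 / (z - w)\<^sup>2)"
    unfolding sum_distrib_left by (intro sum.cong) (auto simp: e)
  ultimately have 2: "(\<Sum>w\<in>hzeros n - {z}. 1 / (z - w)\<^sup>2) = real n - 1 + (1 - real n - z\<^sup>2) / 3"
    using n e[OF z] by (simp add: of_nat_diff)
  have "(\<Sum>w\<in>hzeros n - {z}. (v z - v w) / (z - w)\<^sup>2) =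
     v z * (\<Sum>w\<in>hzeros n - {z}. 1 / (z - w)\<^sup>2) - 2 * real n * (\<Sum>w\<in>hzeros n - {z}. u w / (z - w)\<^sup>2)"
    by (simp add: vu diff_divide_distrib sum_subtractf sum_distrib_left)
  also have "\<dots> = (real n - 1 - real m) * v z"
    unfolding 1 2 vu[of z] by (simp add: algebra_simps)
  finally show ?thesis .
qed

section \<open>Christoffel-Darboux formulas and the covariance matrix\<close>

lemma add_divide_twice: "D \<noteq> 0 \<Longrightarrow> m \<noteq> 0 \<Longrightarrow> A / D + B / (D * m) = (2 * m * A + 2 * B) / (D * m * (2 :: real))"
  by (simp add: field_simps)

lemma christoffel_darboux:
  "(x - y) * (\<Sum>k\<le>n. poly (hermite k) x * poly (hermite k) y / (2 ^ k * fact k)) =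
    (poly (hermite (Suc n)) x * poly (hermite n) y - poly (hermite n) x * poly (hermite (Suc n)) y) / (2 ^ Suc n * fact n)"
proof (induction n)
  case 0
  show ?case by (simp add: hermite.simps algebra_simps diff_divide_distrib)
next
  case (Suc n)
  let ?a = "\<lambda>k. poly (hermite k) x" and ?b = "\<lambda>k. poly (hermite k) y"
  have "(x - y) * (\<Sum>k\<le>Suc n. ?a k * ?b k / (2 ^ k * fact k)) =
     (?a (Suc n) * ?b n - ?a n * ?b (Suc n)) / (2 ^ Suc n * fact n) + (x - y) * (?a (Suc n) * ?b (Suc n)) / (2 ^ Suc n * fact (Suc n))"
    using Suc by (simp add: distrib_left)
  also have "\<dots> = (2 * (real n + 1) * (?a (Suc n) * ?b n - ?a n * ?b (Suc n)) + 2 * (x - y) * (?a (Suc n) * ?b (Suc n))) / (2 ^ Suc (Suc n) * fact (Suc n))"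
    using add_divide_twice[of "2 ^ Suc n * fact n" "real n + 1" "?a (Suc n) * ?b n - ?a n * ?b (Suc n)" "(x - y) * (?a (Suc n) * ?b (Suc n))"]
    by (simp add: mult_ac add.commute)
  also have "2 * (real n + 1) * (?a (Suc n) * ?b n - ?a n * ?b (Suc n)) + 2 * (x - y) * (?a (Suc n) * ?b (Suc n))
     = ?a (Suc (Suc n)) * ?b (Suc n) - ?a (Suc n) * ?b (Suc (Suc n))"
    unfolding hermite_rec by (simp add: algebra_simps)
  finally show ?case .
qed

text \<open>The limit \<open>y \<rightarrow> x\<close> of the preceding formula, obtained by its own
  induction with the differentiated three-term recursion.\<close>

lemma christoffel_darboux_confluent:
  "(\<Sum>k\<le>n. (poly (hermite k) x)\<^sup>2 / (2 ^ k * fact k)) =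
    (poly (pderiv (hermite (Suc n))) x * poly (hermite n) x - poly (pderiv (hermite n)) x * poly (hermite (Suc n)) x) / (2 ^ Suc n * fact n)"
proof (induction n)
  case 0
  show ?case by (simp add: hermite.simps pderiv_pCons)
next
  case (Suc n)
  let ?a = "\<lambda>k. poly (hermite k) x" and ?d = "\<lambda>k. poly (pderiv (hermite k)) x"
  have "(\<Sum>k\<le>Suc n. (?a k)\<^sup>2 / (2 ^ k * fact k)) =
     (?d (Suc n) * ?a n - ?d n * ?a (Suc n)) / (2 ^ Suc n * fact n) + (?a (Suc n))\<^sup>2 / (2 ^ Suc n * fact (Suc n))"
    using Suc by (simp)
  also have "\<dots> = (2 * (real n + 1) * (?d (Suc n) * ?a n - ?d n * ?a (Suc n)) + 2 * (?a (Suc n))\<^sup>2) / (2 ^ Suc (Suc n) * fact (Suc n))"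
    using add_divide_twice[of "2 ^ Suc n * fact n" "real n + 1" "?d (Suc n) * ?a n - ?d n * ?a (Suc n)" "(?a (Suc n))\<^sup>2"]
    by (simp add: mult_ac add.commute)
  also have "2 * (real n + 1) * (?d (Suc n) * ?a n - ?d n * ?a (Suc n)) + 2 * (?a (Suc n))\<^sup>2
     = ?d (Suc (Suc n)) * ?a (Suc n) - ?d (Suc n) * ?a (Suc (Suc n))"
  proof -
    have "?d (Suc (Suc n)) = 2 * ?a (Suc n) + 2 * x * ?d (Suc n) - 2 * (real n + 1) * ?d n"
    proof -
      have "hermite (Suc (Suc n)) = [:0,2:] * hermite (Suc n) - smult (2 * (real n + 1)) (hermite n)"
        by (rule poly_ext_real) (simp add: hermite_rec)
      then have "pderiv (hermite (Suc (Suc n))) = [:0,2:] * pderiv (hermite (Suc n)) + hermite (Suc n) * pderiv [:0,2:] - smult (2 * (real n + 1)) (pderiv (hermite n))"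
        by (simp only: pderiv_diff pderiv_mult pderiv_smult)
      then have "?d (Suc (Suc n)) = poly ([:0,2:] * pderiv (hermite (Suc n)) + hermite (Suc n) * pderiv [:0,2:] - smult (2 * (real n + 1)) (pderiv (hermite n))) x"
        by simp
      then show ?thesis by (simp add: pderiv_pCons algebra_simps)
    qed
    then show ?thesis unfolding hermite_rec power2_eq_square by (simp only:) (simp add: algebra_simps)
  qed
  finally show ?case .
qed

text \<open>Orthonormal up to one common constant: the squared norm of \<open>hermite n\<close> is
  \<open>2 ^ n * fact n * sqrt pi\<close>.\<close>

definition horth :: "nat \<Rightarrow> real \<Rightarrow> real" where
  "horth n x = poly (hermite n) x / sqrt (2 ^ n * fact n)"

text \<open>The polynomials dual to the Hermite polynomials, evaluated at the zeros of \<open>H\<^sub>N\<close>.\<close>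

definition hdual :: "nat \<Rightarrow> real \<Rightarrow> nat \<Rightarrow> real" where
  "hdual N z k = horth (N - Suc k) z / horth (N - 1) z"

lemma hermite_pred_nonzero:
  assumes "z \<in> hzeros N" shows "poly (hermite (N - 1)) z \<noteq> 0" "horth (N - 1) z \<noteq> 0" "0 < N"
proof -
  show n: "0 < N" using assms by (cases N) (auto simp: hzeros_def)
  show "poly (hermite (N - 1)) z \<noteq> 0"
    using hzeros_simple[OF assms] by (simp add: hermite_deriv)
  then show "horth (N - 1) z \<noteq> 0" by (simp add: horth_def)
qed

lemma horth_mult: "horth n x * horth n y = poly (hermite n) x * poly (hermite n) y / (2 ^ n * fact n)"
  by (simp add: horth_def real_sqrt_mult[symmetric])

text \<open>At two distinct zeros of \<open>hermite N\<close> the right-hand side of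
  Christoffel-Darboux vanishes. On the diagonal the confluent formula leaves the derivative, which
  is \<open>2 * N\<close> times \<open>hermite (N - 1)\<close>.\<close>

lemma hdual_orthogonal:
  assumes z: "z \<in> hzeros N" and w: "w \<in> hzeros N"
  shows "(\<Sum>k<N. hdual N z k * hdual N w k) = (if z = w then real N else 0)"
proof -
  let ?H = "\<lambda>n. poly (hermite n)"
  obtain n where N: "N = Suc n" using hermite_pred_nonzero(3)[OF z] by (cases N) auto
  have "(\<Sum>k<N. hdual N z k * hdual N w k) = (\<Sum>k<N. horth (N - Suc k) z * horth (N - Suc k) w) / (horth (N-1) z * horth (N-1) w)"
    by (simp add: hdual_def sum_divide_distrib)
  also have "(\<Sum>k<N. horth (N - Suc k) z * horth (N - Suc k) w) = (\<Sum>k<N. horth k z * horth k w)"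
    by (rule sum.nat_diff_reindex)
  also have "\<dots> = (\<Sum>k\<le>n. ?H k z * ?H k w / (2 ^ k * fact k))"
    unfolding horth_mult N lessThan_Suc_atMost ..
  finally have e: "(\<Sum>k<N. hdual N z k * hdual N w k) = (\<Sum>k\<le>n. ?H k z * ?H k w / (2 ^ k * fact k)) / (horth n z * horth n w)"
    by (simp add: N)
  have z0: "?H (Suc n) z = 0" "?H (Suc n) w = 0" using z w by (auto simp: hzeros_def N)
  have nz: "?H n z \<noteq> 0" using hermite_pred_nonzero(1)[OF z] by (simp add: N)
  show ?thesis
  proof (cases "z = w")
    case True
    have "(\<Sum>k\<le>n. ?H k z * ?H k w / (2 ^ k * fact k)) = (\<Sum>k\<le>n. (?H k z)\<^sup>2 / (2 ^ k * fact k))"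
      by (simp add: True power2_eq_square)
    also have "\<dots> = 2 * (real n + 1) * (?H n z)\<^sup>2 / (2 ^ Suc n * fact n)"
      unfolding christoffel_darboux_confluent z0 pderiv_hermite_Suc by (simp add: power2_eq_square)
    finally show ?thesis
      unfolding e horth_mult using True nz by (simp add: N power2_eq_square)
  next
    case False
    have "(z - w) * (\<Sum>k\<le>n. ?H k z * ?H k w / (2 ^ k * fact k)) = 0"
      unfolding christoffel_darboux z0 by simp
    then show ?thesis unfolding e using False by simp
  qed
qed

text \<open>The \<open>z\<close>-th diagonal entry of the inverse of the matrix with diagonal entries
  \<open>1 + \<Sum> 1/(z - w)\<^sup>2\<close> and off-diagonal entries \<open>- 1/(z - w)\<^sup>2\<close>; its eigenvalues are \<open>1, \<dots>, N\<close>.\<close>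

definition hvar :: "nat \<Rightarrow> real \<Rightarrow> real" where
  "hvar N z = (\<Sum>k<N. (hdual N z k)\<^sup>2 / (real k + 1)) / real N"

text \<open>The \<open>z\<close>-th column of that inverse, divided by its diagonal entry
  \<open>hvar N z\<close> and written in the basis of eigenvectors \<open>hdual\<close> with
  eigenvalues \<open>k + 1\<close>.\<close>

definition hcol :: "nat \<Rightarrow> real \<Rightarrow> real \<Rightarrow> real" where
  "hcol N z w = (\<Sum>k<N. hdual N z k * hdual N w k / (real k + 1)) / (real N * hvar N z)"

lemma hvar_pos:
  assumes "z \<in> hzeros N" shows "0 < hvar N z"
proof -
  have N: "0 < N" by (rule hermite_pred_nonzero(3)[OF assms])
  have "hdual N z 0 = 1" using hermite_pred_nonzero(2)[OF assms] by (simp add: hdual_def)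
  then have "0 < (\<Sum>k<N. (hdual N z k)\<^sup>2 / (real k + 1))"
    using N by (intro sum_pos2[where i=0]) auto
  then show ?thesis using N by (simp add: hvar_def)
qed

lemma hcol_diag:
  assumes "z \<in> hzeros N" shows "hcol N z z = 1"
proof -
  have "real N * hvar N z = (\<Sum>k<N. (hdual N z k)\<^sup>2 / (real k + 1))"
    using hermite_pred_nonzero(3)[OF assms] by (simp add: hvar_def)
  moreover have "0 < real N * hvar N z" using hvar_pos[OF assms] hermite_pred_nonzero(3)[OF assms] by simp
  ultimately show ?thesis by (simp add: hcol_def power2_eq_square)
qed

text \<open>The vector built from \<open>hermite (N - Suc k)\<close> has eigenvalue \<open>k\<close>
  for the matrix without its identity part, hence \<open>k + 1\<close> in all. This cancels the
  denominators, and orthogonality leaves a multiple of the unit vector.\<close>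

lemma hcol_equation:
  assumes z: "z \<in> hzeros N" and w: "w \<in> hzeros N"
  shows "hcol N z w + (\<Sum>x\<in>hzeros N - {w}. (hcol N z w - hcol N z x) / (w - x)\<^sup>2) = (if w = z then 1 / hvar N z else 0)"
proof -
  have N: "0 < N" by (rule hermite_pred_nonzero(3)[OF z])
  let ?s = "real N * hvar N z"
  define v where "v k x = poly (hermite (N - Suc k)) x / poly (hermite (N - 1)) x" for k x
  define c where "c k = sqrt (2 ^ (N-1) * fact (N-1)) / sqrt (2 ^ (N - Suc k) * fact (N - Suc k))" for k
  have dv: "hdual N x k = c k * v k x" for x k by (simp add: hdual_def horth_def v_def c_def)
  have ev: "(\<Sum>x\<in>hzeros N - {w}. (hdual N w k - hdual N x k) / (w - x)\<^sup>2) = real k * hdual N w k" if "k < N" for k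
  proof -
    have "(\<Sum>x\<in>hzeros N - {w}. (hdual N w k - hdual N x k) / (w - x)\<^sup>2) = c k * (\<Sum>x\<in>hzeros N - {w}. (v k w - v k x) / (w - x)\<^sup>2)"
      by (simp add: dv sum_distrib_left right_diff_distrib)
    also have "(\<Sum>x\<in>hzeros N - {w}. (v k w - v k x) / (w - x)\<^sup>2) = (real N - 1 - real (N - Suc k)) * v k w"
      by (rule hermite_eigenvector[OF w _ v_def]) (use N in auto)
    finally show ?thesis using that by (simp add: dv of_nat_diff)
  qed
  have "(\<Sum>x\<in>hzeros N - {w}. (hcol N z w - hcol N z x) / (w - x)\<^sup>2)
      = (\<Sum>x\<in>hzeros N - {w}. \<Sum>k<N. hdual N z k / (real k + 1) / ?s * ((hdual N w k - hdual N x k) / (w - x)\<^sup>2))"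
    by (intro sum.cong refl)
       (simp add: hcol_def diff_divide_distrib[symmetric] sum_subtractf[symmetric] sum_divide_distrib algebra_simps)
  also have "\<dots> = (\<Sum>k<N. hdual N z k / (real k + 1) / ?s * (\<Sum>x\<in>hzeros N - {w}. (hdual N w k - hdual N x k) / (w - x)\<^sup>2))"
    by (subst sum.swap) (simp add: sum_distrib_left)
  also have "\<dots> = (\<Sum>k<N. hdual N z k / (real k + 1) / ?s * (real k * hdual N w k))"
    by (intro sum.cong refl) (use ev in auto)
  finally have "hcol N z w + (\<Sum>x\<in>hzeros N - {w}. (hcol N z w - hcol N z x) / (w - x)\<^sup>2)
     = (\<Sum>k<N. hdual N z k * hdual N w k / (real k + 1) / ?s + hdual N z k / (real k + 1) / ?s * (real k * hdual N w k))"
    unfolding sum.distrib by (simp add: hcol_def sum_divide_distrib)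
  also have "\<dots> = (\<Sum>k<N. hdual N z k * hdual N w k / ?s)"
  proof (intro sum.cong refl)
    fix k
    have "a / (real k + 1) / s + b / (real k + 1) / s * (real k * d) = (a + b * d * real k) / (real k + 1) / s" for a b d s :: real
      by (simp add: add_divide_distrib)
    from this[of "hdual N z k * hdual N w k" ?s "hdual N z k" "hdual N w k"]
    have "hdual N z k * hdual N w k / (real k + 1) / ?s + hdual N z k / (real k + 1) / ?s * (real k * hdual N w k)
       = (hdual N z k * hdual N w k * (1 + real k)) / (real k + 1) / ?s" by (simp add: distrib_left)
    also have "\<dots> = hdual N z k * hdual N w k / ?s" by (simp add: add.commute)
    finally show "hdual N z k * hdual N w k / (real k + 1) / ?s + hdual N z k / (real k + 1) / ?s * (real k * hdual N w k) = hdual N z k * hdual N w k / ?s" .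
  qed
  also have "\<dots> = (if z = w then real N else 0) / ?s"
    unfolding sum_divide_distrib[symmetric] hdual_orthogonal[OF z w] ..
  also have "\<dots> = (if w = z then 1 / hvar N z else 0)" using N by auto
  finally show ?thesis .
qed

section \<open>The limit of large multiplicity\<close>

text \<open>Passes from the pairs \<open>i < j\<close>, as in the density, to all ordered pairs, as
  in the equilibrium condition and in the matrix equation.\<close>

lemma pair_sum:
  fixes a :: "nat \<Rightarrow> nat \<Rightarrow> real"
  shows "(\<Sum>j\<in>{1..N}. \<Sum>i\<in>{1..<j}. a j i + a i j) = (\<Sum>i\<in>{1..N}. \<Sum>j\<in>{1..N} - {i}. a i j)"
proof -
  have "(\<Sum>j\<in>{1..N}. \<Sum>i\<in>{1..<j}. a i j) = (\<Sum>j\<in>{1..N}. \<Sum>i\<in>{1..N}. if i < j then a i j else 0)"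
  proof (rule sum.cong[OF refl])
    fix j assume "j \<in> {1..N}"
    then have "{1..N} \<inter> {i. i < j} = {1..<j}" by auto
    then show "(\<Sum>i\<in>{1..<j}. a i j) = (\<Sum>i\<in>{1..N}. if i < j then a i j else 0)"
      by (simp add: sum.If_cases)
  qed
  also have "\<dots> = (\<Sum>i\<in>{1..N}. \<Sum>j\<in>{1..N}. if i < j then a i j else 0)" by (rule sum.swap)
  also have "\<dots> = (\<Sum>i\<in>{1..N}. \<Sum>j\<in>{i<..N}. a i j)"
  proof (rule sum.cong[OF refl])
    fix i assume "i \<in> {1..N}"
    then have "{1..N} \<inter> {j. i < j} = {i<..N}" by auto
    then show "(\<Sum>j\<in>{1..N}. if i < j then a i j else 0) = (\<Sum>j\<in>{i<..N}. a i j)"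
      by (simp add: sum.If_cases)
  qed
  finally have "(\<Sum>j\<in>{1..N}. \<Sum>i\<in>{1..<j}. a j i + a i j) = (\<Sum>i\<in>{1..N}. (\<Sum>j\<in>{1..<i}. a i j) + (\<Sum>j\<in>{i<..N}. a i j))"
    by (simp add: sum.distrib)
  also have "\<dots> = (\<Sum>i\<in>{1..N}. \<Sum>j\<in>{1..N} - {i}. a i j)"
  proof (intro sum.cong refl)
    fix i assume i: "i \<in> {1..N}"
    have "{1..N} - {i} = {1..<i} \<union> {i<..N}" using i by auto
    moreover have "{1..<i} \<inter> {i<..N} = {}" by auto
    ultimately show "(\<Sum>j\<in>{1..<i}. a i j) + (\<Sum>j\<in>{i<..N}. a i j) = (\<Sum>j\<in>{1..N} - {i}. a i j)"
      using sum.union_disjoint[of "{1..<i}" "{i<..N}" "a i"] by simp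
  qed
  finally show ?thesis .
qed

interpretation lb: product_sigma_finite "\<lambda>_ :: nat. lborel :: real measure" ..

text \<open>One coordinate at a time. It serves twice: for the zoom around the minimal
  configuration, and with \<open>c = 1\<close> for the shear that decouples one coordinate of the
  Gaussian.\<close>

lemma nn_integral_PiM_affine:
  fixes I :: "nat set"
  assumes "finite I" "0 < c" "F \<in> borel_measurable (Pi\<^sub>M I (\<lambda>_. lborel))"
  shows "(\<integral>\<^sup>+x. F x \<partial>Pi\<^sub>M I (\<lambda>_. lborel)) =
    ennreal (c ^ card I) * (\<integral>\<^sup>+x. F (\<lambda>i\<in>I. m i + c * x i) \<partial>Pi\<^sub>M I (\<lambda>_. lborel))"
  using assms(1,3)
proof (induction I arbitrary: F rule: finite_induct)
  case empty
  show ?case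
    by (simp add: lb.nn_integral_empty restrict_def PiM_empty nn_integral_count_space_finite)
next
  case (insert i I)
  let ?P = "Pi\<^sub>M I (\<lambda>_. lborel :: real measure)"
  have [measurable]: "F \<in> borel_measurable (Pi\<^sub>M (insert i I) (\<lambda>_. lborel))" by (rule insert)
  have [simp]: "finite I" "i \<notin> I" by (use insert in auto)
  interpret sigma_finite_measure ?P by (rule lb.sigma_finite) simp
  have upd: "(\<lambda>(x, y). F (x(i := y))) \<in> borel_measurable (?P \<Otimes>\<^sub>M lborel)"
    by measurable
  have m1: "(\<lambda>(x, y). F (x(i := m i + c * y))) \<in> borel_measurable (?P \<Otimes>\<^sub>M lborel)"
    by measurable
  have mG: "(\<lambda>x. \<integral>\<^sup>+y. F (x(i := m i + c * y)) \<partial>lborel) \<in> borel_measurable ?P"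
    using lborel.borel_measurable_nn_integral[OF m1] by simp
  have mx: "(\<lambda>y. F (x(i := y))) \<in> borel_measurable lborel" if "x \<in> space ?P" for x
    using measurable_Pair2[OF upd that] by simp
  have "(\<integral>\<^sup>+x. F x \<partial>Pi\<^sub>M (insert i I) (\<lambda>_. lborel)) = (\<integral>\<^sup>+x. (\<integral>\<^sup>+y. F (x(i := y)) \<partial>lborel) \<partial>?P)"
    by (rule lb.product_nn_integral_insert) auto
  also have "\<dots> = (\<integral>\<^sup>+x. ennreal c * (\<integral>\<^sup>+y. F (x(i := m i + c * y)) \<partial>lborel) \<partial>?P)"
    using mx assms(2) by (intro nn_integral_cong, subst nn_integral_real_affine[where c=c and t="m i"]) auto
  also have "\<dots> = ennreal c * (\<integral>\<^sup>+x. (\<integral>\<^sup>+y. F (x(i := m i + c * y)) \<partial>lborel) \<partial>?P)"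
    by (rule nn_integral_cmult[OF mG])
  also have "\<dots> = ennreal c * (ennreal (c ^ card I) * (\<integral>\<^sup>+x. (\<integral>\<^sup>+y. F ((\<lambda>j\<in>I. m j + c * x j)(i := m i + c * y)) \<partial>lborel) \<partial>?P))"
    unfolding insert.IH[OF mG] ..
  also have "\<dots> = ennreal (c ^ card (insert i I)) * (\<integral>\<^sup>+x. (\<integral>\<^sup>+y. F ((\<lambda>j\<in>I. m j + c * x j)(i := m i + c * y)) \<partial>lborel) \<partial>?P)"
    using assms(2) by (simp add: ennreal_mult mult.assoc)
  also have "(\<integral>\<^sup>+x. (\<integral>\<^sup>+y. F ((\<lambda>j\<in>I. m j + c * x j)(i := m i + c * y)) \<partial>lborel) \<partial>?P)
     = (\<integral>\<^sup>+x. (\<integral>\<^sup>+y. F (\<lambda>j\<in>insert i I. m j + c * (x(i := y)) j) \<partial>lborel) \<partial>?P)"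
  proof -
    have "(\<lambda>j\<in>I. m j + c * x j)(i := m i + c * y) = (\<lambda>j\<in>insert i I. m j + c * (x(i := y)) j)" for x y
      by (auto simp: fun_eq_iff restrict_def)
    then show ?thesis by simp
  qed
  also have "\<dots> = (\<integral>\<^sup>+x. F (\<lambda>j\<in>insert i I. m j + c * x j) \<partial>Pi\<^sub>M (insert i I) (\<lambda>_. lborel))"
  proof (rule lb.product_nn_integral_insert[symmetric])
    show "(\<lambda>x. F (\<lambda>j\<in>insert i I. m j + c * x j)) \<in> borel_measurable (Pi\<^sub>M (insert i I) (\<lambda>_. lborel))"
      by measurable
  qed auto
  finally show ?case .
qed

text \<open>\<open>(1 + v/c)\<^bsup>c\<^sup>2\<^esup> e\<^bsup>-cv\<^esup>\<close>, cut off where the base is negative.\<close>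

definition lap :: "real \<Rightarrow> real \<Rightarrow> real" where
  "lap c v = (if 1 + v / c \<le> 0 then 0 else exp (c\<^sup>2 * ln (1 + v / c) - c * v))"

lemma lap_bounds:
  assumes "c > 0" shows "0 \<le> lap c v" "lap c v \<le> 1"
proof -
  show "0 \<le> lap c v" by (simp add: lap_def)
  have "c\<^sup>2 * ln (1 + v / c) - c * v \<le> 0" if "1 + v / c > 0"
  proof -
    have "ln (1 + v / c) \<le> v / c" using ln_add_one_self_le_self2[of "v/c"] that by simp
    then have "c\<^sup>2 * ln (1 + v / c) \<le> c\<^sup>2 * (v / c)" by (intro mult_left_mono) auto
    then show ?thesis using assms by (simp add: power2_eq_square)
  qed
  then show "lap c v \<le> 1" by (simp add: lap_def)
qed

text \<open>The left side without absolute value has derivative \<open>t\<^sup>2 / (1 + t)\<close>,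
  where \<open>1 + t \<ge> 1/2\<close>, so the mean value theorem gives a cubic bound.\<close>

lemma ln_one_plus_quadratic:
  fixes x :: real
  assumes "\<bar>x\<bar> \<le> 1/2"
  shows "\<bar>ln (1 + x) - x + x\<^sup>2/2\<bar> \<le> 2 * \<bar>x\<bar>^3"
proof -
  let ?f = "\<lambda>x::real. ln (1 + x) - x + x\<^sup>2/2"
  have d: "(?f has_real_derivative t\<^sup>2 / (1 + t)) (at t)" if "\<bar>t\<bar> \<le> 1/2" for t
    using that by (auto intro!: derivative_eq_intros simp: field_simps power2_eq_square)
  have b: "\<bar>t\<^sup>2 / (1 + t)\<bar> \<le> 2 * x\<^sup>2" if "\<bar>t\<bar> \<le> \<bar>x\<bar>" for t
  proof -
    have "1/2 \<le> 1 + t" using that assms by linarith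
    then have "t\<^sup>2 / (1 + t) \<le> t\<^sup>2 / (1/2)" by (intro divide_left_mono) auto
    also have "\<dots> \<le> 2 * x\<^sup>2" using that by (simp add: abs_le_square_iff)
    finally show ?thesis using \<open>1/2 \<le> 1 + t\<close> by simp
  qed
  consider "x = 0" | "x > 0" | "x < 0" by linarith
  then have "\<exists>t. \<bar>t\<bar> \<le> \<bar>x\<bar> \<and> ?f x = x * (t\<^sup>2 / (1 + t))"
  proof cases
    case 2
    have "\<exists>z>0. z < x \<and> ?f x - ?f 0 = (x - 0) * (z\<^sup>2 / (1 + z))"
      by (rule MVT2[OF 2]) (use d assms in auto)
    then obtain z where "0 < z" "z < x" "?f x = x * (z\<^sup>2 / (1 + z))" by auto
    then show ?thesis by (intro exI[of _ z]) auto
  next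
    case 3
    have "\<exists>z>x. z < 0 \<and> ?f 0 - ?f x = (0 - x) * (z\<^sup>2 / (1 + z))"
      by (rule MVT2[OF 3]) (use d assms in auto)
    then obtain z where "x < z" "z < 0" "?f x = x * (z\<^sup>2 / (1 + z))" by auto
    then show ?thesis by (intro exI[of _ z]) auto
  qed auto
  then obtain t where t: "\<bar>t\<bar> \<le> \<bar>x\<bar>" "?f x = x * (t\<^sup>2 / (1 + t))" by blast
  have "\<bar>?f x\<bar> \<le> \<bar>x\<bar> * (2 * x\<^sup>2)" unfolding t(2) abs_mult by (intro mult_left_mono b t(1)) auto
  also have "\<dots> = 2 * \<bar>x\<bar>^3" by (simp add: power2_eq_square power3_eq_cube)
  finally show ?thesis .
qed

text \<open>The exponent plus \<open>v\<^sup>2 / 2\<close> is \<open>c\<^sup>2\<close> times the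
  remainder of the logarithm at \<open>v / c\<close>; its cubic bound leaves
  \<open>2 * \<bar>v\<bar>^3 / c\<close>.\<close>

lemma lap_tendsto: "((\<lambda>c. lap c v) \<longlongrightarrow> exp (- (v\<^sup>2 / 2))) at_top"
proof -
  have l: "((\<lambda>c. 2 * \<bar>v\<bar>^3 / c) \<longlongrightarrow> 0) at_top"
    by (intro tendsto_divide_0[OF tendsto_const] filterlim_at_top_imp_at_infinity filterlim_ident)
  have "((\<lambda>c. (c\<^sup>2 * ln (1 + v / c) - c * v) + v\<^sup>2/2) \<longlongrightarrow> 0) at_top"
  proof (rule Lim_null_comparison[OF _ l])
    show "\<forall>\<^sub>F c in at_top. norm ((c\<^sup>2 * ln (1 + v / c) - c * v) + v\<^sup>2/2) \<le> 2 * \<bar>v\<bar>^3 / c"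
      using eventually_ge_at_top[of "max 1 (2 * \<bar>v\<bar>)"]
    proof eventually_elim
      case (elim c)
      then have c: "c > 0" "\<bar>v / c\<bar> \<le> 1/2" by (auto simp: field_simps)
      have "(c\<^sup>2 * ln (1 + v / c) - c * v) + v\<^sup>2/2 = c\<^sup>2 * (ln (1 + v/c) - v / c + (v/c)\<^sup>2/2)"
        using c by (simp add: field_simps power2_eq_square)
      then have "norm ((c\<^sup>2 * ln (1 + v / c) - c * v) + v\<^sup>2/2) = c\<^sup>2 * \<bar>ln (1 + v/c) - v / c + (v/c)\<^sup>2/2\<bar>"
        by (simp add: abs_mult)
      also have "\<dots> \<le> c\<^sup>2 * (2 * \<bar>v/c\<bar>^3)" using ln_one_plus_quadratic[OF c(2)] by (intro mult_left_mono) auto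
      also have "\<dots> = 2 * \<bar>v\<bar>^3 / c" using c by (simp add: power_divide power2_eq_square power3_eq_cube)
      finally show ?case .
    qed
  qed
  from tendsto_diff[OF this tendsto_const[of "v\<^sup>2/2"]]
  have "((\<lambda>c. c\<^sup>2 * ln (1 + v / c) - c * v) \<longlongrightarrow> - (v\<^sup>2/2)) at_top" by simp
  from tendsto_exp[OF this] show ?thesis
  proof (rule Lim_transform_eventually)
    show "\<forall>\<^sub>F c in at_top. exp (c\<^sup>2 * ln (1 + v / c) - c * v) = lap c v"
      using eventually_gt_at_top[of "max 1 \<bar>v\<bar>"]
    proof eventually_elim
      case (elim c)
      then have "1 + v / c > 0" by (auto simp: field_simps)
      then show ?case by (simp add: lap_def)
    qed
  qed
qed

lemma lap_measurable [measurable]: "lap c \<in> borel_measurable borel"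
  unfolding lap_def[abs_def] by measurable

text \<open>The freezing limit around the configuration \<open>z\<close> of minimal energy. The marginal law of the
  Gaussian limit at the index \<open>m\<close> is obtained by a shear along \<open>w\<close>, the \<open>m\<close>-th column of
  the covariance matrix, scaled to \<open>w m = 1\<close>.\<close>

locale freezing =
  fixes N :: nat and z w :: "nat \<Rightarrow> real" and m :: nat and s :: real
  assumes mono: "\<And>i j. i \<in> {1..N} \<Longrightarrow> j \<in> {1..N} \<Longrightarrow> i < j \<Longrightarrow> z i < z j"
    and equilibrium: "\<And>i. i \<in> {1..N} \<Longrightarrow> (\<Sum>j\<in>{1..N} - {i}. 1 / (z i - z j)) = z i"
    and m: "m \<in> {1..N}" and s: "0 < s" and wm: "w m = 1"
    and w: "\<And>i. i \<in> {1..N} \<Longrightarrow>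
        w i + (\<Sum>j\<in>{1..N} - {i}. (w i - w j) / (z i - z j)\<^sup>2) = (if i = m then 1 / s else 0)"
begin

abbreviation "I \<equiv> {1..N}"
abbreviation "P \<equiv> Pi\<^sub>M I (\<lambda>_. lborel :: real measure)"

text \<open>Relative change of a gap: the gap of \<open>c * z + u\<close> is the gap of
  \<open>c * z\<close> times \<open>1 + slope u j i / c\<close>.\<close>

definition slope :: "(nat \<Rightarrow> real) \<Rightarrow> nat \<Rightarrow> nat \<Rightarrow> real" where
  "slope u j i = (u j - u i) / (z j - z i)"

text \<open>The Hessian as a bilinear form, written through slopes because these are the arguments
  of the factors of the density.\<close>

definition qform :: "(nat \<Rightarrow> real) \<Rightarrow> (nat \<Rightarrow> real) \<Rightarrow> real" where
  "qform u v = (\<Sum>i\<in>I. u i * v i) + (\<Sum>j\<in>I. \<Sum>i\<in>{1..<j}. slope u j i * slope v j i)"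

definition gdens :: "real \<Rightarrow> (nat \<Rightarrow> real) \<Rightarrow> real" where
  "gdens c u = exp (- (\<Sum>i\<in>I. (u i)\<^sup>2) / 2) * (\<Prod>j\<in>I. \<Prod>i\<in>{1..<j}. lap c (slope u j i))"

definition gauss :: "(nat \<Rightarrow> real) \<Rightarrow> real" where
  "gauss u = exp (- qform u u / 2)"

lemma qform_cong: "(\<And>i. i \<in> I \<Longrightarrow> u i = u' i) \<Longrightarrow> (\<And>i. i \<in> I \<Longrightarrow> v i = v' i) \<Longrightarrow> qform u v = qform u' v'"
  unfolding qform_def slope_def by (intro arg_cong2[where f="(+)"] sum.cong refl) auto

text \<open>Regrouping the pairs by the index of \<open>v\<close> produces the matrix equation
  assumed for \<open>w\<close>, of which only the row \<open>m\<close> survives.\<close>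

lemma qform_column: "qform w v = v m / s"
proof -
  have "(\<Sum>j\<in>I. \<Sum>i\<in>{1..<j}. slope w j i * slope v j i) =
     (\<Sum>j\<in>I. \<Sum>i\<in>{1..<j}. v j * ((w j - w i) / (z j - z i)\<^sup>2) + v i * ((w i - w j) / (z i - z j)\<^sup>2))"
  proof (intro sum.cong refl)
    fix j i
    have a: "(z i - z j)\<^sup>2 = (z j - z i)\<^sup>2" by (rule power2_commute)
    show "slope w j i * slope v j i = v j * ((w j - w i) / (z j - z i)\<^sup>2) + v i * ((w i - w j) / (z i - z j)\<^sup>2)"
      unfolding a slope_def by (simp add: power2_eq_square add_divide_distrib[symmetric]) (simp add: algebra_simps)
  qed
  also have "\<dots> = (\<Sum>i\<in>I. \<Sum>j\<in>I - {i}. v i * ((w i - w j) / (z i - z j)\<^sup>2))"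
    by (rule pair_sum)
  finally have "qform w v = (\<Sum>i\<in>I. v i * (w i + (\<Sum>j\<in>I - {i}. (w i - w j) / (z i - z j)\<^sup>2)))"
    unfolding qform_def by (simp add: sum.distrib distrib_left sum_distrib_left mult.commute)
  also have "\<dots> = (\<Sum>i\<in>I. if i = m then v i / s else 0)"
    by (intro sum.cong refl) (use w in auto)
  also have "\<dots> = v m / s" using m by simp
  finally show ?thesis .
qed

text \<open>The mixed term is \<open>qform w v = v m / s\<close>, which vanishes. In the sheared
  coordinates the \<open>m\<close>-th component therefore separates from the others and has variance
  \<open>s\<close>.\<close>

lemma qform_shear:
  assumes "v m = 0"
  shows "qform (\<lambda>i. a * w i + v i) (\<lambda>i. a * w i + v i) = a\<^sup>2 / s + qform v v"
proof -
  have sl: "slope (\<lambda>i. a * w i + v i) j i = a * slope w j i + slope v j i" for j i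
    unfolding slope_def by (simp add: add_divide_distrib[symmetric] algebra_simps)
  have "qform (\<lambda>i. a * w i + v i) (\<lambda>i. a * w i + v i) = a\<^sup>2 * qform w w + 2 * a * qform w v + qform v v"
    unfolding qform_def sl
    by (simp add: sum.distrib sum_distrib_left algebra_simps power2_eq_square)
  then show ?thesis using assms by (simp add: qform_column wm)
qed

lemma slope_measurable [measurable]:
  assumes "j \<in> I" "i \<in> I" shows "(\<lambda>u. slope u j i) \<in> borel_measurable P"
  unfolding slope_def using assms by measurable

lemma gdens_measurable [measurable]: "gdens c \<in> borel_measurable P"
proof -
  have "(\<lambda>u. lap c (slope u j i)) \<in> borel_measurable P" if "j \<in> I" "i \<in> {1..<j}" for j i
    using that by (intro measurable_compose[OF slope_measurable lap_measurable]) auto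
  then have "(\<lambda>u. \<Prod>j\<in>I. \<Prod>i\<in>{1..<j}. lap c (slope u j i)) \<in> borel_measurable P"
    by (intro borel_measurable_prod) auto
  then show ?thesis unfolding gdens_def[abs_def] by (intro borel_measurable_times) measurable
qed

lemma gauss_measurable [measurable]: "gauss \<in> borel_measurable P"
proof -
  have "(\<lambda>u. slope u j i * slope u j i) \<in> borel_measurable P" if "j \<in> I" "i \<in> {1..<j}" for j i
    using that by (intro borel_measurable_times slope_measurable) auto
  then have "(\<lambda>u. \<Sum>j\<in>I. \<Sum>i\<in>{1..<j}. slope u j i * slope u j i) \<in> borel_measurable P"
    by (intro borel_measurable_sum) auto
  then have "(\<lambda>u. qform u u) \<in> borel_measurable P"
    unfolding qform_def[abs_def] by (intro borel_measurable_add) measurable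
  then show ?thesis unfolding gauss_def[abs_def] by measurable
qed

lemma gdens_nonneg: "0 < c \<Longrightarrow> 0 \<le> gdens c u"
  unfolding gdens_def by (intro mult_nonneg_nonneg prod_nonneg ballI lap_bounds) auto

lemma gdens_le: "0 < c \<Longrightarrow> gdens c u \<le> exp (- (\<Sum>i\<in>I. (u i)\<^sup>2) / 2)"
proof -
  assume c: "0 < c"
  have "(\<Prod>j\<in>I. \<Prod>i\<in>{1..<j}. lap c (slope u j i)) \<le> 1"
    by (intro prod_le_1 conjI prod_nonneg lap_bounds c)
  from mult_left_mono[OF this, of "exp (- (\<Sum>i\<in>I. (u i)\<^sup>2) / 2)"] show ?thesis by (simp add: gdens_def)
qed

lemma gdens_tendsto: "((\<lambda>c. gdens c u) \<longlongrightarrow> gauss u) at_top"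
proof -
  have "((\<lambda>c. gdens c u) \<longlongrightarrow> exp (- (\<Sum>i\<in>I. (u i)\<^sup>2) / 2) * (\<Prod>j\<in>I. \<Prod>i\<in>{1..<j}. exp (- ((slope u j i)\<^sup>2 / 2)))) at_top"
    unfolding gdens_def by (intro tendsto_intros tendsto_prod lap_tendsto)
  also have "exp (- (\<Sum>i\<in>I. (u i)\<^sup>2) / 2) * (\<Prod>j\<in>I. \<Prod>i\<in>{1..<j}. exp (- ((slope u j i)\<^sup>2 / 2))) = gauss u"
    unfolding gauss_def qform_def
    by (simp add: exp_sum[symmetric] exp_add[symmetric] sum_negf sum_divide_distrib[symmetric] power2_eq_square
        add_divide_distrib)
  finally show ?thesis .
qed

lemma gauss_dominator_integrable: "integrable P (\<lambda>u. exp (- (\<Sum>i\<in>I. (u i)\<^sup>2) / 2))"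
proof -
  have "integrable lborel (\<lambda>x::real. sqrt (2 * pi) * std_normal_density x)"
    by (intro integrable_mult_right) simp
  then have i: "integrable lborel (\<lambda>x::real. exp (- x\<^sup>2 / 2))"
    by (simp add: std_normal_density_def)
  have "integrable P (\<lambda>u. \<Prod>i\<in>I. exp (- (u i)\<^sup>2 / 2))"
    by (rule lb.product_integrable_prod) (use i in auto)
  then show ?thesis by (simp add: exp_sum[symmetric] sum_negf sum_divide_distrib)
qed

abbreviation cut :: "real \<Rightarrow> (nat \<Rightarrow> real) \<Rightarrow> real" where "cut b u \<equiv> indicator {..b} (u m)"

lemma cut_measurable [measurable]: "cut b \<in> borel_measurable P"
  using m by measurable

lemma cut_times_measurable:
  "(\<lambda>u. cut b u * gdens c u) \<in> borel_measurable P" "(\<lambda>u. cut b u * gauss u) \<in> borel_measurable P"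
  by (intro borel_measurable_times cut_measurable gdens_measurable gauss_measurable)+

lemma cut_gdens_integrable: "0 < c \<Longrightarrow> integrable P (\<lambda>u. cut b u * gdens c u)" "0 < c \<Longrightarrow> integrable P (gdens c)"
proof -
  assume c: "0 < c"
  show "integrable P (\<lambda>u. cut b u * gdens c u)"
    by (rule Bochner_Integration.integrable_bound[OF gauss_dominator_integrable cut_times_measurable(1)])
       (use gdens_le[OF c] gdens_nonneg[OF c] in \<open>auto split: split_indicator\<close>)
  show "integrable P (gdens c)"
    by (rule Bochner_Integration.integrable_bound[OF gauss_dominator_integrable gdens_measurable])
       (use gdens_le[OF c] gdens_nonneg[OF c] in \<open>auto split: split_indicator\<close>)
qed

lemma cut_gdens_limit:
  "integrable P (\<lambda>u. cut b u * gauss u)"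
  "((\<lambda>c. \<integral>u. cut b u * gdens c u \<partial>P) \<longlongrightarrow> (\<integral>u. cut b u * gauss u \<partial>P)) at_top"
  "integrable P gauss"
  "((\<lambda>c. \<integral>u. gdens c u \<partial>P) \<longlongrightarrow> (\<integral>u. gauss u \<partial>P)) at_top"
proof -
  have b: "\<forall>\<^sub>F c in at_top. AE u in P. norm (cut b u * gdens c u) \<le> exp (- (\<Sum>i\<in>I. (u i)\<^sup>2) / 2)"
    using eventually_gt_at_top[of 0]
    by eventually_elim (use gdens_le gdens_nonneg in \<open>auto split: split_indicator\<close>)
  have b': "\<forall>\<^sub>F c in at_top. AE u in P. norm (gdens c u) \<le> exp (- (\<Sum>i\<in>I. (u i)\<^sup>2) / 2)"
    using eventually_gt_at_top[of 0]
    by eventually_elim (use gdens_le gdens_nonneg in \<open>auto split: split_indicator\<close>)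
  have l: "AE u in P. ((\<lambda>c. cut b u * gdens c u) \<longlongrightarrow> cut b u * gauss u) at_top"
    by (intro AE_I2 tendsto_intros gdens_tendsto)
  have l': "AE u in P. ((\<lambda>c. gdens c u) \<longlongrightarrow> gauss u) at_top"
    by (intro AE_I2 gdens_tendsto)
  show "integrable P (\<lambda>u. cut b u * gauss u)"
    by (rule integrable_dominated_convergence_at_top[OF cut_times_measurable(2,1) gauss_dominator_integrable l b])
  show "((\<lambda>c. \<integral>u. cut b u * gdens c u \<partial>P) \<longlongrightarrow> (\<integral>u. cut b u * gauss u \<partial>P)) at_top"
    by (rule integral_dominated_convergence_at_top[OF cut_times_measurable(2,1) gauss_dominator_integrable l b])
  show "integrable P gauss"
    by (rule integrable_dominated_convergence_at_top[OF gauss_measurable gdens_measurable gauss_dominator_integrable l' b'])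
  show "((\<lambda>c. \<integral>u. gdens c u \<partial>P) \<longlongrightarrow> (\<integral>u. gauss u \<partial>P)) at_top"
    by (rule integral_dominated_convergence_at_top[OF gauss_measurable gdens_measurable gauss_dominator_integrable l' b'])
qed

text \<open>The contribution of the other coordinates. It is kept as an extended real; that it is
  finite and positive follows afterwards from the total mass.\<close>

definition gconst :: ennreal where
  "gconst = (\<integral>\<^sup>+v. ennreal (gauss (v(m := 0))) \<partial>Pi\<^sub>M (I - {m}) (\<lambda>_. lborel))"

text \<open>With the \<open>m\<close>-th coordinate fixed at \<open>y\<close>, translating the
  others by \<open>y * w\<close> decouples them, and the translation preserves Lebesgue
  measure.\<close>

lemma gauss_factor:
  assumes [measurable]: "h \<in> borel_measurable borel"
  shows "(\<integral>\<^sup>+u. h (u m) * ennreal (gauss u) \<partial>P) = (\<integral>\<^sup>+x. h x * ennreal (exp (- x\<^sup>2 / (2 * s))) \<partial>lborel) * gconst"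
proof -
  let ?J = "I - {m}"
  let ?Q = "Pi\<^sub>M ?J (\<lambda>_. lborel :: real measure)"
  have I: "insert m ?J = I" using m by auto
  have mg: "gauss \<in> borel_measurable (Pi\<^sub>M (insert m ?J) (\<lambda>_. lborel))" unfolding I by (rule gauss_measurable)
  have mm: "(\<lambda>u. h (u m) * ennreal (gauss u)) \<in> borel_measurable (Pi\<^sub>M (insert m ?J) (\<lambda>_. lborel))"
    using mg by measurable
  have m1: "(\<lambda>x. ennreal (gauss (x(m := y)))) \<in> borel_measurable ?Q" for y
  proof -
    have "(\<lambda>x. x(m := y)) \<in> measurable ?Q (Pi\<^sub>M (insert m ?J) (\<lambda>_. lborel))"
      by (rule measurable_fun_upd[where J="?J"]) auto
    from measurable_compose[OF this mg] show ?thesis by measurable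
  qed
  have "(\<integral>\<^sup>+u. h (u m) * ennreal (gauss u) \<partial>P) = (\<integral>\<^sup>+y. \<integral>\<^sup>+x. h y * ennreal (gauss (x(m := y))) \<partial>?Q \<partial>lborel)"
    using lb.product_nn_integral_insert_rev[OF _ _ mm] unfolding I by simp
  also have "\<dots> = (\<integral>\<^sup>+y. h y * (\<integral>\<^sup>+x. ennreal (gauss (x(m := y))) \<partial>?Q) \<partial>lborel)"
    by (intro nn_integral_cong nn_integral_cmult m1)
  also have "\<dots> = (\<integral>\<^sup>+y. h y * (ennreal (exp (- y\<^sup>2 / (2 * s))) * gconst) \<partial>lborel)"
  proof (intro nn_integral_cong arg_cong2[where f="(*)"] refl)
    fix y :: real
    have "(\<integral>\<^sup>+x. ennreal (gauss (x(m := y))) \<partial>?Q) = (\<integral>\<^sup>+x. ennreal (gauss ((\<lambda>j\<in>?J. y * w j + 1 * x j)(m := y))) \<partial>?Q)"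
      by (subst nn_integral_PiM_affine[OF _ _ m1, of 1 y "\<lambda>j. y * w j"]) auto
    also have "\<dots> = (\<integral>\<^sup>+x. ennreal (exp (- y\<^sup>2 / (2 * s))) * ennreal (gauss (x(m := 0))) \<partial>?Q)"
    proof (intro nn_integral_cong)
      fix x :: "nat \<Rightarrow> real"
      let ?v = "x(m := 0)"
      have "gauss ((\<lambda>j\<in>?J. y * w j + 1 * x j)(m := y)) = exp (- qform (\<lambda>i. y * w i + ?v i) (\<lambda>i. y * w i + ?v i) / 2)"
        unfolding gauss_def by (subst qform_cong[of _ "\<lambda>i. y * w i + ?v i" _ "\<lambda>i. y * w i + ?v i"]) (auto simp: wm)
      also have "\<dots> = exp (- y\<^sup>2 / (2 * s)) * gauss ?v"
        by (subst qform_shear) (auto simp: gauss_def exp_add[symmetric] add_divide_distrib)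
      finally show "ennreal (gauss ((\<lambda>j\<in>?J. y * w j + 1 * x j)(m := y))) = ennreal (exp (- y\<^sup>2 / (2 * s))) * ennreal (gauss ?v)"
        by (simp add: ennreal_mult gauss_def)
    qed
    also have "\<dots> = ennreal (exp (- y\<^sup>2 / (2 * s))) * gconst"
      unfolding gconst_def by (intro nn_integral_cmult m1)
    finally show "(\<integral>\<^sup>+x. ennreal (gauss (x(m := y))) \<partial>?Q) = ennreal (exp (- y\<^sup>2 / (2 * s))) * gconst" .
  qed
  also have "\<dots> = (\<integral>\<^sup>+x. h x * ennreal (exp (- x\<^sup>2 / (2 * s))) \<partial>lborel) * gconst"
    by (subst nn_integral_multc[symmetric]) (auto simp: mult.assoc)
  finally show ?thesis .
qed

lemma normal_dist0_eq:
  "(\<integral>\<^sup>+x. ennreal (indicator {..b} x) * ennreal (exp (- x\<^sup>2 / (2 * s))) \<partial>lborel)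
     = ennreal (sqrt (2 * pi * s) * cdf (normal_dist0 s) b)"
  "(\<integral>\<^sup>+x. 1 * ennreal (exp (- x\<^sup>2 / (2 * s))) \<partial>lborel) = ennreal (sqrt (2 * pi * s))"
proof -
  interpret prob_space "normal_dist0 s"
    unfolding normal_dist0_def using s by (intro prob_space_normal_density) auto
  have e: "ennreal (exp (- x\<^sup>2 / (2 * s))) = ennreal (sqrt (2 * pi * s)) * ennreal (normal_density 0 (sqrt s) x)" for x
    using s by (simp add: normal_density_def ennreal_mult[symmetric] del: real_sqrt_mult)
  note e' = e[unfolded minus_divide_left[symmetric]]
  have A: "(\<integral>\<^sup>+x. ennreal (normal_density 0 (sqrt s) x) * indicator B x \<partial>lborel) = emeasure (normal_dist0 s) B" if "B \<in> sets borel" for B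
    using that unfolding normal_dist0_def by (subst emeasure_density) auto
  have "(\<integral>\<^sup>+x. ennreal (indicator {..b} x) * ennreal (exp (- x\<^sup>2 / (2 * s))) \<partial>lborel)
     = ennreal (sqrt (2 * pi * s)) * (\<integral>\<^sup>+x. ennreal (normal_density 0 (sqrt s) x) * indicator {..b} x \<partial>lborel)"
    by (subst nn_integral_cmult[symmetric]) (auto intro!: nn_integral_cong simp: e e' split: split_indicator)
  also have "\<dots> = ennreal (sqrt (2 * pi * s) * cdf (normal_dist0 s) b)"
    using s by (subst A) (auto simp: emeasure_eq_measure cdf_def ennreal_mult)
  finally show "(\<integral>\<^sup>+x. ennreal (indicator {..b} x) * ennreal (exp (- x\<^sup>2 / (2 * s))) \<partial>lborel)
     = ennreal (sqrt (2 * pi * s) * cdf (normal_dist0 s) b)" .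
  have "(\<integral>\<^sup>+x. 1 * ennreal (exp (- x\<^sup>2 / (2 * s))) \<partial>lborel)
     = ennreal (sqrt (2 * pi * s)) * (\<integral>\<^sup>+x. ennreal (normal_density 0 (sqrt s) x) * indicator UNIV x \<partial>lborel)"
    by (subst nn_integral_cmult[symmetric]) (auto intro!: nn_integral_cong simp: e e' split: split_indicator)
  also have "\<dots> = ennreal (sqrt (2 * pi * s))"
    using emeasure_space_1 by (subst A) (auto simp: normal_dist0_def)
  finally show "(\<integral>\<^sup>+x. 1 * ennreal (exp (- x\<^sup>2 / (2 * s))) \<partial>lborel) = ennreal (sqrt (2 * pi * s))" .
qed

lemma gauss_marginal:
  "0 < (\<integral>u. gauss u \<partial>P)" "(\<integral>u. cut b u * gauss u \<partial>P) / (\<integral>u. gauss u \<partial>P) = cdf (normal_dist0 s) b"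
proof -
  have g0: "0 < gauss u" for u by (simp add: gauss_def)
  have sq: "sqrt (2 * pi * s) > 0" using s by simp
  have tot: "ennreal (\<integral>u. gauss u \<partial>P) = ennreal (sqrt (2 * pi * s)) * gconst"
    using gauss_factor[of "\<lambda>_. 1"] normal_dist0_eq(2) nn_integral_eq_integral[OF cut_gdens_limit(3)] g0
    by (simp add: less_imp_le)
  have part: "ennreal (\<integral>u. cut b u * gauss u \<partial>P) = ennreal (sqrt (2 * pi * s) * cdf (normal_dist0 s) b) * gconst"
    using gauss_factor[of "\<lambda>x. ennreal (indicator {..b} x)"] normal_dist0_eq(1)[of b] nn_integral_eq_integral[OF cut_gdens_limit(1)[of b]] g0
    by (simp add: less_imp_le ennreal_mult)
  \<comment> \<open>An infinite factor would make the total integral infinite, but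
    \<open>gauss\<close> is integrable.\<close>
  have fin: "gconst < \<infinity>"
  proof (rule ccontr)
    assume "\<not> gconst < \<infinity>"
    then have "gconst = \<top>" by (metis infinity_ennreal_def less_top)
    moreover have "ennreal (sqrt (2 * pi * s)) \<noteq> 0" using sq by (simp only: ennreal_eq_0_iff not_le)
    ultimately have "ennreal (\<integral>u. gauss u \<partial>P) = \<top>" unfolding tot by (simp only: ennreal_mult_top if_False)
    then show False by simp
  qed
  then obtain K where K: "gconst = ennreal K" "0 \<le> K" by (cases gconst) auto
  have T: "(\<integral>u. gauss u \<partial>P) = sqrt (2 * pi * s) * K"
  proof -
    have "ennreal (\<integral>u. gauss u \<partial>P) = ennreal (sqrt (2 * pi * s) * K)"
      unfolding tot K(1) using sq K(2) by (intro ennreal_mult[symmetric]) auto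
    moreover have "0 \<le> (\<integral>u. gauss u \<partial>P)" "0 \<le> sqrt (2 * pi * s) * K"
      using g0 sq K(2) by (auto intro!: integral_nonneg_AE mult_nonneg_nonneg simp: less_imp_le)
    ultimately show ?thesis by (simp only: ennreal_inj)
  qed
  have Pt: "(\<integral>u. cut b u * gauss u \<partial>P) = sqrt (2 * pi * s) * cdf (normal_dist0 s) b * K"
  proof -
    have c0: "0 \<le> cdf (normal_dist0 s) b" by (simp add: cdf_def)
    have "ennreal (\<integral>u. cut b u * gauss u \<partial>P) = ennreal (sqrt (2 * pi * s) * cdf (normal_dist0 s) b * K)"
      unfolding part K(1) using sq K(2) c0 by (intro ennreal_mult[symmetric] mult_nonneg_nonneg) auto
    moreover have "0 \<le> (\<integral>u. cut b u * gauss u \<partial>P)"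
      using g0 by (intro integral_nonneg_AE AE_I2 mult_nonneg_nonneg) (auto simp: less_imp_le)
    moreover have "0 \<le> sqrt (2 * pi * s) * cdf (normal_dist0 s) b * K"
      using sq K(2) c0 by (intro mult_nonneg_nonneg) auto
    ultimately show ?thesis by (simp only: ennreal_inj)
  qed
  \<comment> \<open>A positive function with integral 0 would force the product measure to be null,
    but the unit cube has measure 1.\<close>
  have "K \<noteq> 0"
  proof
    assume "K = 0"
    then have "gconst = 0" using K by simp
    then have "(\<integral>\<^sup>+u. ennreal (gauss u) \<partial>P) = 0" using gauss_factor[of "\<lambda>_. 1"] by simp
    then have "AE u in P. ennreal (gauss u) = 0"
      using nn_integral_0_iff_AE[OF measurable_compose[OF gauss_measurable measurable_ennreal]] by simp
    then have "AE u in P. False"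
    proof eventually_elim
      case (elim u)
      then show ?case using g0[of u] by (simp add: ennreal_eq_0_iff)
    qed
    then have "emeasure P (space P) = 0" by (simp add: AE_iff_measurable[of "space P"])
    moreover have "emeasure P (Pi\<^sub>E I (\<lambda>_. {0..1})) = 1" by (subst lb.emeasure_PiM) auto
    moreover have "emeasure P (Pi\<^sub>E I (\<lambda>_. {0..1})) \<le> emeasure P (space P)"
      by (intro emeasure_mono) (auto simp: space_PiM)
    ultimately show False by simp
  qed
  then show "0 < (\<integral>u. gauss u \<partial>P)" using T K sq by simp
  show "(\<integral>u. cut b u * gauss u \<partial>P) / (\<integral>u. gauss u \<partial>P) = cdf (normal_dist0 s) b"
  proof -
    have "q * d * K / (q * K) = d" if "0 < q" for q d :: real using that \<open>K \<noteq> 0\<close> by simp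
    from this[OF sq] show ?thesis unfolding T Pt .
  qed
qed

lemma freezing_ratio_tendsto:
  "((\<lambda>c. (\<integral>u. cut b u * gdens c u \<partial>P) / (\<integral>u. gdens c u \<partial>P)) \<longlongrightarrow> cdf (normal_dist0 s) b) at_top"
  unfolding gauss_marginal(2)[symmetric]
  by (intro tendsto_divide cut_gdens_limit) (use gauss_marginal(1) in auto)

text \<open>The density of the process at time \<open>t\<close> in the coordinates \<open>u\<close> with
  \<open>y = \<surd>t (c z + u)\<close>, \<open>c = \<surd>(2k)\<close>.\<close>

definition frz :: "real \<Rightarrow> real \<Rightarrow> (nat \<Rightarrow> real) \<Rightarrow> nat \<Rightarrow> real" where
  "frz c t u = (\<lambda>i\<in>I. sqrt t * c * z i + sqrt t * u i)"

text \<open>The weight at \<open>u = 0\<close>; it cancels between a probability and the normalising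
  integral.\<close>

definition frz_const :: "real \<Rightarrow> real \<Rightarrow> real" where
  "frz_const c t = exp (- (c\<^sup>2 * (\<Sum>i\<in>I. (z i)\<^sup>2)) / 2) *
     (\<Prod>j\<in>I. \<Prod>i\<in>{1..<j}. (sqrt t * c * (z j - z i)) powr c\<^sup>2)"

lemma frz_const_pos: "0 < c \<Longrightarrow> 0 < t \<Longrightarrow> 0 < frz_const c t"
  unfolding frz_const_def
proof (intro mult_pos_pos prod_pos ballI powr_gt_zero[THEN iffD2])
  fix j i assume "0 < c" "0 < t" "j \<in> I" "i \<in> {1..<j}"
  then have "0 < sqrt t * c" "0 < z j - z i" using mono[of i j] by auto
  then have "0 < sqrt t * c * (z j - z i)" by (rule mult_pos_pos)
  then show "sqrt t * c * (z j - z i) \<noteq> 0" by (metis less_irrefl)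
qed simp

text \<open>The first-order terms of the interaction and of the confining potential agree: this is
  the equilibrium condition, summed against \<open>u\<close>.\<close>

lemma slope_sum: "(\<Sum>j\<in>I. \<Sum>i\<in>{1..<j}. slope u j i) = (\<Sum>i\<in>I. z i * u i)"
proof -
  have "(\<Sum>j\<in>I. \<Sum>i\<in>{1..<j}. slope u j i) = (\<Sum>j\<in>I. \<Sum>i\<in>{1..<j}. u j * (1 / (z j - z i)) + u i * (1 / (z i - z j)))"
  proof (intro sum.cong refl)
    fix j i
    have "1 / (z i - z j) = - (1 / (z j - z i))" by (metis minus_diff_eq minus_divide_right)
    then show "slope u j i = u j * (1 / (z j - z i)) + u i * (1 / (z i - z j))"
      by (simp add: slope_def diff_divide_distrib)
  qed
  also have "\<dots> = (\<Sum>i\<in>I. \<Sum>j\<in>I - {i}. u i * (1 / (z i - z j)))" by (rule pair_sum)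
  also have "\<dots> = (\<Sum>i\<in>I. z i * u i)"
    unfolding sum_distrib_left[symmetric] by (intro sum.cong refl) (use equilibrium in auto)
  finally show ?thesis .
qed

text \<open>Each pair contributes \<open>(1 + slope u j i / c) powr c\<^sup>2\<close>, which is
  \<open>lap\<close> times \<open>exp (c * slope u j i)\<close>. By \<open>slope_sum\<close> these
  exponentials cancel the cross term of the Gaussian factor, so the identity is exact for every
  \<open>c\<close>, before any limit.\<close>

lemma bessel_weight_frz:
  assumes c: "0 < c" and t: "0 < t"
  shows "indicator (weyl_A N) (frz c t u) * bessel_weight N (c\<^sup>2 / 2) t (frz c t u) = frz_const c t * gdens c u"
proof -
  have st: "sqrt t > 0" using t by simp
  have zz: "z j - z i > 0" if "j \<in> I" "i \<in> {1..<j}" for j i using mono[of i j] that by auto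
  have df: "frz c t u j - frz c t u i = sqrt t * c * (z j - z i) * (1 + slope u j i / c)"
    if "j \<in> I" "i \<in> {1..<j}" for j i
    using zz[OF that] that c by (simp add: frz_def slope_def field_simps)
  have pre: "sqrt t * c * (z j - z i) > 0" if "j \<in> I" "i \<in> {1..<j}" for j i
    using zz[OF that] st c by simp
  show ?thesis
  proof (cases "\<exists>j\<in>I. \<exists>i\<in>{1..<j}. 1 + slope u j i / c \<le> 0")
    case True
    then obtain j i where ji: "j \<in> I" "i \<in> {1..<j}" "1 + slope u j i / c \<le> 0" by blast
    have "(\<Prod>i\<in>{1..<j}. lap c (slope u j i)) = 0"
      by (rule prod_zero) (use ji in \<open>auto simp: lap_def\<close>)
    then have "(\<Prod>j\<in>I. \<Prod>i\<in>{1..<j}. lap c (slope u j i)) = 0"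
      using ji by (intro prod_zero) auto
    then have g: "gdens c u = 0" by (simp add: gdens_def)
    have "indicator (weyl_A N) (frz c t u) * bessel_weight N (c\<^sup>2 / 2) t (frz c t u) = 0"
    proof (cases "frz c t u \<in> weyl_A N")
      case True
      \<comment> \<open>In the chamber a nonpositive factor means that two coordinates coincide, and
        there the weight is 0 since \<open>powr\<close> with base 0 is 0. The cut-off of
        \<open>lap\<close> matches this.\<close>
      then have "frz c t u i \<le> frz c t u j" using ji by (auto simp: weyl_A_def)
      moreover have "frz c t u j - frz c t u i \<le> 0"
        unfolding df[OF ji(1,2)] using pre[OF ji(1,2)] ji(3) by (intro mult_nonneg_nonpos) auto
      ultimately have "frz c t u j - frz c t u i = 0" by simp
      then have "(\<Prod>i\<in>{1..<j}. (frz c t u j - frz c t u i) powr (2 * (c\<^sup>2 / 2))) = 0"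
        using ji by (intro prod_zero) auto
      then have "(\<Prod>j\<in>I. \<Prod>i\<in>{1..<j}. (frz c t u j - frz c t u i) powr (2 * (c\<^sup>2 / 2))) = 0"
        using ji by (intro prod_zero) auto
      then show ?thesis by (simp add: bessel_weight_def)
    qed simp
    then show ?thesis using g by simp
  next
    case False
    then have base: "1 + slope u j i / c > 0" if "j \<in> I" "i \<in> {1..<j}" for j i using that by force
    have "frz c t u \<in> weyl_A N"
      unfolding weyl_A_def vecs_def
    proof (intro CollectI conjI ballI impI)
      show "frz c t u \<in> I \<rightarrow>\<^sub>E UNIV" by (auto simp: frz_def)
      fix i j assume ij: "i \<in> I" "j \<in> I" "i \<le> j"
      show "frz c t u i \<le> frz c t u j"
      proof (cases "i = j")
        case False
        then have "i \<in> {1..<j}" using ij by auto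
        then have "frz c t u j - frz c t u i > 0" unfolding df[OF ij(2) \<open>i \<in> {1..<j}\<close>]
          using pre base ij by simp
        then show ?thesis by simp
      qed simp
    qed
    moreover have "bessel_weight N (c\<^sup>2 / 2) t (frz c t u) = frz_const c t * gdens c u"
    proof -
      have pf: "(frz c t u j - frz c t u i) powr (2 * (c\<^sup>2 / 2)) =
          (sqrt t * c * (z j - z i)) powr c\<^sup>2 * (lap c (slope u j i) * exp (c * slope u j i))"
        if "j \<in> I" "i \<in> {1..<j}" for j i
      proof -
        have "(1 + slope u j i / c) powr c\<^sup>2 = lap c (slope u j i) * exp (c * slope u j i)"
          using base[OF that] by (simp add: powr_def lap_def exp_add[symmetric])
        then show ?thesis unfolding df[OF that] using pre[OF that] base[OF that]
          by (simp add: powr_mult)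
      qed
      have "(\<Prod>j\<in>I. \<Prod>i\<in>{1..<j}. (frz c t u j - frz c t u i) powr (2 * (c\<^sup>2 / 2))) =
         (\<Prod>j\<in>I. \<Prod>i\<in>{1..<j}. (sqrt t * c * (z j - z i)) powr c\<^sup>2 * (lap c (slope u j i) * exp (c * slope u j i)))"
        by (intro prod.cong refl pf)
      also have "\<dots> = (\<Prod>j\<in>I. \<Prod>i\<in>{1..<j}. (sqrt t * c * (z j - z i)) powr c\<^sup>2) *
          ((\<Prod>j\<in>I. \<Prod>i\<in>{1..<j}. lap c (slope u j i)) * exp (c * (\<Sum>i\<in>I. z i * u i)))"
      proof -
        have "(\<Prod>j\<in>I. \<Prod>i\<in>{1..<j}. exp (c * slope u j i)) = exp (c * (\<Sum>i\<in>I. z i * u i))"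
          unfolding slope_sum[symmetric] sum_distrib_left by (simp add: exp_sum)
        then show ?thesis unfolding prod.distrib by simp
      qed
      finally have pr: "(\<Prod>j\<in>I. \<Prod>i\<in>{1..<j}. (frz c t u j - frz c t u i) powr (2 * (c\<^sup>2 / 2))) = \<dots>" .
      have "(\<Sum>i\<in>I. (frz c t u i)\<^sup>2) = t * (c\<^sup>2 * (\<Sum>i\<in>I. (z i)\<^sup>2) + 2 * (c * (\<Sum>i\<in>I. z i * u i)) + (\<Sum>i\<in>I. (u i)\<^sup>2))"
      proof -
        have "(frz c t u i)\<^sup>2 = t * (c\<^sup>2 * (z i)\<^sup>2 + 2 * (c * (z i * u i)) + (u i)\<^sup>2)" if "i \<in> I" for i
        proof -
          have "frz c t u i = sqrt t * (c * z i + u i)" using that by (simp add: frz_def distrib_left mult.assoc)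
          then have "(frz c t u i)\<^sup>2 = t * (c * z i + u i)\<^sup>2" using t by (simp add: power_mult_distrib)
          then show ?thesis by (simp add: power2_sum power_mult_distrib mult_ac add_ac)
        qed
        then have "(\<Sum>i\<in>I. (frz c t u i)\<^sup>2) = (\<Sum>i\<in>I. t * (c\<^sup>2 * (z i)\<^sup>2 + 2 * (c * (z i * u i)) + (u i)\<^sup>2))"
          by (intro sum.cong) auto
        then show ?thesis by (simp add: sum.distrib sum_distrib_left distrib_left)
      qed
      then have "exp (- (\<Sum>i\<in>I. (frz c t u i)\<^sup>2) / (2 * t)) = exp (- (c\<^sup>2 * (\<Sum>i\<in>I. (z i)\<^sup>2)) / 2) * (exp (- (\<Sum>i\<in>I. (u i)\<^sup>2) / 2) * exp (- (c * (\<Sum>i\<in>I. z i * u i))))"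
        using t by (simp add: exp_add[symmetric] field_simps)
      then show ?thesis
        unfolding bessel_weight_def pr frz_const_def gdens_def
        by (simp add: exp_minus)
    qed
    ultimately show ?thesis by simp
  qed
qed

end

section \<open>Normal laws and the one-time law of the process\<close>

lemma normal_dist0_cdf_scale:
  assumes "0 < v"
  shows "cdf (normal_dist0 v) x = cdf (normal_dist0 1) (x / sqrt v)"
proof -
  have sv: "0 < sqrt v" using assms by simp
  have em: "emeasure (normal_dist0 v) {..x} = (\<integral>\<^sup>+y. ennreal (normal_density 0 (sqrt v) y) * indicator {..x} y \<partial>lborel)" for v x
    unfolding normal_dist0_def by (subst emeasure_density) auto
  have "emeasure (normal_dist0 v) {..x} = ennreal (sqrt v) * (\<integral>\<^sup>+y. ennreal (normal_density 0 (sqrt v) (0 + sqrt v * y)) * indicator {..x} (0 + sqrt v * y) \<partial>lborel)"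
    unfolding em using sv by (subst nn_integral_real_affine[where c="sqrt v" and t=0]) auto
  also have "\<dots> = (\<integral>\<^sup>+y. ennreal (sqrt v) * (ennreal (normal_density 0 (sqrt v) (0 + sqrt v * y)) * indicator {..x} (0 + sqrt v * y)) \<partial>lborel)"
    by (rule nn_integral_cmult[symmetric]) measurable
  also have "\<dots> = (\<integral>\<^sup>+y. ennreal (normal_density 0 (sqrt 1) y) * indicator {..x / sqrt v} y \<partial>lborel)"
  proof (rule nn_integral_cong)
    fix y
    have "sqrt v * normal_density 0 (sqrt v) (sqrt v * y) = normal_density 0 1 y"
      using assms by (simp add: normal_density_def power_mult_distrib real_sqrt_mult)
    moreover have "indicator {..x} (sqrt v * y) = (indicator {..x / sqrt v} y :: ennreal)"
      using sv by (auto simp: field_simps split: split_indicator)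
    ultimately show "ennreal (sqrt v) * (ennreal (normal_density 0 (sqrt v) (0 + sqrt v * y)) * indicator {..x} (0 + sqrt v * y)) = ennreal (normal_density 0 (sqrt 1) y) * indicator {..x / sqrt v} y"
      using sv by (simp add: mult.assoc[symmetric] ennreal_mult[symmetric])
  qed
  also have "\<dots> = emeasure (normal_dist0 1) {..x / sqrt v}" by (rule em[symmetric])
  finally show ?thesis by (simp add: cdf_def measure_def)
qed

lemma real_distribution_normal_dist0: "0 < v \<Longrightarrow> real_distribution (normal_dist0 v)"
  unfolding real_distribution_def real_distribution_axioms_def normal_dist0_def
  by (auto intro!: prob_space_normal_density)

lemma isCont_cdf_normal: "isCont (cdf (normal_dist0 1)) x"
proof -
  interpret real_distribution "normal_dist0 1" by (rule real_distribution_normal_dist0) simp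
  have "measure (normal_dist0 1) {x} = 0"
  proof -
    have "emeasure (normal_dist0 1) {x} = 0"
      unfolding normal_dist0_def
      by (subst emeasure_density) (auto intro!: nn_integral_0_iff_AE[THEN iffD2] AE_mp[OF AE_lborel_singleton[of x]] split: split_indicator)
    then show ?thesis by (simp add: measure_def)
  qed
  then show ?thesis by (simp add: isCont_cdf)
qed

text \<open>Centred normal laws are dilations of the standard one, so convergence of the variances
  reduces to continuity of a single distribution function.\<close>

lemma normal_dist0_weak_conv:
  assumes "v \<longlonglongrightarrow> V" "0 < V" "\<forall>\<^sub>F n in sequentially. 0 < v n"
  shows "weak_conv_m (\<lambda>n. normal_dist0 (v n)) (normal_dist0 V)"
  unfolding weak_conv_m_def weak_conv_def
proof (intro allI impI)
  fix x
  have "(\<lambda>n. cdf (normal_dist0 1) (x / sqrt (v n))) \<longlonglongrightarrow> cdf (normal_dist0 1) (x / sqrt V)"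
    using assms by (intro isCont_tendsto_compose[OF isCont_cdf_normal] tendsto_intros) auto
  then have "(\<lambda>n. cdf (normal_dist0 (v n)) x) \<longlonglongrightarrow> cdf (normal_dist0 1) (x / sqrt V)"
  proof (rule Lim_transform_eventually)
    show "\<forall>\<^sub>F n in sequentially. cdf (normal_dist0 1) (x / sqrt (v n)) = cdf (normal_dist0 (v n)) x"
      using assms(3) by eventually_elim (rule normal_dist0_cdf_scale[symmetric])
  qed
  then show "(\<lambda>n. cdf (normal_dist0 (v n)) x) \<longlonglongrightarrow> cdf (normal_dist0 V) x"
    unfolding normal_dist0_cdf_scale[OF assms(2), of x] .
qed

text \<open>By the Markov property at time 0 the conditional probability is almost surely the
  constant \<open>measure (bessel_law0 N k t) B\<close>, because the process starts at the origin;
  integrating removes the conditioning.\<close>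

lemma bessel_process0_law:
  assumes X: "bessel_process0 N k M X" and t: "0 < t" and B: "B \<in> sets (weyl_borel N)"
  shows "measure M (X t -` B \<inter> space M) = measure (bessel_law0 N k t) B"
    "X t \<in> measurable M (weyl_borel N)"
proof -
  obtain Q where Q: "bessel_semigroup N k Q" "markov_process M (weyl_borel N) Q X"
    and X0: "AE \<omega> in M. X 0 \<omega> = origin N"
    using X unfolding bessel_process0_def by auto
  have law: "Q t (origin N) = bessel_law0 N k t" using Q(1) t unfolding bessel_semigroup_def by auto
  have pr: "prob_space M" and meas: "\<And>t. t \<ge> 0 \<Longrightarrow> X t \<in> measurable M (weyl_borel N)"
    using Q(2) unfolding markov_process_def by auto
  show mt: "X t \<in> measurable M (weyl_borel N)" using meas t by simp
  interpret prob_space M by (rule pr)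
  let ?F = "natural_filtration M (weyl_borel N) X 0"
  let ?A = "X t -` B \<inter> space M"
  have sub: "subalgebra M ?F"
    unfolding subalgebra_def natural_filtration_def
  proof (intro conjI)
    show "space (sigma (space M) {X s -` B \<inter> space M |s B. 0 \<le> s \<and> s \<le> 0 \<and> B \<in> sets (weyl_borel N)}) = space M"
      by (rule space_measure_of) auto
    show "sets (sigma (space M) {X s -` B \<inter> space M |s B. 0 \<le> s \<and> s \<le> 0 \<and> B \<in> sets (weyl_borel N)}) \<subseteq> sets M"
      by (subst sets_measure_of) (auto intro!: sets.sigma_sets_subset measurable_sets[OF meas])
  qed
  interpret F: finite_measure_subalgebra M ?F by (unfold_locales, rule sub)
  have A: "?A \<in> sets M" using measurable_sets[OF mt B] .
  have i: "integrable M (indicat_real ?A)"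
    by (rule integrable_real_indicator[OF A]) (simp add: emeasure_eq_measure)
  have "AE \<omega> in M. real_cond_exp M ?F (indicat_real ?A) \<omega> = measure (Q (t - 0) (X 0 \<omega>)) B"
    using Q(2) t B unfolding markov_process_def by auto
  then have "AE \<omega> in M. real_cond_exp M ?F (indicat_real ?A) \<omega> = measure (bessel_law0 N k t) B"
    using X0 by eventually_elim (simp add: law)
  then have "(\<integral>\<omega>. real_cond_exp M ?F (indicat_real ?A) \<omega> \<partial>M) = (\<integral>\<omega>. measure (bessel_law0 N k t) B \<partial>M)"
    by (intro integral_cong_AE) auto
  also have "\<dots> = measure (bessel_law0 N k t) B" by (simp add: prob_space)
  finally show "measure M ?A = measure (bessel_law0 N k t) B"
    using F.real_cond_exp_int(2)[OF i] A by simp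
qed

lemma weyl_A_sets: "weyl_A N \<in> sets (Pi\<^sub>M {1..N} (\<lambda>_. borel))"
proof -
  have "weyl_A N = {x \<in> space (Pi\<^sub>M {1..N} (\<lambda>_. borel :: real measure)). \<forall>i\<in>{1..N}. \<forall>j\<in>{1..N}. i \<le> j \<longrightarrow> x i \<le> x j}"
    by (auto simp: weyl_A_def vecs_def space_PiM)
  also have "\<dots> \<in> sets (Pi\<^sub>M {1..N} (\<lambda>_. borel))"
  proof (intro sets.sets_Collect_finite_All)
    fix i j assume "i \<in> {1..N}" "j \<in> {1..N}"
    then have "(\<lambda>x. x i) \<in> borel_measurable (Pi\<^sub>M {1..N} (\<lambda>_. borel :: real measure))"
      "(\<lambda>x. x j) \<in> borel_measurable (Pi\<^sub>M {1..N} (\<lambda>_. borel :: real measure))"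
      by (auto intro: measurable_component_singleton)
    then have "{x \<in> space (Pi\<^sub>M {1..N} (\<lambda>_. borel :: real measure)). x i \<le> x j} \<in> sets (Pi\<^sub>M {1..N} (\<lambda>_. borel))"
      by (rule borel_measurable_le)
    then show "{x \<in> space (Pi\<^sub>M {1..N} (\<lambda>_. borel :: real measure)). i \<le> j \<longrightarrow> x i \<le> x j} \<in> sets (Pi\<^sub>M {1..N} (\<lambda>_. borel))"
      by (cases "i \<le> j") auto
  qed auto
  finally show ?thesis .
qed

lemma sets_PiM_lborel: "sets (Pi\<^sub>M I (\<lambda>_. lborel)) = sets (Pi\<^sub>M I (\<lambda>_. borel))"
  by (intro sets_PiM_cong) auto

lemma component_weyl_borel: "m \<in> {1..N} \<Longrightarrow> (\<lambda>y. y m) \<in> borel_measurable (weyl_borel N)"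
  unfolding weyl_borel_def by (intro measurable_restrict_space1 measurable_component_singleton)

lemma space_weyl_borel: "space (weyl_borel N) = weyl_A N"
  by (auto simp: weyl_borel_def space_restrict_space space_PiM weyl_A_def vecs_def)

context freezing
begin

lemma bessel_weight_measurable: "bessel_weight N k t \<in> borel_measurable P"
proof -
  have "(\<lambda>y. (y j - y i) powr (2 * k)) \<in> borel_measurable P" if "j \<in> I" "i \<in> {1..<j}" for j i
  proof -
    have "i \<in> I" using that by auto
    with that show ?thesis by measurable
  qed
  then have "(\<lambda>y. \<Prod>j\<in>I. \<Prod>i\<in>{1..<j}. (y j - y i) powr (2 * k)) \<in> borel_measurable P"
    by (intro borel_measurable_prod) auto
  then show ?thesis unfolding bessel_weight_def[abs_def] by (intro borel_measurable_times) measurable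
qed

lemma bessel_weight_nonneg: "0 \<le> bessel_weight N k t y"
  unfolding bessel_weight_def by (intro mult_nonneg_nonneg prod_nonneg ballI) auto

lemma weyl_A_sets_P: "weyl_A N \<in> sets P"
  unfolding sets_PiM_lborel by (rule weyl_A_sets)

text \<open>Restriction to the chamber becomes an indicator, which \<open>bessel_weight_frz\<close>
  absorbs into the cut-off of \<open>lap\<close>. The factor in front does not depend on
  \<open>h\<close>, so it will cancel in quotients.\<close>

lemma nn_integral_bessel_weight:
  assumes c: "0 < c" and t: "0 < t" and h: "h \<in> borel_measurable borel" "\<And>x. 0 \<le> h x"
  shows "(\<integral>\<^sup>+y. ennreal (h (y m) * bessel_weight N (c\<^sup>2/2) t y) \<partial>weyl_lborel N) =
    ennreal (sqrt t ^ N * frz_const c t) * (\<integral>\<^sup>+u. ennreal (h (sqrt t * c * z m + sqrt t * u m) * gdens c u) \<partial>P)"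
proof -
  note [measurable] = h(1) bessel_weight_measurable weyl_A_sets_P gdens_measurable
  let ?F = "\<lambda>y. ennreal (h (y m) * (indicator (weyl_A N) y * bessel_weight N (c\<^sup>2/2) t y))"
  have mP: "(\<lambda>y. y m) \<in> borel_measurable P" using m by measurable
  have hm: "(\<lambda>y. h (y m)) \<in> borel_measurable P" by (rule measurable_compose[OF mP h(1)])
  have mF: "?F \<in> borel_measurable P"
    by (intro measurable_compose[OF _ measurable_ennreal] borel_measurable_times hm borel_measurable_indicator weyl_A_sets_P bessel_weight_measurable)
  have "weyl_A N \<inter> space P \<in> sets P" by (rule sets.Int[OF weyl_A_sets_P sets.top])
  then have "(\<integral>\<^sup>+y. ennreal (h (y m) * bessel_weight N (c\<^sup>2/2) t y) \<partial>weyl_lborel N) = (\<integral>\<^sup>+y. ?F y \<partial>P)"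
    unfolding weyl_lborel_def
    by (subst nn_integral_restrict_space) (auto intro!: nn_integral_cong split: split_indicator)
  also have "\<dots> = ennreal (sqrt t ^ N) * (\<integral>\<^sup>+u. ?F (frz c t u) \<partial>P)"
    using nn_integral_PiM_affine[OF _ _ mF, of "sqrt t" "\<lambda>i. sqrt t * c * z i"] t by (simp add: frz_def)
  also have "(\<integral>\<^sup>+u. ?F (frz c t u) \<partial>P) = (\<integral>\<^sup>+u. ennreal (frz_const c t) * ennreal (h (sqrt t * c * z m + sqrt t * u m) * gdens c u) \<partial>P)"
  proof (rule nn_integral_cong)
    fix u
    have "frz c t u m = sqrt t * c * z m + sqrt t * u m" using m by (simp add: frz_def)
    then have "h (frz c t u m) * (indicator (weyl_A N) (frz c t u) * bessel_weight N (c\<^sup>2/2) t (frz c t u))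
       = frz_const c t * (h (sqrt t * c * z m + sqrt t * u m) * gdens c u)"
      unfolding bessel_weight_frz[OF c t] by simp
    then show "?F (frz c t u) = ennreal (frz_const c t) * ennreal (h (sqrt t * c * z m + sqrt t * u m) * gdens c u)"
      using frz_const_pos[OF c t] gdens_nonneg[OF c] h(2) by (simp add: ennreal_mult)
  qed
  also have "\<dots> = ennreal (frz_const c t) * (\<integral>\<^sup>+u. ennreal (h (sqrt t * c * z m + sqrt t * u m) * gdens c u) \<partial>P)"
  proof (rule nn_integral_cmult)
    have "(\<lambda>u. sqrt t * c * z m + sqrt t * u m) \<in> borel_measurable P" using mP by measurable
    from measurable_compose[OF this h(1)]
    show "(\<lambda>u. ennreal (h (sqrt t * c * z m + sqrt t * u m) * gdens c u)) \<in> borel_measurable P"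
      by (intro measurable_compose[OF _ measurable_ennreal] borel_measurable_times gdens_measurable)
  qed
  finally show ?thesis using frz_const_pos[OF c t] t by (simp add: ennreal_mult mult.assoc)
qed

text \<open>Numerator and normalising integral carry the same factor
  \<open>sqrt t ^ N * frz_const c t\<close>.\<close>

lemma bessel_law0_cut:
  assumes c: "0 < c" and t: "0 < t"
  shows "measure (bessel_law0 N (c\<^sup>2/2) t) {y \<in> weyl_A N. y m \<le> sqrt t * c * z m + sqrt t * b}
    = (\<integral>u. cut b u * gdens c u \<partial>P) / (\<integral>u. gdens c u \<partial>P)"
proof -
  let ?w = "bessel_weight N (c\<^sup>2/2) t" and ?L = "weyl_lborel N" and ?a = "sqrt t * c * z m + sqrt t * b"
  let ?K = "sqrt t ^ N * frz_const c t"
  have K: "0 < ?K" using frz_const_pos[OF c t] t by simp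
  have setsL: "sets ?L = sets (weyl_borel N)"
    unfolding weyl_lborel_def weyl_borel_def by (intro sets_restrict_space_cong sets_PiM_lborel)
  have wm: "?w \<in> borel_measurable ?L"
    unfolding weyl_lborel_def by (intro measurable_restrict_space1 bessel_weight_measurable)
  have g0: "0 \<le> gdens c u" for u by (rule gdens_nonneg[OF c])
  have D0: "0 \<le> (\<integral>u. gdens c u \<partial>P)" using g0 by (intro integral_nonneg_AE) auto
  have C0: "0 \<le> (\<integral>u. cut b u * gdens c u \<partial>P)" using g0 by (intro integral_nonneg_AE) auto
  have n1: "(\<integral>\<^sup>+y. ennreal (?w y) \<partial>?L) = ennreal (?K * (\<integral>u. gdens c u \<partial>P))"
  proof -
    have "(\<integral>\<^sup>+y. ennreal (?w y) \<partial>?L) = ennreal ?K * (\<integral>\<^sup>+u. ennreal (gdens c u) \<partial>P)"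
      using nn_integral_bessel_weight[OF c t, of "\<lambda>_. 1"] by simp
    also have "(\<integral>\<^sup>+u. ennreal (gdens c u) \<partial>P) = ennreal (\<integral>u. gdens c u \<partial>P)"
      by (rule nn_integral_eq_integral[OF cut_gdens_integrable(2)[OF c]]) (use g0 in auto)
    finally show ?thesis by (simp only: ennreal_mult[OF less_imp_le[OF K] D0])
  qed
  have n2: "(\<integral>\<^sup>+y. ennreal (indicator {..?a} (y m) * ?w y) \<partial>?L) = ennreal (?K * (\<integral>u. cut b u * gdens c u \<partial>P))"
  proof -
    have "(\<integral>\<^sup>+y. ennreal (indicator {..?a} (y m) * ?w y) \<partial>?L) = ennreal ?K * (\<integral>\<^sup>+u. ennreal (indicator {..?a} (sqrt t * c * z m + sqrt t * u m) * gdens c u) \<partial>P)"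
      by (rule nn_integral_bessel_weight[OF c t]) auto
    also have "(\<integral>\<^sup>+u. ennreal (indicator {..?a} (sqrt t * c * z m + sqrt t * u m) * gdens c u) \<partial>P) = (\<integral>\<^sup>+u. ennreal (cut b u * gdens c u) \<partial>P)"
      using t by (intro nn_integral_cong) (auto split: split_indicator)
    also have "\<dots> = ennreal (\<integral>u. cut b u * gdens c u \<partial>P)"
      by (rule nn_integral_eq_integral[OF cut_gdens_integrable(1)[OF c]]) (use g0 in auto)
    finally show ?thesis by (simp only: ennreal_mult[OF less_imp_le[OF K] C0])
  qed
  define Z where "Z = (LINT u|?L. ?w u)"
  have Z: "Z = ?K * (\<integral>u. gdens c u \<partial>P)"
    unfolding Z_def using integral_eq_nn_integral[OF wm] n1 bessel_weight_nonneg K D0 by simp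
  have B: "{y \<in> weyl_A N. y m \<le> ?a} \<in> sets ?L"
  proof -
    have "{y \<in> weyl_A N. y m \<le> ?a} = (\<lambda>y. y m) -` {..?a} \<inter> space (weyl_borel N)"
      by (auto simp: space_weyl_borel)
    also have "\<dots> \<in> sets (weyl_borel N)" by (rule measurable_sets[OF component_weyl_borel[OF m]]) auto
    finally show ?thesis by (simp only: setsL)
  qed
  have sp: "space ?L = weyl_A N" using sets_eq_imp_space_eq[OF setsL] by (simp add: space_weyl_borel)
  have "emeasure (bessel_law0 N (c\<^sup>2/2) t) {y \<in> weyl_A N. y m \<le> ?a}
      = (\<integral>\<^sup>+y. ennreal (?w y / Z) * indicator {y \<in> weyl_A N. y m \<le> ?a} y \<partial>?L)"
    unfolding bessel_law0_def Z_def[symmetric] by (rule emeasure_density[OF _ B]) (use wm in measurable)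
  also have "\<dots> = (\<integral>\<^sup>+y. ennreal (1 / Z) * ennreal (indicator {..?a} (y m) * ?w y) \<partial>?L)"
  proof (rule nn_integral_cong)
    fix y assume "y \<in> space ?L"
    moreover have "0 \<le> Z" unfolding Z by (rule mult_nonneg_nonneg[OF less_imp_le[OF K] D0])
    ultimately show "ennreal (?w y / Z) * indicator {y \<in> weyl_A N. y m \<le> ?a} y = ennreal (1 / Z) * ennreal (indicator {..?a} (y m) * ?w y)"
      using bessel_weight_nonneg by (auto simp: sp ennreal_mult[symmetric] split: split_indicator)
  qed
  also have "\<dots> = ennreal (1 / Z) * ennreal (?K * (\<integral>u. cut b u * gdens c u \<partial>P))"
    unfolding n2[symmetric]
  proof (rule nn_integral_cmult)
    have "(\<lambda>y. y m) \<in> borel_measurable ?L"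
      using component_weyl_borel[OF m] measurable_cong_sets[OF setsL refl] by blast
    then show "(\<lambda>y. ennreal (indicator {..?a} (y m) * ?w y)) \<in> borel_measurable ?L" using wm by measurable
  qed
  also have "\<dots> = ennreal ((\<integral>u. cut b u * gdens c u \<partial>P) / (\<integral>u. gdens c u \<partial>P))"
  proof -
    have q: "0 \<le> 1 / (q * d)" "1 / (q * d) * (q * e) = e / d" if "0 < q" "0 \<le> d" for q d e :: real
      using that by auto
    show ?thesis
      unfolding Z using ennreal_mult[OF q(1)[OF K D0] mult_nonneg_nonneg[OF less_imp_le[OF K] C0]] q(2)[OF K D0]
      by simp
  qed
  finally show ?thesis using C0 D0 by (simp add: measure_def)
qed

text \<open>The event for the rescaled coordinate is the half space \<open>u m \<le> x / a\<close>,
  so its probability is the quotient \<open>R\<close> at \<open>c = sqrt (2 * k)\<close>, and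
  \<open>a\<close> scales the variance. The spaces \<open>M k\<close> may vary with
  \<open>k\<close>, as only laws enter.\<close>

theorem freezing_limit:
  assumes X: "\<And>k. 0 < k \<Longrightarrow> bessel_process0 N k (M k) (X k)" and t: "0 < t" and a: "0 < a"
  shows "weak_conv_along at_top
    (\<lambda>k. distr (M k) borel (\<lambda>\<omega>. a * sqrt (2 * k) * (X k t \<omega> m / sqrt (2 * k * t) - z m)))
    (normal_dist0 (a\<^sup>2 * s))"
  unfolding weak_conv_along_def
proof (intro allI impI)
  fix x
  define R where "R c = (\<integral>u. cut (x / a) u * gdens c u \<partial>P) / (\<integral>u. gdens c u \<partial>P)" for c
  have "filterlim (\<lambda>k::real. sqrt (2 * k)) at_top at_top"
    by (intro filterlim_compose[OF sqrt_at_top] filterlim_tendsto_pos_mult_at_top[OF tendsto_const] filterlim_ident) auto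
  from filterlim_compose[OF freezing_ratio_tendsto[of "x / a"] this]
  have lim: "((\<lambda>k. R (sqrt (2 * k))) \<longlongrightarrow> cdf (normal_dist0 s) (x / a)) at_top"
    unfolding R_def .
  have "cdf (normal_dist0 s) (x / a) = cdf (normal_dist0 (a\<^sup>2 * s)) x"
    using s a by (simp add: normal_dist0_cdf_scale[of s] normal_dist0_cdf_scale[of "a\<^sup>2 * s"] real_sqrt_mult)
  with lim have "((\<lambda>k. R (sqrt (2 * k))) \<longlongrightarrow> cdf (normal_dist0 (a\<^sup>2 * s)) x) at_top" by simp
  then show "((\<lambda>k. cdf (distr (M k) borel (\<lambda>\<omega>. a * sqrt (2 * k) * (X k t \<omega> m / sqrt (2 * k * t) - z m))) x)
      \<longlongrightarrow> cdf (normal_dist0 (a\<^sup>2 * s)) x) at_top"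
  proof (rule Lim_transform_eventually)
    show "\<forall>\<^sub>F k in at_top. R (sqrt (2 * k)) =
        cdf (distr (M k) borel (\<lambda>\<omega>. a * sqrt (2 * k) * (X k t \<omega> m / sqrt (2 * k * t) - z m))) x"
      using eventually_gt_at_top[of 0]
    proof eventually_elim
      case (elim k)
      define c where "c = sqrt (2 * k)"
      have c: "0 < c" "c\<^sup>2/2 = k" using elim by (auto simp: c_def)
      let ?B = "{y \<in> weyl_A N. y m \<le> sqrt t * c * z m + sqrt t * (x / a)}"
      have B: "?B \<in> sets (weyl_borel N)"
      proof -
        have "?B = (\<lambda>y. y m) -` {..sqrt t * c * z m + sqrt t * (x / a)} \<inter> space (weyl_borel N)"
          by (auto simp: space_weyl_borel)
        also have "\<dots> \<in> sets (weyl_borel N)" by (rule measurable_sets[OF component_weyl_borel[OF m]]) auto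
        finally show ?thesis .
      qed
      note law = bessel_process0_law[OF X[OF elim] t B]
      let ?f = "\<lambda>\<omega>. a * sqrt (2 * k) * (X k t \<omega> m / sqrt (2 * k * t) - z m)"
      have xm: "(\<lambda>\<omega>. X k t \<omega> m) \<in> borel_measurable (M k)"
        by (rule measurable_compose[OF law(2) component_weyl_borel[OF m]])
      have f: "?f \<in> borel_measurable (M k)" using xm by measurable
      have iff: "?f \<omega> \<le> x \<longleftrightarrow> X k t \<omega> m \<le> sqrt t * c * z m + sqrt t * (x / a)" for \<omega>
      proof -
        have "sqrt (2 * k * t) = c * sqrt t" by (simp add: c_def real_sqrt_mult)
        moreover have "0 < sqrt t" using t by simp
        ultimately have "a * c * (X k t \<omega> m / sqrt (2 * k * t) - z m) = (X k t \<omega> m / sqrt t - c * z m) * a"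
          using c(1) by (simp add: right_diff_distrib left_diff_distrib mult_ac)
        also have "\<dots> \<le> x \<longleftrightarrow> X k t \<omega> m / sqrt t - c * z m \<le> x / a"
          using a by (simp add: pos_le_divide_eq)
        also have "\<dots> \<longleftrightarrow> X k t \<omega> m / sqrt t \<le> c * z m + x / a" by linarith
        also have "\<dots> \<longleftrightarrow> X k t \<omega> m \<le> (c * z m + x / a) * sqrt t"
          using t by (simp add: pos_divide_le_eq)
        also have "(c * z m + x / a) * sqrt t = sqrt t * c * z m + sqrt t * (x / a)"
          by (simp add: distrib_left mult_ac)
        finally show ?thesis unfolding c_def[symmetric] .
      qed
      have "cdf (distr (M k) borel ?f) x = measure (M k) (?f -` {..x} \<inter> space (M k))"
        unfolding cdf_def by (rule measure_distr[OF f]) auto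
      also have "?f -` {..x} \<inter> space (M k) = X k t -` ?B \<inter> space (M k)"
        using measurable_space[OF law(2)] unfolding vimage_def atMost_iff iff space_weyl_borel by auto
      also have "measure (M k) \<dots> = R c"
        unfolding law(1) R_def using bessel_law0_cut[OF c(1) t, of "x / a"] c(2) by simp
      finally show ?case by (simp add: c_def)
    qed
  qed
qed

end

text \<open>Transports sums over the set of zeros to sums over indices, which turns
  \<open>stieltjes\<close> and \<open>hcol_equation\<close> into the assumptions of the
  locale.\<close>

lemma hermite_freezing:
  assumes "m \<in> {1..N}"
  shows "freezing N (hermite_zero N) (\<lambda>j. hcol N (hermite_zero N m) (hermite_zero N j)) m (hvar N (hermite_zero N m))"
proof
  note bij = hermite_zero_bij(1)[of N] and sm = hermite_zero_bij(2)[of N]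
  have hz: "hermite_zero N j \<in> hzeros N" if "j \<in> {1..N}" for j using bij that by (auto simp: bij_betw_def)
  have bij': "bij_betw (hermite_zero N) ({1..N} - {i}) (hzeros N - {hermite_zero N i})" if "i \<in> {1..N}" for i
    by (rule bij_betw_DiffI[OF bij]) (use hz that in \<open>auto simp: bij_betw_def\<close>)
  show "hermite_zero N i < hermite_zero N j" if "i \<in> {1..N}" "j \<in> {1..N}" "i < j" for i j
    using sm that by (auto simp: strict_mono_on_def)
  show "(\<Sum>j\<in>{1..N} - {i}. 1 / (hermite_zero N i - hermite_zero N j)) = hermite_zero N i" if "i \<in> {1..N}" for i
    using sum.reindex_bij_betw[OF bij'[OF that], of "\<lambda>w. 1 / (hermite_zero N i - w)"] stieltjes[OF hz[OF that]] by simp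
  show "m \<in> {1..N}" by (rule assms)
  show "0 < hvar N (hermite_zero N m)" by (rule hvar_pos[OF hz[OF assms]])
  show "hcol N (hermite_zero N m) (hermite_zero N m) = 1" by (rule hcol_diag[OF hz[OF assms]])
  fix i assume i: "i \<in> {1..N}"
  have "hermite_zero N i = hermite_zero N m \<longleftrightarrow> i = m"
    using inj_on_eq_iff[OF bij_betw_imp_inj_on[OF bij] i assms] .
  then show "hcol N (hermite_zero N m) (hermite_zero N i) + (\<Sum>j\<in>{1..N} - {i}. (hcol N (hermite_zero N m) (hermite_zero N i) - hcol N (hermite_zero N m) (hermite_zero N j)) / (hermite_zero N i - hermite_zero N j)\<^sup>2)
     = (if i = m then 1 / hvar N (hermite_zero N m) else 0)"
    using sum.reindex_bij_betw[OF bij'[OF i], of "\<lambda>w. (hcol N (hermite_zero N m) (hermite_zero N i) - hcol N (hermite_zero N m) w) / (hermite_zero N i - w)\<^sup>2"]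
      hcol_equation[OF hz[OF assms] hz[OF i]] by simp
qed

section \<open>The largest Hermite zeros\<close>

text \<open>As in \<open>sturm_core\<close>, with infinity as the right end: decay of both functions
  and of their derivatives sends the Wronskian to 0, although it increases strictly from a
  nonnegative value.\<close>

lemma sturm_half_line_core:
  assumes y: "ode2 p y y'" and w: "ode2 q w w'"
    and "w a = 0" "\<And>x. a < x \<Longrightarrow> 0 < w x"
    and pq: "\<And>x. a < x \<Longrightarrow> p x < q x"
    and ypos: "\<And>x. a < x \<Longrightarrow> 0 < y x"
    and lim: "(y \<longlongrightarrow> 0) at_top" "(y' \<longlongrightarrow> 0) at_top" "(w \<longlongrightarrow> 0) at_top" "(w' \<longlongrightarrow> 0) at_top"
  shows False
proof -
  let ?W = "\<lambda>x. y x * w' x - y' x * w x"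
  have wa: "w' a \<ge> 0"
    by (rule pos_right_deriv_nonneg[OF ode2D(1)[OF w], of a "a+1"]) (use assms in auto)
  have ya: "y a \<ge> 0"
    by (rule continuous_ge_on_closure[OF ode2_continuous_on(1)[OF y], of a "{a<..}"])
       (use ypos in \<open>auto intro: less_imp_le\<close>)
  have inc: "?W u < ?W v" if "a \<le> u" "u < v" for u v
  proof (rule DERIV_pos_imp_increasing_open[OF that(2)])
    show "continuous_on {u..v} ?W"
      by (intro continuous_intros ode2_continuous_on[OF y] ode2_continuous_on[OF w])
    fix x assume "u < x" "x < v"
    then have "0 < (q x - p x) * (y x * w x)"
      using pq[of x] ypos[of x] assms(4)[of x] that by (intro mult_pos_pos) auto
    then show "\<exists>d. (?W has_real_derivative d) (at x) \<and> d > 0"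
      using wronskian_deriv[OF y w, of x] by blast
  qed
  have "(?W \<longlongrightarrow> 0 * 0 - 0 * 0) at_top" by (intro tendsto_intros lim)
  then have "(?W \<longlongrightarrow> 0) at_top" by simp
  then have "?W (a + 1) \<le> 0"
  proof (rule tendsto_lowerbound[OF _ eventually_mono[OF eventually_ge_at_top[of "a + 1"]]])
    fix x assume "a + 1 \<le> x"
    then show "?W (a + 1) \<le> ?W x" using inc[of "a + 1" x] by (cases "x = a + 1") auto
  qed simp
  moreover have "0 \<le> ?W a" using wa ya assms(3) by simp
  ultimately show False using inc[of a "a + 1"] by simp
qed

lemma sturm_half_line:
  assumes y: "ode2 p y y'" and w: "ode2 q w w'"
    and w0: "w a = 0" "\<And>x. a < x \<Longrightarrow> w x \<noteq> 0"
    and pq: "\<And>x. a < x \<Longrightarrow> p x < q x"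
    and lim: "(y \<longlongrightarrow> 0) at_top" "(y' \<longlongrightarrow> 0) at_top" "(w \<longlongrightarrow> 0) at_top" "(w' \<longlongrightarrow> 0) at_top"
  shows "\<exists>x>a. y x = 0"
proof (rule ccontr)
  assume "\<not> ?thesis"
  then have y0: "\<And>x. x \<in> {a<..} \<Longrightarrow> y x \<noteq> 0" by auto
  have w0': "\<And>x. x \<in> {a<..} \<Longrightarrow> w x \<noteq> 0" using w0 by auto
  have sy: "(\<forall>x\<in>{a<..}. 0 < y x) \<or> (\<forall>x\<in>{a<..}. y x < 0)"
    by (rule nonzero_const_sign[OF ode2_continuous_on(1)[OF y] _ y0]) auto
  have sw: "(\<forall>x\<in>{a<..}. 0 < w x) \<or> (\<forall>x\<in>{a<..}. w x < 0)"
    by (rule nonzero_const_sign[OF ode2_continuous_on(1)[OF w] _ w0']) auto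
  note lm = lim[THEN tendsto_minus, simplified]
  show False
    using sy sw
  proof (elim disjE)
    assume "\<forall>x\<in>{a<..}. 0 < y x" "\<forall>x\<in>{a<..}. 0 < w x"
    then show False using sturm_half_line_core[OF y w w0(1) _ pq _ lim] by auto
  next
    assume "\<forall>x\<in>{a<..}. 0 < y x" "\<forall>x\<in>{a<..}. w x < 0"
    then show False using sturm_half_line_core[OF y ode2_uminus[OF w] _ _ pq _ lim(1,2) lm(3,4)] w0(1) by auto
  next
    assume "\<forall>x\<in>{a<..}. y x < 0" "\<forall>x\<in>{a<..}. 0 < w x"
    then show False using sturm_half_line_core[OF ode2_uminus[OF y] w w0(1) _ pq _ lm(1,2) lim(3,4)] by auto
  next
    assume "\<forall>x\<in>{a<..}. y x < 0" "\<forall>x\<in>{a<..}. w x < 0"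
    then show False using sturm_half_line_core[OF ode2_uminus[OF y] ode2_uminus[OF w] _ _ pq _ lm] w0(1) by auto
  qed
qed

section \<open>Hermite functions in the edge coordinate\<close>

definition hscale :: "nat \<Rightarrow> real" where "hscale N = sqrt 2 * real N powr (1/6)"

text \<open>Edge coordinate: \<open>x = \<surd>(2N) + \<xi> / (\<surd>2 N\<^bsup>1/6\<^esup>)\<close>.\<close>

definition hedge :: "nat \<Rightarrow> real \<Rightarrow> real" where "hedge N z = hscale N * (z - sqrt (2 * real N))"

definition hunedge :: "nat \<Rightarrow> real \<Rightarrow> real" where "hunedge N u = sqrt (2 * real N) + u / hscale N"

text \<open>The coefficient \<open>x\<^sup>2 - (2 * real N + 1)\<close> in the equation of the
  Hermite function, rewritten in the edge coordinate. The two corrections to \<open>u\<close> have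
  opposite signs.\<close>

definition hpot :: "nat \<Rightarrow> real \<Rightarrow> real" where
  "hpot N u = u + u\<^sup>2 / (hscale N)^4 - 1 / (hscale N)\<^sup>2"

definition hfun :: "nat \<Rightarrow> real \<Rightarrow> real" where
  "hfun N u = poly (hermite N) (hunedge N u) * exp (- (1/2) * (hunedge N u)\<^sup>2)"

definition hfun' :: "nat \<Rightarrow> real \<Rightarrow> real" where
  "hfun' N u = (poly (pderiv (hermite N)) (hunedge N u) - hunedge N u * poly (hermite N) (hunedge N u)) * exp (- (1/2) * (hunedge N u)\<^sup>2) / hscale N"

lemma hscale_pos: "0 < N \<Longrightarrow> 0 < hscale N" by (simp add: hscale_def)

text \<open>The cube explains the exponent 1/6: it gives the linear term of the potential the
  coefficient 1.\<close>

lemma hscale_powers: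
  assumes "0 < N"
  shows "(hscale N)\<^sup>2 = 2 * real N powr (1/3)" "(hscale N)^3 = 2 * sqrt (2 * real N)"
proof -
  have "(real N powr (1/6))\<^sup>2 = real N powr (1/3)"
    using assms by (simp add: powr_power)
  then show "(hscale N)\<^sup>2 = 2 * real N powr (1/3)" by (simp add: hscale_def power_mult_distrib)
  have "(real N powr (1/6))^3 = real N powr (1/2)"
    using assms by (simp add: powr_power)
  moreover have "sqrt 2 ^ 3 = 2 * sqrt 2" by (simp add: power3_eq_cube)
  ultimately show "(hscale N)^3 = 2 * sqrt (2 * real N)"
    using assms by (simp add: hscale_def power_mult_distrib powr_half_sqrt real_sqrt_mult)
qed

lemma hunedge_sq:
  assumes "0 < N"
  shows "((hunedge N u)\<^sup>2 - (2 * real N + 1)) / (hscale N)\<^sup>2 = hpot N u"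
proof -
  let ?b = "hscale N"
  have b: "?b > 0" by (rule hscale_pos[OF assms])
  have "(hunedge N u)\<^sup>2 - (2 * real N + 1) = 2 * sqrt (2 * real N) * u / ?b + u\<^sup>2 / ?b\<^sup>2 - 1"
    by (simp add: hunedge_def power2_sum power_divide)
  also have "\<dots> = ?b^3 * u / ?b + u\<^sup>2 / ?b\<^sup>2 - 1" unfolding hscale_powers(2)[OF assms] ..
  finally show ?thesis using b by (simp add: hpot_def field_simps eval_nat_numeral)
qed

lemma hfun_ode:
  assumes "0 < N"
  shows "ode2 (hpot N) (hfun N) (hfun' N)"
  unfolding ode2_def
proof (intro allI conjI)
  fix u
  let ?b = "hscale N" and ?H = "poly (hermite N)" and ?D = "poly (pderiv (hermite N))"
  have b: "?b \<noteq> 0" using hscale_pos[OF assms] by simp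
  have du: "(hunedge N has_real_derivative 1 / ?b) (at u)"
    unfolding hunedge_def[abs_def] using b by (auto intro!: derivative_eq_intros)
  have d1: "((\<lambda>x. ?H x * exp (- (1/2) * x\<^sup>2)) has_real_derivative (?D x - x * ?H x) * exp (- (1/2) * x\<^sup>2)) (at x)" for x
    by (auto intro!: derivative_eq_intros simp: algebra_simps)
  have d2: "((\<lambda>x. (?D x - x * ?H x) * exp (- (1/2) * x\<^sup>2)) has_real_derivative (x\<^sup>2 - (2 * real N + 1)) * (?H x * exp (- (1/2) * x\<^sup>2))) (at x)" for x
    by (auto intro!: derivative_eq_intros simp: hermite_ode algebra_simps power2_eq_square)
  show "(hfun N has_real_derivative hfun' N u) (at u)"
    using DERIV_chain2[OF d1 du] by (simp add: hfun_def[abs_def] hfun'_def)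
  have "(hfun' N has_real_derivative ((hunedge N u)\<^sup>2 - (2 * real N + 1)) * hfun N u * (1 / ?b) / ?b) (at u)"
    using DERIV_cdivide[OF DERIV_chain2[OF d2 du], of ?b] by (simp add: hfun_def hfun'_def[abs_def])
  then show "(hfun' N has_real_derivative hpot N u * hfun N u) (at u)"
    unfolding hunedge_sq[OF assms, symmetric] by (simp add: power2_eq_square)
qed

lemma hfun_tendsto:
  assumes "0 < N"
  shows "(hfun N \<longlongrightarrow> 0) at_top" "(hfun' N \<longlongrightarrow> 0) at_top"
proof -
  have "filterlim (\<lambda>u. u / hscale N) at_top at_top"
    using filterlim_tendsto_pos_mult_at_top[OF tendsto_const[of "1 / hscale N"] _ filterlim_ident] hscale_pos[OF assms] by simp
  then have f: "filterlim (hunedge N) at_top at_top"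
    unfolding hunedge_def[abs_def] by (rule filterlim_tendsto_add_at_top[OF tendsto_const])
  show "(hfun N \<longlongrightarrow> 0) at_top"
    using filterlim_compose[OF poly_div_exp_tendsto_0[of "1/2" "hermite N"] f] by (simp add: hfun_def[abs_def])
  have "((\<lambda>u. poly (pderiv (hermite N) - [:0,1:] * hermite N) (hunedge N u) * exp (- (1/2) * (hunedge N u)\<^sup>2)) \<longlongrightarrow> 0) at_top"
    by (rule filterlim_compose[OF poly_div_exp_tendsto_0[of "1/2"] f]) simp
  from tendsto_divide[OF this tendsto_const[of "hscale N"]]
  show "(hfun' N \<longlongrightarrow> 0) at_top" using hscale_pos[OF assms] by (simp add: hfun'_def[abs_def])
qed

definition hezeros :: "nat \<Rightarrow> real set" where "hezeros N = hedge N ` hzeros N"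

lemma hezeros_iff: "0 < N \<Longrightarrow> u \<in> hezeros N \<longleftrightarrow> hfun N u = 0"
proof -
  assume "0 < N"
  then have b: "hscale N \<noteq> 0" using hscale_pos[of N] by simp
  have "u = hedge N z \<longleftrightarrow> z = hunedge N u" for z
    using b by (auto simp: hedge_def hunedge_def field_simps)
  then have "u \<in> hezeros N \<longleftrightarrow> hunedge N u \<in> hzeros N" unfolding hezeros_def image_iff by simp
  then show ?thesis by (simp add: hfun_def hzeros_def)
qed

lemma finite_hezeros [simp]: "finite (hezeros N)" by (simp add: hezeros_def)

lemma card_ge_iff_kth:
  fixes S :: "real set"
  assumes fin: "\<And>a. finite {x \<in> S. a \<le> x}" and s: "s \<in> S" "card {x \<in> S. s \<le> x} = r"
  shows "a \<le> s \<longleftrightarrow> r \<le> card {x \<in> S. a \<le> x}"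
proof
  assume "a \<le> s"
  then show "r \<le> card {x \<in> S. a \<le> x}" unfolding s(2)[symmetric] by (intro card_mono fin) auto
next
  assume r: "r \<le> card {x \<in> S. a \<le> x}"
  show "a \<le> s"
  proof (rule ccontr)
    assume "\<not> a \<le> s"
    then have "s \<in> {x \<in> S. s \<le> x}" "s \<notin> {x \<in> S. a \<le> x}" "{x \<in> S. a \<le> x} \<subseteq> {x \<in> S. s \<le> x}" using s by auto
    then have "{x \<in> S. a \<le> x} \<subset> {x \<in> S. s \<le> x}" by blast
    from psubset_card_mono[OF fin this] show False using r s by simp
  qed
qed

definition hze :: "nat \<Rightarrow> nat \<Rightarrow> real" where "hze r N = hedge N (hermite_zero N (N - r + 1))"

lemma hermite_zero_in: "j \<in> {1..N} \<Longrightarrow> hermite_zero N j \<in> hzeros N"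
  using hermite_zero_bij(1)[of N] by (auto simp: bij_betw_def)

lemma hze_kth:
  assumes "1 \<le> r" "r \<le> N"
  shows "hze r N \<in> hezeros N" "card {u \<in> hezeros N. hze r N \<le> u} = r"
proof -
  have N: "0 < N" using assms by simp
  have j: "N - r + 1 \<in> {1..N}" using assms by auto
  show "hze r N \<in> hezeros N" unfolding hze_def hezeros_def using hermite_zero_in[OF j] by simp
  have hz: "hzeros N = hermite_zero N ` {1..N}" and inj: "inj_on (hermite_zero N) {1..N}"
    using hermite_zero_bij(1)[of N] by (auto simp: bij_betw_def)
  have mono: "hedge N x \<le> hedge N y \<longleftrightarrow> x \<le> y" for x y
    using hscale_pos[OF N] by (simp add: hedge_def)
  have injh: "inj (hedge N)" using hscale_pos[OF N] by (auto simp: inj_def hedge_def)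
  have mz: "hermite_zero N i \<le> hermite_zero N i' \<longleftrightarrow> i \<le> i'" if "i \<in> {1..N}" "i' \<in> {1..N}" for i i'
    using strict_mono_on_leD[OF hermite_zero_bij(2)] hermite_zero_bij(2)[of N] that
    by (metis linorder_not_le strict_mono_onD)
  have "{u \<in> hezeros N. hze r N \<le> u} = hedge N ` hermite_zero N ` {i \<in> {1..N}. N - r + 1 \<le> i}"
  proof -
    have "{u \<in> f ` B. c \<le> u} = f ` {i \<in> B. c \<le> f i}" for f :: "nat \<Rightarrow> real" and B c by auto
    from this[of "\<lambda>i. hedge N (hermite_zero N i)" "{1..N}" "hedge N (hermite_zero N (N - r + 1))"]
    have "{u \<in> hezeros N. hze r N \<le> u} = (\<lambda>i. hedge N (hermite_zero N i)) ` {i \<in> {1..N}. hermite_zero N (N - r + 1) \<le> hermite_zero N i}"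
      unfolding hezeros_def hze_def hz image_image mono .
    also have "{i \<in> {1..N}. hermite_zero N (N - r + 1) \<le> hermite_zero N i} = {i \<in> {1..N}. N - r + 1 \<le> i}"
      using mz[OF j] by blast
    finally show ?thesis unfolding image_image .
  qed
  also have "card \<dots> = card {i \<in> {1..N}. N - r + 1 \<le> i}"
    by (subst card_image, rule inj_on_subset[OF injh], simp, rule card_image, rule inj_on_subset[OF inj], auto)
  also have "{i \<in> {1..N}. N - r + 1 \<le> i} = {N - r + 1..N}" by auto
  also have "card {N - r + 1..N} = r" using assms by simp
  finally show "card {u \<in> hezeros N. hze r N \<le> u} = r" .
qed

lemma hze_ge_iff:
  assumes "1 \<le> r" "r \<le> N"
  shows "a \<le> hze r N \<longleftrightarrow> r \<le> card {u \<in> hezeros N. a \<le> u}"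
  by (rule card_ge_iff_kth[OF _ hze_kth[OF assms]]) simp

lemma aa_shift_ode: "ode2 (\<lambda>x. x + d) (\<lambda>x. aa (x + d)) (\<lambda>x. aa' (x + d))"
  using ode2_shift[OF aa_ode, of d] by simp

lemma aa_shift_nontrivial: "\<exists>x. aa (x + d) \<noteq> 0"
  by (rule exI[of _ "- d"]) simp

text \<open>The potential exceeds \<open>u - 2 / (hscale N)\<^sup>2\<close> on the whole line.
  Interlacing gives \<open>r - 1\<close> zeros of the shifted \<open>aa\<close> between the
  \<open>r\<close> largest edge zeros, comparison on the half line gives one beyond the largest, and
  counting yields the bound.\<close>

lemma hze_le:
  assumes r: "1 \<le> r" "r \<le> N"
  shows "hze r N \<le> airy_zero r + 2 / (hscale N)\<^sup>2"
proof -
  have N: "0 < N" using r by simp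
  define e where "e = 2 / (hscale N)\<^sup>2"
  let ?z = "hze r N"
  \<comment> \<open>The upper limit in \<open>?T\<close> makes the set finite without losing a point
    that lies between edge zeros.\<close>
  let ?S = "{u \<in> hezeros N. ?z \<le> u}" and ?T = "{t. ?z \<le> t \<and> t \<le> Max (insert e (hezeros N)) \<and> aa (t - e) = 0}"
  have b: "0 < (hscale N)\<^sup>2" using hscale_pos[OF N] by simp
  have e: "1 / (hscale N)\<^sup>2 < e" unfolding e_def using b by (intro divide_strict_right_mono) auto
  have pot: "u + (- e) < hpot N u" for u
  proof -
    have "0 \<le> u\<^sup>2 / (hscale N)^4" using hscale_pos[OF N] by simp
    then show ?thesis using e unfolding hpot_def by linarith
  qed
  note yo = aa_shift_ode[of "- e"]
  have ne: "?S \<noteq> {}" using hze_kth[OF r] by auto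
  have finT: "finite ?T"
    using ode2_finite_zeros[OF yo _ aa_shift_nontrivial, of ?z "Max (insert e (hezeros N))"]
    by (simp add: continuous_intros)
  have c1: "card ?S \<le> Suc (card {t\<in>?T. Min ?S < t \<and> t < Max ?S})"
  proof (rule interlacing_card[OF _ finT ne])
    fix a b assume ab: "a \<in> ?S" "b \<in> ?S" "a < b"
    have "\<exists>x. a < x \<and> x < b \<and> aa (x + (- e)) = 0"
    proof (rule sturm[OF yo hfun_ode[OF N] ab(3)])
      show "finite {x. a \<le> x \<and> x \<le> b \<and> hfun N x = 0}"
        by (rule finite_subset[of _ "hezeros N"]) (auto simp: hezeros_iff[OF N])
    qed (use ab pot in \<open>auto simp: hezeros_iff[OF N]\<close>)
    then obtain t where t: "a < t" "t < b" "aa (t + (- e)) = 0" by blast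
    have "b \<le> Max (insert e (hezeros N))" using ab by (intro Max_ge) auto
    then have "t \<le> Max (insert e (hezeros N))" using t(2) by linarith
    moreover have "?z \<le> t" using t(1) ab(1) by simp
    moreover have "aa (t - e) = 0" using t(3) by simp
    ultimately have "t \<in> ?T" by blast
    then show "\<exists>t\<in>?T. a < t \<and> t < b" using t by blast
  qed simp
  have mx: "Max ?S \<in> ?S" by (rule Max_in[OF _ ne]) simp
  obtain t0 where t0: "Max ?S < t0" "aa (t0 - e) = 0"
  proof -
    have "\<exists>x>Max ?S. aa (x + (- e)) = 0"
    proof (rule sturm_half_line[OF yo hfun_ode[OF N]])
      show "hfun N (Max ?S) = 0" using mx hezeros_iff[OF N] by auto
      show "hfun N x \<noteq> 0" if "Max ?S < x" for x
      proof
        assume "hfun N x = 0"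
        then have "x \<in> ?S" using that mx hezeros_iff[OF N, of x] by auto
        then have "x \<le> Max ?S" by (intro Max_ge) simp_all
        then show False using that by linarith
      qed
      show "((\<lambda>x. aa (x + - e)) \<longlongrightarrow> 0) at_top"
        by (rule filterlim_compose[OF aa_tendsto filterlim_add_const_at_top])
      show "((\<lambda>x. aa' (x + - e)) \<longlongrightarrow> 0) at_top"
        by (rule filterlim_compose[OF aa'_tendsto filterlim_add_const_at_top])
    qed (use pot hfun_tendsto[OF N] in auto)
    then show ?thesis using that by auto
  qed
  let ?U = "insert t0 {t\<in>?T. Min ?S < t \<and> t < Max ?S}"
  have cU: "card ?U = Suc (card {t\<in>?T. Min ?S < t \<and> t < Max ?S})"
  proof -
    have "finite {t\<in>?T. Min ?S < t \<and> t < Max ?S}" by (rule finite_subset[OF _ finT]) blast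
    moreover have "t0 \<notin> {t\<in>?T. Min ?S < t \<and> t < Max ?S}" using t0(1) by simp
    ultimately show ?thesis by (rule card_insert_disjoint)
  qed
  have sub: "(\<lambda>t. t - e) ` ?U \<subseteq> {x \<in> airy_zeros. ?z - e \<le> x}"
    using t0 mx by (auto simp: airy_zeros_aa)
  have "card ?U = card ((\<lambda>t. t - e) ` ?U)" by (rule card_image[symmetric]) (auto simp: inj_on_def)
  also have "\<dots> \<le> card {x \<in> airy_zeros. ?z - e \<le> x}" by (rule card_mono[OF finite_airy_zeros_ge sub])
  finally have "r \<le> card {x \<in> airy_zeros. ?z - e \<le> x}"
    using c1 cU hze_kth[OF r] by simp
  then have "?z - e \<le> airy_zero r" using airy_zero_ge_iff[OF r(1)] by simp
  then show ?thesis by (simp add: e_def)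
qed

text \<open>The largest zero needs a comparison function with a second zero at large argument:
  a small multiple of the dominant solution is subtracted from the recessive one.\<close>

lemma perturbed_airy_zeros:
  assumes d: "0 < d"
  shows "\<exists>y y' s1 s0. airy_ode 0 y y' \<and> airy_zero 1 - d < s1 \<and> s1 < s0 \<and> y s1 = 0 \<and> y s0 = 0 \<and> (\<exists>x. y x \<noteq> 0)"
proof -
  let ?a = "airy_zero 1"
  have a: "aa ?a = 0" "?a < 0" using airy_zero[of 1] by auto
  have pos: "0 < aa x" if "?a < x" for x
  proof (rule ccontr)
    assume n: "\<not> 0 < aa x"
    have "\<exists>t\<ge>x. t \<le> max x 0 \<and> aa t = 0"
      using IVT'[of aa x 0 "max x 0"] n aa_pos[of "max x 0"] ode2_continuous_on(1)[OF aa_ode] by auto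
    then obtain t where t: "t \<ge> x" "aa t = 0" by auto
    then have "{?a, t} \<subseteq> {x \<in> airy_zeros. ?a \<le> x}" "?a \<noteq> t" using that a by (auto simp: airy_zeros_aa)
    then have "card {?a, t} \<le> 1" "card {?a, t} = 2"
      using card_mono[OF finite_airy_zeros_ge] airy_zero(2)[of 1] by (metis order.refl, simp)
    then show False by simp
  qed
  have "0 \<le> aa' ?a"
    by (rule pos_right_deriv_nonneg[OF ode2D(1)[OF aa_ode], of ?a "?a + 1"]) (use a pos in auto)
  then have a': "0 < aa' ?a" using aa'_airy_zero[of 1] by simp
  obtain e where e: "e > 0" "\<And>h. 0 < h \<Longrightarrow> h < e \<Longrightarrow> aa (?a - h) < aa ?a"
    using DERIV_pos_inc_left[OF ode2D(1)[OF aa_ode] a'] by auto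
  define h where "h = min (e/2) (d/2)"
  have h: "0 < h" "h < e" "h < d" using e d by (auto simp: h_def min_def)
  let ?p = "?a - h"
  have p: "aa ?p < 0" using e(2)[OF h(1,2)] a by simp
  \<comment> \<open>Small enough that subtracting \<open>n * ag\<close> keeps the value at
    \<open>?p\<close> negative. At \<open>?a\<close> the value becomes positive, because
    \<open>ag ?a < 0\<close>, and at \<open>q\<close> the dominant solution wins, so the sign
    changes twice.\<close>
  define n where "n = - aa ?p / (2 * (1 + \<bar>ag ?p\<bar>))"
  have n: "0 < n" unfolding n_def using p by (intro divide_pos_pos) auto
  define y where "y x = aa x - n * ag x" for x
  define y' where "y' x = aa' x - n * ag' x" for x
  have ode: "airy_ode 0 y y'"
    using ode2_lincomb[OF aa_ode ag_ode, of 1 "- n"] unfolding y_def[abs_def] y'_def[abs_def] by simp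
  have yp: "y ?p < 0"
  proof -
    have "n * (1 + \<bar>ag ?p\<bar>) = - aa ?p / 2" unfolding n_def by (simp add: field_simps add_pos_nonneg[THEN less_imp_neq, symmetric])
    moreover have "- (n * ag ?p) \<le> n * (1 + \<bar>ag ?p\<bar>)"
      using n mult_left_mono[of "- ag ?p" "1 + \<bar>ag ?p\<bar>" n] by simp
    ultimately show ?thesis using p by (simp add: y_def)
  qed
  have "aa ?a * ag' ?a - aa' ?a * ag ?a = 1"
    using wronskian_const[OF aa_ode ag_ode, of ?a 0] by simp
  then have "aa' ?a * ag ?a < 0" using a by simp
  then have "ag ?a < 0" using a' by (simp add: mult_less_0_iff)
  then have ya: "0 < y ?a" using n a by (simp add: y_def mult_pos_neg)
  define q where "q = 1 / n + 1"
  have q: "0 < q" using n by (simp add: q_def add_pos_pos)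
  have yq: "y q < 0"
  proof -
    have "aa q \<le> 1"
    proof -
      have "ag' q \<ge> 1" using ag_bounds(2)[of q] q zero_le_power[of q 3] by linarith
      then have "1 / ag' q \<le> 1" by simp
      then show ?thesis using aa_le[of q] q by linarith
    qed
    moreover have "n * ag q \<ge> n * q" using ag_bounds(1)[of q] q n by (intro mult_left_mono) auto
    moreover have "n * q = 1 + n" using n by (simp add: q_def distrib_left)
    ultimately show ?thesis using n by (simp add: y_def)
  qed
  have c: "continuous_on S y" for S by (rule ode2_continuous_on(1)[OF ode])
  obtain s1 where s1: "?p \<le> s1" "s1 \<le> ?a" "y s1 = 0"
    using IVT'[of y ?p 0 ?a] yp ya h c by auto
  obtain s0 where s0: "?a \<le> s0" "s0 \<le> q" "y s0 = 0"
    using IVT2'[of y q 0 ?a] yq ya a q c by auto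
  have "s1 \<noteq> ?a" "s0 \<noteq> ?a" using ya s1 s0 by auto
  then have "?a - d < s1" "s1 < s0" using s1 s0 h by linarith+
  moreover have "\<exists>x. y x \<noteq> 0" using ya by (intro exI[of _ ?a]) simp
  ultimately show ?thesis using ode s1 s0 by blast
qed

lemma filterlim_nat_powr_at_top: "0 < a \<Longrightarrow> filterlim (\<lambda>N. real N powr a) at_top sequentially"
proof -
  assume a: "0 < a"
  have "filterlim (\<lambda>N. exp (a * ln (real N))) at_top sequentially"
    by (intro filterlim_compose[OF exp_at_top] filterlim_tendsto_pos_mult_at_top[OF tendsto_const a]
        filterlim_compose[OF ln_at_top filterlim_real_sequentially])
  moreover have "\<forall>\<^sub>F N in sequentially. exp (a * ln (real N)) = real N powr a"
    using eventually_gt_at_top[of 0] by eventually_elim (simp add: powr_def)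
  ultimately show ?thesis
    by (rule filterlim_cong[THEN iffD1, OF refl refl, rotated])
qed

text \<open>The correction \<open>u\<^sup>2 / (hscale N)^4\<close> is small only for bounded
  \<open>u\<close>. For this reason the lower bound for the edge zeros compares on bounded
  intervals, with a second zero at finite distance.\<close>

lemma hpot_upper:
  assumes "0 < d"
  shows "\<forall>\<^sub>F N in sequentially. \<forall>u\<in>{-R..R}. hpot N u < u + d"
proof -
  have "((\<lambda>N. R\<^sup>2 / (4 * (real N powr (1/3))\<^sup>2)) \<longlongrightarrow> 0) sequentially"
  proof (intro tendsto_divide_0[OF tendsto_const] filterlim_at_top_imp_at_infinity)
    have "filterlim (\<lambda>N. real N powr (1/3)) at_top sequentially"
      by (rule filterlim_nat_powr_at_top) simp
    then show "filterlim (\<lambda>N. 4 * (real N powr (1/3))\<^sup>2) at_top sequentially"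
      by (intro filterlim_tendsto_pos_mult_at_top[OF tendsto_const] filterlim_pow_at_top) auto
  qed
  then have "\<forall>\<^sub>F N in sequentially. R\<^sup>2 / (4 * (real N powr (1/3))\<^sup>2) < d"
    by (rule order_tendstoD) (rule assms)
  then show ?thesis
    using eventually_gt_at_top[of 0]
  proof eventually_elim
    case (elim N)
    show ?case
    proof
      fix u assume "u \<in> {-R..R}"
      then have "u\<^sup>2 \<le> R\<^sup>2" by (intro power2_le_iff_abs_le[THEN iffD2]) auto
      have h4: "(hscale N)^4 = 4 * (real N powr (1/3))\<^sup>2"
      proof -
        have "(hscale N)^4 = ((hscale N)\<^sup>2)\<^sup>2" by simp
        then show ?thesis unfolding hscale_powers(1)[OF elim(2)] by (simp add: power_mult_distrib)
      qed
      have "u\<^sup>2 / (hscale N)^4 \<le> R\<^sup>2 / (hscale N)^4"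
        using \<open>u\<^sup>2 \<le> R\<^sup>2\<close> by (intro divide_right_mono) auto
      also have "\<dots> < d" using elim(1) unfolding h4 .
      finally have "u\<^sup>2 / (hscale N)^4 < d" .
      moreover have "0 \<le> 1 / (hscale N)\<^sup>2" by simp
      ultimately show "hpot N u < u + d" unfolding hpot_def by linarith
    qed
  qed
qed

text \<open>The Airy zeros shifted by \<open>2 * d\<close> enclose \<open>r - 1\<close> edge zeros.
  The missing one comes from the perturbed solution, shifted by \<open>d\<close> only, so that it
  lies to the right of the largest shifted Airy zero.\<close>

lemma hze_ge:
  assumes r: "1 \<le> r" and d: "0 < d"
  shows "\<forall>\<^sub>F N in sequentially. airy_zero r - 2 * d \<le> hze r N"
proof -
  obtain y y' s1 s0 where y: "airy_ode 0 y y'" "airy_zero 1 - d < s1" "s1 < s0" "y s1 = 0" "y s0 = 0" "\<exists>x. y x \<noteq> 0"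
    using perturbed_airy_zeros[OF d] by blast
  define R where "R = \<bar>airy_zero r\<bar> + 2 * d + \<bar>s1\<bar> + \<bar>s0\<bar>"
  have a0: "airy_zero r \<le> airy_zero 1" "airy_zero 1 < 0"
    using airy_zero(2)[OF r] r airy_zero_ge_iff[of 1 "airy_zero r"] airy_zero(4)[of 1] by auto
  show ?thesis
    using hpot_upper[OF d, of R] eventually_ge_at_top[of r]
  proof eventually_elim
    case (elim N)
    have N: "0 < N" using r elim by simp
    let ?A = "{x \<in> airy_zeros. airy_zero r \<le> x}"
    let ?S = "(\<lambda>x. x - 2 * d) ` ?A"
    have cS: "card ?S = r" using airy_zero(2)[OF r] by (subst card_image) (auto simp: inj_on_def)
    have finS: "finite ?S" using finite_airy_zeros_ge by simp
    have ne: "?S \<noteq> {}" using airy_zero(1)[OF r] by auto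
    have mxA: "x \<le> airy_zero 1" if "x \<in> airy_zeros" for x
    proof -
      have "{x} \<subseteq> {t \<in> airy_zeros. x \<le> t}" using that by auto
      from card_mono[OF finite_airy_zeros_ge this] show ?thesis using airy_zero_ge_iff[of 1 x] by simp
    qed
    have "card ?S \<le> Suc (card {t\<in>hezeros N. Min ?S < t \<and> t < Max ?S})"
    proof (rule interlacing_card[OF finS _ ne])
      fix a b assume ab: "a \<in> ?S" "b \<in> ?S" "a < b"
      have "\<exists>x. a < x \<and> x < b \<and> hfun N x = 0"
      proof (rule sturm[OF hfun_ode[OF N] aa_shift_ode[of "2 * d"] ab(3)])
        show "aa (a + 2 * d) = 0" "aa (b + 2 * d) = 0" using ab by (auto simp: airy_zeros_aa)
        show "finite {x. a \<le> x \<and> x \<le> b \<and> aa (x + 2 * d) = 0}"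
          by (rule ode2_finite_zeros[OF aa_shift_ode _ aa_shift_nontrivial]) (intro continuous_intros)
        fix x assume x: "a < x" "x < b"
        have "airy_zero r - 2 * d \<le> a" "b \<le> airy_zero 1 - 2 * d" using ab mxA by auto
        then have "x \<in> {-R..R}" using x a0 d unfolding R_def by auto
        then show "hpot N x < x + 2 * d" using elim(1) d by fastforce
      qed
      then show "\<exists>t\<in>hezeros N. a < t \<and> t < b" using hezeros_iff[OF N] by blast
    qed simp
    moreover have "\<exists>x. s1 - d < x \<and> x < s0 - d \<and> hfun N x = 0"
    proof (rule sturm[OF hfun_ode[OF N] ode2_shift[OF y(1), of d]])
      show "finite {x. s1 - d \<le> x \<and> x \<le> s0 - d \<and> y (x + d) = 0}"
      proof (rule ode2_finite_zeros[OF ode2_shift[OF y(1), of d]])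
        show "continuous_on UNIV (\<lambda>x. x + d - 0)" by (intro continuous_intros)
        show "\<exists>x. y (x + d) \<noteq> 0" using y(6) by (metis diff_add_cancel)
      qed
      fix x assume x: "s1 - d < x" "x < s0 - d"
      then have "x \<in> {-R..R}" using d unfolding R_def by auto
      then show "hpot N x < x + d - 0" using elim(1) by auto
    qed (use y in auto)
    then obtain t0 where t0: "s1 - d < t0" "t0 \<in> hezeros N" using hezeros_iff[OF N] by blast
    let ?V = "{t\<in>hezeros N. Min ?S < t \<and> t < Max ?S}"
    have mS: "Min ?S \<in> ?S" "Max ?S \<in> ?S" using finS ne by (auto intro: Min_in Max_in simp del: )
    have "Max ?S < t0" using mS(2) mxA t0 y(2) by force
    then have "card (insert t0 ?V) = Suc (card ?V)" by (subst card_insert_disjoint) auto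
    moreover have "card (insert t0 ?V) \<le> card {u \<in> hezeros N. airy_zero r - 2 * d \<le> u}"
    proof (rule card_mono)
      have "airy_zero r - 2 * d \<le> Min ?S" using mS(1) by auto
      moreover have "Min ?S \<le> Max ?S" using finS mS(1) by (intro Max_ge)
      ultimately show "insert t0 ?V \<subseteq> {u \<in> hezeros N. airy_zero r - 2 * d \<le> u}"
        using t0 \<open>Max ?S < t0\<close> by auto
    qed simp
    ultimately have "r \<le> card {u \<in> hezeros N. airy_zero r - 2 * d \<le> u}" using cS by simp
    then show ?case using hze_ge_iff[OF r elim(2)] by simp
  qed
qed

theorem hze_tendsto:
  assumes r: "1 \<le> r"
  shows "hze r \<longlonglongrightarrow> airy_zero r"
proof (rule LIMSEQ_I)
  fix e :: real assume e: "0 < e"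
  have "((\<lambda>N. 2 / (2 * real N powr (1/3))) \<longlongrightarrow> 0) sequentially"
    by (intro tendsto_divide_0[OF tendsto_const] filterlim_at_top_imp_at_infinity
        filterlim_tendsto_pos_mult_at_top[OF tendsto_const] filterlim_nat_powr_at_top) auto
  then have "\<forall>\<^sub>F N in sequentially. 2 / (2 * real N powr (1/3)) < e" by (rule order_tendstoD) (rule e)
  moreover have he: "\<forall>\<^sub>F N in sequentially. airy_zero r - 2 * (e / 3) \<le> hze r N"
    by (rule hze_ge[OF r]) (use e in simp)
  ultimately have "\<forall>\<^sub>F N in sequentially. norm (hze r N - airy_zero r) < e"
    using eventually_ge_at_top[of r]
  proof eventually_elim
    case (elim N)
    then have N: "0 < N" using r by simp
    show ?case using hze_le[OF r elim(3)] elim(1,2) e unfolding hscale_powers(1)[OF N] by (simp add: abs_if)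
  qed
  then show "\<exists>no. \<forall>N\<ge>no. norm (hze r N - airy_zero r) < e" by (simp add: eventually_sequentially)
qed

section \<open>The discrete Airy equation\<close>

lemma airy_ode_third:
  assumes "airy_ode l y y'"
  shows "((\<lambda>x. (x - l) * y x) has_real_derivative y x + (x - l) * y' x) (at x)"
  using ode2D[OF assms, of x] by (auto intro!: derivative_eq_intros simp: algebra_simps)

text \<open>Taylor's formula on both sides: the first-order terms cancel, the second-order terms
  give the equation, and the remainder contains the third derivative
  \<open>y + (x - l) * y'\<close>.\<close>

lemma airy_second_difference:
  assumes y: "airy_ode l y y'" and h: "0 < h"
    and M: "\<And>t. t \<in> {x - h..x + h} \<Longrightarrow> \<bar>y t + (t - l) * y' t\<bar> \<le> M"
  shows "\<bar>y (x + h) - 2 * y x + y (x - h) - h\<^sup>2 * ((x - l) * y x)\<bar> \<le> M * h^3"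
proof -
  let ?d = "\<lambda>m::nat. if m = 0 then y else if m = 1 then y' else if m = 2 then (\<lambda>x. (x - l) * y x) else (\<lambda>x. y x + (x - l) * y' x)"
  have D: "\<forall>m t. m < 3 \<and> a \<le> t \<and> t \<le> b \<longrightarrow> DERIV (?d m) t :> ?d (Suc m) t" for a b
  proof (intro allI impI)
    fix m :: nat and t assume "m < 3 \<and> a \<le> t \<and> t \<le> b"
    then have "m = 0 \<or> m = 1 \<or> m = 2" by auto
    then show "DERIV (?d m) t :> ?d (Suc m) t"
      using ode2D[OF y, of t] airy_ode_third[OF y, of t] by auto
  qed
  have "\<exists>t. (if c < x then c < t \<and> t < x else x < t \<and> t < c) \<and>
      y c = (\<Sum>m<3. (?d m x / fact m) * (c - x)^m) + (?d 3 t / fact 3) * (c - x)^3"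
    if "c \<in> {x - h..x + h}" "c \<noteq> x" for c
    by (rule Taylor[OF _ _ D[of "x - h" "x + h"]]) (use that h in auto)
  from this[of "x + h"] this[of "x - h"] h
  obtain t s where t: "x < t" "t < x + h" "y (x + h) = (\<Sum>m<3. (?d m x / fact m) * h^m) + (?d 3 t / fact 3) * h^3"
    and s: "x - h < s" "s < x" "y (x - h) = (\<Sum>m<3. (?d m x / fact m) * (- h)^m) + (?d 3 s / fact 3) * (- h)^3"
    by (auto split: if_splits)
  have e: "(\<Sum>m<3. (?d m x / fact m) * u^m) = y x + y' x * u + (x - l) * y x / 2 * u\<^sup>2" for u
    by (simp add: eval_nat_numeral)
  have "y (x + h) - 2 * y x + y (x - h) - h\<^sup>2 * ((x - l) * y x) = ((y t + (t - l) * y' t) - (y s + (s - l) * y' s)) * h^3 / 6"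
    unfolding t(3) s(3) e by (simp add: eval_nat_numeral field_simps)
  also have "\<bar>\<dots>\<bar> = \<bar>(y t + (t - l) * y' t) - (y s + (s - l) * y' s)\<bar> * h^3 / 6"
    using h by (simp add: abs_mult)
  also have "\<dots> \<le> (M + M) * h^3 / 6"
    using M[of t] M[of s] t s h by (intro divide_right_mono mult_right_mono) auto
  also have "\<dots> \<le> M * h^3"
  proof -
    have "0 \<le> M" using M[of x] h by fastforce
    then show ?thesis using h by simp
  qed
  finally show ?thesis .
qed

lemma discrete_airy_convergence:
  assumes y: "airy_ode l y y'" "y 0 = 0" "y' 0 = 1" and X: "0 < X"
  shows "\<exists>K. \<forall>h n q. 0 < h \<longrightarrow> h \<le> 1 \<longrightarrow> 0 \<le> n \<longrightarrow> n \<le> 1 \<longrightarrow> q 0 = 0 \<longrightarrow> q 1 = h \<longrightarrow>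
     (\<forall>k\<ge>1. real k * h \<le> X \<longrightarrow> \<bar>q (k + 1) - 2 * q k + q (k - 1) - h\<^sup>2 * ((real k * h - l) * q k)\<bar>
          \<le> h\<^sup>2 * n * (\<bar>q k\<bar> + \<bar>q k - q (k - 1)\<bar> / h)) \<longrightarrow>
     (\<forall>k. real k * h \<le> X \<longrightarrow> \<bar>q k - y (real k * h)\<bar> \<le> K * (n + h) * (real k * h))"
proof -
  obtain C1 where C1: "C1 > 0" "\<forall>x\<in>{0..X + 1}. \<bar>y x\<bar> \<le> C1"
    using continuous_bounded_Icc[OF ode2_continuous_on(1)[OF y(1)]] by blast
  obtain C2 where C2: "C2 > 0" "\<forall>x\<in>{0..X + 1}. \<bar>y' x\<bar> \<le> C2"
    using continuous_bounded_Icc[OF ode2_continuous_on(2)[OF y(1)]] by blast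
  have "continuous_on UNIV (\<lambda>x. (x - l) * y x)"
    by (intro continuous_intros ode2_continuous_on(1)[OF y(1)])
  then obtain M2 where M2: "M2 > 0" "\<forall>x\<in>{0..X + 1}. \<bar>(x - l) * y x\<bar> \<le> M2"
    using continuous_bounded_Icc by blast
  have "continuous_on UNIV (\<lambda>x. y x + (x - l) * y' x)"
    by (intro continuous_intros ode2_continuous_on[OF y(1)])
  then obtain M1 where M1: "M1 > 0" "\<forall>x\<in>{0..X + 1}. \<bar>y x + (x - l) * y' x\<bar> \<le> M1"
    using continuous_bounded_Icc by blast
  define L where "L = X + \<bar>l\<bar>"
  \<comment> \<open>Growth rate per unit of \<open>x\<close>: \<open>L * X\<close> from the
    coefficient of the equation, \<open>X + 1\<close> from the relative error applied to the
    deviation and its difference quotient, the rest from the inhomogeneous terms.\<close>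
  define K2 where "K2 = (L + 1) * X + 1 + (C1 + C2 + M1)"
  have K2: "0 < K2" unfolding K2_def L_def using X C1 C2 M1 by (intro add_nonneg_pos add_nonneg_nonneg mult_nonneg_nonneg) auto
  define K where "K = (1 + M2) * exp (K2 * (X + 1))"
  show ?thesis
  proof (intro exI[of _ K] allI impI)
    fix h n :: real and q :: "nat \<Rightarrow> real" and k0 :: nat
    assume h: "0 < h" "h \<le> 1" and n: "0 \<le> n" "n \<le> 1" and q0: "q 0 = 0" "q 1 = h"
      and rec: "\<forall>k\<ge>1. real k * h \<le> X \<longrightarrow> \<bar>q (k + 1) - 2 * q k + q (k - 1) - h\<^sup>2 * ((real k * h - l) * q k)\<bar>
          \<le> h\<^sup>2 * n * (\<bar>q k\<bar> + \<bar>q k - q (k - 1)\<bar> / h)"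
      and k0: "real k0 * h \<le> X"
    \<comment> \<open>Large enough for the first step, where
      \<open>\<bar>D 1\<bar> \<le> M2 * h\<close>, and for absorbing \<open>n + h\<close> at every
      later step.\<close>
    define Pc where "Pc = (1 + M2) * (n + h)"
    have Pc: "n + h \<le> Pc" "M2 * h \<le> Pc" "0 < Pc"
      unfolding Pc_def using M2(1) h n by (auto simp: distrib_right mult_le_cancel_left1 add_nonneg_pos intro!: mult_pos_pos add_increasing)
    define B where "B k = Pc * (1 + h * K2) ^ k" for k :: nat
    have Bpos: "0 < B k" for k unfolding B_def using Pc h K2 by (intro mult_pos_pos zero_less_power add_pos_pos) auto
    have B1: "n + h \<le> B k" for k
    proof -
      have "1 \<le> (1 + h * K2) ^ k" using h K2 by (intro one_le_power) auto
      then have "Pc * 1 \<le> B k" unfolding B_def using Pc by (intro mult_left_mono) auto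
      then show ?thesis using Pc by simp
    qed
    have BS: "B (Suc k) = B k + h * K2 * B k" for k by (simp add: B_def algebra_simps)
    have Bmono: "B k \<le> B (Suc k)" for k unfolding BS using Bpos[of k] h K2 by simp
    define e where "e k = q k - y (real k * h)" for k
    define D where "D k = (e k - e (k - 1)) / h" for k
    have main: "real k * h \<le> X \<longrightarrow> \<bar>D (Suc k)\<bar> \<le> B (Suc k) \<and> \<bar>e (Suc k)\<bar> \<le> real (Suc k) * h * B (Suc k)" for k
    proof (induction k)
      case 0
      have e1: "\<bar>e 1\<bar> \<le> M2 * h\<^sup>2"
      proof -
        have "\<bar>(y h - h) - (y 0 - 0)\<bar> \<le> M2 * (h - 0)\<^sup>2 / 2"
        proof (rule taylor2_bound[where y'="\<lambda>x. y' x - 1" and ?y2.0="\<lambda>x. (x - l) * y x"])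
          fix x
          show "((\<lambda>x. y x - x) has_real_derivative y' x - 1) (at x)"
            using ode2D(1)[OF y(1), of x] by (auto intro!: derivative_eq_intros)
          show "((\<lambda>x. y' x - 1) has_real_derivative (x - l) * y x) (at x)"
            using ode2D(2)[OF y(1), of x] by (auto intro!: derivative_eq_intros)
          assume "min 0 h < x" "x < max 0 h"
          then show "\<bar>(x - l) * y x\<bar> \<le> M2" using M2(2) h X by auto
        qed (use y in simp)
        also have "\<dots> \<le> M2 * h\<^sup>2" using M2(1) by simp
        finally show ?thesis using q0 y by (simp add: e_def abs_minus_commute)
      qed
      have "e 0 = 0" using q0 y by (simp add: e_def)
      then have D1: "\<bar>D 1\<bar> \<le> M2 * h" using e1 h by (simp add: D_def power2_eq_square field_simps)
      have "Pc \<le> B 1" unfolding B_def using Pc h K2 by simp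
      then have D1': "\<bar>D 1\<bar> \<le> B 1" using D1 Pc by linarith
      have "e 1 = h * D 1" using \<open>e 0 = 0\<close> h by (simp add: D_def)
      then have "\<bar>e 1\<bar> \<le> h * B 1" using D1' h by (simp add: abs_mult)
      then show ?case using D1' by simp
    next
      case (Suc k)
      show ?case
      proof
        assume kX: "real (Suc k) * h \<le> X"
        define j where "j = Suc k"
        define x where "x = real j * h"
        have x: "h \<le> x" "x \<le> X" using kX h unfolding x_def j_def by (simp_all add: algebra_simps)
        have "real k * h \<le> X" using kX h by (simp add: algebra_simps)
        then have IH: "\<bar>D j\<bar> \<le> B j" "\<bar>e j\<bar> \<le> x * B j" using Suc unfolding x_def j_def by auto
        have xs: "real (j + 1) * h = x + h" "real (j - 1) * h = x - h"
          unfolding x_def j_def by (auto simp: algebra_simps)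
        have j1: "j \<ge> 1" by (simp add: j_def)
        define rq where "rq = q (j + 1) - 2 * q j + q (j - 1) - h\<^sup>2 * ((x - l) * q j)"
        define ry where "ry = y (x + h) - 2 * y x + y (x - h) - h\<^sup>2 * ((x - l) * y x)"
        have bq: "\<bar>rq\<bar> \<le> h\<^sup>2 * n * (\<bar>q j\<bar> + \<bar>q j - q (j - 1)\<bar> / h)"
          using rec j1 x unfolding rq_def x_def by blast
        have by1: "\<bar>ry\<bar> \<le> M1 * h^3"
          unfolding ry_def by (rule airy_second_difference[OF y(1) h(1)]) (use M1(2) x h in auto)
        have ex: "e j = q j - y x" "e (j + 1) = q (j + 1) - y (x + h)" "e (j - 1) = q (j - 1) - y (x - h)"
          unfolding e_def xs by (simp_all add: x_def)
        have "D (j + 1) - D j = (e (j + 1) - 2 * e j + e (j - 1)) / h"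
          unfolding D_def using h by (simp add: field_simps)
        also have "e (j + 1) - 2 * e j + e (j - 1) = h\<^sup>2 * ((x - l) * e j) + rq - ry"
          unfolding ex rq_def ry_def by (simp add: algebra_simps)
        finally have DD: "D (j + 1) = D j + (h\<^sup>2 * ((x - l) * e j) + rq - ry) / h" by simp
        have "\<bar>y x\<bar> \<le> C1" using C1(2) x h by auto
        then have qj: "\<bar>q j\<bar> \<le> \<bar>e j\<bar> + C1" unfolding ex by linarith
        have "\<exists>z>x - h. z < x \<and> y x - y (x - h) = (x - (x - h)) * y' z"
          by (rule MVT2) (use h ode2D[OF y(1)] in auto)
        then obtain z where z: "x - h < z" "z < x" "y x - y (x - h) = h * y' z" by auto
        have dq: "\<bar>q j - q (j - 1)\<bar> / h \<le> \<bar>D j\<bar> + C2"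
        proof -
          have "(q j - q (j - 1)) / h = D j + y' z"
            unfolding D_def ex using z(3) h by (simp add: field_simps)
          moreover have "\<bar>y' z\<bar> \<le> C2" using C2(2) z x by auto
          ultimately have "\<bar>(q j - q (j - 1)) / h\<bar> \<le> \<bar>D j\<bar> + C2" by linarith
          then show ?thesis using h by (simp add: abs_divide)
        qed
        have t1: "\<bar>h\<^sup>2 * ((x - l) * e j) / h\<bar> \<le> h * (L * X * B j)"
        proof -
          have "\<bar>x - l\<bar> * \<bar>e j\<bar> \<le> L * (X * B j)"
          proof (intro mult_mono)
            show "\<bar>x - l\<bar> \<le> L" unfolding L_def using x h by linarith
            show "\<bar>e j\<bar> \<le> X * B j" using IH(2) mult_right_mono[OF x(2), of "B j"] Bpos[of j] by linarith
          qed (use X in \<open>auto simp: L_def\<close>)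
          then have "h * (\<bar>x - l\<bar> * \<bar>e j\<bar>) \<le> h * (L * (X * B j))" using h by (intro mult_left_mono) auto
          then show ?thesis using h by (simp add: power2_eq_square abs_mult)
        qed
        have t2: "\<bar>rq / h\<bar> \<le> h * (X * B j + B j + (C1 + C2) * n)"
        proof -
          have "\<bar>rq\<bar> \<le> h\<^sup>2 * n * ((\<bar>e j\<bar> + C1) + (\<bar>D j\<bar> + C2))"
            by (rule order.trans[OF bq mult_left_mono[OF add_mono[OF qj dq]]]) (use n in simp)
          also have "\<dots> = h\<^sup>2 * (n * \<bar>e j\<bar> + n * \<bar>D j\<bar> + (C1 + C2) * n)" by (simp add: algebra_simps)
          also have "\<dots> \<le> h\<^sup>2 * (1 * (X * B j) + 1 * B j + (C1 + C2) * n)"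
          proof (intro mult_left_mono add_mono mult_mono)
            show "\<bar>e j\<bar> \<le> X * B j" using IH(2) mult_right_mono[OF x(2), of "B j"] Bpos[of j] by linarith
          qed (use n IH C1(1) C2(1) in auto)
          finally have "\<bar>rq\<bar> / h \<le> h\<^sup>2 * (X * B j + B j + (C1 + C2) * n) / h" using h by (intro divide_right_mono) auto
          then show ?thesis using h by (simp add: power2_eq_square abs_divide)
        qed
        have t3: "\<bar>ry / h\<bar> \<le> h * (M1 * h)"
        proof -
          have "\<bar>ry\<bar> / h \<le> M1 * h^3 / h" using by1 h by (intro divide_right_mono) auto
          then show ?thesis using h by (simp add: power3_eq_cube abs_divide mult_ac)
        qed
        have "\<bar>D (j + 1)\<bar> \<le> \<bar>D j\<bar> + \<bar>h\<^sup>2 * ((x - l) * e j) / h\<bar> + \<bar>rq / h\<bar> + \<bar>ry / h\<bar>"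
        proof -
          have "\<bar>s + (t + u - v)\<bar> \<le> \<bar>s\<bar> + \<bar>t\<bar> + \<bar>u\<bar> + \<bar>v\<bar>" for s t u v :: real by linarith
          then show ?thesis unfolding DD add_divide_distrib diff_divide_distrib .
        qed
        also have "\<dots> \<le> B j + h * (L * X * B j) + h * (X * B j + B j + (C1 + C2) * n) + h * (M1 * h)"
          by (intro add_mono IH t1 t2 t3)
        also have "\<dots> = B j + h * ((L + 1) * X * B j + B j + ((C1 + C2) * n + M1 * h))"
          by (simp add: algebra_simps)
        also have "\<dots> \<le> B j + h * ((L + 1) * X * B j + B j + (C1 + C2 + M1) * B j)"
        proof -
          have "(C1 + C2) * n + M1 * h \<le> (C1 + C2 + M1) * (n + h)"
            using C1(1) C2(1) M1(1) h n by (simp add: algebra_simps)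
          also have "\<dots> \<le> (C1 + C2 + M1) * B j" using C1(1) C2(1) M1(1) B1 by (intro mult_left_mono) auto
          finally show ?thesis using h by (intro add_left_mono mult_left_mono) auto
        qed
        also have "\<dots> = B (Suc j)" unfolding BS K2_def by (simp add: algebra_simps)
        finally have D: "\<bar>D (Suc j)\<bar> \<le> B (Suc j)" by simp
        have "e (Suc j) = e j + h * D (Suc j)" using h by (simp add: D_def)
        then have "\<bar>e (Suc j)\<bar> \<le> \<bar>e j\<bar> + h * \<bar>D (Suc j)\<bar>" using h abs_triangle_ineq[of "e j" "h * D (Suc j)"] by (simp add: abs_mult)
        also have "\<dots> \<le> x * B (Suc j) + h * B (Suc j)"
        proof (intro add_mono)
          have "x * B j \<le> x * B (Suc j)" using x h by (intro mult_left_mono Bmono) auto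
          then show "\<bar>e j\<bar> \<le> x * B (Suc j)" using IH(2) by linarith
          show "h * \<bar>D (Suc j)\<bar> \<le> h * B (Suc j)" using D h by (intro mult_left_mono) auto
        qed
        also have "\<dots> = real (Suc j) * h * B (Suc j)" by (simp add: x_def algebra_simps)
        finally show "\<bar>D (Suc (Suc k))\<bar> \<le> B (Suc (Suc k)) \<and> \<bar>e (Suc (Suc k))\<bar> \<le> real (Suc (Suc k)) * h * B (Suc (Suc k))"
          using D unfolding j_def by simp
      qed
    qed
    show "\<bar>q k0 - y (real k0 * h)\<bar> \<le> K * (n + h) * (real k0 * h)"
    proof (cases k0)
      case 0 then show ?thesis using q0 y by simp
    next
      case (Suc k)
      have "real k * h \<le> X" using k0 h unfolding Suc by (simp add: algebra_simps)
      then have "\<bar>e k0\<bar> \<le> real k0 * h * B k0" using main[of k] unfolding Suc by simp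
      moreover have "B k0 \<le> K * (n + h)"
      proof -
        have "(1 + h * K2) ^ k0 \<le> exp (h * K2) ^ k0" using h K2 exp_ge_add_one_self[of "h * K2"] by (intro power_mono) auto
        also have "\<dots> = exp (K2 * (real k0 * h))" by (simp add: exp_of_nat_mult[symmetric] mult_ac)
        also have "\<dots> \<le> exp (K2 * (X + 1))" using k0 K2 by simp
        finally have "B k0 \<le> Pc * exp (K2 * (X + 1))" unfolding B_def using Pc by (intro mult_left_mono) auto
        then show ?thesis by (simp add: Pc_def K_def mult_ac)
      qed
      then have "real k0 * h * B k0 \<le> real k0 * h * (K * (n + h))" using h by (intro mult_left_mono) auto
      ultimately have "\<bar>e k0\<bar> \<le> real k0 * h * (K * (n + h))" by linarith
      then show ?thesis by (simp add: e_def mult_ac)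
    qed
  qed
qed

lemma riemann_sum_error:
  fixes f :: "real \<Rightarrow> real"
  assumes f: "continuous_on UNIV f" and h: "0 < h"
    and osc: "\<And>s t. 0 \<le> s \<Longrightarrow> s \<le> t \<Longrightarrow> t \<le> real n * h \<Longrightarrow> t - s \<le> h \<Longrightarrow> \<bar>f t - f s\<bar> \<le> w"
  shows "\<bar>(\<Sum>k=1..n. h * f (real k * h)) - integral {0..real n * h} f\<bar> \<le> real n * h * w"
  using osc
proof (induction n)
  case (Suc n)
  let ?a = "real n * h" and ?b = "real (Suc n) * h"
  have ab: "0 \<le> ?a" "?a \<le> ?b" "?b - ?a = h" using h by (auto simp: algebra_simps)
  have io: "f integrable_on {u..v}" for u v
    by (rule integrable_continuous_real) (rule continuous_on_subset[OF f], simp)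
  have "integral {0..?a} f + integral {?a..?b} f = integral {0..?b} f"
    using ab by (intro Henstock_Kurzweil_Integration.integral_combine io) auto
  moreover have "\<bar>h * f ?b - integral {?a..?b} f\<bar> \<le> w * h"
  proof -
    have "integral {?a..?b} (\<lambda>t. f ?b - f t) = integral {?a..?b} (\<lambda>t. f ?b) - integral {?a..?b} f"
      by (intro Henstock_Kurzweil_Integration.integral_diff io) auto
    also have "integral {?a..?b} (\<lambda>t. f ?b) = h * f ?b" using ab by simp
    finally have "h * f ?b - integral {?a..?b} f = integral {?a..?b} (\<lambda>t. f ?b - f t)" by simp
    moreover have "norm (integral {?a..?b} (\<lambda>t. f ?b - f t)) \<le> w * (?b - ?a)"
    proof (rule integral_bound[OF ab(2)])
      show "continuous_on {?a..?b} (\<lambda>t. f ?b - f t)"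
        by (intro continuous_intros continuous_on_subset[OF f]) auto
      fix t assume t: "t \<in> {?a..?b}"
      then have "0 \<le> t" "t \<le> ?b" "?b - t \<le> h" using ab unfolding atLeastAtMost_iff by linarith+
      then have "\<bar>f ?b - f t\<bar> \<le> w" by (intro Suc.prems) auto
      then show "norm (f ?b - f t) \<le> w" by simp
    qed
    ultimately show ?thesis using ab(3) by simp
  qed
  moreover have "\<bar>(\<Sum>k=1..n. h * f (real k * h)) - integral {0..?a} f\<bar> \<le> ?a * w"
    by (rule Suc.IH, rule Suc.prems) (use h in \<open>auto simp: algebra_simps\<close>)
  moreover have "(\<Sum>k=1..Suc n. h * f (real k * h)) = (\<Sum>k=1..n. h * f (real k * h)) + h * f ?b" by simp
  ultimately have "\<bar>(\<Sum>k=1..Suc n. h * f (real k * h)) - integral {0..?b} f\<bar> \<le> ?a * w + w * h"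
    by linarith
  then show ?case by (simp add: algebra_simps)
qed simp

section \<open>The dual polynomials as a discrete Airy function\<close>

definition mesh :: "nat \<Rightarrow> real" where "mesh N = real N powr (- (1/3))"

lemma mesh:
  assumes "0 < N"
  shows "0 < mesh N" "mesh N \<le> 1" "mesh N ^ 3 * real N = 1" "real N powr (1/3) * mesh N = 1"
proof -
  show "0 < mesh N" using assms by (simp add: mesh_def)
  have "real N powr (- (1/3)) \<le> real N powr 0" using assms by (intro powr_mono) auto
  then show "mesh N \<le> 1" using assms by (simp add: mesh_def)
  have "mesh N ^ 3 = real N powr (-1)" using assms by (simp add: mesh_def powr_power)
  then show "mesh N ^ 3 * real N = 1" using assms by (simp add: powr_minus)
  show "real N powr (1/3) * mesh N = 1" using assms by (simp add: mesh_def powr_add[symmetric])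
qed

lemma mesh_tendsto: "mesh \<longlonglongrightarrow> 0"
proof -
  have "(\<lambda>N. inverse (real N powr (1/3))) \<longlonglongrightarrow> 0"
    by (intro tendsto_inverse_0_at_top filterlim_nat_powr_at_top) simp
  then show ?thesis by (simp add: mesh_def[abs_def] powr_minus)
qed

text \<open>The index is shifted by one against \<open>hdual\<close>, so that the sequence starts
  with the boundary value 0, due to \<open>z\<close> being a zero of \<open>hermite N\<close>; the
  factor \<open>mesh N\<close> makes the first difference quotient 1.\<close>

definition hq :: "nat \<Rightarrow> real \<Rightarrow> nat \<Rightarrow> real" where
  "hq N z k = mesh N * (horth (N - k) z / horth (N - 1) z)"

lemma hq_initial:
  assumes "z \<in> hzeros N"
  shows "hq N z 0 = 0" "hq N z 1 = mesh N"
  using assms hermite_pred_nonzero[OF assms] by (auto simp: hq_def horth_def hzeros_def)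

lemma hq_Suc: "hq N z (Suc k) = mesh N * hdual N z k"
  by (simp add: hq_def hdual_def)

lemma sum_Suc_interval: "(\<Sum>k=1..n. f k) = (\<Sum>k<n. f (Suc k))"
  by (simp add: sum.atLeast1_atMost_eq)

text \<open>The first sum is the discrete counterpart of the total mass 1 of the square of
  \<open>ef\<close> and will control the tail of the second, the rescaled variance.\<close>

lemma hq_sums:
  assumes z: "z \<in> hzeros N"
  shows "(\<Sum>k=1..N. mesh N * (hq N z k)\<^sup>2) = 1"
    "(\<Sum>k=1..N. (hq N z k)\<^sup>2 / real k) = real N powr (1/3) * hvar N z"
proof -
  have N: "0 < N" by (rule hermite_pred_nonzero(3)[OF z])
  have "(\<Sum>k=1..N. mesh N * (hq N z k)\<^sup>2) = mesh N ^ 3 * (\<Sum>k<N. hdual N z k * hdual N z k)"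
    unfolding sum_Suc_interval hq_Suc by (simp add: sum_distrib_left power2_eq_square power3_eq_cube mult_ac)
  then show "(\<Sum>k=1..N. mesh N * (hq N z k)\<^sup>2) = 1"
    unfolding hdual_orthogonal[OF z z] using mesh(3)[OF N] by simp
  have "(\<Sum>k=1..N. (hq N z k)\<^sup>2 / real k) = (mesh N)\<^sup>2 * (\<Sum>k<N. (hdual N z k)\<^sup>2 / (real k + 1))"
    unfolding sum_Suc_interval hq_Suc by (simp add: sum_distrib_left power_mult_distrib add.commute)
  also have "(\<Sum>k<N. (hdual N z k)\<^sup>2 / (real k + 1)) = real N * hvar N z"
    using N by (simp add: hvar_def)
  also have "(mesh N)\<^sup>2 * (real N * hvar N z) = real N powr (1/3) * hvar N z"
  proof -
    have "(mesh N)\<^sup>2 * real N = (mesh N)\<^sup>2 * real N * (real N powr (1/3) * mesh N)" using mesh(4)[OF N] by simp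
    also have "\<dots> = (mesh N ^ 3 * real N) * real N powr (1/3)" by (simp add: power2_eq_square power3_eq_cube mult_ac)
    finally have "(mesh N)\<^sup>2 * real N = real N powr (1/3)" using mesh(3)[OF N] by simp
    then show ?thesis by (simp add: mult.assoc[symmetric])
  qed
  finally show "(\<Sum>k=1..N. (hq N z k)\<^sup>2 / real k) = real N powr (1/3) * hvar N z" .
qed

lemma horth_rec:
  "x * horth (Suc n) x = sqrt ((real n + 2) / 2) * horth (Suc (Suc n)) x + sqrt ((real n + 1) / 2) * horth n x"
proof -
  let ?H = "\<lambda>n. poly (hermite n) x"
  define c where "c = sqrt (2 ^ n * fact n :: real)"
  have c: "c > 0" by (simp add: c_def)
  define a where "a = sqrt (2 * (real n + 1))"
  define b where "b = sqrt (2 * (real n + 2))"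
  have a: "a > 0" "a * a = 2 * (real n + 1)" and b: "b > 0" "b * b = 2 * (real n + 2)"
    by (simp_all add: a_def b_def)
  have s1: "sqrt (2 ^ Suc n * fact (Suc n)) = a * c"
    unfolding a_def c_def real_sqrt_mult[symmetric] by (simp add: mult_ac add.commute)
  have s2: "sqrt (2 ^ Suc (Suc n) * fact (Suc (Suc n))) = b * (a * c)"
    unfolding s1[symmetric] b_def real_sqrt_mult[symmetric] by (simp add: mult_ac add.commute)
  have b2: "sqrt ((real n + 2) / 2) = b / 2" and a2: "sqrt ((real n + 1) / 2) = a / 2"
    unfolding a_def b_def by (rule real_sqrt_unique; simp add: power_divide)+
  have "x * horth (Suc n) x = x * ?H (Suc n) / (a * c)" unfolding horth_def s1 by simp
  also have "\<dots> = (?H (Suc (Suc n)) + 2 * (real n + 1) * ?H n) / 2 / (a * c)"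
    unfolding hermite_rec by simp
  also have "\<dots> = b / 2 * (?H (Suc (Suc n)) / (b * (a * c))) + a / 2 * (?H n / c)"
    unfolding a(2)[symmetric] using a(1) b(1) c by (simp add: add_divide_distrib)
  finally show ?thesis unfolding b2 a2 unfolding horth_def s2 c_def by simp
qed

lemma hq_rec:
  assumes k: "1 \<le> k" "k < N"
  shows "z * hq N z k = sqrt ((real N - real k) / 2) * hq N z (k + 1) + sqrt ((real N - real k + 1) / 2) * hq N z (k - 1)"
proof -
  obtain n where n: "N - k = Suc n" using k by (metis Suc_diff_Suc)
  have i: "N - (k + 1) = n" "N - (k - 1) = Suc (Suc n)" "real N - real k = real n + 1"
    using n k by auto
  have "z * hq N z k = mesh N / horth (N - 1) z * (z * horth (Suc n) z)" by (simp add: hq_def n)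
  also have "\<dots> = mesh N / horth (N - 1) z * (sqrt ((real n + 2) / 2) * horth (Suc (Suc n)) z + sqrt ((real n + 1) / 2) * horth n z)"
    unfolding horth_rec ..
  also have "\<dots> = sqrt ((real n + 1) / 2) * hq N z (k + 1) + sqrt ((real n + 2) / 2) * hq N z (k - 1)"
    unfolding hq_def i(1,2) by (simp add: algebra_simps)
  finally show ?thesis unfolding i(3) by (simp add: add.assoc)
qed

lemma sqrt_one_plus_le: "0 \<le> (a::real) \<Longrightarrow> sqrt (1 + a) \<le> 1 + a / 2"
  by (rule real_le_lsqrt) (auto simp: power2_eq_square algebra_simps)

text \<open>With \<open>s = sqrt (1 - c)\<close> the remainder is exactly
  \<open>(1 - s)\<^sup>2 * (s + 2) / (2 * s)\<close>, and \<open>c = (1 - s) * (1 + s)\<close> turns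
  the first factor into \<open>c\<^sup>2\<close>.\<close>

lemma inverse_sqrt_bound:
  fixes c :: real
  assumes "0 \<le> c" "c \<le> 1/2"
  shows "\<bar>1 / sqrt (1 - c) - 1 - c / 2\<bar> \<le> 2 * c\<^sup>2"
proof -
  define s where "s = sqrt (1 - c)"
  have s2: "s\<^sup>2 = 1 - c" unfolding s_def using assms by simp
  have s: "1/2 \<le> s" "s \<le> 1"
  proof -
    show "1/2 \<le> s" unfolding s_def by (rule real_le_rsqrt) (use assms in \<open>simp add: power2_eq_square\<close>)
    show "s \<le> 1" unfolding s_def using assms by simp
  qed
  have c: "c = 1 - s\<^sup>2" using s2 by simp
  have "1 / s - 1 - c / 2 = (1 - s)\<^sup>2 * ((s + 2) / (2 * s))"
    unfolding c using s by (simp add: field_simps power2_eq_square)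
  moreover have "0 \<le> (s + 2) / (2 * s)" "(s + 2) / (2 * s) \<le> 2 * (1 + s)\<^sup>2"
  proof -
    show "0 \<le> (s + 2) / (2 * s)" using s by simp
    have "(s + 2) / (2 * s) \<le> 3" using s by (simp add: field_simps)
    also have "3 \<le> 2 * (1 + s)\<^sup>2"
      using s power_mono[of "3/2" "1 + s" 2] by (simp add: power2_eq_square)
    finally show "(s + 2) / (2 * s) \<le> 2 * (1 + s)\<^sup>2" .
  qed
  ultimately have "\<bar>1 / s - 1 - c / 2\<bar> \<le> (1 - s)\<^sup>2 * (2 * (1 + s)\<^sup>2)"
    by (simp only: abs_of_nonneg mult_nonneg_nonneg zero_le_power2 mult_left_mono)
  also have "\<dots> = 2 * c\<^sup>2" unfolding c by (simp add: power2_eq_square algebra_simps)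
  finally show ?thesis by (simp add: s_def)
qed

text \<open>Divide the recursion by the weight \<open>A\<close> of \<open>q (k + 1)\<close>. The
  expansion of \<open>z / A\<close> gives \<open>2 + c - lN * h\<^sup>2\<close> up to smaller terms,
  with \<open>c = x * h\<^sup>2\<close>, and \<open>q (k - 1)\<close> gets the weight
  \<open>1 + d\<close> with \<open>d \<le> h^3\<close>. Splitting off
  \<open>d * (q k - q (k - 1))\<close> brings the difference quotient into the bound.\<close>

lemma hq_second_difference:
  assumes k: "1 \<le> k" "2 * k \<le> N" and kX: "real k * mesh N \<le> X"
    and z: "z = sqrt (2 * real N) * (1 - lN * (mesh N)\<^sup>2 / 2)"
  shows "\<bar>hq N z (k + 1) - 2 * hq N z k + hq N z (k - 1) - (mesh N)\<^sup>2 * ((real k * mesh N - l) * hq N z k)\<bar>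
     \<le> (mesh N)\<^sup>2 * (\<bar>l - lN\<bar> + (4 * X\<^sup>2 + \<bar>lN\<bar> * (X + 2 * X\<^sup>2) + 1) * mesh N)
        * (\<bar>hq N z k\<bar> + \<bar>hq N z k - hq N z (k - 1)\<bar> / mesh N)"
proof -
  have N: "0 < N" using k by simp
  note m = mesh[OF N]
  define h where "h = mesh N"
  have h: "0 < h" "h \<le> 1" "h^3 * real N = 1" using m by (auto simp: h_def)
  have iN: "1 / real N = h^3" using h(3) N by (simp add: field_simps)
  define q where "q = hq N z"
  define x where "x = real k * h"
  have x: "0 \<le> x" "x \<le> X" using kX h by (auto simp: x_def h_def)
  define c where "c = real k / real N"
  have c: "0 \<le> c" "c \<le> 1/2" "c = x * h\<^sup>2"
  proof -
    show "0 \<le> c" "c \<le> 1/2" using k N by (auto simp: c_def field_simps)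
    have "c = real k * (1 / real N)" by (simp add: c_def)
    then show "c = x * h\<^sup>2" unfolding iN by (simp add: x_def power2_eq_square power3_eq_cube)
  qed
  define A where "A = sqrt ((real N - real k) / 2)"
  define B where "B = sqrt ((real N - real k + 1) / 2)"
  have Nk: "real N / 2 \<le> real N - real k" using k by simp
  have A: "0 < A" unfolding A_def using Nk N by simp
  define rho where "rho = 1 / sqrt (1 - c) - 1 - c / 2"
  have rho: "\<bar>rho\<bar> \<le> 2 * c\<^sup>2" unfolding rho_def by (rule inverse_sqrt_bound[OF c(1,2)])
  have zA: "z / A = 2 * (1 - lN * h\<^sup>2 / 2) * (1 + c / 2 + rho)"
  proof -
    have "(real N - real k) / 2 = (2 * real N) * ((1 - c) / 4)" using N by (simp add: c_def field_simps)
    then have "A = sqrt (2 * real N) * sqrt ((1 - c) / 4)" unfolding A_def by (simp only: real_sqrt_mult)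
    moreover have "sqrt ((1 - c) / 4) = sqrt (1 - c) / 2" unfolding real_sqrt_divide by simp
    ultimately have "A = sqrt (2 * real N) * (sqrt (1 - c) / 2)" by (simp only:)
    moreover have "sqrt (2 * real N) > 0" using N by simp
    ultimately have "z / A = (1 - lN * h\<^sup>2 / 2) / (sqrt (1 - c) / 2)"
      unfolding z h_def[symmetric] using mult_divide_mult_cancel_left[of "sqrt (2 * real N)"] by force
    then show ?thesis by (simp add: rho_def)
  qed
  define d where "d = B / A - 1"
  have d: "0 \<le> d" "d \<le> h^3"
  proof -
    have "B / A = sqrt (1 + 1 / (real N - real k))"
      unfolding A_def B_def real_sqrt_divide[symmetric] using Nk N by (simp add: add_divide_distrib)
    moreover have "1 \<le> sqrt (1 + 1 / (real N - real k))" using Nk N by simp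
    moreover have "sqrt (1 + 1 / (real N - real k)) \<le> 1 + 1 / (real N - real k) / 2"
      using sqrt_one_plus_le[of "1 / (real N - real k)"] Nk N by simp
    moreover have "1 / (real N - real k) / 2 \<le> 1 / real N"
    proof -
      have "1 / (real N - real k) \<le> 2 / real N" using Nk N frac_le[of 1 1 "real N / 2" "real N - real k"] by simp
      from divide_right_mono[OF this, of 2] show ?thesis by simp
    qed
    ultimately show "0 \<le> d" "d \<le> h^3" unfolding d_def iN[symmetric] by auto
  qed
  have rec: "z * q k = A * q (k + 1) + B * q (k - 1)"
    unfolding q_def A_def B_def by (rule hq_rec) (use k in auto)
  then have q1: "q (k + 1) = z / A * q k - (1 + d) * q (k - 1)"
    using A by (simp add: d_def field_simps)
  define E where "E = h\<^sup>2 * (l - lN) + 2 * rho - lN * h\<^sup>2 * (c / 2 + rho) - d"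
  have id: "q (k + 1) - 2 * q k + q (k - 1) - h\<^sup>2 * ((x - l) * q k) = E * q k + d * (q k - q (k - 1))"
  proof -
    have "2 * (1 - lN * h\<^sup>2 / 2) * (1 + c / 2 + rho) = 2 + c - lN * h\<^sup>2 + 2 * rho - lN * h\<^sup>2 * (c / 2 + rho)"
      by (simp add: field_simps)
    moreover have "h\<^sup>2 * ((x - l) * q k) = (c - h\<^sup>2 * l) * q k" unfolding c(3) by (simp add: algebra_simps)
    ultimately show ?thesis unfolding q1 zA E_def by (simp only:) (simp add: algebra_simps)
  qed
  have Eb: "\<bar>E\<bar> \<le> h\<^sup>2 * (\<bar>l - lN\<bar> + (4 * X\<^sup>2 + \<bar>lN\<bar> * (X + 2 * X\<^sup>2) + 1) * h)"
  proof -
    have cX: "c \<le> X * h\<^sup>2" unfolding c(3) using x by (intro mult_right_mono) auto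
    have r1: "\<bar>rho\<bar> \<le> 2 * X\<^sup>2 * h^3"
    proof -
      have "c\<^sup>2 \<le> (X * h\<^sup>2)\<^sup>2" using cX c(1) by (intro power_mono) auto
      also have "\<dots> = X\<^sup>2 * h^3 * h" by (simp add: power_mult_distrib eval_nat_numeral)
      also have "\<dots> \<le> X\<^sup>2 * h^3" using h by (intro mult_left_le) auto
      finally show ?thesis using rho by linarith
    qed
    have "\<bar>c / 2 + rho\<bar> \<le> (X + 2 * X\<^sup>2) * h"
    proof -
      have "h\<^sup>2 \<le> h" "h^3 \<le> h" using h power_decreasing[of 1 2 h] power_decreasing[of 1 3 h] by auto
      then have "X * h\<^sup>2 \<le> X * h" "2 * X\<^sup>2 * h^3 \<le> 2 * X\<^sup>2 * h" using x by (auto intro!: mult_left_mono)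
      then have "\<bar>c / 2 + rho\<bar> \<le> X * h + 2 * X\<^sup>2 * h" using cX c(1) r1 by linarith
      then show ?thesis by (simp add: algebra_simps)
    qed
    then have "\<bar>lN * h\<^sup>2 * (c / 2 + rho)\<bar> \<le> \<bar>lN\<bar> * h\<^sup>2 * ((X + 2 * X\<^sup>2) * h)"
      unfolding abs_mult using h by (intro mult_mono) auto
    then have "\<bar>E\<bar> \<le> h\<^sup>2 * \<bar>l - lN\<bar> + 2 * (2 * X\<^sup>2 * h^3) + \<bar>lN\<bar> * h\<^sup>2 * ((X + 2 * X\<^sup>2) * h) + h^3"
      unfolding E_def using r1 d abs_mult[of "h\<^sup>2" "l - lN"] by auto
    also have "\<dots> = h\<^sup>2 * (\<bar>l - lN\<bar> + (4 * X\<^sup>2 + \<bar>lN\<bar> * (X + 2 * X\<^sup>2) + 1) * h)"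
      by (simp add: algebra_simps power2_eq_square power3_eq_cube)
    finally show ?thesis .
  qed
  let ?n = "\<bar>l - lN\<bar> + (4 * X\<^sup>2 + \<bar>lN\<bar> * (X + 2 * X\<^sup>2) + 1) * h"
  have hn: "h \<le> ?n"
  proof -
    have "1 \<le> 4 * X\<^sup>2 + \<bar>lN\<bar> * (X + 2 * X\<^sup>2) + 1" using x by simp
    then have "1 * h \<le> (4 * X\<^sup>2 + \<bar>lN\<bar> * (X + 2 * X\<^sup>2) + 1) * h" using h by (intro mult_right_mono) auto
    then show ?thesis by simp
  qed
  have "\<bar>E * q k + d * (q k - q (k - 1))\<bar> \<le> \<bar>E\<bar> * \<bar>q k\<bar> + d * \<bar>q k - q (k - 1)\<bar>"
    using abs_triangle_ineq[of "E * q k" "d * (q k - q (k - 1))"] d by (simp add: abs_mult)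
  also have "\<dots> \<le> h\<^sup>2 * ?n * \<bar>q k\<bar> + h\<^sup>2 * ?n * (\<bar>q k - q (k - 1)\<bar> / h)"
  proof (intro add_mono mult_right_mono Eb)
    have "d * \<bar>q k - q (k - 1)\<bar> \<le> h^3 * \<bar>q k - q (k - 1)\<bar>" using d by (intro mult_right_mono) auto
    also have "\<dots> = h\<^sup>2 * h * h * (\<bar>q k - q (k - 1)\<bar> / h)" using h by (simp add: power2_eq_square power3_eq_cube)
    also have "\<dots> \<le> h\<^sup>2 * ?n * 1 * (\<bar>q k - q (k - 1)\<bar> / h)"
      using h hn by (intro mult_right_mono mult_mono mult_left_mono) (auto intro: order.trans[OF _ hn])
    finally show "d * \<bar>q k - q (k - 1)\<bar> \<le> h\<^sup>2 * ?n * (\<bar>q k - q (k - 1)\<bar> / h)" by simp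
  qed auto
  also have "\<dots> = h\<^sup>2 * ?n * (\<bar>q k\<bar> + \<bar>q k - q (k - 1)\<bar> / h)" by (simp add: distrib_left)
  finally show ?thesis
    unfolding id[symmetric] unfolding q_def h_def x_def .
qed

text \<open>Rests on \<open>1 / hscale N = sqrt (2 * real N) * (mesh N)\<^sup>2 / 2\<close>, a
  consequence of the square and the cube of \<open>hscale N\<close>.\<close>

lemma hermite_zero_edge:
  assumes "0 < N"
  shows "hermite_zero N (N - r + 1) = sqrt (2 * real N) * (1 - (- hze r N) * (mesh N)\<^sup>2 / 2)"
proof -
  let ?z = "hermite_zero N (N - r + 1)" and ?b = "hscale N" and ?s = "sqrt (2 * real N)"
  have b: "0 < ?b" by (rule hscale_pos[OF assms])
  have s: "0 < ?s" using assms by simp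
  have m: "0 < mesh N" by (rule mesh(1)[OF assms])
  have "?b\<^sup>2 * mesh N = 2" using hscale_powers(1)[OF assms] mesh(4)[OF assms] by simp
  then have b2: "?b\<^sup>2 = 2 / mesh N" using m by (simp add: field_simps)
  have "?b\<^sup>2 * ?b\<^sup>2 = ?b^3 * ?b" by (simp add: eval_nat_numeral)
  then have "(2 / mesh N) * (2 / mesh N) = 2 * ?s * ?b" unfolding hscale_powers(2)[OF assms] b2 .
  then have "1 / ?b = ?s * (mesh N)\<^sup>2 / 2" using m b s by (simp add: field_simps power2_eq_square)
  moreover have "?z = ?s + hze r N * (1 / ?b)" using b by (simp add: hze_def hedge_def)
  ultimately have "?z = ?s + hze r N * (?s * (mesh N)\<^sup>2 / 2)" by (simp only:)
  then show ?thesis by (simp add: algebra_simps)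
qed

text \<open>Both errors of the discretisation, the distance of \<open>hze r N\<close> from its limit
  and the mesh width, tend to 0, so the constant \<open>K * (n N + mesh N)\<close> falls below
  \<open>e\<close>.\<close>

lemma hq_converges:
  assumes r: "1 \<le> r" and X: "0 < X" and e: "0 < e"
  shows "\<forall>\<^sub>F N in sequentially. \<forall>k. real k * mesh N \<le> X \<longrightarrow>
     \<bar>hq N (hermite_zero N (N - r + 1)) k - ef r (real k * mesh N)\<bar> \<le> e * (real k * mesh N)"
proof -
  obtain K where K: "\<And>h n q k. 0 < h \<Longrightarrow> h \<le> 1 \<Longrightarrow> 0 \<le> n \<Longrightarrow> n \<le> 1 \<Longrightarrow> q 0 = 0 \<Longrightarrow> q 1 = h \<Longrightarrow>
     (\<forall>k\<ge>1. real k * h \<le> X \<longrightarrow> \<bar>q (k + 1) - 2 * q k + q (k - 1) - h\<^sup>2 * ((real k * h - ev r) * q k)\<bar>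
          \<le> h\<^sup>2 * n * (\<bar>q k\<bar> + \<bar>q k - q (k - 1)\<bar> / h)) \<Longrightarrow> real k * h \<le> X \<Longrightarrow> \<bar>q k - ef r (real k * h)\<bar> \<le> K * (n + h) * (real k * h)"
    using discrete_airy_convergence[OF ef_ode ef_0[OF r] X] by metis
  define lN where "lN N = - hze r N" for N
  define n where "n N = \<bar>ev r - lN N\<bar> + (4 * X\<^sup>2 + \<bar>lN N\<bar> * (X + 2 * X\<^sup>2) + 1) * mesh N" for N
  have lN: "lN \<longlonglongrightarrow> ev r" unfolding lN_def[abs_def] ev_def by (intro tendsto_intros hze_tendsto r)
  have "n \<longlonglongrightarrow> \<bar>ev r - ev r\<bar> + (4 * X\<^sup>2 + \<bar>ev r\<bar> * (X + 2 * X\<^sup>2) + 1) * 0"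
    unfolding n_def[abs_def] by (intro tendsto_intros lN mesh_tendsto)
  then have n0: "n \<longlonglongrightarrow> 0" by simp
  have "(\<lambda>N. K * (n N + mesh N)) \<longlonglongrightarrow> K * (0 + 0)" by (intro tendsto_intros n0 mesh_tendsto)
  then have "\<forall>\<^sub>F N in sequentially. K * (n N + mesh N) < e" using e by (intro order_tendstoD(2)) auto
  moreover have "\<forall>\<^sub>F N in sequentially. n N < 1" using n0 by (rule order_tendstoD(2)) simp
  moreover have "(\<lambda>N. 2 * X * (mesh N)\<^sup>2) \<longlonglongrightarrow> 2 * X * 0\<^sup>2" by (intro tendsto_intros mesh_tendsto)
  then have "\<forall>\<^sub>F N in sequentially. 2 * X * (mesh N)\<^sup>2 < 1" by (intro order_tendstoD(2)) auto
  ultimately show ?thesis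
    using eventually_ge_at_top[of r]
  proof eventually_elim
    case (elim N)
    have N: "0 < N" using r elim by simp
    note m = mesh[OF N]
    let ?z = "hermite_zero N (N - r + 1)"
    have z: "?z \<in> hzeros N" by (rule hermite_zero_in) (use elim r in auto)
    show ?case
    proof (intro allI impI)
      fix k assume k: "real k * mesh N \<le> X"
      have "\<bar>hq N ?z k - ef r (real k * mesh N)\<bar> \<le> K * (n N + mesh N) * (real k * mesh N)"
      proof (rule K[OF m(1,2) _ _ hq_initial[OF z] _ k])
        show "0 \<le> n N" unfolding n_def using m X by (intro add_nonneg_nonneg mult_nonneg_nonneg) auto
        show "n N \<le> 1" using elim by simp
        show "\<forall>k\<ge>1. real k * mesh N \<le> X \<longrightarrow> \<bar>hq N ?z (k + 1) - 2 * hq N ?z k + hq N ?z (k - 1) - (mesh N)\<^sup>2 * ((real k * mesh N - ev r) * hq N ?z k)\<bar>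
          \<le> (mesh N)\<^sup>2 * n N * (\<bar>hq N ?z k\<bar> + \<bar>hq N ?z k - hq N ?z (k - 1)\<bar> / mesh N)"
        proof (intro allI impI)
          fix k :: nat assume k: "1 \<le> k" "real k * mesh N \<le> X"
          \<comment> \<open>For \<open>real k * mesh N \<le> X\<close> the index is at most of order
            \<open>real N powr (1/3)\<close>, far below \<open>N / 2\<close>.\<close>
          have "2 * real k \<le> real N"
          proof -
            have "2 * real k * (mesh N ^ 3) \<le> 2 * X * (mesh N)\<^sup>2"
              using mult_right_mono[OF k(2), of "2 * (mesh N)\<^sup>2"] by (simp add: power2_eq_square power3_eq_cube mult_ac)
            also have "\<dots> \<le> mesh N ^ 3 * real N" using elim(3) m(3) by simp
            finally show ?thesis using m(1) by (simp add: mult.commute)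
          qed
          then have "2 * k \<le> N" by linarith
          then show "\<bar>hq N ?z (k + 1) - 2 * hq N ?z k + hq N ?z (k - 1) - (mesh N)\<^sup>2 * ((real k * mesh N - ev r) * hq N ?z k)\<bar>
          \<le> (mesh N)\<^sup>2 * n N * (\<bar>hq N ?z k\<bar> + \<bar>hq N ?z k - hq N ?z (k - 1)\<bar> / mesh N)"
            unfolding n_def lN_def
            by (rule hq_second_difference[OF k(1) _ k(2)]) (rule hermite_zero_edge[OF N])
        qed
      qed
      also have "\<dots> \<le> e * (real k * mesh N)" using elim(1) m by (intro mult_right_mono) auto
      finally show "\<bar>hq N ?z k - ef r (real k * mesh N)\<bar> \<le> e * (real k * mesh N)" .
    qed
  qed
qed

text \<open>Beyond \<open>X\<close> the weight \<open>1 / k\<close> is below \<open>h / X\<close>,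
  so the normalised sum of squares bounds the tail. The five errors, each at most
  \<open>eps / 8\<close>, are the two tails, the replacement of \<open>hq\<close> by
  \<open>ef\<close>, the Riemann sum and the incomplete last cell.\<close>

lemma hvar_limit:
  assumes r: "1 \<le> r"
  shows "(\<lambda>N. real N powr (1/3) * hvar N (hermite_zero N (N - r + 1))) \<longlonglongrightarrow> sigma2_max r"
proof (rule LIMSEQ_I)
  fix eps :: real assume eps: "0 < eps"
  define X where "X = 8 / eps"
  have X: "0 < X" "1 / X = eps / 8" using eps by (auto simp: X_def)
  define F where "F = s2i r"
  have F: "continuous_on UNIV F" unfolding F_def by (rule s2i_continuous_on[OF r])
  obtain C where C: "0 < C" "\<forall>x\<in>{0..X}. \<bar>ef r x\<bar> \<le> C \<and> \<bar>ef' r x\<bar> \<le> C"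
    using ef_lipschitz by blast
  obtain C' where C': "0 < C'" "\<forall>x\<in>{0..X}. \<bar>F x\<bar> \<le> C'" using continuous_bounded_Icc[OF F] by blast
  define w where "w = eps / (8 * X)"
  have w: "0 < w" "X * w = eps / 8" using eps X by (auto simp: w_def)
  have "uniformly_continuous_on {0..X} F"
    by (rule compact_uniformly_continuous[OF continuous_on_subset[OF F]]) auto
  then obtain d where d: "0 < d" "\<And>s t. s \<in> {0..X} \<Longrightarrow> t \<in> {0..X} \<Longrightarrow> \<bar>t - s\<bar> < d \<Longrightarrow> \<bar>F t - F s\<bar> < w"
    unfolding uniformly_continuous_on_def dist_real_def using w(1) by metis
  \<comment> \<open>In the difference of squares divided by \<open>k\<close>, the error
    \<open>e * (real k * h)\<close> cancels the \<open>k\<close> and the other factor is at most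
    \<open>2 * C + X\<close>; summed up to \<open>X\<close> this is at most
    \<open>eps / 8\<close>.\<close>
  define e where "e = min 1 (eps / (8 * X * (2 * C + X)))"
  have cx: "0 < 8 * X * (2 * C + X)" using X C by (intro mult_pos_pos add_pos_pos) auto
  have e: "0 < e" "e \<le> 1" "X * (e * (2 * C + X)) \<le> eps / 8"
  proof -
    show "0 < e" "e \<le> 1" unfolding e_def using eps cx by auto
    have "e \<le> eps / (8 * X * (2 * C + X))" by (simp add: e_def)
    then have "e * (8 * X * (2 * C + X)) \<le> eps" using cx by (simp add: pos_le_divide_eq)
    then show "X * (e * (2 * C + X)) \<le> eps / 8" by (simp add: mult_ac)
  qed
  have "\<forall>\<^sub>F N in sequentially. mesh N < min d (eps / (8 * C'))"
    using mesh_tendsto by (rule order_tendstoD(2)) (use d eps C' in auto)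
  moreover note hq_converges[OF r X(1) e(1)]
  moreover have "(\<lambda>N. X * (mesh N)\<^sup>2) \<longlonglongrightarrow> X * 0\<^sup>2" by (intro tendsto_intros mesh_tendsto)
  then have "\<forall>\<^sub>F N in sequentially. X * (mesh N)\<^sup>2 < 1" by (intro order_tendstoD(2)) auto
  ultimately have "\<forall>\<^sub>F N in sequentially. norm (real N powr (1/3) * hvar N (hermite_zero N (N - r + 1)) - sigma2_max r) < eps"
    using eventually_ge_at_top[of r]
  proof eventually_elim
    case (elim N)
    have N: "0 < N" using r elim by simp
    define h where "h = mesh N"
    have h: "0 < h" "h < d" "h < eps / (8 * C')" "h ^ 3 * real N = 1" using mesh[OF N] elim(1) by (auto simp: h_def)
    define z where "z = hermite_zero N (N - r + 1)"
    have z: "z \<in> hzeros N" unfolding z_def by (rule hermite_zero_in) (use elim r in auto)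
    define q where "q = hq N z"
    have qc: "\<bar>q k - ef r (real k * h)\<bar> \<le> e * (real k * h)" if "real k * h \<le> X" for k
      using elim(2) that unfolding q_def z_def h_def by blast
    define n where "n = nat \<lfloor>X / h\<rfloor>"
    have nX: "real n \<le> X / h" "X / h < real n + 1" using X h by (auto simp: n_def)
    then have nh: "real n * h \<le> X" "X < real n * h + h" using h by (auto simp: field_simps)
    have nN: "n \<le> N"
    proof -
      have "X * h\<^sup>2 < h ^ 3 * real N" using elim(3) h(4) by (simp add: h_def)
      then have "X * h\<^sup>2 < h\<^sup>2 * (h * real N)" by (simp add: power2_eq_square power3_eq_cube)
      then have "X < h * real N" using h by (simp add: mult.commute)
      moreover have "h * real n \<le> X" using nh(1) by (simp add: mult.commute)
      ultimately have "h * real n < h * real N" by linarith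
      then have "real n < real N" using mult_less_cancel_left_pos[OF h(1)] by blast
      then show ?thesis by simp
    qed
    have tot: "real N powr (1/3) * hvar N z = (\<Sum>k=1..n. (q k)\<^sup>2 / real k) + (\<Sum>k=n+1..N. (q k)\<^sup>2 / real k)"
    proof -
      have "{1..N} = {1..n} \<union> {n+1..N}" using nN by auto
      then show ?thesis unfolding hq_sums(2)[OF z, symmetric] q_def by (simp add: sum.union_disjoint)
    qed
    have tail: "0 \<le> (\<Sum>k=n+1..N. (q k)\<^sup>2 / real k)" "(\<Sum>k=n+1..N. (q k)\<^sup>2 / real k) \<le> eps / 8"
    proof -
      show "0 \<le> (\<Sum>k=n+1..N. (q k)\<^sup>2 / real k)" by (intro sum_nonneg) auto
      have "(\<Sum>k=n+1..N. (q k)\<^sup>2 / real k) \<le> (\<Sum>k=n+1..N. 1 / X * (h * (q k)\<^sup>2))"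
      proof (intro sum_mono)
        fix k assume "k \<in> {n+1..N}"
        then have "real n + 1 \<le> real k" "0 < real k" by auto
        then have "X / h < real k" using nX by linarith
        then have "1 / real k \<le> h / X" using h X \<open>0 < real k\<close> by (simp add: field_simps)
        then have "(q k)\<^sup>2 * (1 / real k) \<le> (q k)\<^sup>2 * (h / X)" by (intro mult_left_mono) auto
        then show "(q k)\<^sup>2 / real k \<le> 1 / X * (h * (q k)\<^sup>2)" by (simp add: mult_ac)
      qed
      also have "\<dots> = 1 / X * (\<Sum>k=n+1..N. h * (q k)\<^sup>2)" by (simp add: sum_distrib_left)
      also have "\<dots> \<le> 1 / X * (\<Sum>k=1..N. h * (q k)\<^sup>2)"
        using X h by (intro mult_left_mono sum_mono2) auto
      also have "\<dots> = eps / 8" unfolding q_def h_def hq_sums(1)[OF z] using X by simp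
      finally show "(\<Sum>k=n+1..N. (q k)\<^sup>2 / real k) \<le> eps / 8" .
    qed
    have head: "\<bar>(\<Sum>k=1..n. (q k)\<^sup>2 / real k) - (\<Sum>k=1..n. h * F (real k * h))\<bar> \<le> eps / 8"
    proof -
      have "\<bar>(q k)\<^sup>2 / real k - h * F (real k * h)\<bar> \<le> h * (e * (2 * C + X))" if "k \<in> {1..n}" for k
      proof -
        let ?x = "real k * h" let ?y = "ef r ?x"
        have k: "0 < real k" using that by simp
        have "real k * h \<le> real n * h" using that h by (intro mult_right_mono) auto
        then have "?x \<le> X" using nh(1) by (rule order.trans)
        then have x: "0 < ?x" "?x \<le> X" using k h(1) by simp_all
        have dq: "\<bar>q k - ?y\<bar> \<le> e * ?x" by (rule qc[OF x(2)])
        have ex: "e * ?x \<le> X" using e(1,2) x mult_mono[of e 1 ?x X] by simp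
        have yC: "\<bar>?y\<bar> \<le> C" using C(2) x by auto
        have "h * F ?x = ?y\<^sup>2 / real k" using h k by (simp add: F_def s2i_def)
        then have "(q k)\<^sup>2 / real k - h * F ?x = (q k - ?y) * (q k + ?y) / real k"
          by (simp add: diff_divide_distrib[symmetric] power2_eq_square algebra_simps)
        then have "\<bar>(q k)\<^sup>2 / real k - h * F ?x\<bar> = \<bar>q k - ?y\<bar> * \<bar>q k + ?y\<bar> / real k" by (simp add: abs_mult)
        also have "\<dots> \<le> (e * ?x) * (2 * C + X) / real k"
        proof (intro divide_right_mono mult_mono dq)
          show "\<bar>q k + ?y\<bar> \<le> 2 * C + X" using dq ex yC by linarith
        qed (use e x k in auto)
        also have "\<dots> = h * (e * (2 * C + X))" using k by simp
        finally show ?thesis .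
      qed
      then have "(\<Sum>k=1..n. \<bar>(q k)\<^sup>2 / real k - h * F (real k * h)\<bar>) \<le> (\<Sum>k=1..n. h * (e * (2 * C + X)))"
        by (rule sum_mono)
      also have "\<dots> = (real n * h) * (e * (2 * C + X))" by simp
      also have "\<dots> \<le> X * (e * (2 * C + X))" using nh e C X by (intro mult_right_mono) auto
      finally have "(\<Sum>k=1..n. \<bar>(q k)\<^sup>2 / real k - h * F (real k * h)\<bar>) \<le> eps / 8" using e(3) by simp
      then show ?thesis unfolding sum_subtractf[symmetric] by (rule order.trans[OF sum_abs])
    qed
    have riem: "\<bar>(\<Sum>k=1..n. h * F (real k * h)) - integral {0..real n * h} F\<bar> \<le> eps / 8"
    proof -
      have "\<bar>(\<Sum>k=1..n. h * F (real k * h)) - integral {0..real n * h} F\<bar> \<le> real n * h * w"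
      proof (rule riemann_sum_error[OF F h(1)])
        fix s t assume "0 \<le> s" "s \<le> t" "t \<le> real n * h" "t - s \<le> h"
        then show "\<bar>F t - F s\<bar> \<le> w" using nh h by (intro less_imp_le d(2)) auto
      qed
      also have "\<dots> \<le> X * w" using nh w by (intro mult_right_mono) auto
      finally show ?thesis using w by simp
    qed
    have io: "F integrable_on {u..v}" for u v
      by (rule integrable_continuous_real) (rule continuous_on_subset[OF F], simp)
    have rest: "\<bar>integral {0..real n * h} F - integral {0..X} F\<bar> \<le> eps / 8"
    proof -
      have "integral {0..real n * h} F + integral {real n * h..X} F = integral {0..X} F"
        using nh h by (intro Henstock_Kurzweil_Integration.integral_combine io) auto
      moreover have "norm (integral {real n * h..X} F) \<le> C' * (X - real n * h)"
      proof (rule integral_bound)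
        show "continuous_on {real n * h..X} F" by (rule continuous_on_subset[OF F]) simp
        fix t assume t: "t \<in> {real n * h..X}"
        have "0 \<le> real n * h" using h by simp
        then show "norm (F t) \<le> C'" using t C'(2) by auto
      qed (use nh in auto)
      moreover have "C' * (X - real n * h) \<le> C' * h" using nh C'(1) by (intro mult_left_mono) auto
      moreover have "C' * h \<le> eps / 8" using h(3) C'(1) by (simp add: field_simps)
      ultimately show ?thesis unfolding real_norm_def by linarith
    qed
    have "(LINT x:{0..X}|lborel. F x) = integral {0..X} F"
    proof (rule set_borel_integral_eq_integral(2))
      show "set_integrable lborel {0..X} F"
        by (rule borel_integrable_atLeastAtMost') (rule continuous_on_subset[OF F], simp)
    qed
    then have sg: "sigma2_max r = integral {0..X} F + (LINT x:{X..}|lborel. F x)"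
      using s2i_split(2)[OF r X(1)] by (simp add: F_def)
    have "- ef_en r X / X \<le> 1 / X"
      using ef_en_mono[of 0 X r] ef_en_0[OF r] X by (intro divide_right_mono) auto
    then have st: "0 \<le> (LINT x:{X..}|lborel. F x)" "(LINT x:{X..}|lborel. F x) \<le> eps / 8"
    proof -
      have "1 / X \<le> eps / 8" using X(2) by simp
      with \<open>- ef_en r X / X \<le> 1 / X\<close> show "(LINT x:{X..}|lborel. F x) \<le> eps / 8"
        using s2i_integrable_tail(2)[OF r X(1)] unfolding F_def by linarith
      show "0 \<le> (LINT x:{X..}|lborel. F x)"
        using s2i_integrable_tail(3)[OF r X(1)] unfolding F_def .
    qed
    show ?case
      using tot tail head riem rest sg st eps unfolding z_def[symmetric] real_norm_def by linarith
  qed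
  then show "\<exists>no. \<forall>N\<ge>no. norm (real N powr (1/3) * hvar N (hermite_zero N (N - r + 1)) - sigma2_max r) < eps"
    by (simp add: eventually_sequentially)
qed

text \<open>The inner limits are already normal for each \<open>N\<close>, so the outer limit
  concerns their variances alone.\<close>

lemma bessel_edge_fluctuations:
  assumes r: "1 \<le> r" and t: "0 < t"
    and X: "\<And>N k. r \<le> N \<Longrightarrow> 0 < k \<Longrightarrow> bessel_process0 N k (M N k) (X N k)"
  shows "\<exists>\<mu> :: nat \<Rightarrow> real measure.
           (\<forall>N\<ge>r. real_distribution (\<mu> N) \<and>
              weak_conv_along at_top
                (\<lambda>k. distr (M N k) borel
                  (\<lambda>\<omega>. real N powr (1/6) * sqrt (2 * k) *
                        (X N k t \<omega> (N - r + 1) / sqrt (2 * k * t) - hermite_zero N (N - r + 1))))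
                (\<mu> N)) \<and>
           weak_conv_m \<mu> (normal_dist0 (sigma2_max r))"
proof -
  let ?v = "\<lambda>N. real N powr (1/3) * hvar N (hermite_zero N (N - r + 1))"
  have idx: "N - r + 1 \<in> {1..N}" if "r \<le> N" for N using r that by auto
  have v_pos: "0 < ?v N" if "r \<le> N" for N
    using hvar_pos[OF hermite_zero_in[OF idx[OF that]]] r that by simp
  have inner: "weak_conv_along at_top
      (\<lambda>k. distr (M N k) borel
        (\<lambda>\<omega>. real N powr (1/6) * sqrt (2 * k) *
              (X N k t \<omega> (N - r + 1) / sqrt (2 * k * t) - hermite_zero N (N - r + 1))))
      (normal_dist0 (?v N))" if N: "r \<le> N" for N
  proof -
    have "(real N powr (1/6))\<^sup>2 = real N powr (1/3)" by (simp add: power2_eq_square powr_add[symmetric])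
    moreover have "0 < real N powr (1/6)" using r N by simp
    ultimately show ?thesis
      using freezing.freezing_limit[OF hermite_freezing[OF idx[OF N]] X[OF N] t, of "real N powr (1/6)"] by simp
  qed
  have "\<forall>\<^sub>F N in sequentially. 0 < ?v N"
    using eventually_ge_at_top[of r] by eventually_elim (rule v_pos)
  then have "weak_conv_m (\<lambda>N. normal_dist0 (?v N)) (normal_dist0 (sigma2_max r))"
    by (rule normal_dist0_weak_conv[OF hvar_limit[OF r] sigma2_max_pos[OF r]])
  then show ?thesis
    using inner real_distribution_normal_dist0[OF v_pos] by (intro exI[of _ "\<lambda>N. normal_dist0 (?v N)"]) blast
qed

section \<open>Certified evaluation of three-term recursions\<close>

text \<open>A certificate is a list of integer pairs \<open>(T, E)\<close>, claiming that \<open>\<bar>S t\<^sub>n - T\<bar> \<le> E\<close> for the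
  solution of \<open>d\<^sub>n t\<^sub>n\<^sub>+\<^sub>3 = p\<^sub>n \<alpha> t\<^sub>n - q\<^sub>n \<beta> t\<^sub>n\<^sub>+\<^sub>1\<close>, where \<open>\<alpha>\<close>, \<open>\<beta>\<close> are only known to be close to
  \<open>a/M\<close>, \<open>b/M\<close>. No division is needed to check it.\<close>

fun cert_ok :: "(int \<Rightarrow> int) \<Rightarrow> (int \<Rightarrow> int) \<Rightarrow> (int \<Rightarrow> int) \<Rightarrow> int \<Rightarrow> int \<Rightarrow> int \<Rightarrow> int \<Rightarrow> int \<Rightarrow> int \<Rightarrow>
    (int \<times> int) list \<Rightarrow> bool" where
  "cert_ok p q d a da b db M n (x0 # x1 # x2 # x3 # xs) \<longleftrightarrow>
     (case x0 of (T0, E0) \<Rightarrow> case x1 of (T1, E1) \<Rightarrow> case x3 of (T3, E3) \<Rightarrow>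
       \<bar>p n * a * T0 - q n * b * T1 - M * d n * T3\<bar> + \<bar>p n\<bar> * (\<bar>a\<bar> * E0 + da * (\<bar>T0\<bar> + E0))
         + \<bar>q n\<bar> * (\<bar>b\<bar> * E1 + db * (\<bar>T1\<bar> + E1)) \<le> M * d n * E3) \<and>
     cert_ok p q d a da b db M (n + 1) (x1 # x2 # x3 # xs)"
| "cert_ok p q d a da b db M n _ \<longleftrightarrow> True"

text \<open>After multiplication by \<open>S * M\<close> three sources of error remain: rounding of
  \<open>T3\<close>, the uncertainty of the earlier terms and that of the parameters. All of them
  are visible in \<open>ok\<close>.\<close>

lemma cert_step:
  fixes T0 T1 T3 E0 E1 E3 S t0 t1 t3 p q d a da b db M al be :: real
  assumes rec: "d * t3 = p * al * t0 - q * be * t1" and d: "0 < d" "0 < M"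
    and al: "\<bar>M * al - a\<bar> \<le> da" and be: "\<bar>M * be - b\<bar> \<le> db"
    and e: "\<bar>S * t0 - T0\<bar> \<le> E0" "\<bar>S * t1 - T1\<bar> \<le> E1"
    and ok: "\<bar>p * a * T0 - q * b * T1 - M * d * T3\<bar> + \<bar>p\<bar> * (\<bar>a\<bar> * E0 + da * (\<bar>T0\<bar> + E0))
         + \<bar>q\<bar> * (\<bar>b\<bar> * E1 + db * (\<bar>T1\<bar> + E1)) \<le> M * d * E3"
  shows "\<bar>S * t3 - T3\<bar> \<le> E3"
proof -
  have prod: "\<bar>M * x * (S * t) - c * T\<bar> \<le> \<bar>c\<bar> * E + dc * (\<bar>T\<bar> + E)"
    if "\<bar>M * x - c\<bar> \<le> dc" "\<bar>S * t - T\<bar> \<le> E" for x t c dc T E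
  proof -
    have "M * x * (S * t) - c * T = c * (S * t - T) + (M * x - c) * (S * t)" by (simp add: algebra_simps)
    moreover have "\<bar>c * (S * t - T)\<bar> \<le> \<bar>c\<bar> * E" unfolding abs_mult using that by (intro mult_left_mono) auto
    moreover have "\<bar>(M * x - c) * (S * t)\<bar> \<le> dc * (\<bar>T\<bar> + E)"
      unfolding abs_mult using that by (intro mult_mono) auto
    ultimately show ?thesis by linarith
  qed
  let ?P = "M * al * (S * t0) - a * T0" and ?Q = "M * be * (S * t1) - b * T1"
  have "M * d * (S * t3 - T3) = M * S * (d * t3) - M * d * T3" by (simp add: algebra_simps)
  also have "\<dots> = (p * a * T0 - q * b * T1 - M * d * T3) + p * ?P - q * ?Q"
    unfolding rec by (simp add: algebra_simps)
  finally have "\<bar>M * d * (S * t3 - T3)\<bar> \<le> \<bar>p * a * T0 - q * b * T1 - M * d * T3\<bar> + \<bar>p * ?P\<bar> + \<bar>q * ?Q\<bar>"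
    by linarith
  also have "\<dots> \<le> \<bar>p * a * T0 - q * b * T1 - M * d * T3\<bar> + \<bar>p\<bar> * (\<bar>a\<bar> * E0 + da * (\<bar>T0\<bar> + E0))
         + \<bar>q\<bar> * (\<bar>b\<bar> * E1 + db * (\<bar>T1\<bar> + E1))"
    unfolding abs_mult[of p] abs_mult[of q]
    by (intro add_mono mult_left_mono prod al be e) auto
  finally have "\<bar>M * d * (S * t3 - T3)\<bar> \<le> M * d * E3" using ok by linarith
  moreover have "\<bar>M * d * (S * t3 - T3)\<bar> = M * d * \<bar>S * t3 - T3\<bar>" using d by (simp add: abs_mult)
  moreover have "0 < M * d" using d by simp
  ultimately show ?thesis by (metis mult_le_cancel_left_pos)
qed

definition encloses :: "real \<Rightarrow> (nat \<Rightarrow> real) \<Rightarrow> (int \<times> int) list \<Rightarrow> bool" where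
  "encloses S t xs \<longleftrightarrow> (\<forall>k<length xs. \<bar>S * t k - of_int (fst (xs ! k))\<bar> \<le> of_int (snd (xs ! k)))"

lemma encloses_Cons: "encloses S t (x # xs) \<longleftrightarrow>
    \<bar>S * t 0 - of_int (fst x)\<bar> \<le> of_int (snd x) \<and> encloses S (\<lambda>k. t (Suc k)) xs"
  unfolding encloses_def by (auto simp: less_Suc_eq_0_disj)

lemma encloses_Nil [simp]: "encloses S t []" by (simp add: encloses_def)

lemma cert_ok_encloses:
  assumes "cert_ok p q d a da b db M n xs"
    and "\<And>k. of_int (d (n + int k)) * t (k + 3) = of_int (p (n + int k)) * al * t k - of_int (q (n + int k)) * be * t (k + 1)"
    and "\<And>k. 0 < d (n + int k)" "0 < M"
    and "\<bar>of_int M * al - of_int a\<bar> \<le> of_int da" "\<bar>of_int M * be - of_int b\<bar> \<le> of_int db"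
    and "encloses S t (take 3 xs)"
  shows "encloses S t xs"
  using assms
proof (induction p q d a da b db M n xs arbitrary: t rule: cert_ok.induct)
  case (1 p q d a da b db M n x0 x1 x2 x3 xs)
  obtain T0 E0 T1 E1 T2 E2 T3 E3 where x: "x0 = (T0, E0)" "x1 = (T1, E1)" "x2 = (T2, E2)" "x3 = (T3, E3)"
    by (metis surj_pair)
  have init: "\<bar>S * t 0 - of_int T0\<bar> \<le> of_int E0" "\<bar>S * t 1 - of_int T1\<bar> \<le> of_int E1"
     "\<bar>S * t 2 - of_int T2\<bar> \<le> of_int E2"
    using 1(8) by (auto simp: x encloses_Cons numeral_3_eq_3 numeral_2_eq_2)
  have ok: "\<bar>p n * a * T0 - q n * b * T1 - M * d n * T3\<bar> + \<bar>p n\<bar> * (\<bar>a\<bar> * E0 + da * (\<bar>T0\<bar> + E0))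
         + \<bar>q n\<bar> * (\<bar>b\<bar> * E1 + db * (\<bar>T1\<bar> + E1)) \<le> M * d n * E3"
    and rest: "cert_ok p q d a da b db M (n + 1) (x1 # x2 # x3 # xs)"
    using 1(2) by (auto simp: x)
  have "\<bar>S * t 3 - of_int T3\<bar> \<le> of_int E3"
  proof (rule cert_step[OF _ _ _ 1(6,7) init(1,2)])
    show "of_int (d n) * t 3 = of_int (p n) * al * t 0 - of_int (q n) * be * t 1" using 1(3)[of 0] by simp
    show "0 < real_of_int (d n)" "0 < real_of_int M" using 1(4)[of 0] 1(5) by auto
    have "real_of_int (\<bar>p n * a * T0 - q n * b * T1 - M * d n * T3\<bar> + \<bar>p n\<bar> * (\<bar>a\<bar> * E0 + da * (\<bar>T0\<bar> + E0))
         + \<bar>q n\<bar> * (\<bar>b\<bar> * E1 + db * (\<bar>T1\<bar> + E1))) \<le> real_of_int (M * d n * E3)"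
      using ok by (simp only: of_int_le_iff)
    then show "\<bar>real_of_int (p n) * real_of_int a * real_of_int T0 - real_of_int (q n) * real_of_int b * real_of_int T1 - real_of_int M * real_of_int (d n) * real_of_int T3\<bar>
        + \<bar>real_of_int (p n)\<bar> * (\<bar>real_of_int a\<bar> * real_of_int E0 + real_of_int da * (\<bar>real_of_int T0\<bar> + real_of_int E0))
        + \<bar>real_of_int (q n)\<bar> * (\<bar>real_of_int b\<bar> * real_of_int E1 + real_of_int db * (\<bar>real_of_int T1\<bar> + real_of_int E1))
        \<le> real_of_int M * real_of_int (d n) * real_of_int E3"
      by (simp only: of_int_add of_int_mult of_int_abs of_int_diff)
  qed
  then have "encloses S (\<lambda>k. t (Suc k)) (x1 # x2 # x3 # xs)"
  proof (intro 1(1)[OF rest])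
    fix k
    show "of_int (d (n + 1 + int k)) * t (Suc (k + 3)) = of_int (p (n + 1 + int k)) * al * t (Suc k) - of_int (q (n + 1 + int k)) * be * t (Suc (k + 1))"
      using 1(3)[of "Suc k"] by (simp add: add_ac)
    show "0 < d (n + 1 + int k)" using 1(4)[of "Suc k"] by (simp add: add_ac)
  qed (use 1(5-7) init in \<open>auto simp: x encloses_Cons numeral_3_eq_3 numeral_2_eq_2\<close>)
  then show ?case unfolding encloses_Cons[of S t x0] using init(1) by (simp add: x)
qed (auto simp: encloses_def)

text \<open>The two components are midpoint and radius of the weighted partial sum, in the scale of
  the certificate.\<close>

fun cert_sum :: "(int \<Rightarrow> int) \<Rightarrow> int \<Rightarrow> (int \<times> int) list \<Rightarrow> int \<times> int" where
  "cert_sum f n [] = (0, 0)"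
| "cert_sum f n ((T, E) # xs) = (case cert_sum f (n + 1) xs of (A, B) \<Rightarrow> (f n * T + A, \<bar>f n\<bar> * E + B))"

lemma cert_sum_sound:
  assumes "encloses S t xs" "cert_sum f n xs = (A, B)"
  shows "\<bar>S * (\<Sum>k<length xs. of_int (f (n + int k)) * t k) - of_int A\<bar> \<le> of_int B"
  using assms
proof (induction f n xs arbitrary: t A B rule: cert_sum.induct)
  case (2 f n T E xs)
  obtain A' B' where AB: "cert_sum f (n + 1) xs = (A', B')" by fastforce
  then have A: "A = f n * T + A'" "B = \<bar>f n\<bar> * E + B'" using 2 by auto
  have e: "\<bar>S * t 0 - of_int T\<bar> \<le> of_int E" "encloses S (\<lambda>k. t (Suc k)) xs"
    using 2(2) by (auto simp: encloses_Cons)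
  have s: "(\<Sum>k<length ((T, E) # xs). of_int (f (n + int k)) * t k) =
      of_int (f n) * t 0 + (\<Sum>k<length xs. of_int (f (n + 1 + int k)) * t (Suc k))"
    by (simp only: length_Cons sum.lessThan_Suc_shift) (simp add: add_ac)
  have "\<bar>of_int (f n) * (S * t 0 - of_int T)\<bar> \<le> \<bar>of_int (f n)\<bar> * of_int E"
    unfolding abs_mult using e(1) by (intro mult_left_mono) auto
  moreover have "\<bar>S * (\<Sum>k<length xs. of_int (f (n + 1 + int k)) * t (Suc k)) - of_int A'\<bar> \<le> of_int B'"
    by (rule 2(1)[OF e(2) AB])
  moreover have "S * (\<Sum>k<length ((T, E) # xs). of_int (f (n + int k)) * t k) - of_int A =
     of_int (f n) * (S * t 0 - of_int T) + (S * (\<Sum>k<length xs. of_int (f (n + 1 + int k)) * t (Suc k)) - of_int A')"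
    unfolding s A by (simp add: algebra_simps)
  ultimately show ?case unfolding A by simp
qed simp

text \<open>Tests whether the last three entries can start a decay with ratio 1/2, as the hypotheses
  of \<open>geometric_decay_rec\<close> demand.\<close>

fun cert_tail :: "int \<Rightarrow> (int \<times> int) list \<Rightarrow> bool" where
  "cert_tail c (x0 # x1 # x2 # x3 # xs) = cert_tail c (x1 # x2 # x3 # xs)"
| "cert_tail c [(T0, E0), (T1, E1), (T2, E2)] \<longleftrightarrow>
     \<bar>T0\<bar> + E0 \<le> c \<and> 2 * (\<bar>T1\<bar> + E1) \<le> c \<and> 4 * (\<bar>T2\<bar> + E2) \<le> c"
| "cert_tail c _ = False"

lemma cert_tail_sound:
  assumes "cert_tail c xs" "encloses S t xs" "0 < S"
  shows "3 \<le> length xs \<and> \<bar>t (length xs - 3)\<bar> \<le> of_int c / S \<and> \<bar>t (length xs - 3 + 1)\<bar> \<le> of_int c / S / 2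
    \<and> \<bar>t (length xs - 3 + 2)\<bar> \<le> of_int c / S / 4"
  using assms
proof (induction c xs arbitrary: t rule: cert_tail.induct)
  case (1 c x0 x1 x2 x3 xs)
  have "encloses S (\<lambda>k. t (Suc k)) (x1 # x2 # x3 # xs)" using 1(3) by (simp only: encloses_Cons)
  from 1(1)[OF _ this 1(4)] 1(2) show ?case by simp
next
  case (2 c T0 E0 T1 E1 T2 E2)
  have *: "\<bar>u\<bar> \<le> of_int c / S / w" if "\<bar>S * u - of_int T\<bar> \<le> of_int E" "w * (\<bar>of_int T\<bar> + of_int E) \<le> of_int c" "0 < w" for u w :: real and T E :: int
  proof -
    have "\<bar>S * u\<bar> \<le> \<bar>of_int T\<bar> + of_int E" using that(1) by linarith
    then have "w * (S * \<bar>u\<bar>) \<le> w * (\<bar>of_int T\<bar> + of_int E)" using 2(3) that(3) by (intro mult_left_mono) (auto simp: abs_mult)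
    then have "w * (S * \<bar>u\<bar>) \<le> of_int c" using that(2) by linarith
    then show ?thesis using 2(3) that(3) by (simp add: field_simps)
  qed
  have c: "1 * (\<bar>real_of_int T0\<bar> + of_int E0) \<le> of_int c" "2 * (\<bar>real_of_int T1\<bar> + of_int E1) \<le> of_int c" "4 * (\<bar>real_of_int T2\<bar> + of_int E2) \<le> of_int c"
  proof -
    have i: "1 * (\<bar>T0\<bar> + E0) \<le> c" "2 * (\<bar>T1\<bar> + E1) \<le> c" "4 * (\<bar>T2\<bar> + E2) \<le> c"
      using 2(1) by simp_all
    have "real_of_int (1 * (\<bar>T0\<bar> + E0)) \<le> of_int c" "real_of_int (2 * (\<bar>T1\<bar> + E1)) \<le> of_int c" "real_of_int (4 * (\<bar>T2\<bar> + E2)) \<le> of_int c"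
      using i by (simp_all only: of_int_le_iff)
    then show "1 * (\<bar>real_of_int T0\<bar> + of_int E0) \<le> of_int c" "2 * (\<bar>real_of_int T1\<bar> + of_int E1) \<le> of_int c" "4 * (\<bar>real_of_int T2\<bar> + of_int E2) \<le> of_int c"
      by (simp_all only: of_int_add of_int_mult of_int_abs of_int_numeral of_int_1)
  qed
  show ?case
    using *[of "t 0" T0 E0 1] *[of "t 1" T1 E1 2] *[of "t 2" T2 E2 4] 2(2) c
    by (simp add: encloses_Cons numeral_2_eq_2)
qed auto

text \<open>From 7 on one step enlarges the cube by at most \<open>(8/7)^3 < 3/2\<close>; against
  the decay \<open>1 / 2 ^ k\<close> this leaves a geometric series with ratio 3/4.\<close>

lemma power_shift_bound:
  assumes "7 \<le> m"
  shows "real (m + k) ^ 3 \<le> real m ^ 3 * (3/2) ^ k"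
proof (induction k)
  case (Suc k)
  have "real (m + Suc k) \<le> 8/7 * real (m + k)" using assms by (simp add: field_simps)
  then have "real (m + Suc k) ^ 3 \<le> (8/7 * real (m + k)) ^ 3" by (intro power_mono) auto
  also have "\<dots> = (8/7) ^ 3 * real (m + k) ^ 3" by (rule power_mult_distrib)
  also have "\<dots> \<le> 3/2 * real (m + k) ^ 3"
    by (rule mult_right_mono) (simp_all add: power3_eq_cube)
  also have "\<dots> \<le> 3/2 * (real m ^ 3 * (3/2) ^ k)" using Suc by (intro mult_left_mono) auto
  finally show ?case by simp
qed simp

lemma cert_series:
  assumes xs: "encloses S t xs" "cert_tail c xs" "0 < S" and len: "length xs = m + 3" "7 \<le> m"
    and dec: "\<And>n. m \<le> n \<Longrightarrow> \<bar>t (n + 3)\<bar> \<le> p * \<bar>t n\<bar> + q * \<bar>t (n + 1)\<bar>" "0 \<le> p" "0 \<le> q" "p + q / 2 \<le> 1 / 8"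
    and sum: "cert_sum f 0 xs = (A, B)" and f: "\<And>n. \<bar>of_int (f (int n))\<bar> \<le> real n ^ 3 + 1"
    and s: "(\<lambda>n. of_int (f (int n)) * t n) sums v"
  shows "\<bar>S * v - of_int A\<bar> \<le> of_int B + 8 * real m ^ 3 * of_int c"
proof -
  note tl = cert_tail_sound[OF xs(2,1,3)]
  define C where "C = of_int c / S"
  have C0: "0 \<le> C" using tl by (auto simp: C_def intro: order.trans[OF abs_ge_zero])
  have B: "\<bar>t (m + k)\<bar> \<le> C / 2 ^ k" for k
    by (rule geometric_decay_rec[OF dec]) (use tl len in \<open>auto simp: C_def\<close>)
  let ?g = "\<lambda>n. of_int (f (int n)) * t n"
  have gb: "\<bar>?g (n + (m + 3))\<bar> \<le> 2 * real m ^ 3 * C * (3/4) ^ n" for n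
  proof -
    define k where "k = n + 3"
    have mk: "n + (m + 3) = m + k" by (simp add: k_def)
    have m1: "1 \<le> real (m + k) ^ 3" using len(2) by (intro one_le_power) auto
    have "\<bar>of_int (f (int (m + k)))\<bar> \<le> 2 * real (m + k) ^ 3" using f[of "m + k"] m1 by linarith
    also have "\<dots> \<le> 2 * (real m ^ 3 * (3/2) ^ k)" using power_shift_bound[OF len(2), of k] by (intro mult_left_mono) auto
    finally have "\<bar>?g (m + k)\<bar> \<le> (2 * (real m ^ 3 * (3/2) ^ k)) * (C / 2 ^ k)"
      unfolding abs_mult using B[of k] by (intro mult_mono) auto
    also have "\<dots> = 2 * real m ^ 3 * C * ((3/2) ^ k / 2 ^ k)" by simp
    also have "(3/2) ^ k / 2 ^ k = (3/4 :: real) ^ k" by (simp add: power_divide[symmetric])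
    also have "(3/4 :: real) ^ k \<le> (3/4) ^ n" unfolding k_def by (intro power_decreasing) auto
    finally show ?thesis unfolding mk using C0 by (simp add: mult_left_mono)
  qed
  have gs: "(\<lambda>n. 2 * real m ^ 3 * C * (3/4) ^ n) sums (2 * real m ^ 3 * C * (1 / (1 - 3/4)))"
    by (intro sums_mult geometric_sums) auto
  have "(\<lambda>n. ?g (n + (m + 3))) sums (v - (\<Sum>n<m + 3. ?g n))"
    by (rule sums_split_initial_segment[OF s])
  then have "\<bar>v - (\<Sum>n<m + 3. ?g n)\<bar> \<le> 2 * real m ^ 3 * C * (1 / (1 - 3/4))"
    using norm_suminf_le[of "\<lambda>n. ?g (n + (m + 3))" "\<lambda>n. 2 * real m ^ 3 * C * (3/4) ^ n"] gb gs
    by (simp add: sums_iff)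
  then have "S * \<bar>v - (\<Sum>n<m + 3. ?g n)\<bar> \<le> S * (8 * real m ^ 3 * C)" using xs(3) by (intro mult_left_mono) auto
  also have "\<dots> = 8 * real m ^ 3 * of_int c" using xs(3) by (simp add: C_def)
  finally have "\<bar>S * v - S * (\<Sum>n<m + 3. ?g n)\<bar> \<le> 8 * real m ^ 3 * of_int c"
    using xs(3) by (simp add: right_diff_distrib[symmetric] abs_mult)
  moreover have "\<bar>S * (\<Sum>n<m + 3. ?g n) - of_int A\<bar> \<le> of_int B"
    using cert_sum_sound[OF xs(1) sum] len by simp
  ultimately show ?thesis by linarith
qed

section \<open>Certified values of solutions of the Airy equation\<close>

lemma airy_coeff_rec:
  "(real n + 2) * (real n + 3) * airy_coeff l a b (n + 3) = airy_coeff l a b n - l * airy_coeff l a b (n + 1)"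
proof -
  have *: "airy_coeff l a b (n + 3) = (airy_coeff l a b n - l * airy_coeff l a b (n + 1)) / ((real n + 2) * (real n + 3))"
    by (simp add: numeral_3_eq_3 algebra_simps)
  have "(real n + 2) * (real n + 3) \<noteq> 0" by (simp add: add_eq_0_iff_both_eq_0)
  then show ?thesis unfolding * by simp
qed

lemma airy_sol_sums: "(\<lambda>n. airy_coeff l a b n * z ^ n) sums airy_sol l a b z"
  using sums_eval_fps[of z "airy_fps l a b"] by (simp add: airy_sol_def nth_airy_fps)

text \<open>For \<open>l = 0\<close> the recursion links only indices three apart, so the second
  coefficient of the certificate is 0. The bound on \<open>\<bar>z\<bar> ^ 3\<close> gives the decay
  factor 1/8 from index \<open>m\<close> on.\<close>

lemma airy_series_cert:
  assumes ok: "cert_ok (\<lambda>_. 1) (\<lambda>_. 0) (\<lambda>n. (n + 2) * (n + 3)) a da 0 0 M 0 xs" "0 < M"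
    and al: "\<bar>of_int M * z ^ 3 - of_int a\<bar> \<le> of_int da"
    and init: "encloses S (\<lambda>n. airy_coeff 0 u v n * z ^ n) (take 3 xs)" "0 < S"
    and tl: "cert_tail c xs" "length xs = m + 3" "7 \<le> m" "8 * \<bar>z\<bar> ^ 3 \<le> real m * real m"
    and sum: "cert_sum (\<lambda>_. 1) 0 xs = (A, B)"
  shows "\<bar>S * airy_sol 0 u v z - of_int A\<bar> \<le> of_int B + 8 * real m ^ 3 * of_int c"
proof -
  let ?t = "\<lambda>n. airy_coeff 0 u v n * z ^ n"
  have rec: "((real n + 2) * (real n + 3)) * ?t (n + 3) = z ^ 3 * ?t n" for n
  proof -
    have "((real n + 2) * (real n + 3)) * ?t (n + 3) = ((real n + 2) * (real n + 3) * airy_coeff 0 u v (n + 3)) * (z ^ n * z ^ 3)"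
      by (simp only: power_add mult_ac)
    then show ?thesis unfolding airy_coeff_rec by (simp add: mult_ac)
  qed
  have enc: "encloses S ?t xs"
  proof (rule cert_ok_encloses[OF ok(1) _ _ ok(2) al _ init(1)])
    fix k
    show "of_int ((0 + int k + 2) * (0 + int k + 3)) * ?t (k + 3) = of_int 1 * z ^ 3 * ?t k - of_int 0 * 0 * ?t (k + 1)"
      using rec[of k] by (simp add: of_int_mult)
    show "0 < (0 + int k + 2) * (0 + int k + 3)" by simp
  qed simp
  show ?thesis
  proof (rule cert_series[OF enc tl(1) init(2) tl(2,3) _ _ _ _ sum])
    fix n assume n: "m \<le> n"
    have "real m * real m \<le> (real n + 2) * (real n + 3)" using n by (intro mult_mono) auto
    then have D: "8 * \<bar>z\<bar> ^ 3 \<le> (real n + 2) * (real n + 3)" using tl(4) by linarith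
    have pos: "0 < (real n + 2) * (real n + 3)" by simp
    have "(real n + 2) * (real n + 3) * \<bar>?t (n + 3)\<bar> = \<bar>z\<bar> ^ 3 * \<bar>?t n\<bar>"
      using arg_cong[OF rec[of n], of abs] pos by (simp only: abs_mult power_abs abs_of_pos)
    also have "8 * \<dots> \<le> ((real n + 2) * (real n + 3)) * \<bar>?t n\<bar>"
      unfolding mult.assoc[symmetric] using D by (intro mult_right_mono) auto
    finally have "(real n + 2) * (real n + 3) * (8 * \<bar>?t (n + 3)\<bar>) \<le> (real n + 2) * (real n + 3) * \<bar>?t n\<bar>"
      by (simp only: mult_ac)
    then have "8 * \<bar>?t (n + 3)\<bar> \<le> \<bar>?t n\<bar>" using pos by (simp only: mult_le_cancel_left_pos)
    then show "\<bar>?t (n + 3)\<bar> \<le> 1/8 * \<bar>?t n\<bar> + 0 * \<bar>?t (n + 1)\<bar>" by simp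
  next
    show "(\<lambda>n. of_int 1 * ?t n) sums airy_sol 0 u v z" using airy_sol_sums by simp
  qed auto
qed

definition airy_check :: "int \<Rightarrow> int \<Rightarrow> int \<Rightarrow> int \<Rightarrow> int \<Rightarrow> (int \<times> int) list \<Rightarrow> bool" where
  "airy_check M a da m c xs \<longleftrightarrow> cert_ok (\<lambda>_. 1) (\<lambda>_. 0) (\<lambda>n. (n + 2) * (n + 3)) a da 0 0 M 0 xs \<and>
     cert_tail c xs \<and> int (length xs) = m + 3 \<and> 7 \<le> m"

lemma airy_checkD:
  assumes ck: "airy_check M a da m c xs" "0 < M" "\<bar>of_int M * z ^ 3 - of_int a\<bar> \<le> of_int da" "8 * \<bar>z\<bar> ^ 3 \<le> of_int (m * m)"
    and init: "encloses S (\<lambda>n. airy_coeff 0 u v n * z ^ n) (take 3 xs)" "0 < S"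
    and sum: "cert_sum (\<lambda>_. 1) 0 xs = (A, B)"
  shows "\<bar>S * airy_sol 0 u v z - of_int A\<bar> \<le> of_int (B + 8 * (m * m * m) * c)"
proof -
  have m: "int (nat m) = m" using ck(1) by (auto simp: airy_check_def)
  then have mr: "real (nat m) = of_int m" by (metis of_int_of_nat_eq)
  have "\<bar>S * airy_sol 0 u v z - of_int A\<bar> \<le> of_int B + 8 * real (nat m) ^ 3 * of_int c"
  proof (rule airy_series_cert[OF _ ck(2,3) init _ _ _ _ sum])
    show "length xs = nat m + 3" "7 \<le> nat m" using ck(1) by (auto simp: airy_check_def)
    show "8 * \<bar>z\<bar> ^ 3 \<le> real (nat m) * real (nat m)" using ck(4) unfolding mr by simp
  qed (use ck(1) in \<open>auto simp: airy_check_def\<close>)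
  also have "\<dots> = of_int (B + 8 * (m * m * m) * c)" unfolding mr by (simp add: power3_eq_cube)
  finally show ?thesis .
qed


text \<open>On the half line \<open>ag\<close> is convex and vanishes at 0, hence
  \<open>x * ag' x \<ge> ag x\<close>. This trades the derivative in the lower bound for
  \<open>ag\<close> itself, so two series values at one point enclose
  \<open>airy_kappa\<close>.\<close>

lemma airy_kappa_lower:
  assumes "0 < x"
  shows "af x / ag x - x / (ag x)\<^sup>2 \<le> airy_kappa"
proof -
  have g: "0 < ag x" "0 < ag' x" using ag_pos[of x] assms by auto
  have "0 * ag' 0 - ag 0 \<le> x * ag' x - ag x"
  proof (rule DERIV_nonneg_imp_nondecreasing[of 0 x "\<lambda>x. x * ag' x - ag x"])
    fix s :: real assume "0 \<le> s"
    then have "0 \<le> ag s" using ag_pos(1)[of s] by (cases "s = 0") auto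
    moreover have "((\<lambda>x. x * ag' x - ag x) has_real_derivative s * (s * ag s)) (at s)"
      using ode2D[OF ag_ode, of s] by (auto intro!: derivative_eq_intros)
    ultimately show "\<exists>d. ((\<lambda>x. x * ag' x - ag x) has_real_derivative d) (at s) \<and> 0 \<le> d"
      using \<open>0 \<le> s\<close> by auto
  qed (use assms in simp)
  then have "1 / (ag x * ag' x) \<le> x / (ag x)\<^sup>2"
    using g by (simp add: field_simps power2_eq_square)
  then show ?thesis using airy_kappa_bounds(2)[OF assms] by linarith
qed

text \<open>The lists evaluate \<open>af\<close> and \<open>ag\<close> at \<open>X\<close> in the
  scale \<open>S\<close>; \<open>w\<close> bounds \<open>S * X / ag X\<close>, the correction in the
  numerator of the lower bound, and \<open>e\<close> is the truncation error.\<close>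

definition kappa_check :: "int \<Rightarrow> int \<Rightarrow> int \<Rightarrow> int \<Rightarrow> int \<Rightarrow> int \<Rightarrow> int \<Rightarrow> int \<Rightarrow> (int \<times> int) list \<Rightarrow> (int \<times> int) list \<Rightarrow> bool" where
  "kappa_check X S M K dK w m c xs ys \<longleftrightarrow>
     0 < X \<and> 0 < S \<and> 0 < M \<and> dK < K \<and> 8 * (X * X * X) \<le> m * m \<and>
     airy_check 1 (X * X * X) 0 m c xs \<and> take 3 xs = [(S, 0), (0, 0), (0, 0)] \<and>
     airy_check 1 (X * X * X) 0 m c ys \<and> take 3 ys = [(0, 0), (X * S, 0), (0, 0)] \<and>
     (case cert_sum (\<lambda>_. 1) 0 xs of (A, B) \<Rightarrow> case cert_sum (\<lambda>_. 1) 0 ys of (A', B') \<Rightarrow>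
       let e = 8 * (m * m * m) * c in
       0 < A' - (B' + e) \<and> M * (A + (B + e)) \<le> (K + dK) * (A' - (B' + e)) \<and>
       X * S * S \<le> w * (A' - (B' + e)) \<and>
       (K - dK) * (A' + (B' + e)) \<le> M * (A - (B + e) - w))"

lemma kappa_check_sound:
  assumes "kappa_check X S M K dK w m c xs ys"
  shows "\<bar>of_int M * airy_kappa - of_int K\<bar> \<le> of_int dK"
proof -
  obtain A B where AB: "cert_sum (\<lambda>_. 1) 0 xs = (A, B)" by fastforce
  obtain A' B' where AB': "cert_sum (\<lambda>_. 1) 0 ys = (A', B')" by fastforce
  define e where "e = 8 * (m * m * m) * c"
  define E where "E = B + e" define E' where "E' = B' + e"
  have pos: "0 < X" "0 < S" "0 < M" "dK < K" "8 * (X * X * X) \<le> m * m"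
    and ck: "airy_check 1 (X * X * X) 0 m c xs" "airy_check 1 (X * X * X) 0 m c ys"
    and t3: "take 3 xs = [(S, 0), (0, 0), (0, 0)]" "take 3 ys = [(0, 0), (X * S, 0), (0, 0)]"
    and i: "0 < A' - E'" "M * (A + E) \<le> (K + dK) * (A' - E')" "X * S * S \<le> w * (A' - E')"
      "(K - dK) * (A' + E') \<le> M * (A - E - w)"
    using assms by (auto simp: kappa_check_def AB AB' E_def E'_def e_def Let_def)
  define x s M' where "x = real_of_int X" and "s = real_of_int S" and "M' = real_of_int M"
  have pr: "0 < x" "0 < s" "0 < M'" using pos by (simp_all add: x_def s_def M'_def)
  have al: "\<bar>of_int 1 * x ^ 3 - of_int (X * X * X)\<bar> \<le> of_int 0" by (simp add: x_def power3_eq_cube)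
  have "real_of_int (8 * (X * X * X)) \<le> of_int (m * m)" using pos(5) by (simp only: of_int_le_iff)
  then have dec: "8 * \<bar>x\<bar> ^ 3 \<le> of_int (m * m)" using pr by (simp add: x_def power3_eq_cube)
  have f: "\<bar>s * af x - of_int A\<bar> \<le> of_int E" unfolding af_def E_def e_def
    by (rule airy_checkD[OF ck(1) _ al dec _ pr(2) AB]) (simp_all add: t3 encloses_Cons s_def numeral_2_eq_2)
  have g: "\<bar>s * ag x - of_int A'\<bar> \<le> of_int E'" unfolding ag_def E'_def e_def
    by (rule airy_checkD[OF ck(2) _ al dec _ pr(2) AB']) (simp_all add: t3 encloses_Cons s_def x_def numeral_2_eq_2)
  have ir: "real_of_int (M * (A + E)) \<le> real_of_int ((K + dK) * (A' - E'))"
     "real_of_int (X * S * S) \<le> real_of_int (w * (A' - E'))"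
     "real_of_int ((K - dK) * (A' + E')) \<le> real_of_int (M * (A - E - w))" "0 < real_of_int (A' - E')"
    using i by (simp_all only: of_int_le_iff of_int_0_less_iff)
  have gp: "0 < ag x" using ag_pos(1) pr by simp
  define F G where "F = s * af x" and "G = s * ag x"
  have FG: "\<bar>F - of_int A\<bar> \<le> of_int E" "\<bar>G - of_int A'\<bar> \<le> of_int E'" using f g by (simp_all add: F_def G_def)
  have G: "0 < G" "of_int (A' - E') \<le> G" "G \<le> of_int (A' + E')" using FG ir(4) pr gp by (auto simp: G_def)
  \<comment> \<open>That \<open>dK\<close> is nonnegative follows from the compatibility of the two
    inequalities; the positive signs then allow multiplication with the bounds for
    \<open>G\<close>.\<close>
  have KK: "0 < real_of_int (K + dK)" "0 < real_of_int (K - dK)"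
  proof -
    have "0 \<le> dK" using al
    proof -
      have "real_of_int (K - dK) * (of_int A' + of_int E') \<le> M' * (F - of_int w)"
      proof -
        have "M' * (of_int A - of_int E - of_int w) \<le> M' * (F - of_int w)" using FG(1) pr by (intro mult_left_mono) auto
        then show ?thesis using ir(3) by (simp add: M'_def)
      qed
      moreover have "M' * F \<le> real_of_int (K + dK) * of_int (A' - E')"
      proof -
        have "M' * F \<le> M' * (of_int A + of_int E)" using FG(1) pr by (intro mult_left_mono) auto
        then show ?thesis using ir(1) by (simp add: M'_def)
      qed
      moreover have "0 \<le> real_of_int w"
      proof -
        have "0 \<le> real_of_int w * of_int (A' - E')" using ir(2) pos by (auto intro: order.trans[rotated])
        then show ?thesis using ir(4) by (simp add: zero_le_mult_iff)
      qed
      then have "0 \<le> M' * of_int w" using pr by simp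
      ultimately have 1: "real_of_int (K - dK) * (of_int A' + of_int E') \<le> real_of_int (K + dK) * of_int (A' - E')"
        by (simp add: right_diff_distrib)
      have "of_int (A' - E') \<le> real_of_int A' + of_int E'" using G(2,3) by simp
      then have "real_of_int (K - dK) * of_int (A' - E') \<le> real_of_int (K - dK) * (of_int A' + of_int E')"
        using pos(4) by (intro mult_left_mono) auto
      with 1 have "real_of_int (K - dK) * of_int (A' - E') \<le> real_of_int (K + dK) * of_int (A' - E')" by linarith
      then have "real_of_int (K - dK) \<le> real_of_int (K + dK)" using ir(4) by (simp only: mult_le_cancel_right_pos)
      then show ?thesis by simp
    qed
    then show "0 < real_of_int (K + dK)" "0 < real_of_int (K - dK)" using pos(4) by auto
  qed
  have ratio: "af x / ag x = F / G" using pr by (simp add: F_def G_def)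
  have "M' * F \<le> M' * (of_int A + of_int E)" using FG(1) pr by (intro mult_left_mono) auto
  also have "\<dots> \<le> of_int (K + dK) * of_int (A' - E')" using ir(1) by (simp add: M'_def)
  also have "\<dots> \<le> of_int (K + dK) * G" using G(2) KK by (intro mult_left_mono) auto
  finally have up: "M' * (F / G) \<le> of_int (K + dK)" using G(1) by (simp add: field_simps)
  have "M' * airy_kappa \<le> M' * (F / G)"
    using airy_kappa_bounds(1)[OF pr(1)] pr unfolding ratio by (intro mult_left_mono) auto
  with up have 1: "M' * airy_kappa \<le> of_int K + of_int dK" by simp
  have "x * s * s \<le> of_int w * of_int (A' - E')" using ir(2) by (simp add: x_def s_def)
  also have "\<dots> \<le> of_int w * G"
  proof (intro mult_left_mono G(2))
    have "0 \<le> real_of_int w * of_int (A' - E')" using ir(2) pos by (auto intro: order.trans[rotated])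
    then show "0 \<le> real_of_int w" using ir(4) by (simp add: zero_le_mult_iff)
  qed
  finally have wG: "x * s * s / G \<le> of_int w" using G(1) by (simp add: field_simps)
  have "of_int (K - dK) * G \<le> of_int (K - dK) * of_int (A' + E')" using G(3) KK by (intro mult_left_mono) auto
  also have "\<dots> \<le> M' * (of_int A - of_int E - of_int w)" using ir(3) by (simp add: M'_def)
  also have "\<dots> \<le> M' * (F - x * s * s / G)" using FG(1) wG pr by (intro mult_left_mono) auto
  finally have "of_int (K - dK) \<le> M' * ((F - x * s * s / G) / G)" using G(1) by (simp add: field_simps)
  also have "(F - x * s * s / G) / G = af x / ag x - x / (ag x)\<^sup>2"
    using pr gp by (simp add: F_def G_def field_simps power2_eq_square)
  also have "M' * \<dots> \<le> M' * airy_kappa" using airy_kappa_lower[OF pr(1)] pr by (intro mult_left_mono) auto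
  finally have 2: "of_int K - of_int dK \<le> M' * airy_kappa" by simp
  show ?thesis using 1 2 unfolding M'_def by linarith
qed

text \<open>Tests for the sign \<open>s\<close> at the point \<open>- L / M\<close>. The linear
  coefficient of the series is \<open>- airy_kappa\<close>, whose uncertainty enters through the
  entry \<open>(T1, E1)\<close>; \<open>a / M\<close> approximates the cube of the point.\<close>

definition aa_check :: "int \<Rightarrow> int \<Rightarrow> int \<Rightarrow> int \<Rightarrow> int \<Rightarrow> int \<Rightarrow> int \<Rightarrow> int \<Rightarrow> int \<Rightarrow> int \<Rightarrow> int \<Rightarrow> int \<Rightarrow> int \<Rightarrow> (int \<times> int) list \<Rightarrow> bool" where
  "aa_check s S M N K dK L a da T1 E1 m c xs \<longleftrightarrow>
     0 < S \<and> 0 < M \<and> 0 < N \<and> 0 \<le> L \<and> 8 * (L * L * L) \<le> M * M * M * (m * m) \<and>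
     \<bar>M * M * a + L * L * L\<bar> \<le> M * M * da \<and> airy_check M a da m c xs \<and>
     take 3 xs = [(S, 0), (T1, E1), (0, 0)] \<and> \<bar>S * K * L - N * M * T1\<bar> + S * L * dK \<le> N * M * E1 \<and>
     (case cert_sum (\<lambda>_. 1) 0 xs of (A, B) \<Rightarrow> B + 8 * (m * m * m) * c < s * A)"

lemma aa_check_sound:
  assumes ck: "aa_check s S M N K dK L a da T1 E1 m c xs" and kap: "\<bar>of_int N * airy_kappa - of_int K\<bar> \<le> of_int dK"
    and s: "s = 1 \<or> s = -1"
  shows "0 < of_int s * aa (- of_int L / of_int M)"
proof -
  obtain A B where AB: "cert_sum (\<lambda>_. 1) 0 xs = (A, B)" by fastforce
  have xs: "take 3 xs = [(S, 0), (T1, E1), (0, 0)]"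
    and T: "\<bar>S * K * L - N * M * T1\<bar> + S * L * dK \<le> N * M * E1"
    using ck by (auto simp: aa_check_def)
  define z where "z = - real_of_int L / of_int M"
  define m' where "m' = real_of_int M"
  have pos: "0 < S" "0 < M" "0 < N" "0 \<le> L" and i: "8 * (L * L * L) \<le> M * M * M * (m * m)" 
     "\<bar>M * M * a + L * L * L\<bar> \<le> M * M * da" and ack: "airy_check M a da m c xs"
     and sgn: "B + 8 * (m * m * m) * c < s * A"
    using ck by (auto simp: aa_check_def AB)
  have M0: "0 < m'" "0 < real_of_int N" "0 < real_of_int S" "0 \<le> real_of_int L" using pos by (simp_all add: m'_def)
  have z: "m' * z = - of_int L" using M0 by (simp add: z_def m'_def)
  have z3: "m' * m' * (m' * z ^ 3) = - (of_int L * of_int L * of_int L)"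
  proof -
    have "m' * m' * (m' * z ^ 3) = (m' * z) * (m' * z) * (m' * z)" by (simp add: power3_eq_cube mult_ac)
    then show ?thesis unfolding z by simp
  qed
  have "real_of_int (8 * (L * L * L)) \<le> of_int (M * M * M * (m * m))" using i(1) by (simp only: of_int_le_iff)
  then have "(m' * m' * m') * (8 * \<bar>z\<bar> ^ 3) \<le> (m' * m' * m') * of_int (m * m)"
  proof -
    have "\<bar>z\<bar> ^ 3 = - (z ^ 3)" using M0 by (simp add: z_def m'_def power_abs[symmetric] power3_eq_cube)
    then have "(m' * m' * m') * (8 * \<bar>z\<bar> ^ 3) = 8 * - (m' * m' * (m' * z ^ 3))" by (simp add: mult_ac)
    also have "\<dots> = real_of_int (8 * (L * L * L))" unfolding z3 by simp
    finally show ?thesis using \<open>real_of_int (8 * (L * L * L)) \<le> _\<close> by (simp add: m'_def)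
  qed
  then have dec: "8 * \<bar>z\<bar> ^ 3 \<le> of_int (m * m)" using M0 by (simp only: mult_le_cancel_left_pos mult_pos_pos)
  have "real_of_int \<bar>M * M * a + L * L * L\<bar> \<le> of_int (M * M * da)" using i(2) by (simp only: of_int_le_iff)
  then have "\<bar>m' * m' * of_int a + of_int L * of_int L * of_int L\<bar> \<le> m' * m' * of_int da" by (simp add: m'_def)
  moreover have "m' * m' * (m' * z ^ 3 - of_int a) = - (m' * m' * of_int a + of_int L * of_int L * of_int L)"
    unfolding right_diff_distrib z3 by simp
  ultimately have "\<bar>m' * m' * (m' * z ^ 3 - of_int a)\<bar> \<le> m' * m' * of_int da" by simp
  then have "(m' * m') * \<bar>m' * z ^ 3 - of_int a\<bar> \<le> (m' * m') * of_int da" using M0 by (simp add: abs_mult)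
  then have al: "\<bar>of_int M * z ^ 3 - of_int a\<bar> \<le> of_int da" using M0 by (simp only: mult_le_cancel_left_pos mult_pos_pos m'_def)
  have T1: "\<bar>of_int S * (- airy_kappa * z) - of_int T1\<bar> \<le> of_int E1"
  proof -
    have "real_of_int (\<bar>S * K * L - N * M * T1\<bar> + S * L * dK) \<le> of_int (N * M * E1)" using T by (simp only: of_int_le_iff)
    then have T': "\<bar>of_int S * of_int K * of_int L - of_int N * m' * of_int T1\<bar> + of_int S * of_int L * of_int dK \<le> of_int N * m' * of_int E1"
      by (simp add: m'_def)
    have "of_int N * m' * (of_int S * (- airy_kappa * z) - of_int T1)
       = - (of_int S * (of_int N * airy_kappa) * (m' * z)) - of_int N * m' * of_int T1"
      by (simp add: algebra_simps)
    also have "\<dots> = of_int S * of_int L * (of_int N * airy_kappa - of_int K) + (of_int S * of_int K * of_int L - of_int N * m' * of_int T1)"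
      unfolding z by (simp add: algebra_simps)
    finally have "\<bar>of_int N * m' * (of_int S * (- airy_kappa * z) - of_int T1)\<bar> \<le>
       \<bar>of_int S * of_int L * (of_int N * airy_kappa - of_int K)\<bar> + \<bar>of_int S * of_int K * of_int L - of_int N * m' * of_int T1\<bar>" by linarith
    moreover have "\<bar>of_int S * of_int L * (of_int N * airy_kappa - of_int K)\<bar> \<le> of_int S * of_int L * of_int dK"
      unfolding abs_mult[of "of_int S * of_int L"] using kap M0 by (intro mult_mono) auto
    moreover have "\<bar>of_int N * m' * u\<bar> = (of_int N * m') * \<bar>u\<bar>" for u using M0 by (simp only: abs_mult abs_of_pos)
    ultimately have "(of_int N * m') * \<bar>of_int S * (- airy_kappa * z) - of_int T1\<bar> \<le> (of_int N * m') * of_int E1"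
      using T' by linarith
    then show ?thesis using M0 by (simp only: mult_le_cancel_left_pos mult_pos_pos)
  qed
  have c2: "airy_coeff 0 u v (Suc (Suc 0)) = 0" for u v by simp
  have "\<bar>of_int S * airy_sol 0 1 (- airy_kappa) z - of_int A\<bar> \<le> of_int (B + 8 * (m * m * m) * c)"
  proof (rule airy_checkD[OF ack pos(2) al dec _ M0(3) AB])
    show "encloses (of_int S) (\<lambda>n. airy_coeff 0 1 (- airy_kappa) n * z ^ n) (take 3 xs)"
      unfolding xs encloses_Cons using T1 by (simp add: c2 del: airy_coeff.simps(3))
  qed
  also have "\<dots> < of_int (s * A)" using sgn by (simp only: of_int_less_iff)
  finally have 1: "0 < of_int s * (of_int S * airy_sol 0 1 (- airy_kappa) z)" using s by (auto simp: abs_if split: if_splits)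
  have "aa z = airy_sol 0 1 (- airy_kappa) z"
    using airy_represent[OF airy_sol_ode, of 1 "- airy_kappa" z] by (simp add: aa_def)
  with 1 have "0 < of_int S * (of_int s * aa z)" by (simp add: mult_ac)
  then show ?thesis using M0(3) by (simp add: zero_less_mult_iff z_def)
qed

subsection \<open>The variances\<close>

definition ef_sq_fps :: "real \<Rightarrow> real fps" where
  "ef_sq_fps l = airy_fps l 0 1 * airy_fps l 0 1"

lemma ef_eq_airy_sol: "r \<ge> 1 \<Longrightarrow> ef r x = airy_sol (ev r) 0 1 x"
  using ode2_represent[OF airy_sol_ode[of "ev r" 1 0] _ _ airy_sol_ode[of "ev r" 0 1] _ _ ef_ode[of r], of 0 x]
  by (simp add: ef_0)

lemma conv_radius_ef_sq_fps [simp]: "fps_conv_radius (ef_sq_fps l) = \<infinity>"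
  using fps_conv_radius_mult[of "airy_fps l 0 1" "airy_fps l 0 1"] by (simp add: ef_sq_fps_def)

text \<open>For \<open>U = F * F\<close> one finds
  \<open>U'' = 2 * (F' * F') + 2 * (X - l) * U\<close>; differentiating once more and using the
  equation for \<open>F\<close> eliminates \<open>F'\<close>.\<close>

lemma ef_sq_fps_ode:
  "fps_deriv (fps_deriv (fps_deriv (ef_sq_fps l)))
     = fps_const 4 * (fps_X - fps_const l) * fps_deriv (ef_sq_fps l) + fps_const 2 * ef_sq_fps l"
proof -
  define F where "F = airy_fps l 0 1"
  have F2: "fps_deriv (fps_deriv F) = (fps_X - fps_const l) * F" unfolding F_def by (rule airy_fps_ode)
  have c: "fps_const (4::real) = 4" "fps_const (2::real) = 2" by (simp_all add: numeral_fps_const)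
  have 1: "fps_deriv (F * F) = 2 * (F * fps_deriv F)" by (simp add: mult.commute)
  have 2: "fps_deriv (fps_deriv (F * F)) = 2 * (fps_deriv F * fps_deriv F) + 2 * ((fps_X - fps_const l) * (F * F))"
    unfolding 1 by (simp add: F2 algebra_simps c[symmetric])
  show ?thesis
    unfolding ef_sq_fps_def F_def[symmetric] 2 c 1
    by (simp add: F2 algebra_simps c[symmetric])
qed

lemma ef_sq_fps_rec:
  "(real n + 1) * (real n + 2) * (real n + 3) * fps_nth (ef_sq_fps l) (n + 3)
     = (4 * real n + 2) * fps_nth (ef_sq_fps l) n - 4 * l * (real n + 1) * fps_nth (ef_sq_fps l) (n + 1)"
proof -
  have "fps_nth (fps_const 4 * (fps_X - fps_const l) * fps_deriv (ef_sq_fps l)) n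
    = 4 * (real n * fps_nth (ef_sq_fps l) n) - 4 * l * ((real n + 1) * fps_nth (ef_sq_fps l) (n + 1))"
    by (cases n) (simp_all add: mult.assoc left_diff_distrib right_diff_distrib algebra_simps)
  then show ?thesis
    using arg_cong[OF ef_sq_fps_ode[of l], of "\<lambda>f. fps_nth f n"]
    by (simp add: numeral_3_eq_3 numeral_2_eq_2 algebra_simps)
qed

lemma ef_sq_fps_init:
  "fps_nth (ef_sq_fps l) 0 = 0" "fps_nth (ef_sq_fps l) 1 = 0" "fps_nth (ef_sq_fps l) 2 = 1"
  by (simp_all add: ef_sq_fps_def fps_mult_nth nth_airy_fps numeral_2_eq_2)

lemma eval_ef_sq_fps:
  assumes r: "r \<ge> 1"
  shows "eval_fps (ef_sq_fps (ev r)) x = (ef r x)\<^sup>2"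
    "eval_fps (fps_deriv (fps_deriv (ef_sq_fps (ev r)))) x = 2 * (ef' r x)\<^sup>2 + 2 * (x - ev r) * (ef r x)\<^sup>2"
proof -
  show 0: "eval_fps (ef_sq_fps (ev r)) x = (ef r x)\<^sup>2" for x
    unfolding ef_sq_fps_def by (subst eval_fps_mult) (simp_all add: ef_eq_airy_sol[OF r] airy_sol_def power2_eq_square)
  have E: "eval_fps (ef_sq_fps (ev r)) = (\<lambda>x. (ef r x)\<^sup>2)" using 0 by auto
  have 1: "eval_fps (fps_deriv (ef_sq_fps (ev r))) x = 2 * ef r x * ef' r x" for x
  proof (rule DERIV_unique[of "eval_fps (ef_sq_fps (ev r))"])
    show "(eval_fps (ef_sq_fps (ev r)) has_real_derivative eval_fps (fps_deriv (ef_sq_fps (ev r))) x) (at x)"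
      by (rule has_field_derivative_eval_fps) simp
    show "(eval_fps (ef_sq_fps (ev r)) has_real_derivative 2 * ef r x * ef' r x) (at x)"
      unfolding E using ode2D(1)[OF ef_ode[of r], of x] by (auto intro!: derivative_eq_intros)
  qed
  have E1: "eval_fps (fps_deriv (ef_sq_fps (ev r))) = (\<lambda>x. 2 * ef r x * ef' r x)" using 1 by auto
  show "eval_fps (fps_deriv (fps_deriv (ef_sq_fps (ev r)))) x = 2 * (ef' r x)\<^sup>2 + 2 * (x - ev r) * (ef r x)\<^sup>2"
  proof (rule DERIV_unique[of "eval_fps (fps_deriv (ef_sq_fps (ev r)))"])
    show "(eval_fps (fps_deriv (ef_sq_fps (ev r))) has_real_derivative eval_fps (fps_deriv (fps_deriv (ef_sq_fps (ev r)))) x) (at x)"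
      by (rule has_field_derivative_eval_fps) simp
    show "(eval_fps (fps_deriv (ef_sq_fps (ev r))) has_real_derivative 2 * (ef' r x)\<^sup>2 + 2 * (x - ev r) * (ef r x)\<^sup>2) (at x)"
      unfolding E1 using ode2D[OF ef_ode[of r], of x]
      by (auto intro!: derivative_eq_intros simp: power2_eq_square algebra_simps)
  qed
qed

text \<open>For \<open>n = 0\<close> the division by zero gives the right value 0.\<close>

definition s2_term :: "real \<Rightarrow> real \<Rightarrow> nat \<Rightarrow> real" where
  "s2_term l X n = fps_nth (ef_sq_fps l) n * X ^ n / real n"

lemma s2_term_mult: "real n * s2_term l X n = fps_nth (ef_sq_fps l) n * X ^ n"
  by (cases n) (simp_all add: s2_term_def ef_sq_fps_init del: of_nat_Suc)

lemma s2_term_rec: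
  "(real n + 1) * (real n + 2) * (real n + 3) * (real n + 3) * s2_term l X (n + 3)
     = (4 * real n + 2) * real n * X ^ 3 * s2_term l X n - 4 * (real n + 1) * (real n + 1) * X\<^sup>2 * l * s2_term l X (n + 1)"
proof -
  have 3: "(real n + 3) * s2_term l X (n + 3) = fps_nth (ef_sq_fps l) (n + 3) * X ^ (n + 3)"
    using s2_term_mult[of "n + 3" l X] by simp
  have 1: "(real n + 1) * s2_term l X (n + 1) = fps_nth (ef_sq_fps l) (n + 1) * X ^ (n + 1)"
    using s2_term_mult[of "n + 1" l X] by (simp add: add.commute)
  have "(real n + 1) * (real n + 2) * (real n + 3) * (real n + 3) * s2_term l X (n + 3)
      = ((real n + 1) * (real n + 2) * (real n + 3) * fps_nth (ef_sq_fps l) (n + 3)) * X ^ (n + 3)"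
    unfolding mult.assoc 3 ..
  also have "\<dots> = (4 * real n + 2) * X ^ 3 * (fps_nth (ef_sq_fps l) n * X ^ n)
      - 4 * l * (real n + 1) * X\<^sup>2 * (fps_nth (ef_sq_fps l) (n + 1) * X ^ (n + 1))"
    unfolding ef_sq_fps_rec by (simp add: power_add power2_eq_square power3_eq_cube algebra_simps)
  finally show ?thesis unfolding 1[symmetric] s2_term_mult[symmetric] by (simp add: mult_ac)
qed

text \<open>The first series is integrated term by term. The second is \<open>X\<^sup>2\<close>
  times the second derivative of the square of \<open>ef\<close>; one of its factors
  \<open>real n\<close> undoes the division in \<open>s2_term\<close>.\<close>

lemma s2_term_sums:
  assumes r: "r \<ge> 1" and X: "0 < X"
  shows "s2_term (ev r) X sums (LINT x:{0..X}|lborel. s2i r x)"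
    "(\<lambda>n. real n * real n * (real n - 1) * s2_term (ev r) X n) sums (X\<^sup>2 * (2 * (ef' r X)\<^sup>2 + 2 * (X - ev r) * (ef r X)\<^sup>2))"
proof -
  define U where "U = ef_sq_fps (ev r)"
  define P where "P = fps_integral (fps_shift 1 U) 0"
  have Pn: "fps_nth P n = fps_nth U n / real n" for n
    by (cases n) (simp_all add: P_def fps_integral_def divide_inverse mult.commute)
  have rad: "fps_conv_radius P = \<infinity>"
    unfolding fps_conv_radius_def
  proof (rule conv_radius_inftyI'')
    fix z :: real
    have "summable (\<lambda>n. norm (fps_nth U n * z ^ n))"
      by (rule abs_summable_in_conv_radius) (use conv_radius_ef_sq_fps[of "ev r"] in \<open>simp add: fps_conv_radius_def U_def\<close>)
    then show "summable (\<lambda>n. fps_nth P n * z ^ n)"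
    proof (rule summable_comparison_test'[where N = 0])
      fix n
      have "\<bar>fps_nth U n\<bar> / real n \<le> \<bar>fps_nth U n\<bar>"
        by (cases n) (simp_all add: divide_le_eq mult_le_cancel_left1 del: of_nat_Suc)
      then show "norm (fps_nth P n * z ^ n) \<le> norm (fps_nth U n * z ^ n)"
        unfolding Pn real_norm_def abs_mult abs_divide abs_of_nat by (rule mult_right_mono) simp
    qed
  qed
  have dP: "(eval_fps P has_real_derivative s2i r x) (at x)" for x
  proof -
    have "eval_fps (fps_deriv P) x = s2i r x"
    proof (cases "x = 0")
      case True
      then show ?thesis by (simp add: P_def fps_deriv_fps_integral eval_fps_at_0 s2i_def U_def ef_sq_fps_init[simplified])
    next
      case False
      \<comment> \<open>The shift loses nothing, because the constant coefficient of
        \<open>U\<close> is 0.\<close>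
      have "fps_shift 1 U * fps_X = U"
        by (rule fps_ext) (auto simp: U_def ef_sq_fps_init)
      then have "eval_fps U x = eval_fps (fps_shift 1 U) x * x"
        using eval_fps_mult[of x "fps_shift 1 U" fps_X] by (simp add: U_def)
      then show ?thesis using False eval_ef_sq_fps(1)[OF r, of x]
        by (simp add: P_def fps_deriv_fps_integral s2i_def U_def)
    qed
    then show ?thesis using has_field_derivative_eval_fps[of x P UNIV] rad by simp
  qed
  have "(LINT x:{0..X}|lborel. s2i r x) = eval_fps P X - eval_fps P 0"
    using X dP by (intro s2i_antiderivative[OF r]) auto
  also have "\<dots> = eval_fps P X" by (simp add: eval_fps_at_0 P_def fps_integral_def)
  finally have I: "(LINT x:{0..X}|lborel. s2i r x) = eval_fps P X" .
  have "(\<lambda>n. fps_nth P n * X ^ n) sums eval_fps P X" using rad by (intro sums_eval_fps) simp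
  then show "s2_term (ev r) X sums (LINT x:{0..X}|lborel. s2i r x)"
    unfolding I s2_term_def[abs_def] Pn U_def by (simp add: mult.commute)
  have "(\<lambda>n. fps_nth (fps_deriv (fps_deriv U)) n * X ^ n) sums eval_fps (fps_deriv (fps_deriv U)) X"
    by (intro sums_eval_fps) (simp add: U_def)
  then have "(\<lambda>n. X\<^sup>2 * (fps_nth (fps_deriv (fps_deriv U)) n * X ^ n)) sums (X\<^sup>2 * eval_fps (fps_deriv (fps_deriv U)) X)"
    by (rule sums_mult)
  moreover have "X\<^sup>2 * (fps_nth (fps_deriv (fps_deriv U)) n * X ^ n)
      = real (n + 2) * real (n + 2) * (real (n + 2) - 1) * s2_term (ev r) X (n + 2)" for n
  proof -
    have "real (n + 2) * real (n + 2) * (real (n + 2) - 1) * s2_term (ev r) X (n + 2)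
        = (real n + 2) * (real n + 1) * (real (n + 2) * s2_term (ev r) X (n + 2))" by (simp add: algebra_simps)
    also have "\<dots> = (real n + 2) * (real n + 1) * (fps_nth U (n + 2) * X ^ (n + 2))"
      unfolding s2_term_mult U_def ..
    finally show ?thesis by (simp add: numeral_2_eq_2 power2_eq_square algebra_simps)
  qed
  ultimately have *: "(\<lambda>n. real (n + 2) * real (n + 2) * (real (n + 2) - 1) * s2_term (ev r) X (n + 2)) sums
      (X\<^sup>2 * (2 * (ef' r X)\<^sup>2 + 2 * (X - ev r) * (ef r X)\<^sup>2))"
    by (simp only: U_def eval_ef_sq_fps(2)[OF r])
  show "(\<lambda>n. real n * real n * (real n - 1) * s2_term (ev r) X n) sums (X\<^sup>2 * (2 * (ef' r X)\<^sup>2 + 2 * (X - ev r) * (ef r X)\<^sup>2))"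
    using * sums_iff_shift[of "\<lambda>n. real n * real n * (real n - 1) * s2_term (ev r) X n" 2]
    by (simp add: numeral_2_eq_2)
qed

text \<open>\<open>lo\<close> is the claim in units of 1/1000. The lower bound uses the integral up
  to \<open>X\<close> only. The upper bound adds the tail, where the second certified sum is
  \<open>X\<^sup>2\<close> times the second derivative, whence the factor
  \<open>2 * (X * X * X)\<close>. The condition \<open>L + dL \<le> X * M\<close> puts
  \<open>X\<close> beyond \<open>ev r\<close>, as the tail bound demands.\<close>

definition sigma_check :: "int \<Rightarrow> int \<Rightarrow> int \<Rightarrow> int \<Rightarrow> int \<Rightarrow> int \<Rightarrow> int \<Rightarrow> int \<Rightarrow> int \<Rightarrow> (int \<times> int) list \<Rightarrow> bool" where
  "sigma_check X S M L dL m c T lo xs \<longleftrightarrow>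
     0 < X \<and> 0 < S \<and> 0 < M \<and> L + dL \<le> X * M \<and> 7 \<le> m \<and> int (length xs) = m + 3 \<and>
     8 * (4 * (X * X * X) * M + 2 * (X * X) * (L + dL)) \<le> M * (m * m) \<and>
     take 3 xs = [(0, 0), (0, 0), (T, 0)] \<and> 2 * T = S * (X * X) \<and>
     cert_ok (\<lambda>n. (4 * n + 2) * n * (X * X * X)) (\<lambda>n. 4 * (n + 1) * (n + 1) * (X * X))
       (\<lambda>n. (n + 1) * (n + 2) * (n + 3) * (n + 3)) M 0 L dL M 0 xs \<and> cert_tail c xs \<and>
     (case cert_sum (\<lambda>_. 1) 0 xs of (A, B) \<Rightarrow> case cert_sum (\<lambda>n. n * n * (n - 1)) 0 xs of (A', B') \<Rightarrow>
       let e = 8 * (m * m * m) * c in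
       lo * S \<le> 1000 * (A - (B + e)) \<and>
       1000 * ((A + (B + e)) * (2 * (X * X * X)) + (A' + (B' + e))) < (lo + 1) * S * (2 * (X * X * X)))"

lemma sigma_check_sound:
  assumes ck: "sigma_check X S M L dL m c T lo xs" and r: "r \<ge> 1"
    and ev: "\<bar>of_int M * ev r - of_int L\<bar> \<le> of_int dL"
  shows "of_int lo / 1000 \<le> sigma2_max r" "sigma2_max r < (of_int lo + 1) / 1000"
proof -
  obtain A B where AB: "cert_sum (\<lambda>_. 1) 0 xs = (A, B)" by fastforce
  obtain A' B' where AB': "cert_sum (\<lambda>n. n * n * (n - 1)) 0 xs = (A', B')" by fastforce
  define e where "e = 8 * (m * m * m) * c"
  define E where "E = B + e" define E' where "E' = B' + e"
  have pos: "0 < X" "0 < S" "0 < M" and LX: "L + dL \<le> X * M" and m: "7 \<le> m" "int (length xs) = m + 3"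
    and dec: "8 * (4 * (X * X * X) * M + 2 * (X * X) * (L + dL)) \<le> M * (m * m)"
    and t3: "take 3 xs = [(0, 0), (0, 0), (T, 0)]" "2 * T = S * (X * X)"
    and ok: "cert_ok (\<lambda>n. (4 * n + 2) * n * (X * X * X)) (\<lambda>n. 4 * (n + 1) * (n + 1) * (X * X))
       (\<lambda>n. (n + 1) * (n + 2) * (n + 3) * (n + 3)) M 0 L dL M 0 xs" and tl: "cert_tail c xs"
    and i: "lo * S \<le> 1000 * (A - E)" "1000 * ((A + E) * (2 * (X * X * X)) + (A' + E')) < (lo + 1) * S * (2 * (X * X * X))"
    using ck by (auto simp: sigma_check_def AB AB' Let_def E_def E'_def e_def)
  define k where "k = nat m"
  have k: "int k = m" "real k = of_int m" "length xs = k + 3" "7 \<le> k" using m by (auto simp: k_def)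
  define x s M' l where "x = real_of_int X" and "s = real_of_int S" and "M' = real_of_int M" and "l = ev r"
  have pr: "0 < x" "0 < s" "0 < M'" using pos by (simp_all add: x_def s_def M'_def)
  have l0: "0 < l" using ev_pos[OF r] by (simp add: l_def)
  have Ml: "M' * l \<le> of_int (L + dL)" using ev by (simp add: l_def M'_def abs_le_iff)
  have "real_of_int (L + dL) \<le> of_int (X * M)" using LX by (simp only: of_int_le_iff)
  with Ml have "M' * l \<le> M' * x" by (simp add: M'_def x_def mult.commute)
  then have lx: "l \<le> x" using pr by simp
  have "real_of_int (8 * (4 * (X * X * X) * M + 2 * (X * X) * (L + dL))) \<le> of_int (M * (m * m))" using dec by (simp only: of_int_le_iff)
  then have d1: "8 * (4 * (x * x * x) * M' + 2 * (x * x) * of_int (L + dL)) \<le> M' * (real k * real k)" by (simp add: x_def M'_def k(2))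
  have "2 * (x * x) * (M' * l) \<le> 2 * (x * x) * of_int (L + dL)" using Ml by (intro mult_left_mono) auto
  then have "M' * (8 * (4 * (x * x * x) + 2 * (x * x) * l)) \<le> M' * (real k * real k)" using d1 by (simp add: algebra_simps)
  then have d2: "8 * (4 * (x * x * x) + 2 * (x * x) * l) \<le> real k * real k" using pr by simp
  let ?t = "s2_term l x"
  have enc: "encloses s ?t xs"
  proof (rule cert_ok_encloses[OF ok, of _ 1 l])
    fix n
    show "real_of_int ((0 + int n + 1) * (0 + int n + 2) * (0 + int n + 3) * (0 + int n + 3)) * ?t (n + 3)
      = of_int ((4 * (0 + int n) + 2) * (0 + int n) * (X * X * X)) * 1 * ?t n
        - of_int (4 * (0 + int n + 1) * (0 + int n + 1) * (X * X)) * l * ?t (n + 1)"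
      using s2_term_rec[of n l x] by (simp add: x_def power2_eq_square power3_eq_cube mult_ac)
    show "0 < (0 + int n + 1) * (0 + int n + 2) * (0 + int n + 3) * (0 + int n + 3)" by simp
  next
    have "real_of_int (2 * T) = of_int (S * (X * X))" using t3(2) by (simp only:)
    then have "s * ?t 2 = of_int T" by (simp add: s2_term_def ef_sq_fps_init(3) s_def x_def power2_eq_square)
    then show "encloses s ?t (take 3 xs)"
      unfolding t3 encloses_Cons
      by (simp add: s2_term_def ef_sq_fps_init[simplified] numeral_2_eq_2)
  qed (use pos ev in \<open>auto simp: l_def\<close>)
  \<comment> \<open>Leading parts of the two recursion coefficients, with \<open>k\<close> in place
    of the index; they dominate the coefficients at all later indices.\<close>
  define P Q where "P = 4 * (x * x * x) / (real k * real k)" and "Q = 4 * (x * x) * l / (real k * real k)"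
  have kk: "0 < real k * real k" using k(4) by simp
  have PQ: "0 \<le> P" "0 \<le> Q" using pr l0 by (simp_all add: P_def Q_def)
  have "4 * a / K + 4 * b * l / K / 2 = (8 * (4 * a + 2 * b * l)) / K / 8" for a b K :: real
    by (cases "K = 0") (simp_all add: field_simps)
  then have "P + Q / 2 = (8 * (4 * (x * x * x) + 2 * (x * x) * l)) / (real k * real k) / 8" unfolding P_def Q_def .
  also have "\<dots> \<le> 1 / 8" using d2 kk by (simp add: divide_le_eq)
  finally have PQ8: "P + Q / 2 \<le> 1 / 8" .
  have decay: "\<bar>?t (n + 3)\<bar> \<le> P * \<bar>?t n\<bar> + Q * \<bar>?t (n + 1)\<bar>" if n: "k \<le> n" for n
  proof -
    define d where "d = (real n + 1) * (real n + 2) * (real n + 3) * (real n + 3)"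
    have d0: "0 < d" by (simp add: d_def)
    have kn: "real k * real k \<le> (real n + 3) * (real n + 3)" using n by (intro mult_mono) auto
    have b1: "(4 * real n + 2) * real n * x ^ 3 \<le> P * d"
    proof -
      have "(4 * real n + 2) * real n * x ^ 3 = ((4 * real n + 2) * real n) * (x * x * x)" by (simp add: power3_eq_cube)
      also have "\<dots> \<le> ((4 * (real n + 1)) * (real n + 2)) * (x * x * x)" using pr by (intro mult_right_mono mult_mono) auto
      also have "\<dots> = (real n + 1) * (real n + 2) * (P * (real k * real k))" using k(4) by (simp add: P_def)
      also have "\<dots> \<le> (real n + 1) * (real n + 2) * (P * ((real n + 3) * (real n + 3)))"
        using kn PQ by (intro mult_left_mono) auto
      finally show ?thesis by (simp add: d_def mult_ac)
    qed
    have b2: "4 * (real n + 1) * (real n + 1) * x\<^sup>2 * l \<le> Q * d"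
    proof -
      have "4 * (real n + 1) * (real n + 1) * x\<^sup>2 * l = ((real n + 1) * (real n + 1)) * (4 * (x * x) * l)" by (simp add: power2_eq_square)
      also have "\<dots> \<le> ((real n + 1) * (real n + 2)) * (4 * (x * x) * l)" using pr l0 by (intro mult_right_mono mult_mono) auto
      also have "\<dots> = (real n + 1) * (real n + 2) * (Q * (real k * real k))" using k(4) by (simp add: Q_def)
      also have "\<dots> \<le> (real n + 1) * (real n + 2) * (Q * ((real n + 3) * (real n + 3)))"
        using kn PQ by (intro mult_left_mono) auto
      finally show ?thesis by (simp add: d_def mult_ac)
    qed
    have "d * \<bar>?t (n + 3)\<bar> = \<bar>d * ?t (n + 3)\<bar>" using d0 by (simp add: abs_mult)
    also have "d * ?t (n + 3) = (4 * real n + 2) * real n * x ^ 3 * ?t n - 4 * (real n + 1) * (real n + 1) * x\<^sup>2 * l * ?t (n + 1)"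
      unfolding d_def by (rule s2_term_rec)
    also have "\<bar>\<dots>\<bar> \<le> \<bar>(4 * real n + 2) * real n * x ^ 3 * ?t n\<bar> + \<bar>4 * (real n + 1) * (real n + 1) * x\<^sup>2 * l * ?t (n + 1)\<bar>"
      by (rule abs_triangle_ineq4)
    also have "\<dots> = (4 * real n + 2) * real n * x ^ 3 * \<bar>?t n\<bar> + 4 * (real n + 1) * (real n + 1) * x\<^sup>2 * l * \<bar>?t (n + 1)\<bar>"
      using pr l0 by (simp add: abs_mult)
    also have "\<dots> \<le> P * d * \<bar>?t n\<bar> + Q * d * \<bar>?t (n + 1)\<bar>" by (intro add_mono mult_right_mono b1 b2) auto
    finally have "d * \<bar>?t (n + 3)\<bar> \<le> d * (P * \<bar>?t n\<bar> + Q * \<bar>?t (n + 1)\<bar>)" by (simp add: algebra_simps)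
    then show ?thesis using d0 by simp
  qed
  have er: "8 * real k ^ 3 * of_int c = of_int e" by (simp add: e_def k(2) power3_eq_cube)
  define I where "I = (LINT x:{0..x}|lborel. s2i r x)"
  define V where "V = 2 * (ef' r x)\<^sup>2 + 2 * (x - ev r) * (ef r x)\<^sup>2"
  have "\<bar>s * I - of_int A\<bar> \<le> of_int B + 8 * real k ^ 3 * of_int c"
  proof (rule cert_series[OF enc tl pr(2) k(3,4) decay PQ PQ8 AB])
    show "(\<lambda>n. of_int 1 * ?t n) sums I" using s2_term_sums(1)[OF r pr(1)] by (simp add: I_def l_def)
  qed auto
  then have I: "\<bar>s * I - of_int A\<bar> \<le> of_int E" unfolding er by (simp add: E_def)
  have "\<bar>s * (x\<^sup>2 * V) - of_int A'\<bar> \<le> of_int B' + 8 * real k ^ 3 * of_int c"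
  proof (rule cert_series[OF enc tl pr(2) k(3,4) decay PQ PQ8 AB'])
    show "(\<lambda>n. of_int (int n * int n * (int n - 1)) * ?t n) sums (x\<^sup>2 * V)"
      using s2_term_sums(2)[OF r pr(1)] by (simp add: V_def l_def)
    fix n :: nat
    show "\<bar>real_of_int (int n * int n * (int n - 1))\<bar> \<le> real n ^ 3 + 1"
    proof (cases "n = 0")
      case False
      then have "0 \<le> real n * real n * (real n - 1)" by (intro mult_nonneg_nonneg) auto
      moreover have "real n * real n * (real n - 1) \<le> real n * real n * real n" by (intro mult_left_mono) auto
      moreover have "real_of_int (int n * int n * (int n - 1)) = real n * real n * (real n - 1)" by simp
      ultimately show ?thesis unfolding power3_eq_cube by linarith
    qed simp
  qed
  then have V: "\<bar>s * (x\<^sup>2 * V) - of_int A'\<bar> \<le> of_int E'" unfolding er by (simp add: E'_def)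
  have tail: "0 \<le> (LINT y:{x..}|lborel. s2i r y)" "(LINT y:{x..}|lborel. s2i r y) \<le> V / (2 * x)"
  proof -
    have "0 \<le> (x - ev r) * (ef r x)\<^sup>2" using lx by (simp add: l_def)
    then have "- ef_en r x \<le> V / 2" by (simp add: ef_en_def V_def field_simps)
    then have "- ef_en r x / x \<le> V / 2 / x" using pr by (intro divide_right_mono) auto
    then show "(LINT y:{x..}|lborel. s2i r y) \<le> V / (2 * x)" using s2i_integrable_tail(2)[OF r pr(1)] by simp
    show "0 \<le> (LINT y:{x..}|lborel. s2i r y)" by (rule s2i_integrable_tail(3)[OF r pr(1)])
  qed
  have sp: "sigma2_max r = I + (LINT y:{x..}|lborel. s2i r y)" unfolding I_def by (rule s2i_split(2)[OF r pr(1)])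
  have ir: "real_of_int (lo * S) \<le> of_int (1000 * (A - E))"
    "real_of_int (1000 * ((A + E) * (2 * (X * X * X)) + (A' + E'))) < of_int ((lo + 1) * S * (2 * (X * X * X)))"
    using i by (simp_all only: of_int_le_iff of_int_less_iff)
  have "of_int lo * s \<le> 1000 * (of_int A - of_int E)" using ir(1) by (simp add: s_def)
  also have "\<dots> \<le> 1000 * (s * I)" using I by simp
  finally have "s * of_int lo \<le> s * (1000 * I)" by (simp add: mult_ac)
  then have "of_int lo \<le> 1000 * I" using pr by simp
  then show "of_int lo / 1000 \<le> sigma2_max r" using sp tail(1) by simp
  define w where "w = 2 * (x * x * x)"
  have w: "0 < w" using pr by (simp add: w_def)
  have "(s * I) * w \<le> (of_int A + of_int E) * w" using I w by (intro mult_right_mono) auto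
  moreover have "s * (x\<^sup>2 * V) \<le> of_int A' + of_int E'" using V by linarith
  ultimately have "1000 * ((s * I) * w + s * (x\<^sup>2 * V)) \<le> 1000 * ((of_int A + of_int E) * w + (of_int A' + of_int E'))" by simp
  also have "\<dots> < (of_int lo + 1) * s * w" using ir(2) by (simp add: s_def w_def x_def)
  finally have "1000 * ((s * I) * w + s * (x\<^sup>2 * V)) < (of_int lo + 1) * s * w" .
  moreover have "x\<^sup>2 * V = w * (V / (2 * x))" using pr by (simp add: w_def power2_eq_square)
  moreover have "1000 * ((s * I) * w + s * (w * v)) = (s * w) * (1000 * (I + v))" for v
    by (simp add: algebra_simps)
  moreover have "(of_int lo + 1) * s * w = (s * w) * (of_int lo + 1)" by (simp only: mult_ac)
  ultimately have "(s * w) * (1000 * (I + V / (2 * x))) < (s * w) * (of_int lo + 1)" by (simp only:)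
  then have "1000 * (I + V / (2 * x)) < of_int lo + 1" using pr w by (simp only: mult_less_cancel_left_pos mult_pos_pos)
  then show "sigma2_max r < (of_int lo + 1) / 1000" using sp tail(2) by simp
qed

subsection \<open>The certificates\<close>

text \<open>Obtained by running the recursions in rounded arithmetic and accumulating the error bounds. Only the
  first three entries of a list are given data, the others are verified by the checker.\<close>

definition kappa_f_cert :: "(int \<times> int) list" where
  "kappa_f_cert = [(324518553658426726783156020576256, 0), (0, 0), (0, 0), (265726609020641751447607588181857621, 1), (0, 0), (0,
    0), (43517161003947097495403202691248883066, 164), (0, 0), (0, 0), (2969441833505445694373832428084802256990,
    11200), (0, 0), (0, 0), (110521725212214050730747263024095708246908, 417000), (0, 0), (0, 0),
    (2585682076036226815429339539225629593414567, 9760000), (0, 0), (0, 0),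
    (41514562220803863869948840379789275138711659, 157000000), (0, 0), (0, 0),
    (485621533787641388554901554252154068467834240, 1840000000), (0, 0), (0, 0),
    (4322207600541090836902593000073972714460995690, 16400000000), (0, 0), (0, 0),
    (30249296212903674190459315397953601062887281802, 115000000000), (0, 0), (0, 0),
    (170821600337926150916927145459937979335592201716, 650000000000), (0, 0), (0, 0),
    (794741025057037101756499115193821299692958794537, 3030000000000), (0, 0), (0, 0),
    (3098859250877161334071174724561304797929767109175, 11900000000000), (0, 0), (0, 0),
    (10273073886342438349724481391207618402313728614964, 39500000000000), (0, 0), (0, 0),
    (29309879212311498032634365316494209762234232686015, 113000000000000), (0, 0), (0, 0),
    (72726988166710297896127594343402046748412517770905, 281000000000000), (0, 0), (0, 0),
    (158381069531492771969714038567878659430385948496656, 612000000000000), (0, 0), (0, 0),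
    (305147527297342740661649047640779550502543594103557, 1180000000000000), (0, 0), (0, 0),
    (523825926489114215538323469971750500216281159270012, 2030000000000000), (0, 0), (0, 0),
    (806252123070494405056323060141356581316600669014276, 3130000000000000), (0, 0), (0, 0),
    (1118959514306592941254721806348724543505214431318401, 4350000000000000), (0, 0), (0, 0),
    (1407436787964232237681630372399202171592708269602484, 5480000000000000), (0, 0), (0, 0),
    (1611826792370226802734230773798899829611882454209092, 6280000000000000), (0, 0), (0, 0),
    (1687746170271722992718089469666239314339978366907346, 6580000000000000), (0, 0), (0, 0),
    (1622045566225542852743343811516086414583785938305123, 6330000000000000), (0, 0), (0, 0),
    (1435875651687584150545594260536672532405430687368121, 5610000000000000), (0, 0), (0, 0),
    (1174568277845671150787629803865579778839141020153110, 4590000000000000), (0, 0), (0, 0),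
    (890533016829596043799324880615986644048873430866085, 3490000000000000), (0, 0), (0, 0),
    (627537107240935938494848413434644633134267809214727, 2460000000000000), (0, 0), (0, 0),
    (412067603297877341061907278161508832209122927916594, 1620000000000000), (0, 0), (0, 0),
    (252745085518410908444088696330523457258854050543599, 994000000000000), (0, 0), (0, 0),
    (145130505510980924869776503631587394286202658990264, 571000000000000), (0, 0), (0, 0),
    (78182694470992246040045171309428603961415971888067, 308000000000000), (0, 0), (0, 0),
    (39590968659656246629018957600826915199179207368179, 156000000000000), (0, 0), (0, 0),
    (18880841489506031808228512783232637776506255659082, 74400000000000), (0, 0), (0, 0),
    (8494649655489298010423688947254757270693702752113, 33500000000000), (0, 0), (0, 0),
    (3611475749170900062756281048620856911640547042327, 14300000000000), (0, 0), (0, 0),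
    (1453167924297840459321999082053584767149058773051, 5760000000000), (0, 0), (0, 0),
    (554216271702786071778371486580442630104279285204, 2200000000000), (0, 0), (0, 0),
    (200623676899188621474148181076459964758497209564, 797000000000), (0, 0), (0, 0),
    (69024098361744656673843838489401106922863920910, 275000000000), (0, 0), (0, 0),
    (22598653555327968695094947254326778509398270254, 90100000000), (0, 0), (0, 0),
    (7049345074115956203111204816540156369312615985, 28200000000), (0, 0), (0, 0),
    (2097470466880553102342862721878742020496177467, 8400000000), (0, 0), (0, 0),
    (595932940306740538503960476092427686022306263, 2390000000), (0, 0), (0, 0),
    (161847348575291114741291200610397856353100645, 650000000), (0, 0), (0, 0),
    (42058395406241682361364840188241017045529645, 169000000), (0, 0), (0, 0),
    (10467725259922258634315372839150360524046968, 42100000), (0, 0), (0, 0),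
    (2497471552156082783138666800638389726818316, 10100000), (0, 0), (0, 0),
    (571711757326569504871879134821377724716167, 2320000), (0, 0), (0, 0),
    (125674266834247694739845288115321197383916, 510000), (0, 0), (0, 0),
    (26549607540276011534952696100385837751427, 108000), (0, 0), (0, 0),
    (5394467404688835594343366250669794080759, 22000), (0, 0), (0, 0), (1054972468722086190391249040265134078448,
    4310), (0, 0), (0, 0), (198722480593191068683084369865140852980, 813), (0, 0), (0, 0),
    (36079953701195407259423263457037583544, 148), (0, 0), (0, 0), (6318107090603544192527320122769662388, 27),
    (0, 0), (0, 0), (1067797046306680860608418430105516041, 5), (0, 0), (0, 0),
    (174277021078490567675541816062334739, 1), (0, 0), (0, 0), (27485330141198772438043687156980309, 1), (0, 0),
    (0, 0), (4191043668023264090257871973998891, 1), (0, 0), (0, 0), (618224870623860459840176695137709, 1), (0,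
    0), (0, 0), (88269072635135903493019125347619, 1), (0, 0), (0, 0), (12204940725442493917066389812925, 1), (0,
    0), (0, 0), (1635113268545456277665444294036, 1), (0, 0), (0, 0), (212352933871631686285232033217, 1), (0, 0),
    (0, 0), (26746909811601458101813694796, 1), (0, 0), (0, 0), (3268844972746218001348524441, 1), (0, 0), (0, 0),
    (387806320658315682425994895, 1), (0, 0), (0, 0), (44681123150750549874745859, 1), (0, 0), (0, 0),
    (5001557485523751458979868, 1), (0, 0), (0, 0), (544172467144525443306938, 1), (0, 0), (0, 0),
    (57569322374699687833053, 1), (0, 0), (0, 0), (5924303146640265726693, 1), (0, 0), (0, 0),
    (593251423901260150733, 1), (0, 0), (0, 0), (57830242968787522233, 1), (0, 0), (0, 0), (5489604755113476635,
    1), (0, 0), (0, 0), (507630870729766812, 1), (0, 0), (0, 0), (45742827994118784, 1), (0, 0), (0, 0),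
    (4017995314580304, 1), (0, 0), (0, 0), (344149424346810, 1), (0, 0), (0, 0), (28752272248000, 1), (0, 0), (0,
    0), (2343784860701, 1), (0, 0), (0, 0), (186471936466, 1), (0, 0), (0, 0), (14483915510, 1), (0, 0), (0, 0),
    (1098648709, 1), (0, 0), (0, 0), (81405319, 1), (0, 0), (0, 0), (5893668, 1), (0, 0), (0, 0), (417035, 1), (0,
    0), (0, 0), (28849, 1), (0, 0), (0, 0), (1951, 1), (0, 0), (0, 0), (129, 1), (0, 0), (0, 0), (8, 1), (0, 0),
    (0, 0), (1, 1)]"

definition kappa_g_cert :: "(int \<times> int) list" where
  "kappa_g_cert = [(0, 0), (5516815412193254355313652349796352, 0), (0, 0), (0, 0), (2258676176675454887304664499545789781, 1),
    (0, 0), (0, 0), (264211334666821663364948016339725361763, 118), (0, 0), (0, 0),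
    (14423003191312164801244328936411896692685, 6450), (0, 0), (0, 0),
    (454232145377670933772521718362766977251035, 204000), (0, 0), (0, 0),
    (9298510542668738740101663342984475663476396, 4180000), (0, 0), (0, 0),
    (133577726012080448626080327497317920861577583, 60100000), (0, 0), (0, 0),
    (1420492138305955073809378028126240141110239535, 640000000), (0, 0), (0, 0),
    (11631463125828595462709123753640363022124344726, 5250000000), (0, 0), (0, 0),
    (75589124784650647497737996033908867100128182062, 34200000000), (0, 0), (0, 0),
    (399321903297837237802566424209241144153687912334, 181000000000), (0, 0), (0, 0),
    (1748545909895075177650631766613192282733572828250, 793000000000), (0, 0), (0, 0),
    (6449403945431309570418583986013974238040573051946, 2930000000000), (0, 0), (0, 0),
    (20311488194810271743247758412363240661213676541161, 9230000000000), (0, 0), (0, 0),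
    (55254895626302804581714416987785493559547504344808, 25200000000000), (0, 0), (0, 0),
    (131143624257017236188387889208207792201959849684078, 59900000000000), (0, 0), (0, 0),
    (273940742336192891748958205646226565938872764242294, 126000000000000), (0, 0), (0, 0),
    (507492785481793241765698214306150497155988646577070, 234000000000000), (0, 0), (0, 0),
    (839499008441767743028577551140106866170832397519577, 388000000000000), (0, 0), (0, 0),
    (1247567643216698403357350728599922877645886137027732, 577000000000000), (0, 0), (0, 0),
    (1674672085006458813031328997161590463900065188857171, 775000000000000), (0, 0), (0, 0),
    (2040591258342443489192192302344963777068705424815298, 945000000000000), (0, 0), (0, 0),
    (2267169799239354333424070733021439854531558062441782, 1050000000000000), (0, 0), (0, 0),
    (2306129445892949863377320809800069152238829143017904, 1070000000000000), (0, 0), (0, 0),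
    (2155634316528170220466662317075292949952314988517306, 1010000000000000), (0, 0), (0, 0),
    (1858005508263666718096967011191388467213284831330794, 871000000000000), (0, 0), (0, 0),
    (1481399068824958550147744064586707487734318139618337, 695000000000000), (0, 0), (0, 0),
    (1095771397942942089261648086316545300698389795234100, 515000000000000), (0, 0), (0, 0),
    (753995080965500628087181659394003790242463454339655, 355000000000000), (0, 0), (0, 0),
    (483852903968587328342779975522824010117714596547900, 228000000000000), (0, 0), (0, 0),
    (290252663882499333839814166024863780428367742715486, 137000000000000), (0, 0), (0, 0),
    (163121864293607781646649164685444492478216737584212, 77000000000000), (0, 0), (0, 0),
    (86062899406625325518684208129251373662529943272254, 40700000000000), (0, 0), (0, 0),
    (42709800483308103461949041872627474626667637504705, 20200000000000), (0, 0), (0, 0),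
    (19972706051255731230587820552086310950011241486828, 9450000000000), (0, 0), (0, 0),
    (8816343650477934190105836691141064303450604620376, 4180000000000), (0, 0), (0, 0),
    (3679467920047408314304279278251448260520966743111, 1750000000000), (0, 0), (0, 0),
    (1454088311711141976204707536522632344267978572145, 692000000000), (0, 0), (0, 0),
    (544922644960857401151314121047726369747412564832, 260000000000), (0, 0), (0, 0),
    (193916047710610778781428819115419357856659273578, 92600000000), (0, 0), (0, 0),
    (65613604848638481828730012969287555451085882306, 31400000000), (0, 0), (0, 0),
    (21135565212520381669587631374122066609702657997, 10200000000), (0, 0), (0, 0),
    (6489128352025536504354707720351313164196297884, 3140000000), (0, 0), (0, 0),
    (1901078568485477689081376209307453880482791384, 920000000), (0, 0), (0, 0),
    (532011791237705165553474670558642111802913766, 258000000), (0, 0), (0, 0),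
    (142362414507126660041624240547636639176890813, 69100000), (0, 0), (0, 0),
    (36462649487723557542722338328148201870298434, 17700000), (0, 0), (0, 0),
    (8947207917949547408220699640704830475915303, 4350000), (0, 0), (0, 0),
    (2105250598701442836043500830209905753264937, 1030000), (0, 0), (0, 0),
    (475413503926281883318703786487464008355885, 233000), (0, 0), (0, 0),
    (103121701756725072527363872097700250465892, 50600), (0, 0), (0, 0),
    (21502288461539354949789436534080355255875, 10600), (0, 0), (0, 0), (4313275486344228763200861574879012958195,
    2130), (0, 0), (0, 0), (832984373600990405409034312790117557532, 412), (0, 0), (0, 0),
    (154981906669001964014791546570394893591, 78), (0, 0), (0, 0), (27799419768704149295533803150797740497, 15),
    (0, 0), (0, 0), (4810458908271466803640376686385929102, 3), (0, 0), (0, 0),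
    (803542248617493417866352871624305375, 1), (0, 0), (0, 0), (129648705006822501214364258071928155, 1), (0, 0),
    (0, 0), (20217231247969242317849666727206977, 1), (0, 0), (0, 0), (3048718757559020488262597072767584, 1), (0,
    0), (0, 0), (444831172959356963020733529891516, 1), (0, 0), (0, 0), (62832946718110538764903220986632, 1), (0,
    0), (0, 0), (8596442974828100165746853932256, 1), (0, 0), (0, 0), (1139743208531154364052091250248, 1), (0,
    0), (0, 0), (146508591928664609905492525182, 1), (0, 0), (0, 0), (18268024774009675358247925898, 1), (0, 0),
    (0, 0), (2210502086466418773338063641, 1), (0, 0), (0, 0), (259689066255607733940935119, 1), (0, 0), (0, 0),
    (29632394614311612710233515, 1), (0, 0), (0, 0), (3285577854662896710570464, 1), (0, 0), (0, 0),
    (354131981921785168246955, 1), (0, 0), (0, 0), (37119184741033677496102, 1), (0, 0), (0, 0),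
    (3785109062530063460738, 1), (0, 0), (0, 0), (375636101163701405539, 1), (0, 0), (0, 0),
    (36293021927576499615, 1), (0, 0), (0, 0), (3415069653148382414, 1), (0, 0), (0, 0), (313073540937416084, 1),
    (0, 0), (0, 0), (27971091227960088, 1), (0, 0), (0, 0), (2436300592188205, 1), (0, 0), (0, 0),
    (206942337645585, 1), (0, 0), (0, 0), (17147468543020, 1), (0, 0), (0, 0), (1386483541553, 1), (0, 0), (0, 0),
    (109426403850, 1), (0, 0), (0, 0), (8432334559, 1), (0, 0), (0, 0), (634621012, 1), (0, 0), (0, 0), (46659678,
    1), (0, 0), (0, 0), (3352330, 1), (0, 0), (0, 0), (235420, 1), (0, 0), (0, 0), (16164, 1), (0, 0), (0, 0),
    (1085, 1), (0, 0), (0, 0), (71, 1), (0, 0), (0, 0), (5, 1), (0, 0), (0, 0)]"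

definition aa_sign_1a_cert :: "(int \<times> int) list" where
  "aa_sign_1a_cert = [(1099511627776, 0), (1868471377990, 1), (0, 0), (-2321164732245, 1), (-1972252842188, 2), (0, 0),
    (980036150253, 1), (594799626711, 1), (0, 0), (-172411800144, 1), (-83711584998, 1), (0, 0), (16544377927, 1),
    (6797016962, 1), (0, 0), (-997903474, 1), (-358727358, 1), (0, 0), (41307080, 1), (13286047, 1), (0, 0),
    (-1245755, 1), (-364260, 1), (0, 0), (28586, 1), (7690, 1), (0, 0), (-516, 1), (-129, 1), (0, 0), (8, 1), (2,
    1), (0, 0), (0, 1), (0, 1), (0, 0), (0, 1), (0, 1), (0, 0), (0, 1), (0, 1), (0, 0), (0, 1)]"

definition aa_sign_1b_cert :: "(int \<times> int) list" where
  "aa_sign_1b_cert = [(1099511627776, 0), (1875516305683, 1), (0, 0), (-2347519169877, 1), (-2002166402694, 2), (0, 0),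
    (1002417093867, 1), (610676840891, 2), (0, 0), (-178351406556, 1), (-86921960282, 1), (0, 0), (17308649308,
    1), (7137818243, 1), (0, 0), (-1055855424, 1), (-380991086, 1), (0, 0), (44202171, 1), (14270832, 1), (0, 0),
    (-1348202, 1), (-395702, 1), (0, 0), (31288, 1), (8448, 1), (0, 0), (-571, 1), (-143, 1), (0, 0), (8, 1), (2,
    1), (0, 0), (0, 1), (0, 1), (0, 0), (0, 1), (0, 1), (0, 0), (0, 1), (0, 1), (0, 0), (0, 1)]"

definition aa_sign_2a_cert :: "(int \<times> int) list" where
  "aa_sign_2a_cert = [(1237940039285380274899124224, 0), (3689260199190172029163763495, 1), (0, 0), (-14094994412036186889832416984,
    1), (-21002673894508991977724492520, 7), (0, 0), (32096686619816572151340035186, 3),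
    (34161886658075233621150333714, 13), (0, 0), (-30453993744610032960938996400, 4),
    (-25930798276150428310507672130, 11), (0, 0), (15761112597338201230842817574, 3),
    (11355541190737536469021419351, 6), (0, 0), (-5127245653194645121686619401, 2),
    (-3232311027791928701417713705, 2), (0, 0), (1144667224480015419586125261, 1), (645659561043349607634006354,
    1), (0, 0), (-186185778917051715338848870, 1), (-95472470249402421123386473, 1), (0, 0),
    (23042201860559863097271587, 1), (10870348255683165010633760, 1), (0, 0), (-2242350064595089143208668, 1),
    (-982286580666552086593199, 1), (0, 0), (176076221327086065235454, 1), (72155893876450662522671, 1), (0, 0),
    (-11390776745583708230898, 1), (-4393346963196807107077, 1), (0, 0), (617588703363154865973, 1),
    (225324194245041893011, 1), (0, 0), (-28468703448750772883, 1), (-9867332820882092145, 1), (0, 0),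
    (1129408599095315584, 1), (373248937129889500, 1), (0, 0), (-38967491418962132, 1), (-12318129993401856, 1),
    (0, 0), (1179994279212838, 1), (357786553059569, 1), (0, 0), (-31612312758542, 1), (-9216521553869, 1), (0,
    0), (754576349760, 1), (211995744115, 1), (0, 0), (-16149417240, 1), (-4380673059, 1), (0, 0), (311652160, 1),
    (81766669, 1), (0, 0), (-5450727, 1), (-1385391, 1), (0, 0), (86799, 1), (21403, 1), (0, 0), (-1264, 1),
    (-303, 1), (0, 0), (17, 1), (4, 1), (0, 0), (0, 1), (0, 1), (0, 0)]"

definition aa_sign_2b_cert :: "(int \<times> int) list" where
  "aa_sign_2b_cert = [(1237940039285380274899124224, 0), (3689260199190172029188225049, 1), (0, 0), (-14094994412036186890112786588,
    1), (-21002673894508991978281523492, 7), (0, 0), (32096686619816572152616933219, 3),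
    (34161886658075233622735900908, 13), (0, 0), (-30453993744610032962756316915, 4),
    (-25930798276150428312227007712, 11), (0, 0), (15761112597338201232096861888, 3),
    (11355541190737536470000223844, 6), (0, 0), (-5127245653194645122196560658, 2),
    (-3232311027791928701760621922, 2), (0, 0), (1144667224480015419722739673, 1), (645659561043349607715345939,
    1), (0, 0), (-186185778917051715364773380, 1), (-95472470249402421137313089, 1), (0, 0),
    (23042201860559863100938326, 1), (10870348255683165012435650, 1), (0, 0), (-2242350064595089143610100, 1),
    (-982286580666552086775563, 1), (0, 0), (176076221327086065270478, 1), (72155893876450662537503, 1), (0, 0),
    (-11390776745583708233390, 1), (-4393346963196807108067, 1), (0, 0), (617588703363154866120, 1),
    (225324194245041893066, 1), (0, 0), (-28468703448750772890, 1), (-9867332820882092148, 1), (0, 0),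
    (1129408599095315584, 1), (373248937129889500, 1), (0, 0), (-38967491418962132, 1), (-12318129993401856, 1),
    (0, 0), (1179994279212838, 1), (357786553059569, 1), (0, 0), (-31612312758542, 1), (-9216521553869, 1), (0,
    0), (754576349760, 1), (211995744115, 1), (0, 0), (-16149417240, 1), (-4380673059, 1), (0, 0), (311652160, 1),
    (81766669, 1), (0, 0), (-5450727, 1), (-1385391, 1), (0, 0), (86799, 1), (21403, 1), (0, 0), (-1264, 1),
    (-303, 1), (0, 0), (17, 1), (4, 1), (0, 0), (0, 1), (0, 1), (0, 0)]"

definition sigma_cert_2 :: "(int \<times> int) list" where
  "sigma_cert_2 = [(0, 0), (0, 0), (28924494707576576933888, 0), (0, 0), (-965641955169789431571893, 3210),
    (661406778979917725888239, 1), (17193535928838074078293768, 115000), (-25235443095103830478412136, 83900),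
    (-175217743618180301475514532, 1850000), (421241630256532814918197309, 2810000), (995461580610832764159083658,
    18200000), (-4011553409007417269398268523, 41000000), (-1915783016244840217700462997, 130000000),
    (23862539544898757085597967020, 354000000), (-15541517121307836936829245355, 748000000),
    (-88534222872880760932565344592, 2090000000), (152277654889793783689132208672, 3930000000),
    (167708505710341102263872393652, 9200000000), (-674884940968312689067339297832, 17900000000),
    (147755606290877824862374513892, 33400000000), (1781100013394640994732782716302, 65700000000),
    (-2094979060050516005272565069470, 108000000000), (-2438636627100201385104388036299, 197000000000),
    (7128359669955305878203107483947, 318000000000), (-1207901424378883082833492847850, 503000000000),
    (-13558162932167817570519855191997, 808000000000), (14407326298625967365303526634882, 1160000000000),
    (12272059307157045562902245117758, 1760000000000), (-35725528148754560316795146479802, 2480000000000),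
    (10146681401169856893077366765573, 3380000000000), (47815268546391700722556668696784, 4690000000000),
    (-54961380230140670190824413046779, 6000000000000), (-23700695497235057090909711486601, 7840000000000),
    (94739582686392094181350973834672, 9860000000000), (-44390671887465080628070840438291, 12000000000000),
    (-84748741984988402183527712609976, 14600000000000), (119833430496245145299834995674593, 17000000000000),
    (6807140049129450619517570940287, 19700000000000), (-139807887528812835139753282607594, 22400000000000),
    (97529770339507783405801437957614, 24500000000000), (73681862708783520331750676899003, 27000000000000),
    (-152338089106739062290517251320832, 28700000000000), (38602974995354501801878644168162, 30000000000000),
    (115876921361775982503858147645337, 31300000000000), (-117316617286261266170395904110265, 31400000000000),
    (-20131796836728854630741955563999, 31500000000000), (114414259403457122263520909000187, 31000000000000),
    (-61779011440594373479159054698914, 29700000000000), (-50295395971136251818083700739847, 28500000000000),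
    (82175658466415051191904849710097, 26600000000000), (-16391249944600176941815965017819, 24500000000000),
    (-50017118102892493421837230021394, 22400000000000), (44421661492653023074806560195133, 20000000000000),
    (6369915412942996240007696907180, 17800000000000), (-34403207439640491788287522128583, 15500000000000),
    (17562401744940639926355471774733, 13300000000000), (11290726939228717501251823707737, 11400000000000),
    (-18135442350218710450668402027308, 9490000000000), (4207703754583763703987556066553, 7870000000000),
    (8361328934998769264302920750319, 6470000000000), (-7540382886089992751717048622800, 5190000000000),
    (-283395261876751912290564662701, 4160000000000), (4408365177188019811430767985411, 3290000000000),
    (-2445506396875676718961239951343, 2550000000000), (-939824950747247622898228664068, 1980000000000),
    (1832327331270560372080274151499, 1510000000000), (-570512393651536297293995169900, 1140000000000),
    (-598492704650059994435284375543, 849000000000), (620831912644338949241881289539, 627000000000),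
    (-59140606080859980630189807955, 458000000000), (-261570065446552407428473033552, 331000000000),
    (172219314464039258610507453173, 237000000000), (24756186357150746026380885458, 168000000000),
    (-90546160451646283351540189199, 118000000000), (38102912620740652759591832210, 81700000000),
    (18558184745940229979231889906, 56300000000), (-26007962454774931509804891857, 38300000000),
    (6053004612037799250857778395, 25900000000), (7430187637252786545846785574, 17300000000),
    (-6301863691711788271980979810, 11500000000), (338218440462745149910549472, 7520000000),
    (2265299758707534089609246016, 4900000000), (-1286081994134577387813218763, 3160000000),
    (-194946518145140748430375967, 2020000000), (571520426319928042711708324, 1280000000),
    (-215609267017134519946376626, 804000000), (-96289248598669741972699599, 501000000),
    (123151127418561361178706605, 310000000), (-27256120928701725455241223, 190000000),
    (-28521205715468493592311766, 116000000), (22940893385214660063741092, 69700000), (-1661708599936873008815764,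
    41800000), (-6644326613318373076266940, 24900000), (3692732266104484589956651, 14600000),
    (344922234109223507849037, 8560000), (-1307631232540380878873781, 4970000), (505634716205990657419479,
    2860000), (159182232692298181782490, 1640000), (-223748919305151408067861, 929000), (56099244389199008065357,
    523000), (39035946367187263283029, 294000), (-33704910944166184650626, 163000), (4238697427022926235620,
    89700), (7445389344326655908256, 49300), (-4482818538933549591204, 26800), (-21061212570053578383, 14500),
    (1204158344069712135065, 7780), (-523096361805656091047, 4150), (-84364083018254921180, 2200),
    (170791810405419056367, 1160), (-52420031395251665462, 605), (-20186882784852659448, 315),
    (21578513864045958263, 163), (-4251525405768480668, 84), (-3402682955424362396, 43), (2444931911238343119,
    23), (-223235525653141613, 12), (-475573603849078429, 6), (248508330958592880, 3), (5509300207015961, 2),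
    (-58072473547407142, 1), (22504248076603519, 1), (3597700943943774, 1), (-6340729896886279, 1),
    (1781355392492451, 1), (632073826244335, 1), (-626205838649450, 1), (117377548894130, 1), (82272380276490, 1),
    (-56229378943006, 1), (5474387317855, 1), (9056401367988, 1), (-4593061986216, 1), (9467122723, 1),
    (882414944945, 1), (-339743098799, 1), (-37253380806, 1), (77716702068, 1), (-22474433439, 1), (-5797081304,
    1), (6254599992, 1), (-1291354882, 1), (-634232174, 1), (462508792, 1), (-59615680, 1), (-58172975, 1),
    (31482148, 1)]"

definition aa_sign_3a_cert :: "(int \<times> int) list" where
  "aa_sign_3a_cert = [(81129638414606681695789005144064, 0), (326510251783794638918069823729815, 1), (0, 0),
    (-2274980364011650338810315342678330, 1), (-4577885628311251634892425541361927, 15), (0, 0),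
    (12758680447186046275545330857515597, 7), (18338550703040474360597219797723198, 62), (0, 0),
    (-29814163330908552975087457474192617, 19), (-34282450958833010865876231142298314, 119), (0, 0),
    (38001265333251641012103400037764885, 28), (36974016233398787476075833415020643, 132), (0, 0),
    (-30445851542630452196739855769413432, 25), (-25919985147649210834313053008671365, 95), (0, 0),
    (16740023425353104857664697962902753, 16), (12751403975317200081648047503676965, 48), (0, 0),
    (-6705885495640237795300573988608914, 8), (-4643713224092792958721955852883491, 19), (0, 0),
    (2043931883214292942885860167330641, 4), (1302157461484546265602287599365656, 6), (0, 0),
    (-489867546522565312670720920702412, 2), (-289795121950531754604524877039930, 2), (0, 0),
    (94734633324213513881773025586822, 1), (52427299105806637678928783196018, 1), (0, 0),
    (-15093648181758458396310147233209, 1), (-7861655162358075574135633206144, 1), (0, 0),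
    (2015454694944982198329752236477, 1), (993022589418959290985353338346, 1), (0, 0),
    (-228809577416491223433114096563, 1), (-107098624265218314901223853727, 1), (0, 0),
    (22355810229923236671700184298, 1), (9977356923311140235293321958, 1), (0, 0), (-1899654350759304576725773606,
    1), (-810950835710822506431584180, 1), (0, 0), (141672270390743905763412158, 1), (58010494932359400050469620,
    1), (0, 0), (-9347469050395736633932662, 1), (-3680293151790464169260362, 1), (0, 0),
    (549507683009769133209614, 1), (208485246146006342966259, 1), (0, 0), (-28964114040425813816368, 1),
    (-10610157726015406192912, 1), (0, 0), (1376595511691683282326, 1), (487741957667127834434, 1), (0, 0),
    (-59295737190538432249, 1), (-20352555895207378010, 1), (0, 0), (2325495712169568533, 1), (774371891540132150,
    1), (0, 0), (-83388642154834148, 1), (-26974401168949340, 1), (0, 0), (2744513803966766, 1), (863467146595986,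
    1), (0, 0), (-83199707380511, 1), (-25487094247024, 1), (0, 0), (2330697087591, 1), (695901853812, 1), (0, 0),
    (-60514603225, 1), (-17627815025, 1), (0, 0), (1460333924, 1), (415383877, 1), (0, 0), (-32838539, 1),
    (-9128451, 1), (0, 0), (689764, 1), (187526, 1), (0, 0), (-13564, 1), (-3609, 1), (0, 0), (250, 1), (65, 1),
    (0, 0), (-4, 1), (-1, 1), (0, 0)]"

definition aa_sign_3b_cert :: "(int \<times> int) list" where
  "aa_sign_3b_cert = [(81129638414606681695789005144064, 0), (326510251783794638918069848191370, 1), (0, 0),
    (-2274980364011650338810315853990509, 1), (-4577885628311251634892426913229410, 15), (0, 0),
    (12758680447186046275545336592658463, 7), (18338550703040474360597229414959389, 62), (0, 0),
    (-29814163330908552975087477576798862, 19), (-34282450958833010865876256826087393, 119), (0, 0),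
    (38001265333251641012103434201593460, 28), (36974016233398787476075869425359739, 132), (0, 0),
    (-30445851542630452196739889983631164, 25), (-25919985147649210834313084078722068, 95), (0, 0),
    (16740023425353104857664720537280962, 16), (12751403975317200081648065654605073, 48), (0, 0),
    (-6705885495640237795300584538856674, 8), (-4643713224092792958721963506651660, 18), (0, 0),
    (2043931883214292942885863842394504, 4), (1302157461484546265602290038247402, 6), (0, 0),
    (-489867546522565312670721911602035, 2), (-289795121950531754604525484945794, 2), (0, 0),
    (94734633324213513881773238507218, 1), (52427299105806637678928904956514, 1), (0, 0),
    (-15093648181758458396310184549236, 1), (-7861655162358075574135653231495, 1), (0, 0),
    (2015454694944982198329757672268, 1), (993022589418959290985356090978, 1), (0, 0),
    (-228809577416491223433114765100, 1), (-107098624265218314901224174672, 1), (0, 0),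
    (22355810229923236671700254642, 1), (9977356923311140235293354100, 1), (0, 0), (-1899654350759304576725780010,
    1), (-810950835710822506431586975, 1), (0, 0), (141672270390743905763412667, 1), (58010494932359400050469833,
    1), (0, 0), (-9347469050395736633932698, 1), (-3680293151790464169260376, 1), (0, 0),
    (549507683009769133209616, 1), (208485246146006342966260, 1), (0, 0), (-28964114040425813816368, 1),
    (-10610157726015406192912, 1), (0, 0), (1376595511691683282326, 1), (487741957667127834434, 1), (0, 0),
    (-59295737190538432249, 1), (-20352555895207378010, 1), (0, 0), (2325495712169568533, 1), (774371891540132150,
    1), (0, 0), (-83388642154834148, 1), (-26974401168949340, 1), (0, 0), (2744513803966766, 1), (863467146595986,
    1), (0, 0), (-83199707380511, 1), (-25487094247024, 1), (0, 0), (2330697087591, 1), (695901853812, 1), (0, 0),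
    (-60514603225, 1), (-17627815025, 1), (0, 0), (1460333924, 1), (415383877, 1), (0, 0), (-32838539, 1),
    (-9128451, 1), (0, 0), (689764, 1), (187526, 1), (0, 0), (-13564, 1), (-3609, 1), (0, 0), (250, 1), (65, 1),
    (0, 0), (-4, 1), (-1, 1), (0, 0)]"

definition sigma_cert_3 :: "(int \<times> int) list" where
  "sigma_cert_3 = [(0, 0), (0, 0), (2475880078570760549798248448, 0), (0, 0), (-145794603743357837977699732480, 5470),
    (84510040015215293433113547025, 1), (4578803669780995020639103092090, 344000),
    (-5687378066026606708158648611790, 214000), (-84895232076315501997032500856029, 9760000),
    (167453391351990675040515770224984, 12600000), (981551307068431049150343614306721, 166000000),
    (-2845910389891286625142971246775361, 324000000), (-6906394372798456479403370074197114, 1950000000),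
    (31277447748917404977312475142116291, 4910000000), (21854528143671201913491673085147538, 17500000000),
    (-234236798545616145623145428813893288, 50100000000), (96506131112480007015641803033413184, 128000000000),
    (1204865927661050179036900871655185722, 375000000000), (-1661783646084161922150770690083672520, 812000000000),
    (-3982482944762653545841001775106410177, 2180000000000), (10928559802854202054219771913169755904,
    4600000000000), (5361650422633163972578343385438948111, 10400000000000),
    (-45256874287486441351973809484407194840, 22100000000000), (23874373665057186073673677213083518673,
    42900000000000), (123223917330433337900560336542988076644, 88900000000000),
    (-184720230847952723435438817462220559814, 160000000000000), (-182153753251766927667359373074743619184,
    305000000000000), (657487923098539324804351856032754687078, 538000000000000),
    (-122004241657449853399153312757793046882, 921000000000000), (-1469687538007501950929204581873246497134,
    1590000000000000), (1553069163626773530941989424973377943328, 2530000000000000),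
    (1850815890311832961556101718237184655468, 4140000000000000), (-4778218177848944430497887945824711113422,
    6390000000000000), (367169757106211737271149559082129197962, 9690000000000000),
    (8696675181160754182598895066487393891019, 14600000000000000), (-7815717400878199544693080142705041064177,
    20800000000000000), (-8673581367625644252357675171541056161062, 30100000000000000),
    (19956056019724718632664270023505095554487, 41600000000000000), (-2080551120587992394113625088206026946721,
    56500000000000000), (-28969187470945849676646871420945680783037, 76200000000000000),
    (25705557574674190634420480478178096641538, 98600000000000000), (21369148632660796315667731016223575405564,
    128000000000000000), (-51684820618399997860784041851972050315100, 161000000000000000),
    (10841242491664256443731867469492488122516, 199000000000000000), (58149416505806056952513639900691916974672,
    244000000000000000), (-56709909061537254404722435629969702150480, 290000000000000000),
    (-28062016223300931128527732563031625111121, 343000000000000000), (86487196407919465249430232493704633356118,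
    397000000000000000), (-30892267393125866642802900822773820679013, 451000000000000000),
    (-72541943173205356442456044879035602704828, 509000000000000000), (84357725263075058023230793985069999993940,
    560000000000000000), (15514626169713079109989133803213264910245, 610000000000000000),
    (-95486104226476766365495397640338237101870, 656000000000000000), (50903029230840005296790344973029166463217,
    691000000000000000), (55789364125481472234583847186030591633522, 722000000000000000),
    (-85006076488950215916426231089492147549551, 742000000000000000), (7052560535361372684632366905030654115977,
    752000000000000000), (69918469801868179081003825358771387694419, 754000000000000000),
    (-52400815837300347861157319492080173881959, 743000000000000000), (-23925962337971700692943931077006664766861,
    726000000000000000), (58318724782990424632208795909310234142933, 699000000000000000),
    (-18707435862023106463066368067301143399910, 664000000000000000), (-33316187434909251513875239503255961032307,
    625000000000000000), (35436796544760292333864208334545611134794, 580000000000000000),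
    (2329050081447926182976124518470746989231, 532000000000000000), (-27189045892801337764655561813114155043995,
    483000000000000000), (15278014550526166175323620886125873907186, 433000000000000000),
    (9452629227344833239994738687557932312101, 384000000000000000), (-16194057751195164641259383860915660249700,
    337000000000000000), (3566449399432463595676172791287756917489, 292000000000000000),
    (8411105095150076214090900245366345278208, 251000000000000000), (-7330432703105485742957546865466731366043,
    213000000000000000), (-901243300208480777726093517978868936618, 179000000000000000),
    (5037614963167633253554315062767446765232, 149000000000000000), (-2418512351807463571507814502172010672409,
    123000000000000000), (-1565658330917271015139021356727229775487, 100000000000000000),
    (2310679578948075809474297835320493945707, 80800000000000000), (-439710448006301675078227079860504484030,
    64700000000000000), (-1039747604240679672652550775809259783017, 51200000000000000),
    (832310527120859756077611293598205591922, 40200000000000000), (90427234066893720006857865973040081786,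
    31300000000000000), (-491479686564350074250672184525608354619, 24100000000000000),
    (226929430940286050088198349059333283522, 18400000000000000), (125661536876430866125407959219308205751,
    14000000000000000), (-183270069792199958053909338182352481509, 10500000000000000),
    (38127927401534951116114379350146038620, 7770000000000000), (68383625386341471927915089898104945947,
    5750000000000000), (-55186952985719018066510841212365271380, 4200000000000000),
    (-2542078340429063044339966171343641818, 3040000000000000), (26914219379588101681913514960255795624,
    2190000000000000), (-13123831567578263147513696107792666371, 1560000000000000),
    (-5153499860935298053238121146376019388, 1110000000000000), (8501063759235943159530503971891035168,
    774000000000000), (-2190398425866173559648143752171513019, 539000000000000),
    (-2507505783087612959054148453286365758, 373000000000000), (2217264866094207176346256598198680947,
    255000000000000), (-93497511190213905365841419353907858, 174000000000000),
    (-861181570269911439105363942718972407, 117000000000000), (474275471355376321387866263927281278,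
    78400000000000), (103871948664350837268206202840487290, 52200000000000),
    (-238275853381526508116476907754671799, 34400000000000), (78595420754093004131043277051351588,
    22600000000000), (51988378780445688046903161667741094, 14700000000000), (-55239811745277172063116721656965619,
    9460000000000), (7794403402422710275882596437506311, 6080000000000), (16438592604174186090665907207792760,
    3870000000000), (-10800404989673759469804570221933714, 2450000000000), (-648591023420141660867611046586391,
    1540000000000), (4115422765613289345286303050680476, 958000000000), (-1742279663158470258964629257077693,
    595000000000), (-583530704028867835405536771399768, 366000000000), (866577263665985006567129511654505,
    224000000000), (-212907947288515896875531299996454, 136000000000), (-186562007677235536633320413070315,
    82000000000), (156493395603301369004504284977652, 49200000000), (-12487092254847441406125545282203,
    29300000000), (-44071840670286434611578309888191, 17400000000), (24187201953399484621914668980601,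
    10300000000), (2637510836287876161778671190511, 5970000000), (-8632393800020023696676922397699, 3490000000),
    (3111133345909233445403120512827, 2020000000), (1187586752078295406513542290153, 1160000000),
    (-1456261271799518548676678843666, 661000000), (302507480330793764084925843104, 376000000),
    (287732340923135050652632951216, 212000000), (-214173844439518283348127750596, 119000000),
    (12835485549265372823379671368, 66300000), (54428938177646315648790865007, 36800000),
    (-27344019504736005689975734405, 20300000), (-3037497849784424926134364820, 11200000),
    (8737177038588276794996057219, 6060000), (-2952364375801680258535170368, 3300000),
    (-1053485625462149377486743304, 1780000), (1226537287021109126077900044, 951000),
    (-248123262903703488933720622, 509000), (-210580559023694688013052201, 270000), (152117551285855311606644987,
    142000), (-10837640188298718295117575, 74800), (-33439594012594701981724382, 39000),
    (16619566954978935876170677, 20300), (1281739429366166881772972, 10500), (-4556268224048976748825828, 5380),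
    (1568917691821115675123728, 2760), (438784942378779059367502, 1410), (-548327634896726632319507, 710),
    (120885870575082541147002, 359), (77535485591106249971357, 181), (-58931274008233234687208, 90),
    (6142118129708516763053, 45), (10757924583515450622219, 23), (-5657383868383551861195, 12),
    (-119851465321153710982, 6), (1281612166395212400635, 3), (-479633590942338964143, 2), (-86054459084497199129,
    1), (135510298319163192480, 1), (-34748266315661332790, 1), (-14755280915570976084, 1), (12894857580562293742,
    1), (-1950822691281065164, 1), (-1869277033455120083, 1), (1108612578715689705, 1), (-49838124970320297, 1),
    (-200472900391034490, 1), (85725057843674751, 1), (6651201536419901, 1), (-19043880675671525, 1),
    (5865423649316022, 1), (1423286760263704, 1), (-1633774176020324, 1), (340322644053754, 1), (176719229788049,
    1), (-127611621972160, 1), (14653457314045, 1), (17703902013409, 1), (-9083693372175, 1), (151883806846, 1)]"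

definition aa_sign_4a_cert :: "(int \<times> int) list" where
  "aa_sign_4a_cert = [(5316911983139663491615228241121378304, 0), (26305877981593259204062997023832176236, 116), (0, 0),
    (-277003801860646336905243008097946722649, 1), (-685250031906743107662529675979209913483, 3030), (0, 0),
    (2886303421556439142998396923580901625617, 13), (5100083460507605911445602278558752304836, 22600), (0, 0),
    (-12531036555771711147773065528686235208351, 65), (-17713822269356391325684522021960321075835, 78600), (0, 0),
    (29674989561702271092747033239489488617747, 172), (35494837616960096382529327771534806705533, 158000), (0, 0),
    (-44172175529346170524928124454793886852191, 283), (-46230805576163891277885920135775196580218, 206000), (0,
    0), (45123717532479384577019126725669525202655, 317), (42255462952954917475051156340408706210392, 189000), (0,
    0), (-33584051769199279780418151910150026596765, 257), (-28590279285994838436638958752331007528870, 128000),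
    (0, 0), (19018292481763051512749043733767322797471, 158), (14895142299876256375012769464764898923091, 66700),
    (0, 0), (-8468605829418952206719901429762792697043, 76), (-6158860541435879614164449062164982314939, 27600),
    (0, 0), (3042777356282288303357688638210501273803, 30), (2070117185795551557923503617336971619254, 9280), (0,
    0), (-900707474241944801352008569504999694505, 10), (-576739349220442333067741651297732905236, 2590), (0, 0),
    (223455336409824283695956550918730737067, 3), (135348319336135932132848772745074737896, 609), (0, 0),
    (-47132452243423808618857565518785081563, 2), (-27121004961619491309420405049861112405, 123), (0, 0),
    (8555874354108145800101317742406474542, 1), (4694242718975299612301254389882198808, 22), (0, 0),
    (-1350755414469698364317114466989880941, 1), (-708879969761809675122032966564922304, 4), (0, 0),
    (187160902583848004824156371797846598, 1), (94213447671049619215632063460551144, 1), (0, 0),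
    (-22943119101860878876437874833040618, 1), (-11104957126526338293616027109161816, 1), (0, 0),
    (2505880400529300762272791280605594, 1), (1168793926082450464684469610536924, 1), (0, 0),
    (-245400230220925552467852829998085, 1), (-110512805956470217576997240695137, 1), (0, 0),
    (21669516085440387763196680880371, 1), (9438631474991196411067700529170, 1), (0, 0),
    (-1734181237342545031483317972122, 1), (-731755533777624795458741343634, 1), (0, 0),
    (126361478894545213047300318913, 1), (51727892687965908446453666546, 1), (0, 0),
    (-8418490105888687745706115757, 1), (-3347766542340049096349300631, 1), (0, 0), (514779056796025990192679465,
    1), (199102776943089477799843999, 1), (0, 0), (-28993817159571935018365067, 1), (-10918927208943436058981753,
    1), (0, 0), (1509028969237625873610249, 1), (553905638320938569492417, 1), (0, 0), (-72794753609245899219675,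
    1), (-26068402853153661501422, 1), (0, 0), (3263774997319542286681, 1), (1141283980022121282181, 1), (0, 0),
    (-136357809640671382855, 1), (-46598217654607858179, 1), (0, 0), (5321389023606072631, 1),
    (1778537034648936495, 1), (0, 0), (-194415883247951117, 1), (-63595973538642033, 1), (0, 0),
    (6663684298002025, 1), (2134834250310980, 1), (0, 0), (-214699311824781, 1), (-67407229308325, 1), (0, 0),
    (6514582915311, 1), (2005610474234, 1), (0, 0), (-186483961673, 1), (-56328596954, 1), (0, 0), (5044422600,
    1), (1495740281, 1), (0, 0), (-129143725, 1), (-37609079, 1), (0, 0), (3133773, 1), (896742, 1), (0, 0),
    (-72177, 1), (-20304, 1), (0, 0), (1580, 1), (437, 1), (0, 0), (-33, 1), (-9, 1), (0, 0), (1, 1), (0, 1), (0,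
    0)]"

definition aa_sign_4b_cert :: "(int \<times> int) list" where
  "aa_sign_4b_cert = [(5316911983139663491615228241121378304, 0), (26305877981593259204062997023856637791, 116), (0, 0),
    (-277003801860646336905243008098719471264, 1), (-685250031906743107662529675981758740189, 3030), (0, 0),
    (2886303421556439142998396923597005281642, 13), (5100083460507605911445602278591949896243, 22600), (0, 0),
    (-12531036555771711147773065528791107499753, 64), (-17713822269356391325684522022125040014253, 78600), (0, 0),
    (29674989561702271092747033239820622081323, 170), (35494837616960096382529327771963888212831, 158000), (0, 0),
    (-44172175529346170524928124455410015353533, 281), (-46230805576163891277885920136463029084788, 206000), (0,
    0), (45123717532479384577019126726424806321373, 315), (42255462952954917475051156341155271366435, 189000), (0,
    0), (-33584051769199279780418151910805845055619, 256), (-28590279285994838436638958752915895015444, 128000),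
    (0, 0), (19018292481763051512749043734191760558284, 157), (14895142299876256375012769465111169759896, 66700),
    (0, 0), (-8468605829418952206719901429975414077814, 76), (-6158860541435879614164449062325339953716, 27600),
    (0, 0), (3042777356282288303357688638295384657064, 30), (2070117185795551557923503617396645993800, 9280), (0,
    0), (-900707474241944801352008569532639116542, 10), (-576739349220442333067741651315967232757, 2590), (0, 0),
    (223455336409824283695956550926211131223, 3), (135348319336135932132848772749731519198, 609), (0, 0),
    (-47132452243423808618857565520494372122, 1), (-27121004961619491309420405050869893699, 123), (0, 0),
    (8555874354108145800101317742740627214, 1), (4694242718975299612301254390069899230, 22), (0, 0),
    (-1350755414469698364317114467046403326, 1), (-708879969761809675122032966595244579, 4), (0, 0),
    (187160902583848004824156371806200466, 1), (94213447671049619215632063464843940, 1), (0, 0),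
    (-22943119101860878876437874834128680, 1), (-11104957126526338293616027109698788, 1), (0, 0),
    (2505880400529300762272791280731424, 1), (1168793926082450464684469610596700, 1), (0, 0),
    (-245400230220925552467852830011092, 1), (-110512805956470217576997240701097, 1), (0, 0),
    (21669516085440387763196680881580, 1), (9438631474991196411067700529705, 1), (0, 0),
    (-1734181237342545031483317972224, 1), (-731755533777624795458741343677, 1), (0, 0),
    (126361478894545213047300318921, 1), (51727892687965908446453666550, 1), (0, 0),
    (-8418490105888687745706115758, 1), (-3347766542340049096349300632, 1), (0, 0), (514779056796025990192679465,
    1), (199102776943089477799843999, 1), (0, 0), (-28993817159571935018365067, 1), (-10918927208943436058981753,
    1), (0, 0), (1509028969237625873610249, 1), (553905638320938569492417, 1), (0, 0), (-72794753609245899219675,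
    1), (-26068402853153661501422, 1), (0, 0), (3263774997319542286681, 1), (1141283980022121282181, 1), (0, 0),
    (-136357809640671382855, 1), (-46598217654607858179, 1), (0, 0), (5321389023606072631, 1),
    (1778537034648936495, 1), (0, 0), (-194415883247951117, 1), (-63595973538642033, 1), (0, 0),
    (6663684298002025, 1), (2134834250310980, 1), (0, 0), (-214699311824781, 1), (-67407229308325, 1), (0, 0),
    (6514582915311, 1), (2005610474234, 1), (0, 0), (-186483961673, 1), (-56328596954, 1), (0, 0), (5044422600,
    1), (1495740281, 1), (0, 0), (-129143725, 1), (-37609079, 1), (0, 0), (3133773, 1), (896742, 1), (0, 0),
    (-72177, 1), (-20304, 1), (0, 0), (1580, 1), (437, 1), (0, 0), (-33, 1), (-9, 1), (0, 0), (1, 1), (0, 1), (0,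
    0)]"

definition sigma_cert_4 :: "(int \<times> int) list" where
  "sigma_cert_4 = [(0, 0), (0, 0), (205359397236973163042465919270912, 0), (0, 0), (-18815142815105748265831939530495271, 8750),
    (9980466705716895723863843676566323, 1), (919388750105762724755119892449426210, 856000),
    (-1045046789501873560822208298493794468, 486000), (-26777764078533056722647906355776290446, 37800000),
    (47873885630507216167605885828259407342, 44600000), (501170352782958535776810916752134988341, 993000000),
    (-1270573427779219062762246275353970945350, 1790000000), (-6203674100064823288395049970697353745527,
    17800000000), (22032672599221684136609817306947518635165, 42100000000),
    (48915944311754394000036185127705199938633, 236000000000), (-266205478719317545095772642588776372408372,
    666000000000), (-182413492764727828859509290568103551903448, 2480000000000),
    (2316336901199459517030592844900956534508224, 7650000000000), (-882758307670985504504480453566431027125019,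
    21600000000000), (-14596459715526529456492171664189337057534231, 67500000000000),
    (19286250366775599712115110163873919154176977, 164000000000000),
    (64026103067391324089385033119790917987941055, 478000000000000),
    (-161024486298993917837877463039354430949404935, 1110000000000000),
    (-159694477404181469394518924459838702309963643, 2820000000000000),
    (877208681477912233394683854949025515240054335, 6490000000000000),
    (-135266704912697691994913923490355606136026836, 14500000000000000),
    (-3359797495322449150263597105973314694694867144, 32500000000000000),
    (3566460251435099673460904239886896005097377809, 65800000000000000),
    (8617367845819427699568343337611833047075811240, 141000000000000000),
    (-19608902360468977693387166856751518636163299521, 273000000000000000),
    (-9761781488308208955650194444878490948222991472, 538000000000000000),
    (67356180321478043179782708980835537660976001017, 1020000000000000000),
    (-31080422108548796960049408019476950582044787361, 1850000000000000000),
    (-155864554670174170179293377198186537161469668992, 3390000000000000000),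
    (214442540208248814583898277710249782236100145623, 5820000000000000000),
    (202973365317155891675338840879105746867312730882, 10200000000000000000),
    (-679237248127249762925856311383805413145663370403, 16900000000000000000),
    (108267980030414517875300936389656156881729741472, 27700000000000000000),
    (1388715248686051032659406581085920251336088409018, 44800000000000000000),
    (-1369400805984145329475872954866748596721270897224, 69400000000000000000),
    (-1674850177289071120517907839054751309202063407461, 109000000000000000000),
    (4005702253653957002733990357764351366945383104502, 163000000000000000000),
    (-89519165030317065238710107098620897868868036076, 242000000000000000000),
    (-7135192228369738089511488667882655486402586132414, 354000000000000000000),
    (5783585073189193170141683371467065288831674888226, 500000000000000000000),
    (7450208352209847130908804127050893113926692132173, 708000000000000000000),
    (-15165619014817141117613201567518030777143225267427, 972000000000000000000),
    (-33338079351420972034592082119418559976949682356, 1320000000000000000000),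
    (23095622320896567844605798965194343118467056488858, 1770000000000000000000),
    (-17433439478274320723334290071842836218131833345446, 2310000000000000000000),
    (-19936264744442907266189800293810052329973244112460, 3000000000000000000000),
    (39046838552537884824184223201411254395100702349388, 3810000000000000000000),
    (-1988077947510274287395361312882108327978752137820, 4770000000000000000000),
    (-49682763680888082998745501082156735542858304388852, 5910000000000000000000),
    (38682971529031300334616844630221318917650930500373, 7170000000000000000000),
    (33617900876824300615503554521987565054413028932875, 8620000000000000000000),
    (-70735744627231322823931004015501733236617107781303, 10200000000000000000000),
    (10827953369194795727766674890115918582718857677127, 11900000000000000000000),
    (73292861805049120825667384585025429871180026344460, 13800000000000000000000),
    (-63431451348154172085370316808940523223596909532806, 15600000000000000000000),
    (-35608494790724794834225935946262348620412227582178, 17600000000000000000000),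
    (91911163688003366303933008402340666392099129581951, 19500000000000000000000),
    (-26117354906647025532106869602428723733257619959095, 21300000000000000000000),
    (-75208958979502862582905288094495935854853279605463, 23100000000000000000000),
    (76642951788182397812856932156045319426481644652819, 24600000000000000000000),
    (21207042925829153030949764630186674771494750796399, 26000000000000000000000),
    (-86510015561225902649713998912238499192279613612807, 27200000000000000000000),
    (37675618532075493559979636004870940999830630306603, 28000000000000000000000),
    (53401034188851851218589501454662075479551155585556, 28600000000000000000000),
    (-68187959107864586001051709753015855225508387856397, 28800000000000000000000),
    (-2005734179882879668836827118254308163616650022890, 28800000000000000000000),
    (59108962846967661547210670834654852096135387071669, 28400000000000000000000),
    (-36170243868569833212303213434980080124593111395600, 27700000000000000000000),
    (-25110775592869936957549818840740904472024719422478, 26800000000000000000000),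
    (44726137799777340308006890985750970360509863240168, 25600000000000000000000),
    (-8435409330093763448614979033466943436764967926917, 24300000000000000000000),
    (-29055670753201404294358131107414997274470680745352, 22800000000000000000000),
    (24362824436231656944808691188025191522443639237312, 21100000000000000000000),
    (6452900834116038856049192652773590527288229959279, 19500000000000000000000),
    (-21615485518664263972049447136297583032356747519289, 17700000000000000000000),
    (8560932125686460810168022778603092478506139240625, 16000000000000000000000),
    (9932350090669187553977955404497528894260149719767, 14300000000000000000000),
    (-11850446267265228617040676196058704421236616030037, 12700000000000000000000),
    (381860058005128636772039718539213141090290244837, 11100000000000000000000),
    (7629876309826933357450375537337368833138121767547, 9650000000000000000000),
    (-4755654472792477320739022956539405747123336079032, 8320000000000000000000),
    (-2095602110686602491364259925900886057858031973437, 7090000000000000000000),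
    (4219719681801524105225757545843453808371895753164, 6000000000000000000000),
    (-1151198864529393056274117206306706098980266969425, 5040000000000000000000),
    (-1907694378536306794598052832083002641206066535239, 4190000000000000000000),
    (1785527375440308970594805135098907940072314473690, 3460000000000000000000),
    (106792563705836736288466456210097109793887999371, 2830000000000000000000),
    (-1097990400283721291118565787229702533953679637104, 2300000000000000000000),
    (558810513144269540278971620448010732131112704543, 1850000000000000000000),
    (304601303849591094584024090744443309503847342747, 1480000000000000000000),
    (-480051331518905976483565159565905962457435167134, 1170000000000000000000),
    (100256717979020340831594699984683024957629274554, 920000000000000000000),
    (202967531989528624467644024914194877678964534795, 718000000000000000000),
    (-164723852394605201892631890738344284538234830841, 555000000000000000000),
    (-16002831767776983857629907414538413151597791581, 427000000000000000000),
    (93548954040439366380946972427079712867630869058, 325000000000000000000),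
    (-42497206920357672510262473481050414954632869086, 246000000000000000000),
    (-23950309133224006585097050406156844477112314811, 185000000000000000000),
    (33805888787412388681065340966454742750054834139, 138000000000000000000),
    (-6357901861077556593041683836727083570957796609, 102000000000000000000),
    (-12860255629431474003063589954128754225102432354, 75100000000000000000),
    (9797311603867318714454018511043992322640410079, 54800000000000000000),
    (865432421573902249700359644022759910370486518, 39700000000000000000),
    (-4969811715877016439038726852248967466744632786, 28600000000000000000),
    (2190346340072148587869537973787686504937685624, 20500000000000000000),
    (1098649255088168319159061504428971977981196405, 14500000000000000000),
    (-1536869214166807867569435982455192970967365531, 10300000000000000000),
    (306872645105843520478296527399438924128950041, 7180000000000000000),
    (507597937685574739462161534875315494619644078, 5000000000000000000),
    (-388684822100662715782793965351946492755546770, 3470000000000000000),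
    (-17475332781353209334402236157229504465046697, 2380000000000000000),
    (170576640235837835776472123573158171994242548, 1630000000000000000),
    (-78232556051838394102348514965721722946142903, 1110000000000000000),
    (-30289079386465171858649352391066781116429231, 744000000000000000),
    (46426703147464517093312819172180930372670850, 500000000000000000),
    (-10923535953521614753626874705900497771679352, 333000000000000000),
    (-12821708249154126204362794821475530452360277, 220000000000000000),
    (10508532436821558353173531258339256411078063, 145000000000000000),
    (-214086099720281721555698019306879699371896, 94600000000000000),
    (-3872834687873728646526222712291853653184253, 61500000000000000),
    (1951554640115723394371026115627545392179662, 39800000000000000), (493576052368973645940536159778808755049167,
    25500000000000000), (-950255834139225409783686246369980292137709, 16300000000000000),
    (274787203088782186757217408499623158607597, 10400000000000000), (209385754101250581132478858283656633430596,
    6520000000000000), (-196264689475979898788409309235877008487755, 4110000000000000),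
    (19172476274128101825182079611663964248273, 2570000000000000), (58953480941851793150146051453051764585824,
    1590000000000000), (-34107302319109290257718602891468427805646, 982000000000000),
    (-4110051839138157381241680290483997745675, 603000000000000), (13341265389110417243143648379613193865020,
    368000000000000), (-4792778285424057025374338174948841185781, 224000000000000),
    (-2178338821582828305966116870695438402483, 135000000000000), (2554933089844136618062661865762924811790,
    81000000000000), (-464142753399467021391695868629515823924, 48500000000000),
    (-602834920276938489052138034970210224264, 28800000000000), (419025589300583124704608013294337738324,
    17000000000000), (-660030066844360916772432594161321935, 10100000000000),
    (-129192923910389009198192811831311184879, 5850000000000), (57966260479515594809057779297247158778,
    3420000000000), (13327819361477495266897246004099506841, 1990000000000),
    (-23307510078482327596444817784930568881, 1140000000000), (6341503070453680812719254276754879150,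
    655000000000), (4068022360240244784472796312910303408, 375000000000), (-3633542643161989488584503929098192053,
    212000000000), (413193941682551841065363042789334789, 120000000000), (859673722775117763111645326194427608,
    67500000000), (-490078599571111792555170468657787712, 37700000000), (-29595955538660294758332497992407546,
    21100000000), (149118266920086325904392321443189029, 11700000000), (-55827037734713335638825111294469631,
    6430000000), (-16875878239569672101320486587363651, 3540000000), (22306797198471962847911833390241579,
    1940000000), (-4940347800431089965787749732780340, 1050000000), (-3843686464266549882141834959720164,
    570000000), (2922661925159740401409661564831246, 308000000), (-223070481593556053774945460625099, 165000000),
    (-663811623194712892146451044732639, 88000000), (334171634299470223075268777214921, 46900000),
    (30122949273630438065732783013127, 24800000), (-96842274932871784394958333646837, 13100000),
    (32438033923798773831674103117855, 6860000), (10691680922630600376553751121909, 3590000),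
    (-12367857414808489158964141466344, 1870000), (2444364220947722687215659419464, 965000),
    (1998303558687141733896763771785, 499000), (-1397976006629524913330808395246, 256000),
    (89755315272461989655999184900, 131000), (293981918720507966968958678103, 66700),
    (-139182162513217843188856281815, 33800), (-12563244258758327577817806371, 17100),
    (37103460987622543240938989300, 8580), (-11894044253722917572145488144, 4300), (-3700390992670501047571376698,
    2150), (4141026793963716421043984182, 1070), (-805798419474426556001771722, 527),
    (-601194445511313264443150031, 261), (412713137933521054302816963, 129), (-29943225037653680844514270, 63),
    (-77732550222693497482028334, 31), (36599619852161363579747410, 16), (2424149304989519825100120, 8),
    (-8683999483640246202018176, 5), (2829257774039549258213075, 3), (726982414514225433456711, 1),
    (-863608428664191920264616, 2), (179587538614218304986795, 1), (107997053272477126887365, 1),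
    (-77273577787914719379234, 1), (7457151921841344439786, 1), (12620798876554021415885, 1),
    (-6215047914464832901956, 1), (-158267973030277023482, 1), (1273659542939909294223, 1),
    (-443125893530967280294, 1), (-81057135571141030690, 1), (114777546942769966804, 1), (-26927515447862557997,
    1), (-11758946040983708864, 1), (9359204430526640572, 1), (-1233299219320787344, 1), (-1280771994300459972,
    1), (692181508515990548, 1), (-17340819649695005, 1), (-119150243993142090, 1)]"

text \<open>The scale is \<open>2^128\<close>. At \<open>X = 17\<close> the two bounds for
  \<open>airy_kappa\<close> differ by \<open>17 / (ag 17)\<^sup>2\<close>, less than
  \<open>10^-38\<close>, so the allowed error is dominated by rounding in the series.\<close>

lemma airy_kappa_enclosure:
  "\<bar>of_int 340282366920938463463374607431768211456 * airy_kappa - of_int 248069633830997343000284708569475951574\<bar> \<le> of_int 1084"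
proof (rule kappa_check_sound)
  show "kappa_check 17 324518553658426726783156020576256 340282366920938463463374607431768211456 248069633830997343000284708569475951574 1084 90337420686630 277 8 kappa_f_cert kappa_g_cert"
    unfolding kappa_check_def airy_check_def kappa_f_cert_def kappa_g_cert_def by code_simp
qed

text \<open>A coarse bracket is enough here: the first zero only serves to number the following
  ones.\<close>

lemma aa_sign_1a: "0 < of_int (1) * aa (- of_int 2563021733888 / of_int 1099511627776)"
proof (rule aa_check_sound[OF _ airy_kappa_enclosure])
  show "aa_check (1) 1099511627776 1099511627776 340282366920938463463374607431768211456 248069633830997343000284708569475951574 1084 2563021733888 (-13926988393472) 1 1868471377990 1 40 4 aa_sign_1a_cert"
    unfolding aa_check_def airy_check_def aa_sign_1a_cert_def by code_simp
qed simp

lemma aa_sign_1b: "0 < of_int (-1) * aa (- of_int 2572685410304 / of_int 1099511627776)"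
proof (rule aa_check_sound[OF _ airy_kappa_enclosure])
  show "aa_check (-1) 1099511627776 1099511627776 340282366920938463463374607431768211456 248069633830997343000284708569475951574 1084 2572685410304 (-14085115019264) 1 1875516305683 1 40 4 aa_sign_1b_cert"
    unfolding aa_check_def airy_check_def aa_sign_1b_cert_def by code_simp
qed simp

text \<open>From here on each bracket has width \<open>2^25\<close> in its scale, that is
  \<open>2^-65\<close>, \<open>2^-81\<close> and \<open>2^-97\<close> for the zeros 2, 3 and 4. In
  the scales of the variance certificates this is 32, the interval of radius
  \<open>dL = 16\<close>.\<close>

lemma aa_sign_2a: "0 < of_int (-1) * aa (- of_int 5060636295464142222390198272 / of_int 1237940039285380274899124224)"
proof (rule aa_check_sound[OF _ airy_kappa_enclosure])
  show "aa_check (-1) 1237940039285380274899124224 1237940039285380274899124224 340282366920938463463374607431768211456 248069633830997343000284708569475951574 1084 5060636295464142222390198272 (-84569966472217121338994501905) 1 3689260199190172029163763495 1 75 2 aa_sign_2a_cert"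
    unfolding aa_check_def airy_check_def aa_sign_2a_cert_def by code_simp
qed simp

lemma aa_sign_2b: "0 < of_int (1) * aa (- of_int 5060636295464142222423752704 / of_int 1237940039285380274899124224)"
proof (rule aa_check_sound[OF _ airy_kappa_enclosure])
  show "aa_check (1) 1237940039285380274899124224 1237940039285380274899124224 340282366920938463463374607431768211456 248069633830997343000284708569475951574 1084 5060636295464142222423752704 (-84569966472217121340676719529) 1 3689260199190172029188225049 1 75 2 aa_sign_2b_cert"
    unfolding aa_check_def airy_check_def aa_sign_2b_cert_def by code_simp
qed simp

text \<open>The cut-off 7, and 8 and 9 for the next zeros, is a compromise: the tail beyond it must
  fit below the third decimal, while the terms of the series and their errors grow with it.\<close>

lemma sigma_check_2: "sigma_check 7 1180591620717411303424 1180591620717411303424 4826198859657423231513 16 144 125928596 28924494707576576933888 582 sigma_cert_2"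
  unfolding sigma_check_def sigma_cert_2_def by code_simp

lemma aa_sign_3a: "0 < of_int (1) * aa (- of_int 447881022699595278267493561401344 / of_int 81129638414606681695789005144064)"
proof (rule aa_check_sound[OF _ airy_kappa_enclosure])
  show "aa_check (1) 81129638414606681695789005144064 81129638414606681695789005144064 340282366920938463463374607431768211456 248069633830997343000284708569475951574 1084 447881022699595278267493561401344 (-13649882184069902032861892056069980) 1 326510251783794638918069823729815 1 99 5 aa_sign_3a_cert"
    unfolding aa_check_def airy_check_def aa_sign_3a_cert_def by code_simp
qed simp

lemma aa_sign_3b: "0 < of_int (-1) * aa (- of_int 447881022699595278267493594955776 / of_int 81129638414606681695789005144064)"
proof (rule aa_check_sound[OF _ airy_kappa_enclosure])
  show "aa_check (-1) 81129638414606681695789005144064 81129638414606681695789005144064 340282366920938463463374607431768211456 248069633830997343000284708569475951574 1084 447881022699595278267493594955776 (-13649882184069902032861895123943056) 1 326510251783794638918069848191370 1 99 5 aa_sign_3b_cert"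
    unfolding aa_check_def airy_check_def aa_sign_3b_cert_def by code_simp
qed simp

lemma sigma_check_3: "sigma_check 8 77371252455336267181195264 77371252455336267181195264 427132628154368665950292185 16 174 18167386744352 2475880078570760549798248448 472 sigma_cert_3"
  unfolding sigma_check_def sigma_cert_3_def by code_simp

lemma aa_sign_4a: "0 < of_int (-1) * aa (- of_int 36084329570173434098935513168942727168 / of_int 5316911983139663491615228241121378304)"
proof (rule aa_check_sound[OF _ airy_kappa_enclosure])
  show "aa_check (-1) 5316911983139663491615228241121378304 5316911983139663491615228241121378304 340282366920938463463374607431768211456 248069633830997343000284708569475951574 1084 36084329570173434098935513168942727168 (-1662022811163878021431458048587680335894) 1 26305877981593259204062997023832176236 116 126 2 aa_sign_4a_cert"
    unfolding aa_check_def airy_check_def aa_sign_4a_cert_def by code_simp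
qed simp

lemma aa_sign_4b: "0 < of_int (1) * aa (- of_int 36084329570173434098935513168976281600 / of_int 5316911983139663491615228241121378304)"
proof (rule aa_check_sound[OF _ airy_kappa_enclosure])
  show "aa_check (1) 5316911983139663491615228241121378304 5316911983139663491615228241121378304 340282366920938463463374607431768211456 248069633830997343000284708569475951574 1084 36084329570173434098935513168976281600 (-1662022811163878021431458048592316827584) 1 26305877981593259204062997023856637791 116 126 2 aa_sign_4b_cert"
    unfolding aa_check_def airy_check_def aa_sign_4b_cert_def by code_simp
qed simp

lemma sigma_check_4: "sigma_check 9 5070602400912917605986812821504 5070602400912917605986812821504 34412698335812982653556359452209 16 207 692181508515990549 205359397236973163042465919270912 407 sigma_cert_4"
  unfolding sigma_check_def sigma_cert_4_def by code_simp

subsection \<open>Locating the zeros\<close>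

lemma aa_zero_bracket:
  assumes "0 < of_int s * aa (- of_int L / of_int M)" "0 < of_int s' * aa (- of_int L' / of_int M')"
    and "0 < M" "0 < M'" "L * M' \<le> L' * M" "s = 1 \<and> s' = - 1 \<or> s = - 1 \<and> s' = 1"
  obtains z where "z \<in> airy_zeros" "- of_int L' / of_int M' \<le> z" "z \<le> - real_of_int L / of_int M"
proof -
  let ?a = "- real_of_int L' / of_int M'" and ?b = "- real_of_int L / of_int M"
  have "real_of_int (L * M') \<le> of_int (L' * M)" using assms(5) by (simp only: of_int_le_iff)
  then have ab: "?a \<le> ?b" using assms(3,4) by (simp add: field_simps)
  have c: "\<forall>x. ?a \<le> x \<and> x \<le> ?b \<longrightarrow> isCont aa x" using ode2_isCont(1)[OF aa_ode] by simp
  have "\<exists>x\<ge>?a. x \<le> ?b \<and> aa x = 0"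
    using assms(6)
  proof
    assume "s = 1 \<and> s' = - 1"
    then show ?thesis using IVT[of aa ?a 0 ?b] assms(1,2) ab c by auto
  next
    assume "s = - 1 \<and> s' = 1"
    then show ?thesis using IVT2[of aa ?b 0 ?a] assms(1,2) ab c by auto
  qed
  then show ?thesis using that by (auto simp: airy_zeros_aa)
qed

lemma airy_zeros_gap:
  assumes "a \<in> airy_zeros" "b \<in> airy_zeros" "a < b" "- q \<le> a"
  shows "8 \<le> q * (b - a)\<^sup>2"
proof (rule ode2_zero_gap[OF aa_ode airy_ode_continuous assms(3)])
  show "aa a = 0" "aa b = 0" using assms by (simp_all add: airy_zeros_aa)
  show "\<exists>s. aa s \<noteq> 0" by (rule exI[of _ 0]) simp
  fix x assume "x \<in> {a..b}"
  then show "\<bar>x - 0\<bar> \<le> q" using airy_zeros_neg[OF assms(2)] assms(4) by auto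
qed

text \<open>At an interior maximum \<open>c\<close> of \<open>\<bar>aa\<bar>\<close> on \<open>[x, 0]\<close>, Taylor's formula bounds \<open>\<bar>aa c - aa x\<bar>\<close> by
  a fraction of \<open>\<bar>aa c\<bar>\<close>.\<close>

lemma airy_zeros_less_minus1:
  assumes "x \<in> airy_zeros"
  shows "x < - 1"
proof (rule ccontr)
  assume nx: "\<not> x < - 1"
  have x: "x < 0" "aa x = 0" using assms airy_zeros_neg by (auto simp: airy_zeros_aa)
  have "continuous_on {x..0} (\<lambda>t. (aa t)\<^sup>2)" by (intro continuous_intros ode2_continuous_on(1)[OF aa_ode])
  then obtain c where c: "c \<in> {x..0}" "\<And>t. t \<in> {x..0} \<Longrightarrow> (aa t)\<^sup>2 \<le> (aa c)\<^sup>2"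
    using continuous_attains_sup[of "{x..0}" "\<lambda>t. (aa t)\<^sup>2"] x by auto
  have d: "((\<lambda>t. (aa t)\<^sup>2) has_real_derivative 2 * aa t * aa' t) (at t)" for t
    using ode2D(1)[OF aa_ode, of t] by (auto intro!: derivative_eq_intros)
  have "1 \<le> (aa c)\<^sup>2" using c(2)[of 0] x by simp
  then have "c \<noteq> x" using x by auto
  \<comment> \<open>At 0 the square of \<open>aa\<close> has slope
    \<open>- 2 * airy_kappa < 0\<close>, so larger values occur just to the left.\<close>
  moreover have "c \<noteq> 0"
  proof
    assume "c = 0"
    have "((\<lambda>t. (aa t)\<^sup>2) has_real_derivative - 2 * airy_kappa) (at 0)" using d[of 0] by simp
    then obtain e where e: "e > 0" "\<And>h. 0 < h \<Longrightarrow> h < e \<Longrightarrow> (aa 0)\<^sup>2 < (aa (0 - h))\<^sup>2"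
      using DERIV_neg_dec_left[of "\<lambda>t. (aa t)\<^sup>2" "- 2 * airy_kappa" 0] airy_kappa_pos by auto
    have "(aa 0)\<^sup>2 < (aa (0 - min (e/2) (- x)))\<^sup>2" by (rule e(2)) (use e(1) x in \<open>auto simp: min_def\<close>)
    moreover have "(aa (0 - min (e/2) (- x)))\<^sup>2 \<le> (aa 0)\<^sup>2"
      using c(2)[of "0 - min (e/2) (- x)"] e(1) x unfolding \<open>c = 0\<close> by (auto simp: min_def)
    ultimately show False by simp
  qed
  ultimately have cc: "x < c" "c < 0" using c(1) by auto
  have "2 * aa c * aa' c = 0"
  proof (rule DERIV_local_max[OF d, of "min (c - x) (- c)"])
    show "0 < min (c - x) (- c)" using cc by auto
    show "\<forall>y. \<bar>c - y\<bar> < min (c - x) (- c) \<longrightarrow> (aa y)\<^sup>2 \<le> (aa c)\<^sup>2"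
    proof (intro allI impI)
      fix y assume "\<bar>c - y\<bar> < min (c - x) (- c)"
      then have "y \<in> {x..0}" by auto
      then show "(aa y)\<^sup>2 \<le> (aa c)\<^sup>2" by (rule c(2))
    qed
  qed
  moreover have ac: "1 \<le> \<bar>aa c\<bar>" using \<open>1 \<le> (aa c)\<^sup>2\<close> by (metis abs_1 abs_le_square_iff one_power2)
  ultimately have "aa' c = 0" by auto
  have "\<bar>aa x - aa c\<bar> \<le> \<bar>aa c\<bar> * (x - c)\<^sup>2 / 2"
  proof (rule taylor2_bound[OF ode2D[OF aa_ode] \<open>aa' c = 0\<close>])
    fix t assume "min c x < t" "t < max c x"
    then have t: "x < t" "t < 0" using cc by auto
    then have "\<bar>aa t\<bar> \<le> \<bar>aa c\<bar>" using c(2)[of t] by (simp add: abs_le_square_iff)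
    moreover have "\<bar>t - 0\<bar> \<le> 1" using t nx by auto
    ultimately have "\<bar>t - 0\<bar> * \<bar>aa t\<bar> \<le> 1 * \<bar>aa c\<bar>" by (intro mult_mono) auto
    then show "\<bar>(t - 0) * aa t\<bar> \<le> \<bar>aa c\<bar>" by (simp add: abs_mult)
  qed
  moreover have "(x - c)\<^sup>2 \<le> 1"
    using cc nx by (auto simp: power2_le_iff_abs_le abs_square_le_1)
  then have "\<bar>aa c\<bar> * (x - c)\<^sup>2 \<le> \<bar>aa c\<bar> * 1" by (intro mult_left_mono) auto
  ultimately show False using x(2) ac by simp
qed

text \<open>One of the two gaps is at most half of \<open>b - a\<close>, so the spacing bound 8 for
  that gap forces \<open>q * (b - a)\<^sup>2 \<ge> 32\<close>.\<close>

lemma airy_zeros_between: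
  assumes ab: "a \<in> airy_zeros" "b \<in> airy_zeros" "x \<in> airy_zeros" "a < x" "x < b"
    and q: "- q \<le> a" "q * (b - a)\<^sup>2 < 32"
  shows False
proof -
  have q0: "0 < q" using q(1) airy_zeros_neg[OF ab(1)] by simp
  have 1: "8 \<le> q * (x - a)\<^sup>2" "8 \<le> q * (b - x)\<^sup>2"
    using airy_zeros_gap[OF ab(1,3,4) q(1)] airy_zeros_gap[OF ab(3,2,5), of q] q(1) ab(4) by auto
  have "(b - a)\<^sup>2 \<ge> 4 * min ((x - a)\<^sup>2) ((b - x)\<^sup>2)"
  proof (cases "x - a \<le> b - x")
    case True
    then have "(2 * (x - a))\<^sup>2 \<le> (b - a)\<^sup>2" using ab by (intro power_mono) auto
    then have "4 * (x - a)\<^sup>2 \<le> (b - a)\<^sup>2" unfolding power_mult_distrib by simp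
    then show ?thesis by linarith
  next
    case False
    then have "(2 * (b - x))\<^sup>2 \<le> (b - a)\<^sup>2" using ab by (intro power_mono) auto
    then have "4 * (b - x)\<^sup>2 \<le> (b - a)\<^sup>2" unfolding power_mult_distrib by simp
    then show ?thesis by linarith
  qed
  then have "q * (4 * min ((x - a)\<^sup>2) ((b - x)\<^sup>2)) \<le> q * (b - a)\<^sup>2" using q0 by (intro mult_left_mono) auto
  moreover have "8 \<le> q * min ((x - a)\<^sup>2) ((b - x)\<^sup>2)" using 1 by (simp add: min_def)
  ultimately show False using q(2) by simp
qed

text \<open>No further zero fits between \<open>z\<close> and the \<open>r\<close>-th one, so a zero
  found by a sign change is the next in order.\<close>

lemma airy_zero_Suc_eqI:
  assumes z: "r \<ge> 1" "z \<in> airy_zeros" "z < airy_zero r" and q: "- q \<le> z" "q * (airy_zero r - z)\<^sup>2 < 32"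
  shows "airy_zero (Suc r) = z"
proof (rule airy_zero_eqI[OF z(2)])
  have "{x \<in> airy_zeros. z \<le> x} = insert z {x \<in> airy_zeros. airy_zero r \<le> x}"
    using airy_zeros_between[OF z(2) airy_zero(1)[OF z(1)] _ _ _ q] z by force
  then show "card {x \<in> airy_zeros. z \<le> x} = Suc r"
    using finite_airy_zeros_ge[of "airy_zero r"] airy_zero(2)[OF z(1)] z(3) by simp
qed

text \<open>A larger zero would have to lie below -1 and would thus be too close to
  \<open>z\<close>.\<close>

lemma airy_zero_1_eqI:
  assumes z: "z \<in> airy_zeros" and q: "- q \<le> z" "q * (z + 1)\<^sup>2 < 8"
  shows "airy_zero 1 = z"
proof (rule airy_zero_eqI[OF z])
  have "x = z" if "x \<in> airy_zeros" "z \<le> x" for x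
  proof (rule ccontr)
    assume "x \<noteq> z"
    then have zx: "z < x" using that by simp
    have x1: "x < - 1" by (rule airy_zeros_less_minus1[OF that(1)])
    have "8 \<le> q * (x - z)\<^sup>2" by (rule airy_zeros_gap[OF z that(1) zx q(1)])
    also have "\<dots> \<le> q * (- 1 - z)\<^sup>2" 
      using zx x1 q(1) airy_zeros_neg[OF z] by (intro mult_left_mono power_mono) auto
    also have "(- 1 - z)\<^sup>2 = (z + 1)\<^sup>2" by (simp add: power2_eq_square algebra_simps)
    finally show False using q(2) by simp
  qed
  then have "{x \<in> airy_zeros. z \<le> x} = {z}" using z by auto
  then show "card {x \<in> airy_zeros. z \<le> x} = 1" by simp
qed

lemma airy_zero_1_bounds: "airy_zero 1 \<in> airy_zeros" "- 2.34 \<le> airy_zero 1" "airy_zero 1 \<le> - 2.33"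
proof -
  obtain z where z: "z \<in> airy_zeros" "- of_int 2572685410304 / of_int 1099511627776 \<le> z" "z \<le> - real_of_int 2563021733888 / of_int 1099511627776"
    by (rule aa_zero_bracket[OF aa_sign_1a aa_sign_1b]) simp_all
  have b: "- 2.34 \<le> z" "z \<le> - 2.33" using z(2,3) by simp_all
  have "\<bar>z + 1\<bar> \<le> 1.34" using b by simp
  then have "(z + 1)\<^sup>2 \<le> 1.34\<^sup>2" by (rule power2_le_iff_abs_le[THEN iffD2, rotated]) simp
  \<comment> \<open>\<open>2.34 * 1.34\<^sup>2\<close> is about 4.2, below 8.\<close>
  then have "airy_zero 1 = z" using b(1) by (intro airy_zero_1_eqI[OF z(1), of "2.34"]) (auto simp: power2_eq_square)
  then show "airy_zero 1 \<in> airy_zeros" "- 2.34 \<le> airy_zero 1" "airy_zero 1 \<le> - 2.33" using z(1) b by simp_all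
qed

lemma airy_zero_2_bounds: "- 4.09 \<le> airy_zero 2" "airy_zero 2 \<le> - 4.08"
    "\<bar>of_int 1180591620717411303424 * ev 2 - of_int 4826198859657423231513\<bar> \<le> of_int 16"
proof -
  obtain z where z: "z \<in> airy_zeros" "- of_int 5060636295464142222423752704 / of_int 1237940039285380274899124224 \<le> z" "z \<le> - real_of_int 5060636295464142222390198272 / of_int 1237940039285380274899124224"
    by (rule aa_zero_bracket[OF aa_sign_2a aa_sign_2b]) simp_all
  have b: "- 4.09 \<le> z" "z \<le> - 4.08" using z(2,3) by simp_all
  have "\<bar>airy_zero 1 - z\<bar> \<le> 1.76" "z < airy_zero 1" using b airy_zero_1_bounds(2,3) by simp_all
  then have g: "(airy_zero 1 - z)\<^sup>2 \<le> 1.76\<^sup>2" "z < airy_zero 1"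
    by (simp_all add: power2_le_iff_abs_le)
  \<comment> \<open>\<open>4.09 * 1.76\<^sup>2\<close> is about 12.7, below 32; the products for the
    third and fourth zero are still smaller.\<close>
  have "airy_zero (Suc 1) = z"
    using b(1) g by (intro airy_zero_Suc_eqI[OF _ z(1), of _ "4.09"]) (auto simp: power2_eq_square)
  then have e: "airy_zero 2 = z" by (simp add: eval_nat_numeral)
  then show "- 4.09 \<le> airy_zero 2" "airy_zero 2 \<le> - 4.08" using b by simp_all
  show "\<bar>of_int 1180591620717411303424 * ev 2 - of_int 4826198859657423231513\<bar> \<le> of_int 16"
    using z(2,3) by (simp add: ev_def e abs_le_iff)
qed

lemma airy_zero_3_bounds: "- 5.53 \<le> airy_zero 3" "airy_zero 3 \<le> - 5.52"
    "\<bar>of_int 77371252455336267181195264 * ev 3 - of_int 427132628154368665950292185\<bar> \<le> of_int 16"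
proof -
  obtain z where z: "z \<in> airy_zeros" "- of_int 447881022699595278267493594955776 / of_int 81129638414606681695789005144064 \<le> z" "z \<le> - real_of_int 447881022699595278267493561401344 / of_int 81129638414606681695789005144064"
    by (rule aa_zero_bracket[OF aa_sign_3a aa_sign_3b]) simp_all
  have b: "- 5.53 \<le> z" "z \<le> - 5.52" using z(2,3) by simp_all
  have "\<bar>airy_zero 2 - z\<bar> \<le> 1.45" "z < airy_zero 2" using b airy_zero_2_bounds(1,2) by simp_all
  then have g: "(airy_zero 2 - z)\<^sup>2 \<le> 1.45\<^sup>2" "z < airy_zero 2"
    by (simp_all add: power2_le_iff_abs_le)
  have "airy_zero (Suc 2) = z"
    using b(1) g by (intro airy_zero_Suc_eqI[OF _ z(1), of _ "5.53"]) (auto simp: power2_eq_square)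
  then have e: "airy_zero 3 = z" by (simp add: eval_nat_numeral)
  then show "- 5.53 \<le> airy_zero 3" "airy_zero 3 \<le> - 5.52" using b by simp_all
  show "\<bar>of_int 77371252455336267181195264 * ev 3 - of_int 427132628154368665950292185\<bar> \<le> of_int 16"
    using z(2,3) by (simp add: ev_def e abs_le_iff)
qed

lemma airy_zero_4_bounds: "- 6.79 \<le> airy_zero 4" "airy_zero 4 \<le> - 6.78"
    "\<bar>of_int 5070602400912917605986812821504 * ev 4 - of_int 34412698335812982653556359452209\<bar> \<le> of_int 16"
proof -
  obtain z where z: "z \<in> airy_zeros" "- of_int 36084329570173434098935513168976281600 / of_int 5316911983139663491615228241121378304 \<le> z" "z \<le> - real_of_int 36084329570173434098935513168942727168 / of_int 5316911983139663491615228241121378304"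
    by (rule aa_zero_bracket[OF aa_sign_4a aa_sign_4b]) simp_all
  have b: "- 6.79 \<le> z" "z \<le> - 6.78" using z(2,3) by simp_all
  have "\<bar>airy_zero 3 - z\<bar> \<le> 1.27" "z < airy_zero 3" using b airy_zero_3_bounds(1,2) by simp_all
  then have g: "(airy_zero 3 - z)\<^sup>2 \<le> 1.27\<^sup>2" "z < airy_zero 3"
    by (simp_all add: power2_le_iff_abs_le)
  have "airy_zero (Suc 3) = z"
    using b(1) g by (intro airy_zero_Suc_eqI[OF _ z(1), of _ "6.79"]) (auto simp: power2_eq_square)
  then have e: "airy_zero 4 = z" by (simp add: eval_nat_numeral)
  then show "- 6.79 \<le> airy_zero 4" "airy_zero 4 \<le> - 6.78" using b by simp_all
  show "\<bar>of_int 5070602400912917605986812821504 * ev 4 - of_int 34412698335812982653556359452209\<bar> \<le> of_int 16"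
    using z(2,3) by (simp add: ev_def e abs_le_iff)
qed

lemma sigma2_max_2: "0.582 \<le> sigma2_max 2" "sigma2_max 2 < 0.583"
  using sigma_check_sound[OF sigma_check_2 _ airy_zero_2_bounds(3)] by simp_all

lemma sigma2_max_3: "0.472 \<le> sigma2_max 3" "sigma2_max 3 < 0.473"
  using sigma_check_sound[OF sigma_check_3 _ airy_zero_3_bounds(3)] by simp_all

lemma sigma2_max_4: "0.407 \<le> sigma2_max 4" "sigma2_max 4 < 0.408"
  using sigma_check_sound[OF sigma_check_4 _ airy_zero_4_bounds(3)] by simp_all

text \<open>The inner limit laws are existentially quantified, one for each \<open>N\<close>, and
  \<open>k\<close> runs through the reals. Integrability is included because the integral of a
  non-integrable function is 0 by convention, positivity because \<open>normal_dist0 0\<close> is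
  the zero measure.\<close>

theorem theorem1p1:
  shows
    "(\<forall>r\<ge>1. \<forall>(M :: nat \<Rightarrow> real \<Rightarrow> 'w measure) (X :: nat \<Rightarrow> real \<Rightarrow> real \<Rightarrow> 'w \<Rightarrow> nat \<Rightarrow> real).
        (\<forall>N\<ge>r. \<forall>k>0. bessel_process0 N k (M N k) (X N k)) \<longrightarrow>
        (\<forall>t>0. \<exists>\<mu> :: nat \<Rightarrow> real measure.
           (\<forall>N\<ge>r. real_distribution (\<mu> N) \<and>
              weak_conv_along at_top
                (\<lambda>k. distr (M N k) borel
                  (\<lambda>\<omega>. real N powr (1/6) * sqrt (2 * k) *
                        (X N k t \<omega> (N - r + 1) / sqrt (2 * k * t) - hermite_zero N (N - r + 1))))
                (\<mu> N)) \<and>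
           weak_conv_m \<mu> (normal_dist0 (sigma2_max r)))) \<and>
     (\<forall>r\<ge>1. set_integrable lborel {0<..} (sigma2_integrand r) \<and> 0 < sigma2_max r) \<and>
     0.582 \<le> sigma2_max 2 \<and> sigma2_max 2 < 0.583 \<and>
     0.472 \<le> sigma2_max 3 \<and> sigma2_max 3 < 0.473 \<and>
     0.407 \<le> sigma2_max 4 \<and> sigma2_max 4 < 0.408 \<and>
     sigma2_max \<longlonglongrightarrow> 0"
proof (intro conjI allI impI)
  fix r :: nat and M :: "nat \<Rightarrow> real \<Rightarrow> 'w measure" and X :: "nat \<Rightarrow> real \<Rightarrow> real \<Rightarrow> 'w \<Rightarrow> nat \<Rightarrow> real" and t :: real
  assume r: "1 \<le> r" and X: "\<forall>N\<ge>r. \<forall>k>0. bessel_process0 N k (M N k) (X N k)" and t: "0 < t"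
  show "\<exists>\<mu> :: nat \<Rightarrow> real measure.
           (\<forall>N\<ge>r. real_distribution (\<mu> N) \<and>
              weak_conv_along at_top
                (\<lambda>k. distr (M N k) borel
                  (\<lambda>\<omega>. real N powr (1/6) * sqrt (2 * k) *
                        (X N k t \<omega> (N - r + 1) / sqrt (2 * k * t) - hermite_zero N (N - r + 1))))
                (\<mu> N)) \<and>
           weak_conv_m \<mu> (normal_dist0 (sigma2_max r))"
    by (rule bessel_edge_fluctuations[OF r t]) (use X in blast)
next
  fix r :: nat
  assume r: "1 \<le> r"
  have "sigma2_integrand r = s2i r" using sigma2_integrand_eq by blast
  then show "set_integrable lborel {0<..} (sigma2_integrand r)" using s2i_split(1)[OF r, of 1] by simp
  show "0 < sigma2_max r" by (rule sigma2_max_pos[OF r])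
qed (use sigma2_max_2 sigma2_max_3 sigma2_max_4 sigma2_max_tendsto in simp_all)

end
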